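(* Let $d\ge 1$ and let $\mathscr G$ be the inhomogeneous long-range percolation graph built from a stationary, ergodic and positively correlated point set $\eta$ and a connection function $\varphi$ with $\bar\delta_{\mathsf{eff}}(0+)<2$. If $\theta_{\mathscr G}>0$, then for every $\lambda\in(0,1)$, $$\lim_{n\to\infty}\mathbb P\big(|\mathscr C_{\mathsf{max}}(\mathscr G[\Gamma^n])|>n^{\lambda d}\big)=1,$$ where $\Gamma^n=(-n/2,n/2]^d$, $\mathscr G[\Gamma^n]$ is the subgraph of $\mathscr G$ induced by the vertices located in $\Gamma^n$, and $\mathscr C_{\mathsf{max}}(\cdot)$ denotes a connected component of maximal cardinality.
   Context: Point set. Let $\Lambda$ be $\mathbb Z^d$ or $\mathbb R^d$, and let $\eta$ be a simple point process on $\Lambda$ (a random subset if $\Lambda=\mathbb Z^d$) of finite positive intensity, stationary and ergodic under shifts of $\Lambda$. (Normalising the intensity to one, by rescaling space, is only a convention.) $\eta$ is positively correlated: $\mathbb E[f(\eta)g(\eta)]\ge \mathbb E[f(\eta)]\,\mathbb E[g(\eta)]$ for all functionals $f,g$ that are non-decreasing under addition of points. Graph. The function $\varphi:(0,1)\times(0,1)\times(0,\infty)\to[0,\infty)$ is symmetric in its first two arguments and non-increasing in each argument. Give the points of $\eta$ i.i.d. Uniform$(0,1)$ marks, independent of $\eta$, yielding $\eta'$; its elements $\mathbf x=(x,s)$ are the vertices of $\mathscr G$ (location $x$, mark $s$). Given $\eta'$, each pair of distinct vertices $(x,s),(y,t)$ is joined by an edge independently with probability $1-e^{-\varphi(s,t,|x-y|)}$;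 this is realised by i.i.d. Uniform$(0,1)$ edge marks, independent of $\eta'$, an edge being present iff its mark is at most this probability. Decay exponent. For $\mu\in[0,1)$, $$\bar\delta_{\mathsf{eff}}(\mu)=-\liminf_{r\to\infty}\frac{\log\Big[\int_{r^{d(\mu-1)}}^{1-r^{d(\mu-1)}}\int_{r^{d(\mu-1)}}^{1-r^{d(\mu-1)}}\varphi(s,t,r)\,ds\,dt\Big]}{d\log r},$$ and $\bar\delta_{\mathsf{eff}}(0+)=\lim_{\mu\downarrow0}\bar\delta_{\mathsf{eff}}(\mu)$ (the limit exists by monotonicity). Percolation. $\theta_{\mathscr G}=\mathbb P(|\mathscr C_0(\mathscr G_0)|=\infty)$, where $\mathscr G_0$ is the Palm version of $\mathscr G$ (the same construction with $\eta$ replaced by its Palm version $\eta_0$, which has a point at the origin) and $\mathscr C_0(\mathscr G_0)$ is the connected component of the vertex at the origin. Standing assumption: $\eta$ and $\varphi$ are such that (by a finite energy property) $\mathscr G$ almost surely has at most one infinite connected component. *)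

theory Defs
  imports "HOL-Probability.Probability"
begin

section \<open>Point processes\<close>

definition integer_lattice :: "(real^'d) set" where
  "integer_lattice = {x. \<forall>i. x $ i \<in> \<int>}"

definition cube :: "real \<Rightarrow> (real^'d) set" where
  "cube n = {x. \<forall>i. - n / 2 < x $ i \<and> x $ i \<le> n / 2}"

text \<open>A simple point process is treated through its law, a probability measure on the locally
  finite subsets of the ground set \<open>\<Lambda>\<close>, with the \<open>\<sigma>\<close>-algebra generated by the counting maps.\<close>

definition configurations :: "(real^'d) set \<Rightarrow> (real^'d) set set" where
  "configurations \<Lambda> = {\<omega>. \<omega> \<subseteq> \<Lambda> \<and> (\<forall>r. finite (\<omega> \<inter> cball 0 r))}"

definition configs :: "(real^'d) set \<Rightarrow> (real^'d) set measure" where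
  "configs \<Lambda> = sigma (configurations \<Lambda>)
     {{\<omega> \<in> configurations \<Lambda>. card (\<omega> \<inter> B) = k} | B k. B \<in> sets borel \<and> bounded B}"

definition point_process :: "(real^'d) set \<Rightarrow> (real^'d) set measure \<Rightarrow> bool" where
  "point_process \<Lambda> P \<longleftrightarrow> prob_space P \<and> sets P = sets (configs \<Lambda>)"

definition shift :: "real^'d \<Rightarrow> (real^'d) set \<Rightarrow> (real^'d) set" where
  "shift z \<omega> = (\<lambda>y. y + z) ` \<omega>"

definition stationary :: "(real^'d) set \<Rightarrow> (real^'d) set measure \<Rightarrow> bool" where
  "stationary \<Lambda> P \<longleftrightarrow> (\<forall>z\<in>\<Lambda>. distr P (configs \<Lambda>) (shift z) = P)"

definition ergodic :: "(real^'d) set \<Rightarrow> (real^'d) set measure \<Rightarrow> bool" where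
  "ergodic \<Lambda> P \<longleftrightarrow>
     (\<forall>A\<in>sets P. (\<forall>z\<in>\<Lambda>. shift z -` A \<inter> space P = A) \<longrightarrow> measure P A = 0 \<or> measure P A = 1)"

definition positively_correlated :: "(real^'d) set measure \<Rightarrow> bool" where
  "positively_correlated P \<longleftrightarrow>
     (\<forall>f g :: (real^'d) set \<Rightarrow> real.
        mono_on (space P) f \<and> mono_on (space P) g \<and>
        integrable P f \<and> integrable P g \<and> integrable P (\<lambda>\<omega>. f \<omega> * g \<omega>) \<longrightarrow>
        (LINT \<omega>|P. f \<omega> * g \<omega>) \<ge> (LINT \<omega>|P. f \<omega>) * (LINT \<omega>|P. g \<omega>))"

definition intensity :: "(real^'d) set measure \<Rightarrow> ennreal" where
  "intensity P = (\<integral>\<^sup>+ \<omega>. of_nat (card (\<omega> \<inter> cube 1)) \<partial>P)"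

text \<open>The Palm distribution of a stationary process on \<open>\<real>\<^sup>d\<close> or \<open>\<int>\<^sup>d\<close>. On the lattice the unit cube
  contains no point other than the origin, so there it is the conditional law of the process given
  that the origin is occupied.\<close>

definition palm :: "(real^'d) set \<Rightarrow> (real^'d) set measure \<Rightarrow> (real^'d) set measure" where
  "palm \<Lambda> P = measure_of (space (configs \<Lambda>)) (sets (configs \<Lambda>))
     (\<lambda>A. (\<integral>\<^sup>+ \<omega>. (\<Sum>x\<in>\<omega> \<inter> cube 1. indicator A (shift (- x) \<omega>)) \<partial>P) / intensity P)"


section \<open>Graphs\<close>

type_synonym 'v graph = "'v set \<times> 'v rel"

definition induced :: "'v graph \<Rightarrow> 'v set \<Rightarrow> 'v graph" where
  "induced G S = (fst G \<inter> S, snd G \<inter> S \<times> S)"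

definition component :: "'v graph \<Rightarrow> 'v \<Rightarrow> 'v set" where
  "component G v = {w. (v, w) \<in> (snd G)\<^sup>*}"

definition components :: "'v graph \<Rightarrow> 'v set set" where
  "components G = component G ` fst G"

text \<open>For finite graphs this is the cardinality of a largest component, and \<open>0\<close> if there
  are no vertices.\<close>

definition max_component_card :: "'v graph \<Rightarrow> nat" where
  "max_component_card G = Sup (card ` components G)"

definition at_most_one_infinite_component :: "'v graph \<Rightarrow> bool" where
  "at_most_one_infinite_component G \<longleftrightarrow>
     (\<forall>C\<in>components G. \<forall>D\<in>components G. infinite C \<and> infinite D \<longrightarrow> C = D)"


section \<open>The inhomogeneous long-range percolation graph\<close>

definition connection_function :: "(real \<Rightarrow> real \<Rightarrow> real \<Rightarrow> real) \<Rightarrow> bool" where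
  "connection_function \<phi> \<longleftrightarrow>
     (\<forall>s\<in>{0<..<1}. \<forall>t\<in>{0<..<1}. \<forall>r\<in>{0<..}. 0 \<le> \<phi> s t r \<and> \<phi> s t r = \<phi> t s r) \<and>
     (\<forall>t\<in>{0<..<1}. \<forall>r\<in>{0<..}. antimono_on {0<..<1} (\<lambda>s. \<phi> s t r)) \<and>
     (\<forall>s\<in>{0<..<1}. \<forall>r\<in>{0<..}. antimono_on {0<..<1} (\<lambda>t. \<phi> s t r)) \<and>
     (\<forall>s\<in>{0<..<1}. \<forall>t\<in>{0<..<1}. antimono_on {0<..} (\<lambda>r. \<phi> s t r))"

text \<open>To attach i.i.d. marks to the points of a configuration and to their pairs in a measurable way,
  the points are numbered by increasing norm. Ties are broken lexicographically, with the coordinates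
  taken in the order given by \<^const>\<open>to_nat\<close>. The marks are independent of the configuration, so the
  law of the graph does not depend on the numbering.\<close>

definition precedes :: "real^'d \<Rightarrow> real^'d \<Rightarrow> bool" where
  "precedes x y \<longleftrightarrow> norm x < norm y \<or>
     norm x = norm y \<and> (\<exists>i. x $ i < y $ i \<and> (\<forall>j. to_nat j < to_nat i \<longrightarrow> x $ j = y $ j))"

definition point_rank :: "(real^'d) set \<Rightarrow> real^'d \<Rightarrow> nat" where
  "point_rank \<omega> x = card {y \<in> \<omega>. precedes y x}"

definition uniform01 :: "real measure" where
  "uniform01 = uniform_measure lborel {0<..<1}"

text \<open>A realisation consists of a configuration, the vertex marks (indexed by the ranks of the points)
  and the edge marks (indexed by two-element sets of ranks).\<close>

type_synonym 'd realisation = "(real^'d) set \<times> (nat \<Rightarrow> real) \<times> (nat set \<Rightarrow> real)"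

text \<open>The completion is needed because \<^const>\<open>connection_function\<close> does not force Borel measurability:
  a function that is monotone in each argument is in general only Lebesgue measurable.\<close>

definition graph_space :: "(real^'d) set measure \<Rightarrow> 'd realisation measure" where
  "graph_space P = completion
     (P \<Otimes>\<^sub>M (\<Pi>\<^sub>M i\<in>UNIV. uniform01) \<Otimes>\<^sub>M (\<Pi>\<^sub>M e\<in>{e. card e = 2}. uniform01))"

definition vertex :: "'d realisation \<Rightarrow> real^'d \<Rightarrow> (real^'d) \<times> real" where
  "vertex = (\<lambda>(\<omega>, u, v) x. (x, u (point_rank \<omega> x)))"

definition percolation_graph ::
  "(real \<Rightarrow> real \<Rightarrow> real \<Rightarrow> real) \<Rightarrow> 'd realisation \<Rightarrow> ((real^'d) \<times> real) graph" where
  "percolation_graph \<phi> = (\<lambda>(\<omega>, u, v).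
     let V = vertex (\<omega>, u, v) ` \<omega> in
       (V, {((x, s), (y, t)) | x s y t. (x, s) \<in> V \<and> (y, t) \<in> V \<and> x \<noteq> y \<and>
              v {point_rank \<omega> x, point_rank \<omega> y} \<le> 1 - exp (- \<phi> s t (dist x y))}))"

definition theta ::
  "(real^'d) set \<Rightarrow> (real^'d) set measure \<Rightarrow> (real \<Rightarrow> real \<Rightarrow> real \<Rightarrow> real) \<Rightarrow> real" where
  "theta \<Lambda> P \<phi> = (let Q = graph_space (palm \<Lambda> P) in
     measure Q {z \<in> space Q. infinite (component (percolation_graph \<phi> z) (vertex z 0))})"


section \<open>The decay exponent\<close>

text \<open>The library's \<^term>\<open>ln 0 = (0 :: real)\<close> would give the wrong exponent if the integral vanishes.\<close>

definition eln :: "real \<Rightarrow> ereal" where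
  "eln x = (if x \<le> 0 then - \<infinity> else ereal (ln x))"

definition delta_eff :: "nat \<Rightarrow> (real \<Rightarrow> real \<Rightarrow> real \<Rightarrow> real) \<Rightarrow> real \<Rightarrow> ereal" where
  "delta_eff d \<phi> \<mu> = - Liminf at_top (\<lambda>r :: real.
     let a = r powr (real d * (\<mu> - 1)) in
       eln (LINT s:{a..1 - a}|lborel. (LINT t:{a..1 - a}|lborel. \<phi> s t r)) / ereal (real d * ln r))"

definition delta_eff_0plus :: "nat \<Rightarrow> (real \<Rightarrow> real \<Rightarrow> real \<Rightarrow> real) \<Rightarrow> ereal" where
  "delta_eff_0plus d \<phi> = Lim (at_right 0) (delta_eff d \<phi>)"

end

theory Submission
  imports Defs "HOL-Real_Asymp.Real_Asymp"
begin

text \<open>The connection probability is replaced by a Borel minorant that gives almost surely the same graph.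
  Conditionally on the configuration, percolation has probability \<open>0\<close> or \<open>1\<close>, so by ergodicity \<open>\<theta> > 0\<close>
  forces it almost surely; then most boxes of a large finite tiling meet an infinite cluster. These clusters
  coincide by uniqueness, and in a large window they are already joined. Hence with probability close to \<open>1\<close> the box of
  side \<open>M\<close> carries a cluster with at least \<open>M powr (D * (1 - \<kappa>))\<close> of its points, where \<open>D\<close> is the dimension.

  This property is propagated from boxes of side \<open>R\<close> to boxes of side about \<open>R powr (1 + \<kappa>)\<close>, for a fixed
  configuration. The decay exponent being below \<open>2\<close> provides mark levels \<open>\<sigma>\<close>, \<open>\<tau>\<close> such that points with marks below
  \<open>\<sigma>\<close> and \<open>\<tau>\<close> are linked with probability well above \<open>R powr (- 2 * D) / (\<sigma> * \<tau>)\<close>, and a large cluster contains about the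
  expected number of such points, because low marks only help a cluster to grow. Removing an edge between low
  marks with a small probability \<open>q\<close> is a negligible change of law, yet restoring the removed edges joins all the
  large clusters of the sub-boxes. The errors are summable over the scales, and boxes with too many points are
  controlled through the intensity.\<close>

section \<open>Sprinkling\<close>

text \<open>Ordinary sprinkling spends part of the edge intensity, and percolation could be lost
  with it, since nothing is assumed about weaker laws. So the thinning is made too small to be
  noticed. Let \<open>p\<close> be the linking probability at the two mark levels,
  \<open>F = p * \<sigma> * \<tau>\<close>, and thin with probability
  \<open>q = \<delta> * p\<close>. A box of side \<open>S\<close> with about \<open>S powr D\<close>
  points has on average \<open>\<sigma> * \<tau> * S powr (2 * D)\<close> relevant pairs. The cost
  of the change of law is then of order \<open>\<delta>^2 * F * S powr (2 * D)\<close>, while two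
  clusters of nearly full size receive about \<open>\<delta> * F * S powr (2 * D)\<close> restored
  edges between them. A small cost and a large gain are compatible once
  \<open>F * S powr (2 * D)\<close> grows like a power of \<open>S\<close>; this is the role of the
  exponent 2. The other obstacle is that the point process gives no independence between distant
  boxes. Hence every estimate is made for a fixed configuration, where the marks are independent,
  and the failure probabilities of sub-boxes enter linearly. Averaging over the configuration then
  needs only first moments, which stationarity makes the same for all boxes of a tiling.\<close>

lemma bernoulli_pmf_sprinkle:
  assumes "0 \<le> q" "q < 1" "q \<le> p" "p \<le> 1"
  shows "bernoulli_pmf p =
    bind_pmf (bernoulli_pmf ((p - q) / (1 - q)))
      (\<lambda>a. if a then return_pmf True else bernoulli_pmf q)"
proof (rule pmf_eqI)
  fix b
  have r: "0 \<le> (p - q) / (1 - q)" "(p - q) / (1 - q) \<le> 1"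
    using assms by (auto simp: field_simps)
  \<comment> \<open>Closed means closed in both rounds, so the first round must leave the edge
    closed with probability \<open>(1 - p) / (1 - q)\<close>.\<close>
  have c: "1 - (p - q) / (1 - q) = (1 - p) / (1 - q)"
    using assms by (simp add: diff_divide_eq_iff)
  have "(p - q) / (1 - q) + (1 - p) / (1 - q) * q = (p * (1 - q)) / (1 - q)"
    by (simp add: add_divide_distrib[symmetric] algebra_simps)
  hence "p = (p - q) / (1 - q) + (1 - (p - q) / (1 - q)) * q"
    using assms c by simp
  moreover have "1 - p = (1 - (p - q) / (1 - q)) * (1 - q)"
    using assms c by simp
  ultimately show "pmf (bernoulli_pmf p) b = pmf (bind_pmf (bernoulli_pmf ((p - q) / (1 - q)))
      (\<lambda>a. if a then return_pmf True else bernoulli_pmf q)) b"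
    using assms r by (cases b) (simp_all add: pmf_bind mult.commute)
qed

lemma Pi_pmf_bernoulli_finite_support:
  assumes "finite E"
  shows "set_pmf (Pi_pmf E False p) \<subseteq> PiE_dflt E False (\<lambda>_. UNIV :: bool set)"
    and "finite (PiE_dflt E False (\<lambda>_. UNIV :: bool set))"
  using assms finite_PiE_dflt[of E "\<lambda>_. UNIV :: bool set" False]
  by (simp_all add: set_Pi_pmf) (auto simp: PiE_dflt_def)

lemma measure_bind_pmf_expectation:
  "measure_pmf.prob (bind_pmf M N) A = measure_pmf.expectation M (\<lambda>x. measure_pmf.prob (N x) A)"
proof -
  have "ennreal (measure_pmf.prob (bind_pmf M N) A) = (\<integral>\<^sup>+x. ennreal (measure_pmf.prob (N x) A) \<partial>measure_pmf M)"
    by (simp add: measure_pmf.emeasure_eq_measure[symmetric])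
  also have "\<dots> = ennreal (measure_pmf.expectation M (\<lambda>x. measure_pmf.prob (N x) A))"
    by (intro nn_integral_eq_integral measure_pmf.integrable_const_bound[where B = 1]) auto
  finally show ?thesis by (simp add: integral_nonneg_AE)
qed

lemma prob_finite_support:
  assumes "finite S" "set_pmf p \<subseteq> S"
  shows "measure_pmf.prob p A = (\<Sum>x\<in>S \<inter> A. pmf p x)"
proof -
  have "measure_pmf.prob p A = measure_pmf.prob p (S \<inter> A)"
    using assms by (intro measure_prob_cong_0) (auto simp: set_pmf_eq)
  thus ?thesis
    using assms by (simp add: measure_measure_pmf_finite)
qed

text \<open>The \<open>\<chi>\<^sup>2\<close>-distance between the two laws is of order \<open>q^2 / p * card L\<close>.\<close>

lemma Pi_pmf_bernoulli_perturb:
  fixes pr :: "'e \<Rightarrow> real"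
  assumes E: "finite E" and L: "L \<subseteq> E"
    and pr: "\<And>e. e \<in> E \<Longrightarrow> 0 \<le> pr e \<and> pr e \<le> 1"
    and p: "0 < p" "\<And>e. e \<in> L \<Longrightarrow> p \<le> pr e"
    and q: "0 \<le> q" "q \<le> 1/2" "q \<le> p" and s: "0 < s" "s \<le> 1"
  defines "pr' \<equiv> \<lambda>e. if e \<in> L then (pr e - q) / (1 - q) else pr e"
  shows "measure_pmf.prob (Pi_pmf E False (\<lambda>e. bernoulli_pmf (pr e))) A
     \<le> measure_pmf.prob (Pi_pmf E False (\<lambda>e. bernoulli_pmf (pr' e))) A
        + s / 2 + 4 * q^2 / p * card L / s"
proof -
  define Z where "Z = Pi_pmf E False (\<lambda>e. bernoulli_pmf (pr e))"
  define Y where "Y = Pi_pmf E False (\<lambda>e. bernoulli_pmf (pr' e))"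
  define S where "S = PiE_dflt E False (\<lambda>_. UNIV :: bool set)"
  \<comment> \<open>\<open>g\<close> is the density of one thinned edge with respect to the original
    one. For a closed edge the factor \<open>1 - pr e\<close> cancels and leaves
    \<open>1 / (1 - q)\<close>, which is also correct when \<open>pr e = 1\<close>.\<close>
  define g where "g = (\<lambda>e b. if e \<in> L then (if b then pr' e / pr e else 1 / (1 - q)) else (1::real))"
  define f where "f = (\<lambda>b. \<Prod>e\<in>E. g e (b e))"
  define y where "y = 4 * q^2 / p * card L"
  have [simp]: "finite E" "finite L" using E L finite_subset by auto
  have S: "finite S" "set_pmf Z \<subseteq> S" "set_pmf Y \<subseteq> S"
    unfolding S_def Z_def Y_def using Pi_pmf_bernoulli_finite_support[OF E] by auto
  have y0: "0 \<le> y" using p by (simp add: y_def)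
  have pr': "0 \<le> pr' e \<and> pr' e \<le> 1" if "e \<in> E" for e
    using pr[OF that] p(2)[of e] q by (auto simp: pr'_def field_simps)
  have pm: "pmf (bernoulli_pmf (pr' e)) b = pmf (bernoulli_pmf (pr e)) b * g e b" if "e \<in> E" for e b
  proof (cases "e \<in> L")
    case True
    hence "pr e > 0" using p by force
    thus ?thesis using True pr[OF that] pr'[OF that] q
      by (cases b) (auto simp: g_def pr'_def field_simps)
  qed (auto simp: g_def pr'_def)
  have YZ: "pmf Y b = pmf Z b * f b" if "b \<in> S" for b
    using that unfolding Y_def Z_def f_def S_def
    by (subst (1 2) pmf_Pi') (auto simp: PiE_dflt_def pm prod.distrib)
  have g0: "0 \<le> g e b" if "e \<in> E" for e b
    using pr[OF that] pr'[OF that] q by (auto simp: g_def)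
  have sum1: "(\<Sum>b\<in>S. pmf Z b) = 1" "(\<Sum>b\<in>S. pmf Y b) = 1"
    using S by (auto intro!: sum_pmf_eq_1)
  have int: "integrable (measure_pmf (bernoulli_pmf (pr e))) h" for e and h :: "bool \<Rightarrow> real"
    by (intro integrable_measure_pmf_finite) auto
  have "(\<Sum>b\<in>S. pmf Z b * (f b)^2) = measure_pmf.expectation Z (\<lambda>b. (f b)^2)"
    using S by (subst integral_measure_pmf_real[of S]) (auto simp: mult.commute)
  also have "\<dots> = measure_pmf.expectation Z (\<lambda>b. \<Prod>e\<in>E. (g e (b e))^2)"
    by (simp add: f_def prod_power_distrib)
  also have "\<dots> = (\<Prod>e\<in>E. measure_pmf.expectation (bernoulli_pmf (pr e)) (\<lambda>b. (g e b)^2))"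
    unfolding Z_def by (rule expectation_prod_Pi_pmf) (auto intro: int)
  also have "\<dots> \<le> (\<Prod>e\<in>E. if e \<in> L then 1 + 4 * q^2 / p else 1)"
  proof (rule prod_mono)
    fix e assume e: "e \<in> E"
    have ex: "measure_pmf.expectation (bernoulli_pmf (pr e)) (\<lambda>b. (g e b)^2)
        = pr e * (g e True)^2 + (1 - pr e) * (g e False)^2"
      using pr[OF e] by (subst integral_bernoulli_pmf) auto
    have "pr e * (g e True)^2 + (1 - pr e) * (g e False)^2 \<le> (if e \<in> L then 1 + 4 * q^2 / p else 1)"
    proof (cases "e \<in> L")
      case True
      hence pe: "pr e \<ge> p" "pr e > 0" "pr e \<le> 1" using p pr[OF e] by (auto intro: less_le_trans)
      \<comment> \<open>The second moment of the density is 1 plus its variance;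
        \<open>q \<le> 1/2\<close> turns the denominator \<open>(1-q)^2\<close> into the factor
        4.\<close>
      have "pr e * (g e True)^2 + (1 - pr e) * (g e False)^2
          = 1 + q^2 / (1-q)^2 * ((1 - pr e) / pr e)"
      proof -
        have "pr e * (g e True)^2 + (1 - pr e) * (g e False)^2
            = ((pr e - q)^2 + (1 - pr e) * pr e) / (pr e * (1-q)^2)"
          using True pe q unfolding g_def pr'_def
          by (simp add: add_divide_distrib power_divide power2_eq_square)
        also have "(pr e - q)^2 + (1 - pr e) * pr e = pr e * (1-q)^2 + q^2 * (1 - pr e)"
          by (simp add: power2_eq_square algebra_simps)
        also have "\<dots> / (pr e * (1-q)^2) = 1 + q^2 / (1-q)^2 * ((1 - pr e) / pr e)"
          using pe q by (simp add: add_divide_distrib)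
        finally show ?thesis .
      qed
      also have "\<dots> \<le> 1 + (4 * q^2) * (1 / p)"
      proof -
        have "(1/2)^2 \<le> (1-q)^2" using q by (intro power_mono) auto
        hence "q^2 / (1-q)^2 \<le> q^2 / (1/2)^2" by (intro divide_left_mono) (use q in auto)
        hence A: "q^2 / (1-q)^2 \<le> 4 * q^2" by (simp add: power2_eq_square)
        have B: "(1 - pr e) / pr e \<le> 1 / p" using pe p by (intro frac_le) auto
        show ?thesis using mult_mono[OF A B] pe by simp
      qed
      finally show ?thesis using True by simp
    qed (auto simp: g_def)
    moreover have "0 \<le> pr e * (g e True)^2 + (1 - pr e) * (g e False)^2"
      using pr[OF e] by auto
    ultimately show "0 \<le> measure_pmf.expectation (bernoulli_pmf (pr e)) (\<lambda>b. (g e b)^2) \<and>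
       measure_pmf.expectation (bernoulli_pmf (pr e)) (\<lambda>b. (g e b)^2) \<le> (if e \<in> L then 1 + 4 * q^2 / p else 1)"
      using ex by simp
  qed
  also have "\<dots> = (1 + 4 * q^2 / p) ^ card L"
    using L by (subst prod.If_cases) (auto simp: Int_absorb1)
  also have "\<dots> \<le> exp (4 * q^2 / p) ^ card L"
    using p by (intro power_mono exp_ge_add_one_self) auto
  also have "\<dots> = exp y" by (simp add: y_def exp_of_nat_mult[symmetric] mult.commute)
  finally have f2: "(\<Sum>b\<in>S. pmf Z b * (f b)^2) \<le> exp y" .
  have sf: "(\<Sum>b\<in>S. pmf Z b * f b) = 1"
    using sum1(2) YZ by simp
  have main: "measure_pmf.prob Z A - measure_pmf.prob Y A \<le> s / 2 + y / s"
  proof (cases "y \<le> 1")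
    case True
    have "measure_pmf.prob Z A - measure_pmf.prob Y A = (\<Sum>b\<in>S \<inter> A. pmf Z b * (1 - f b))"
      using S YZ by (simp add: prob_finite_support sum_subtractf[symmetric] algebra_simps)
    \<comment> \<open>Cauchy-Schwarz in linear form: completing the square with a free parameter
      \<open>s\<close> avoids square roots. Later \<open>s\<close> is a small power of the
      scale.\<close>
    also have "\<dots> \<le> (\<Sum>b\<in>S \<inter> A. pmf Z b * (s / 2 + (1 - f b)^2 / (2 * s)))"
    proof (intro sum_mono mult_left_mono)
      fix b
      have "0 \<le> (s - (1 - f b))^2" by simp
      hence "2 * s * (1 - f b) \<le> s^2 + (1 - f b)^2" by (simp add: power2_eq_square algebra_simps)
      thus "1 - f b \<le> s / 2 + (1 - f b)^2 / (2 * s)"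
        using s by (simp add: field_simps power2_eq_square)
    qed auto
    also have "\<dots> \<le> (\<Sum>b\<in>S. pmf Z b * (s / 2 + (1 - f b)^2 / (2 * s)))"
      using S s by (intro sum_mono2) (auto intro!: mult_nonneg_nonneg add_nonneg_nonneg)
    also have "\<dots> = (\<Sum>b\<in>S. s / 2 * pmf Z b + (pmf Z b + pmf Z b * (f b)^2 - 2 * (pmf Z b * f b)) / (2 * s))"
      using s by (intro sum.cong) (auto simp: field_simps power2_eq_square)
    also have "\<dots> = s / 2 * (\<Sum>b\<in>S. pmf Z b) + ((\<Sum>b\<in>S. pmf Z b) + (\<Sum>b\<in>S. pmf Z b * (f b)^2)
        - 2 * (\<Sum>b\<in>S. pmf Z b * f b)) / (2 * s)"
      by (simp only: sum.distrib sum_subtractf sum_distrib_left sum_divide_distrib[symmetric])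
    also have "\<dots> = s / 2 + ((\<Sum>b\<in>S. pmf Z b * (f b)^2) - 1) / (2 * s)"
      using sum1 sf by simp
    also have "\<dots> \<le> s / 2 + (exp y - 1) / (2 * s)"
      using f2 s by (intro add_left_mono divide_right_mono) auto
    also have "\<dots> \<le> s / 2 + (2 * y) / (2 * s)"
    proof -
      have "exp y \<le> 1 + y + y^2" using exp_bound[OF y0 True] .
      also have "\<dots> \<le> 1 + 2 * y" using True y0 by (simp add: power2_eq_square mult_left_le_one_le)
      finally show ?thesis using s by (intro add_left_mono divide_right_mono) auto
    qed
    also have "\<dots> = s / 2 + y / s" by simp
    finally show ?thesis .
  next
    case False
    \<comment> \<open>For \<open>y > 1\<close> the claimed bound exceeds 1, because
      \<open>s \<le> 1\<close>.\<close>
    hence "1 \<le> y / s" using s by (simp add: field_simps)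
    moreover have "measure_pmf.prob Z A - measure_pmf.prob Y A \<le> 1"
      by (smt (verit) measure_nonneg measure_pmf.prob_le_1)
    ultimately show ?thesis using s by linarith
  qed
  show ?thesis using main unfolding Z_def Y_def y_def by linarith
qed

lemma Pi_pmf_all_closed:
  fixes q :: real
  assumes "finite E" "H \<subseteq> E" "0 \<le> q" "q \<le> 1" "\<And>e. e \<in> H \<Longrightarrow> \<exists>r. p e = bernoulli_pmf r \<and> q \<le> r \<and> r \<le> 1"
  shows "measure_pmf.prob (Pi_pmf E False p) {b. \<forall>e\<in>H. \<not> b e} \<le> (1 - q) ^ card H"
proof -
  have "{b. \<forall>e\<in>H. \<not> b e} = Pi E (\<lambda>e. if e \<in> H then {False} else UNIV)"
    using assms(2) by (auto simp: Pi_def split: if_splits)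
  hence "measure_pmf.prob (Pi_pmf E False p) {b. \<forall>e\<in>H. \<not> b e}
      = (\<Prod>e\<in>E. measure_pmf.prob (p e) (if e \<in> H then {False} else UNIV))"
    using assms(1) by (simp add: measure_Pi_pmf_Pi)
  also have "\<dots> \<le> (\<Prod>e\<in>E. if e \<in> H then 1 - q else 1)"
  proof (rule prod_mono)
    fix e assume "e \<in> E"
    show "0 \<le> measure_pmf.prob (p e) (if e \<in> H then {False} else UNIV) \<and>
       measure_pmf.prob (p e) (if e \<in> H then {False} else UNIV) \<le> (if e \<in> H then 1 - q else 1)"
      using assms(3) assms(5)[of e] by (auto simp: measure_pmf_single)
  qed
  also have "\<dots> = (1 - q) ^ card H"
    using assms(1,2) by (subst prod.If_cases) (auto simp: Int_absorb1)
  finally show ?thesis .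
qed

section \<open>Clusters of a graph given by the states of unordered pairs\<close>

definition pairs :: "'a set \<Rightarrow> 'a set set" where
  "pairs X = {e. e \<subseteq> X \<and> card e = 2}"

definition linked :: "('a set \<Rightarrow> bool) \<Rightarrow> 'a set \<Rightarrow> 'a rel" where
  "linked b X = {(x, y). x \<in> X \<and> y \<in> X \<and> x \<noteq> y \<and> b {x, y}}"

definition cluster :: "('a set \<Rightarrow> bool) \<Rightarrow> 'a set \<Rightarrow> 'a \<Rightarrow> 'a set" where
  "cluster b X x = (linked b X)\<^sup>* `` {x}"

text \<open>The cluster may run through all of \<open>X\<close>, and only its points in
  \<open>B\<close> are counted. This makes the property monotone in the window, and boxes whose
  points are joined through their surroundings count as good.\<close>

definition big :: "('a set \<Rightarrow> bool) \<Rightarrow> 'a set \<Rightarrow> 'a set \<Rightarrow> real \<Rightarrow> bool" where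
  "big b X B N \<longleftrightarrow> (\<exists>x\<in>X. N \<le> real (card (cluster b X x \<inter> B)))"

lemma pairs_iff: "{x, y} \<in> pairs X \<longleftrightarrow> x \<in> X \<and> y \<in> X \<and> x \<noteq> y"
  by (auto simp: pairs_def card_insert_if)

lemma finite_pairs [simp]: "finite X \<Longrightarrow> finite (pairs X)"
  by (auto simp: pairs_def)

lemma sym_linked: "sym (linked b X)"
  by (auto simp: linked_def sym_def insert_commute)

lemma linked_mono:
  assumes "\<And>e. e \<in> pairs X \<Longrightarrow> b e \<Longrightarrow> c e" "X \<subseteq> Y"
  shows "linked b X \<subseteq> linked c Y"
  using assms by (auto simp: linked_def pairs_iff)

lemma cluster_mono:
  assumes "\<And>e. e \<in> pairs X \<Longrightarrow> b e \<Longrightarrow> c e" "X \<subseteq> Y"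
  shows "cluster b X x \<subseteq> cluster c Y x"
  unfolding cluster_def using rtrancl_mono[OF linked_mono[of X b c Y]] assms by blast

lemma cluster_subset: "x \<in> X \<Longrightarrow> cluster b X x \<subseteq> X"
  unfolding cluster_def by (auto simp: linked_def elim: rtranclE)

lemma cluster_refl: "x \<in> cluster b X x"
  by (simp add: cluster_def)

lemma cluster_sym: "y \<in> cluster b X x \<Longrightarrow> x \<in> cluster b X y"
  using sym_rtrancl[OF sym_linked, of b X] unfolding cluster_def by (auto dest: symD)

lemma cluster_eq: "y \<in> cluster b X x \<Longrightarrow> cluster b X y = cluster b X x"
  using cluster_sym[of y b X x] unfolding cluster_def by (auto intro: rtrancl_trans)

lemma big_mono:
  assumes "big b X B N" "finite Y" "\<And>e. e \<in> pairs X \<Longrightarrow> b e \<Longrightarrow> c e" "X \<subseteq> Y" "B \<subseteq> B'" "N' \<le> N"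
  shows "big c Y B' N'"
proof -
  obtain x where x: "x \<in> X" "N \<le> real (card (cluster b X x \<inter> B))" using assms(1) by (auto simp: big_def)
  have "finite (cluster c Y x)"
    using x(1) assms(2,4) cluster_subset[of x Y c] finite_subset by blast
  hence "card (cluster b X x \<inter> B) \<le> card (cluster c Y x \<inter> B')"
    using cluster_mono[of X b c Y x] assms(3-5) by (intro card_mono) auto
  thus ?thesis using x assms(4,6) unfolding big_def by (intro bexI[of _ x]) auto
qed

text \<open>\<open>L1\<close> and \<open>L2\<close> stand for the points with marks at most
  \<open>\<sigma>\<close> and \<open>\<tau>\<close>. One cluster has to own enough points of both
  kinds, because in a pair of boxes it may have to provide either end of a candidate edge.\<close>

definition big2 :: "('a set \<Rightarrow> bool) \<Rightarrow> 'a set \<Rightarrow> 'a set \<Rightarrow> real \<Rightarrow> 'a set \<Rightarrow> real \<Rightarrow> 'a set \<Rightarrow> real \<Rightarrow> bool" where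
  "big2 b X B N L1 k1 L2 k2 \<longleftrightarrow> (\<exists>x\<in>X. N \<le> real (card (cluster b X x \<inter> B)) \<and>
     k1 \<le> real (card (cluster b X x \<inter> B \<inter> L1)) \<and> k2 \<le> real (card (cluster b X x \<inter> B \<inter> L2)))"

text \<open>Attaching every cluster to that of one fixed index \<open>i0\<close> is enough to join
  them all. Points are counted separately in the disjoint sets \<open>Q i\<close>, so the sum is
  correct even if some of the clusters already coincide.\<close>

lemma big_merge:
  assumes X: "finite X" and disj: "disjoint_family_on Q J" and J: "finite J" "J \<noteq> {}"
    and sub: "\<And>i. i \<in> J \<Longrightarrow> Q i \<subseteq> B"
    and t: "\<And>i. i \<in> J \<Longrightarrow> t i \<in> X \<and> N \<le> real (card (cluster a X (t i) \<inter> Q i))"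
    and ab: "\<And>e. e \<in> pairs X \<Longrightarrow> a e \<Longrightarrow> b e"
    and con: "\<And>i j. i \<in> J \<Longrightarrow> j \<in> J \<Longrightarrow> i \<noteq> j \<Longrightarrow>
       \<exists>x\<in>cluster a X (t i). \<exists>y\<in>cluster a X (t j). x \<noteq> y \<and> b {x, y}"
  shows "big b X B (real (card J) * N)"
proof -
  obtain i0 where i0: "i0 \<in> J" using J by auto
  define D where "D = cluster b X (t i0)"
  have sub_D: "cluster a X (t i) \<subseteq> D" if i: "i \<in> J" for i
  proof (cases "i = i0")
    case True
    thus ?thesis using cluster_mono[of X a b X] ab unfolding D_def by blast
  next
    case False
    then obtain x y where xy: "x \<in> cluster a X (t i0)" "y \<in> cluster a X (t i)" "x \<noteq> y" "b {x, y}"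
      using con[OF i0 i] by auto
    have "x \<in> X" "y \<in> X" using xy cluster_subset[of "t i0" X a] cluster_subset[of "t i" X a] t i i0 by auto
    have "x \<in> D" using xy(1) cluster_mono[of X a b X] ab unfolding D_def by blast
    moreover have "(x, y) \<in> linked b X" using xy \<open>x \<in> X\<close> \<open>y \<in> X\<close> by (auto simp: linked_def)
    ultimately have yD: "y \<in> D" unfolding D_def cluster_def by (auto intro: rtrancl_into_rtrancl)
    have "cluster a X (t i) = cluster a X y" using cluster_eq[OF xy(2)] by simp
    also have "\<dots> \<subseteq> cluster b X y" using cluster_mono[of X a b X] ab by blast
    also have "\<dots> = D" using cluster_eq[of y b X "t i0"] yD by (simp add: D_def)
    finally show ?thesis .
  qed
  have DX: "D \<subseteq> X" using cluster_subset[of "t i0" X b] t[OF i0] by (simp add: D_def)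
  hence fD: "finite D" using X finite_subset by auto
  have fin: "finite (cluster a X (t i) \<inter> Q i)" if "i \<in> J" for i
    using sub_D[OF that] fD by (auto intro: finite_subset)
  have "real (card J) * N = (\<Sum>i\<in>J. N)" by simp
  also have "\<dots> \<le> (\<Sum>i\<in>J. real (card (cluster a X (t i) \<inter> Q i)))"
    using t by (intro sum_mono) auto
  also have "\<dots> = real (card (\<Union>i\<in>J. cluster a X (t i) \<inter> Q i))"
    using disj fin J by (subst card_UN_disjoint) (auto simp: disjoint_family_on_def)
  also have "\<dots> \<le> real (card (D \<inter> B))"
    using sub_D sub fD by (intro of_nat_mono card_mono) auto
  finally show ?thesis using t i0 unfolding big_def D_def by auto
qed

text \<open>\<open>Z\<close> is realised as a thinned round \<open>Y\<close> followed by a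
  restoration \<open>W\<close>. Passing from \<open>Z\<close> to \<open>Y\<close> costs the
  perturbation error. Given a thinned graph with a fraction \<open>\<theta>\<close> of good boxes,
  any two of the chosen clusters have at least \<open>k1 * k2\<close> candidate edges in
  \<open>L\<close>; the last error term is a union bound, over at most \<open>(card I)^2\<close>
  pairs of boxes, for all candidates of a pair staying closed.\<close>

lemma sprinkle:
  fixes pr :: "'a set \<Rightarrow> real"
  assumes X: "finite X" and I: "finite I" "I \<noteq> {}" and disj: "disjoint_family_on Q I"
    and sub: "\<And>i. i \<in> I \<Longrightarrow> Q i \<subseteq> B"
    and pr: "\<And>e. e \<in> pairs X \<Longrightarrow> 0 \<le> pr e \<and> pr e \<le> 1"
    and p: "0 < p" "\<And>x y. x \<in> L1 \<inter> B \<inter> X \<Longrightarrow> y \<in> L2 \<inter> B \<inter> X \<Longrightarrow> x \<noteq> y \<Longrightarrow> p \<le> pr {x, y}"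
    and q: "0 \<le> q" "q \<le> 1/2" "q \<le> p" and s: "0 < s" "s \<le> 1" and \<theta>: "0 < \<theta>" "0 \<le> N"
    and k: "0 \<le> k1" "0 \<le> k2"
  defines "L \<equiv> {{x, y} | x y. x \<in> L1 \<inter> B \<inter> X \<and> y \<in> L2 \<inter> B \<inter> X \<and> x \<noteq> y}"
    and "Z \<equiv> Pi_pmf (pairs X) False (\<lambda>e. bernoulli_pmf (pr e))"
  shows "measure_pmf.prob Z {b. \<theta> * real (card I) \<le> real (card {i\<in>I. big2 b X (Q i) N L1 k1 L2 k2})}
     \<le> measure_pmf.prob Z {b. big b X B (\<theta> * real (card I) * N)}
        + s / 2 + 4 * q^2 / p * card L / s + (real (card I))^2 * exp (- (q * (k1 * k2)))"
proof -
  define A where "A = {b. \<theta> * real (card I) \<le> real (card {i\<in>I. big2 b X (Q i) N L1 k1 L2 k2})}"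
  define G where "G = {b. big b X B (\<theta> * real (card I) * N)}"
  define \<epsilon> where "\<epsilon> = (real (card I))^2 * exp (- (q * (k1 * k2)))"
  define pr' where "pr' = (\<lambda>e. if e \<in> L then (pr e - q) / (1 - q) else pr e)"
  define Y where "Y = Pi_pmf (pairs X) False (\<lambda>e. bernoulli_pmf (pr' e))"
  define W where "W = (\<lambda>a. Pi_pmf (pairs X) False (\<lambda>e. if a e then return_pmf True
      else bernoulli_pmf (if e \<in> L then q else 0)))"
  have fin: "finite (pairs X)" using X by simp
  have LE: "L \<subseteq> pairs X" by (auto simp: L_def pairs_iff)
  have Lp: "p \<le> pr e" if "e \<in> L" for e using that p(2) by (auto simp: L_def)
  have pert: "measure_pmf.prob Z A \<le> measure_pmf.prob Y A + s / 2 + 4 * q^2 / p * card L / s"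
    unfolding Z_def Y_def pr'_def
    by (rule Pi_pmf_bernoulli_perturb) (use fin LE pr p Lp q s in auto)
  have ZY: "Z = bind_pmf Y W"
  proof -
    have "Z = Pi_pmf (pairs X) False (\<lambda>e. bind_pmf (bernoulli_pmf (pr' e))
      (\<lambda>a. if a then return_pmf True else bernoulli_pmf (if e \<in> L then q else 0)))"
      unfolding Z_def
    proof (rule Pi_pmf_cong)
      fix e assume e: "e \<in> pairs X"
      define q' where "q' = (if e \<in> L then q else 0)"
      have 1: "pr' e = (pr e - q') / (1 - q')"
        by (simp add: pr'_def q'_def)
      have 2: "0 \<le> q'" "q' < 1" "q' \<le> pr e" "pr e \<le> 1"
        using pr[OF e] q Lp[of e] by (auto simp: q'_def)
      show "bernoulli_pmf (pr e) = bind_pmf (bernoulli_pmf (pr' e))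
          (\<lambda>a. if a then return_pmf True else bernoulli_pmf (if e \<in> L then q else 0))"
        unfolding 1 q'_def[symmetric] by (rule bernoulli_pmf_sprinkle[OF 2])
    qed auto
    also have "\<dots> = bind_pmf Y W"
      unfolding Y_def W_def by (subst Pi_pmf_bind[OF fin, where d' = False]) simp
    finally show ?thesis .
  qed
  have W: "1 - \<epsilon> \<le> measure_pmf.prob (W a) G" if a: "a \<in> A" for a
  proof -
    define J where "J = {i\<in>I. big2 a X (Q i) N L1 k1 L2 k2}"
    have JI: "J \<subseteq> I" and fJ: "finite J" using I by (auto simp: J_def)
    have cJ: "\<theta> * real (card I) \<le> real (card J)" using a by (simp add: A_def J_def)
    have "0 < \<theta> * real (card I)" using \<theta> I by (simp add: card_gt_0_iff)
    hence J0: "J \<noteq> {}" using cJ by auto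
    have "\<forall>i. i\<in>J \<longrightarrow> (\<exists>x. x\<in>X \<and> N \<le> real (card (cluster a X x \<inter> Q i)) \<and>
     k1 \<le> real (card (cluster a X x \<inter> Q i \<inter> L1)) \<and> k2 \<le> real (card (cluster a X x \<inter> Q i \<inter> L2)))"
      by (auto simp: J_def big2_def)
    then obtain t where t: "\<And>i. i \<in> J \<Longrightarrow> t i \<in> X \<and> N \<le> real (card (cluster a X (t i) \<inter> Q i)) \<and>
     k1 \<le> real (card (cluster a X (t i) \<inter> Q i \<inter> L1)) \<and> k2 \<le> real (card (cluster a X (t i) \<inter> Q i \<inter> L2))"
      unfolding choice_iff' by blast
    \<comment> \<open>Candidate edges have their \<open>L1\<close> end in box \<open>i\<close> and
      their \<open>L2\<close> end in box \<open>j\<close>. The boxes are disjoint, so distinct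
      ordered pairs give distinct unordered ones and the count is a full product.\<close>
    define H where "H = (\<lambda>i j. (\<lambda>(x, y). {x, y}) ` ((cluster a X (t i) \<inter> Q i \<inter> L1) \<times> (cluster a X (t j) \<inter> Q j \<inter> L2)))"
    define bad where "bad = (\<lambda>i j. {b. \<forall>e\<in>H i j. \<not> b e})"
    have HL: "H i j \<subseteq> L" and Hk: "k1 * k2 \<le> real (card (H i j))" if ij: "i \<in> J" "j \<in> J" "i \<noteq> j" for i j
    proof -
      have d: "Q i \<inter> Q j = {}" using disj ij JI by (auto simp: disjoint_family_on_def)
      have cX: "cluster a X (t i) \<subseteq> X" "cluster a X (t j) \<subseteq> X" using t[OF ij(1)] t[OF ij(2)] by (simp_all add: cluster_subset)
      show "H i j \<subseteq> L"
      proof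
        fix e assume "e \<in> H i j"
        then obtain x y where xy: "e = {x, y}" "x \<in> cluster a X (t i)" "x \<in> Q i" "x \<in> L1"
            "y \<in> cluster a X (t j)" "y \<in> Q j" "y \<in> L2"
          by (auto simp: H_def)
        moreover have "x \<noteq> y" using xy d by auto
        moreover have "x \<in> B" "y \<in> B" using xy sub[of i] sub[of j] ij JI by auto
        ultimately show "e \<in> L" using cX unfolding L_def by auto
      qed
      have inj: "inj_on (\<lambda>(x, y). {x, y}) ((cluster a X (t i) \<inter> Q i \<inter> L1) \<times> (cluster a X (t j) \<inter> Q j \<inter> L2))"
      proof (rule inj_onI, clarify)
        fix x y x' y' assume "x \<in> Q i" "x' \<in> Q i" "y \<in> Q j" "y' \<in> Q j" "{x, y} = {x', y'}"
        thus "x = x' \<and> y = y'" using d unfolding doubleton_eq_iff by blast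
      qed
      have "k1 * k2 \<le> real (card (cluster a X (t i) \<inter> Q i \<inter> L1)) * real (card (cluster a X (t j) \<inter> Q j \<inter> L2))"
        using t ij k by (intro mult_mono) auto
      also have "\<dots> = real (card (H i j))"
        unfolding H_def by (subst card_image[OF inj]) (simp add: card_cartesian_product)
      finally show "k1 * k2 \<le> real (card (H i j))" .
    qed
    have badp: "measure_pmf.prob (W a) (bad i j) \<le> exp (- (q * (k1 * k2)))" if ij: "i \<in> J" "j \<in> J" "i \<noteq> j" for i j
    proof -
      have "measure_pmf.prob (W a) (bad i j) \<le> (1 - q) ^ card (H i j)"
        unfolding W_def bad_def
      proof (rule Pi_pmf_all_closed)
        fix e assume e: "e \<in> H i j"
        \<comment> \<open>An edge that is open already after thinning is treated as a Bernoulli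
          variable with parameter 1, so every candidate edge is open with probability at least
          \<open>q\<close>.\<close>
        have "return_pmf True = bernoulli_pmf 1"
        proof (rule pmf_eqI)
          show "pmf (return_pmf True) b = pmf (bernoulli_pmf 1) b" for b by (cases b) auto
        qed
        moreover have "e \<in> L" using e HL[OF ij] by blast
        ultimately have "(if a e then return_pmf True else bernoulli_pmf (if e \<in> L then q else 0))
            = bernoulli_pmf (if a e then 1 else q)" by simp
        thus "\<exists>r. (if a e then return_pmf True else bernoulli_pmf (if e \<in> L then q else 0)) = bernoulli_pmf r \<and> q \<le> r \<and> r \<le> 1"
          using q by (intro exI[of _ "if a e then 1 else q"]) simp
      qed (use fin HL[OF ij] LE q in auto)
      also have "\<dots> \<le> exp (- q) ^ card (H i j)"
        using q exp_ge_add_one_self[of "-q"] by (intro power_mono) auto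
      also have "\<dots> = exp (- (q * real (card (H i j))))" by (simp add: exp_of_nat_mult[symmetric] mult.commute)
      also have "\<dots> \<le> exp (- (q * (k1 * k2)))" using Hk[OF ij] q by (simp add: mult_left_mono)
      finally show ?thesis .
    qed
    define P where "P = {(i, j). i \<in> J \<and> j \<in> J \<and> i \<noteq> j}"
    have fP: "finite P" and cP: "card P \<le> (card I)^2"
    proof -
      have "P \<subseteq> I \<times> I" using JI by (auto simp: P_def)
      thus "finite P" "card P \<le> (card I)^2"
        using I card_mono[of "I \<times> I" P] finite_subset[of P "I \<times> I"] by (auto simp: card_cartesian_product power2_eq_square)
    qed
    have "measure_pmf.prob (W a) (UNIV - G) \<le> measure_pmf.prob (W a) (\<Union>(i, j)\<in>P. bad i j)"
    proof (rule measure_pmf.finite_measure_mono_AE)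
      show "AE b in measure_pmf (W a). b \<in> UNIV - G \<longrightarrow> b \<in> (\<Union>(i, j)\<in>P. bad i j)"
      proof (rule AE_pmfI)
        fix b assume b: "b \<in> set_pmf (W a)"
        have ab: "b e" if "e \<in> pairs X" "a e" for e
        proof -
          have "b e \<in> set_pmf (if a e then return_pmf True else bernoulli_pmf (if e \<in> L then q else 0))"
            using b that(1) fin unfolding W_def by (auto simp: set_Pi_pmf PiE_dflt_def)
          thus ?thesis using that by simp
        qed
        have "b \<in> G" if nb: "b \<notin> (\<Union>(i, j)\<in>P. bad i j)"
        proof -
          have "big b X B (real (card J) * N)"
          proof (rule big_merge[OF X _ fJ J0, where a = a and t = t and Q = Q])
            show "disjoint_family_on Q J" using disj JI by (auto simp: disjoint_family_on_def)
            fix i j assume ij: "i \<in> J" "j \<in> J" "i \<noteq> j"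
            hence "b \<notin> bad i j" using nb by (auto simp: P_def)
            then obtain x y where "x \<in> cluster a X (t i) \<inter> Q i" "y \<in> cluster a X (t j) \<inter> Q j" "b {x, y}"
              by (auto simp: bad_def H_def)
            moreover have "Q i \<inter> Q j = {}" using disj ij JI by (auto simp: disjoint_family_on_def)
            ultimately show "\<exists>x\<in>cluster a X (t i). \<exists>y\<in>cluster a X (t j). x \<noteq> y \<and> b {x, y}"
              by (intro bexI[of _ x] bexI[of _ y]) auto
          next
            show "Q i \<subseteq> B" if "i \<in> J" for i using sub JI that by auto
            show "t i \<in> X \<and> N \<le> real (card (cluster a X (t i) \<inter> Q i))" if "i \<in> J" for i
              using t[OF that] by simp
          qed (rule ab)
          hence "big b X B (\<theta> * real (card I) * N)"
            by (rule big_mono[OF _ X]) (use mult_right_mono[OF cJ \<theta>(2)] in simp_all)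
          thus ?thesis by (simp add: G_def)
        qed
        thus "b \<in> UNIV - G \<longrightarrow> b \<in> (\<Union>(i, j)\<in>P. bad i j)" by (intro impI) (erule contrapos_pp, simp)
      qed
    qed auto
    also have "\<dots> \<le> (\<Sum>(i, j)\<in>P. measure_pmf.prob (W a) (bad i j))"
      using measure_UNION_le[OF fP, of "\<lambda>(i, j). bad i j" "measure_pmf (W a)"] by (simp add: case_prod_unfold)
    also have "\<dots> \<le> (\<Sum>(i, j)\<in>P. exp (- (q * (k1 * k2))))"
      using badp by (intro sum_mono) (auto simp: P_def)
    also have "\<dots> = real (card P) * exp (- (q * (k1 * k2)))" by simp
    also have "\<dots> \<le> \<epsilon>"
      using cP unfolding \<epsilon>_def by (intro mult_right_mono) (auto simp flip: of_nat_power)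
    finally show ?thesis using measure_pmf.prob_compl[of G "W a"] by simp
  qed
  have "measure_pmf.prob Y A - \<epsilon> \<le> measure_pmf.prob Z G"
  proof -
    have e0: "0 \<le> \<epsilon>" by (simp add: \<epsilon>_def)
    have int: "integrable (measure_pmf Y) (\<lambda>a. measure_pmf.prob (W a) G)"
      by (rule measure_pmf.integrable_const_bound[where B = 1]) auto
    have int2: "integrable (measure_pmf Y) (indicator A :: _ \<Rightarrow> real)"
      by (rule measure_pmf.integrable_const_bound[where B = 1]) (auto simp: indicator_def)
    have "measure_pmf.prob Y A = measure_pmf.expectation Y (indicator A)"
      by simp
    also have "\<dots> \<le> measure_pmf.expectation Y (\<lambda>a. measure_pmf.prob (W a) G + \<epsilon>)"
    proof (rule integral_mono[OF int2])
      show "integrable (measure_pmf Y) (\<lambda>a. measure_pmf.prob (W a) G + \<epsilon>)"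
        using int by (intro Bochner_Integration.integrable_add) simp_all
      show "indicator A a \<le> measure_pmf.prob (W a) G + \<epsilon>" for a
        using W[of a] e0 by (cases "a \<in> A") (simp_all add: add_nonneg_nonneg)
    qed
    also have "\<dots> = measure_pmf.expectation Y (\<lambda>a. measure_pmf.prob (W a) G) + \<epsilon>"
      using int by simp
    also have "measure_pmf.expectation Y (\<lambda>a. measure_pmf.prob (W a) G) = measure_pmf.prob Z G"
      unfolding ZY by (rule measure_bind_pmf_expectation[symmetric])
    finally have "measure_pmf.prob Y A \<le> measure_pmf.prob Z G + \<epsilon>" .
    thus ?thesis by simp
  qed
  thus ?thesis using pert unfolding A_def G_def \<epsilon>_def by linarith
qed

section \<open>Low marks in a cluster\<close>

lemma sets_uniform01 [measurable_cong, simp]: "sets uniform01 = sets borel"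
  by (simp add: uniform01_def)

lemma space_uniform01 [simp]: "space uniform01 = UNIV"
  by (simp add: uniform01_def)

lemma emeasure_uniform01: "A \<in> sets borel \<Longrightarrow> emeasure uniform01 A = emeasure lborel ({0<..<1} \<inter> A)"
  by (simp add: uniform01_def emeasure_uniform_measure divide_ennreal_def)

interpretation U: prob_space uniform01
  by standard (simp add: emeasure_uniform01)

lemma uniform01_low:
  assumes "0 \<le> \<sigma>" "\<sigma> \<le> 1"
  shows "emeasure uniform01 {..\<sigma>} = ennreal \<sigma>" and "emeasure uniform01 {\<sigma><..} = ennreal (1 - \<sigma>)"
proof -
  have "emeasure uniform01 {..\<sigma>} = ennreal \<sigma>"
  proof (cases "\<sigma> = 1")
    case True
    hence "{0<..<1} \<inter> {..\<sigma>} = {0<..<1::real}" by auto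
    thus ?thesis using True by (simp add: emeasure_uniform01)
  next
    case False
    hence "{0<..<1} \<inter> {..\<sigma>} = {0<..\<sigma>}" using assms by auto
    thus ?thesis using assms by (simp add: emeasure_uniform01)
  qed
  thus "emeasure uniform01 {..\<sigma>} = ennreal \<sigma>" .
  have "{0<..<1} \<inter> {\<sigma><..} = {\<sigma><..<1}" using assms by auto
  thus "emeasure uniform01 {\<sigma><..} = ennreal (1 - \<sigma>)" using assms by (simp add: emeasure_uniform01)
qed

text \<open>Divided by its mean \<open>1 - \<sigma> / 2\<close>, this is the density of a mark law
  in which low marks are half as likely relative to the others.\<close>

definition tilt :: "real \<Rightarrow> real \<Rightarrow> ennreal" where
  "tilt \<sigma> t = (if t \<le> \<sigma> then ennreal (1/2) else 1)"

lemma measurable_tilt [measurable]: "tilt \<sigma> \<in> borel_measurable borel"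
  unfolding tilt_def by measurable

lemma tilt_le_1: "tilt \<sigma> t \<le> 1"
proof -
  have "ennreal (1/2) \<le> ennreal 1" by (rule ennreal_leI) simp
  thus ?thesis by (simp only: tilt_def ennreal_1 split: if_split) simp
qed

text \<open>Positive association of two non-decreasing functions of one mark. Comparing
  \<open>h\<close> with the constant \<open>h \<sigma>\<close> on both sides of
  \<open>\<sigma>\<close> gives \<open>(1 - \<sigma>) * a' \<le> \<sigma> * b'\<close>, to which the
  claim is equivalent.\<close>

lemma uniform01_tilt:
  fixes h :: "real \<Rightarrow> ennreal"
  assumes [measurable]: "h \<in> borel_measurable borel" and mono: "\<And>s t. s \<le> t \<Longrightarrow> h s \<le> h t"
    and h1: "\<And>t. h t \<le> 1" and \<sigma>: "0 \<le> \<sigma>" "\<sigma> \<le> 1"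
  shows "ennreal (1 - \<sigma>/2) * (\<integral>\<^sup>+t. h t \<partial>uniform01) \<le> (\<integral>\<^sup>+t. h t * tilt \<sigma> t \<partial>uniform01)"
proof -
  define a where "a = (\<integral>\<^sup>+t. h t * indicator {..\<sigma>} t \<partial>uniform01)"
  define b where "b = (\<integral>\<^sup>+t. h t * indicator {\<sigma><..} t \<partial>uniform01)"
  have "(\<integral>\<^sup>+t. h t \<partial>uniform01) = (\<integral>\<^sup>+t. h t * indicator {..\<sigma>} t + h t * indicator {\<sigma><..} t \<partial>uniform01)"
    by (intro nn_integral_cong) (auto simp: indicator_def)
  also have "\<dots> = a + b" unfolding a_def b_def by (intro nn_integral_add) measurable
  finally have ab: "(\<integral>\<^sup>+t. h t \<partial>uniform01) = a + b" .
  have "(\<integral>\<^sup>+t. h t * tilt \<sigma> t \<partial>uniform01)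
      = (\<integral>\<^sup>+t. ennreal (1/2) * (h t * indicator {..\<sigma>} t) + h t * indicator {\<sigma><..} t \<partial>uniform01)"
    by (intro nn_integral_cong) (auto simp: indicator_def tilt_def mult.commute)
  also have "\<dots> = ennreal (1/2) * a + b" unfolding a_def b_def
    by (subst nn_integral_add) (auto simp: nn_integral_cmult)
  finally have g: "(\<integral>\<^sup>+t. h t * tilt \<sigma> t \<partial>uniform01) = ennreal (1/2) * a + b" .
  have le1: "a \<le> 1" "b \<le> 1"
  proof -
    have "a \<le> (\<integral>\<^sup>+t. 1 \<partial>uniform01)" "b \<le> (\<integral>\<^sup>+t. 1 \<partial>uniform01)"
      unfolding a_def b_def by (intro nn_integral_mono; simp add: h1 indicator_def)+
    thus "a \<le> 1" "b \<le> 1" by (simp_all add: U.emeasure_space_1[simplified])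
  qed
  obtain a' where a': "a = ennreal a'" "0 \<le> a'" using le1 by (cases a) (auto simp: top_unique)
  obtain b' where b': "b = ennreal b'" "0 \<le> b'" using le1 by (cases b) (auto simp: top_unique)
  obtain c where c: "h \<sigma> = ennreal c" "0 \<le> c" using h1[of \<sigma>] by (cases "h \<sigma>") (auto simp: top_unique)
  have "a \<le> (\<integral>\<^sup>+t. h \<sigma> * indicator {..\<sigma>} t \<partial>uniform01)"
    unfolding a_def using mono by (intro nn_integral_mono) (auto simp: indicator_def)
  also have "\<dots> = ennreal (c * \<sigma>)" using uniform01_low[OF \<sigma>] c \<sigma>
    by (simp add: nn_integral_cmult_indicator ennreal_mult')
  finally have A: "a' \<le> c * \<sigma>" using a' c \<sigma> by simp
  have "(\<integral>\<^sup>+t. h \<sigma> * indicator {\<sigma><..} t \<partial>uniform01) \<le> b"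
    unfolding b_def using mono by (intro nn_integral_mono) (auto simp: indicator_def)
  moreover have "(\<integral>\<^sup>+t. h \<sigma> * indicator {\<sigma><..} t \<partial>uniform01) = ennreal (c * (1 - \<sigma>))"
    using uniform01_low[OF \<sigma>] c \<sigma> by (simp add: nn_integral_cmult_indicator ennreal_mult')
  ultimately have B: "c * (1 - \<sigma>) \<le> b'" using b' c \<sigma> by simp
  have "(1 - \<sigma>) * a' \<le> (1 - \<sigma>) * (c * \<sigma>)" using A \<sigma> by (intro mult_left_mono) auto
  also have "\<dots> = \<sigma> * (c * (1 - \<sigma>))" by simp
  also have "\<dots> \<le> \<sigma> * b'" using B \<sigma> by (intro mult_left_mono) auto
  finally have "(1 - \<sigma>/2) * (a' + b') \<le> 1/2 * a' + b'" by (simp add: field_simps)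
  moreover have "ennreal (1/2) * ennreal a' + ennreal b' = ennreal (1/2 * a' + b')"
    using a' b' ennreal_mult[of "1/2" a'] ennreal_plus[of "1/2 * a'" b'] by (simp only: zero_le_divide_1_iff zero_le_numeral mult_nonneg_nonneg)
  moreover have "ennreal (1 - \<sigma>/2) * (ennreal a' + ennreal b') = ennreal ((1 - \<sigma>/2) * (a' + b'))"
    using a' b' \<sigma> by (simp add: ennreal_mult flip: ennreal_plus)
  ultimately show ?thesis unfolding ab g unfolding a'(1) b'(1) by (metis ennreal_leI)
qed

interpretation UP: product_sigma_finite "\<lambda>_. uniform01"
  by standard

text \<open>One coordinate at a time: when the mark at \<open>x\<close> is integrated with all other
  marks frozen, the tilts at the other points are constant and the integrand is non-decreasing in
  this mark.\<close>

lemma PiM_tilt: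
  fixes F :: "('a \<Rightarrow> real) \<Rightarrow> ennreal"
  assumes X: "finite X" and S: "S \<subseteq> X" and F[measurable]: "F \<in> borel_measurable (Pi\<^sub>M X (\<lambda>_. uniform01))"
    and F1: "\<And>u. F u \<le> 1" and \<sigma>: "0 \<le> \<sigma>" "\<sigma> \<le> 1"
    and mono: "\<And>u x s t. x \<in> S \<Longrightarrow> s \<le> t \<Longrightarrow> F (u(x := s)) \<le> F (u(x := t))"
  shows "ennreal (1 - \<sigma>/2) ^ card S * (\<integral>\<^sup>+u. F u \<partial>Pi\<^sub>M X (\<lambda>_. uniform01))
    \<le> (\<integral>\<^sup>+u. F u * (\<Prod>x\<in>S. tilt \<sigma> (u x)) \<partial>Pi\<^sub>M X (\<lambda>_. uniform01))"
proof -
  have "finite S" using S X finite_subset by auto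
  thus ?thesis using S mono
  proof (induction S rule: finite_induct)
    case (insert x S)
    define F' where "F' = (\<lambda>u. F u * (\<Prod>x\<in>S. tilt \<sigma> (u x)))"
    have SX: "S \<subseteq> X" "x \<in> X" using insert.prems by auto
    have [measurable]: "F' \<in> borel_measurable (Pi\<^sub>M X (\<lambda>_. uniform01))"
      unfolding F'_def
    proof (intro borel_measurable_times_ennreal F borel_measurable_prod_ennreal)
      fix y assume "y \<in> S"
      hence [measurable]: "y \<in> X" using SX by auto
      show "(\<lambda>u. tilt \<sigma> (u y)) \<in> borel_measurable (Pi\<^sub>M X (\<lambda>_. uniform01))" by measurable
    qed
    have F'1: "F' u \<le> 1" for u
    proof -
      have "(\<Prod>x\<in>S. tilt \<sigma> (u x)) \<le> 1" using tilt_le_1 by (intro prod_le_1) auto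
      thus ?thesis unfolding F'_def using F1[of u] by (metis mult_mono mult_1 zero_le)
    qed
    have F'm: "F' (u(x := s)) \<le> F' (u(x := t))" if "s \<le> t" for u s t
    proof -
      have "(\<Prod>y\<in>S. tilt \<sigma> ((u(x := s)) y)) = (\<Prod>y\<in>S. tilt \<sigma> ((u(x := t)) y))"
        using insert.hyps by (intro prod.cong) auto
      moreover have "F (u(x := s)) \<le> F (u(x := t))"
        by (rule insert.prems(2)[OF _ that]) simp
      ultimately show ?thesis unfolding F'_def
        by (simp only: mult_right_mono zero_le)
    qed
    have ins: "insert x (X - {x}) = X" using SX by auto
    have meas: "(\<lambda>t. F' (w(x := t))) \<in> borel_measurable borel" if w: "w \<in> space (Pi\<^sub>M (X - {x}) (\<lambda>_. uniform01))" for w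
    proof -
      have "(\<lambda>t. w(x := t)) \<in> measurable uniform01 (Pi\<^sub>M (insert x (X - {x})) (\<lambda>_. uniform01))"
        by (rule measurable_fun_upd[where J = "X - {x}"]) (use w in auto)
      hence "(\<lambda>t. F' (w(x := t))) \<in> borel_measurable uniform01"
        unfolding ins by (rule measurable_compose) measurable
      thus ?thesis by (simp add: measurable_def)
    qed
    have int: "(\<integral>\<^sup>+u. H u \<partial>Pi\<^sub>M X (\<lambda>_. uniform01))
      = (\<integral>\<^sup>+w. (\<integral>\<^sup>+t. H (w(x := t)) \<partial>uniform01) \<partial>Pi\<^sub>M (X - {x}) (\<lambda>_. uniform01))"
      if [measurable]: "H \<in> borel_measurable (Pi\<^sub>M X (\<lambda>_. uniform01))" for H :: "_ \<Rightarrow> ennreal"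
      using UP.product_nn_integral_insert[of "X - {x}" x H] X that unfolding ins by simp
    have [measurable]: "(\<lambda>u. F' u * tilt \<sigma> (u x)) \<in> borel_measurable (Pi\<^sub>M X (\<lambda>_. uniform01))"
      using SX by measurable
    have "ennreal (1 - \<sigma>/2) ^ card (insert x S) * (\<integral>\<^sup>+u. F u \<partial>Pi\<^sub>M X (\<lambda>_. uniform01))
        \<le> ennreal (1 - \<sigma>/2) * (\<integral>\<^sup>+u. F' u \<partial>Pi\<^sub>M X (\<lambda>_. uniform01))"
      using insert.IH[OF SX(1)] insert.prems(2) insert.hyps unfolding F'_def
      by (simp add: mult.assoc mult_left_mono)
    also have "\<dots> = (\<integral>\<^sup>+w. ennreal (1 - \<sigma>/2) * (\<integral>\<^sup>+t. F' (w(x := t)) \<partial>uniform01) \<partial>Pi\<^sub>M (X - {x}) (\<lambda>_. uniform01))"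
    proof -
      have "(\<lambda>w. \<integral>\<^sup>+t. F' (w(x := t)) \<partial>uniform01) \<in> borel_measurable (Pi\<^sub>M (X - {x}) (\<lambda>_. uniform01))"
      proof (rule U.borel_measurable_nn_integral)
        have "(\<lambda>(w, t). w(x := t)) \<in> measurable (Pi\<^sub>M (X - {x}) (\<lambda>_. uniform01) \<Otimes>\<^sub>M uniform01) (Pi\<^sub>M (insert x (X - {x})) (\<lambda>_. uniform01))"
          by (rule measurable_add_dim)
        hence "(\<lambda>wt. F' ((\<lambda>(w, t). w(x := t)) wt)) \<in> borel_measurable (Pi\<^sub>M (X - {x}) (\<lambda>_. uniform01) \<Otimes>\<^sub>M uniform01)"
          unfolding ins by (rule measurable_compose) measurable
        thus "(\<lambda>(w, t). F' (w(x := t))) \<in> borel_measurable (Pi\<^sub>M (X - {x}) (\<lambda>_. uniform01) \<Otimes>\<^sub>M uniform01)"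
          by (simp add: case_prod_unfold)
      qed
      thus ?thesis by (subst int) (auto simp: nn_integral_cmult)
    qed
    also have "\<dots> \<le> (\<integral>\<^sup>+w. (\<integral>\<^sup>+t. F' (w(x := t)) * tilt \<sigma> ((w(x := t)) x) \<partial>uniform01) \<partial>Pi\<^sub>M (X - {x}) (\<lambda>_. uniform01))"
      using uniform01_tilt[OF meas F'm F'1 \<sigma>] by (intro nn_integral_mono) auto
    also have "\<dots> = (\<integral>\<^sup>+u. F' u * tilt \<sigma> (u x) \<partial>Pi\<^sub>M X (\<lambda>_. uniform01))"
      by (subst int) auto
    also have "\<dots> = (\<integral>\<^sup>+u. F u * (\<Prod>x\<in>insert x S. tilt \<sigma> (u x)) \<partial>Pi\<^sub>M X (\<lambda>_. uniform01))"
      unfolding F'_def using insert.hyps by (intro nn_integral_cong) (simp add: mult_ac)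
    finally show ?case .
  qed simp
qed

text \<open>Edges inside \<open>C\<close> are kept and no edge is added, so \<open>C\<close> remains
  connected and isolated. Applied to raising the mark of a point outside \<open>C\<close>: the event
  that \<open>C\<close> is a cluster is non-decreasing in the marks outside
  \<open>C\<close>.\<close>

lemma cluster_anti_outside:
  assumes C: "cluster b X y = C"
    and le: "\<And>e. e \<in> pairs X \<Longrightarrow> c e \<Longrightarrow> b e" and eq: "\<And>e. e \<in> pairs X \<Longrightarrow> e \<subseteq> C \<Longrightarrow> b e \<Longrightarrow> c e"
  shows "cluster c X y = C"
proof
  show "cluster c X y \<subseteq> C" using cluster_mono[of X c b X y] le C by auto
  have "(y, z) \<in> (linked c X)\<^sup>*" if "(y, z) \<in> (linked b X)\<^sup>*" for z
    using that
  proof (induction rule: rtrancl_induct)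
    case (step z w)
    have "z \<in> C" "w \<in> C" using step.hyps C unfolding cluster_def by (auto intro: rtrancl_into_rtrancl)
    moreover have "{z, w} \<in> pairs X" "b {z, w}" using step.hyps(2) by (auto simp: linked_def pairs_iff)
    ultimately have "c {z, w}" using eq by auto
    hence "(z, w) \<in> linked c X" using step.hyps(2) by (auto simp: linked_def)
    thus ?case using step.IH by (rule rtrancl_into_rtrancl[rotated])
  qed simp
  thus "C \<subseteq> cluster c X y" using C unfolding cluster_def by auto
qed

text \<open>Weighting a cluster by \<open>1/2\<close> per low mark changes the mark law on the cluster only; by monotonicity the
  same change of law outside the cluster can only help. Summing over clusters then costs no entropy.\<close>

lemma cluster_low_marks:
  fixes st :: "('a \<Rightarrow> real) \<Rightarrow> 'a set \<Rightarrow> bool" and X :: "'a set"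
  defines "M \<equiv> Pi\<^sub>M X (\<lambda>_. uniform01)"
  assumes X: "finite X" and Q: "Q \<subseteq> X" and \<sigma>: "0 \<le> \<sigma>" "\<sigma> \<le> 1" and N: "0 < N"
    and mono: "\<And>u x s t e. e \<in> pairs X \<Longrightarrow> x \<in> X \<Longrightarrow> s \<le> t \<Longrightarrow> st (u(x := t)) e \<Longrightarrow> st (u(x := s)) e"
    and loc: "\<And>u x s e. e \<in> pairs X \<Longrightarrow> x \<in> X - e \<Longrightarrow> st (u(x := s)) e = st u e"
    and meas: "\<And>C. C \<subseteq> X \<Longrightarrow> Measurable.pred M (\<lambda>u. \<exists>x\<in>X. cluster (st u) X x = C)"
  shows "emeasure M {u\<in>space M. \<exists>x\<in>X. N \<le> real (card (cluster (st u) X x \<inter> Q)) \<and>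
       real (card (cluster (st u) X x \<inter> Q \<inter> {y. u y \<le> \<sigma>})) < k}
     \<le> ennreal (real (card Q) / N * 2 powr k * (1 - \<sigma>/2) powr N)" (is "emeasure M ?bad \<le> _")
proof -
  interpret M: prob_space M unfolding M_def by (intro prob_space_PiM U.prob_space_axioms)
  define \<gamma> where "\<gamma> = 1 - \<sigma>/2"
  have \<gamma>: "0 < \<gamma>" "\<gamma> \<le> 1" using \<sigma> by (auto simp: \<gamma>_def)
  define n where "n = card Q"
  have fQ: "finite Q" using Q X finite_subset by auto
  define CC where "CC = {C. C \<subseteq> X \<and> N \<le> real (card (C \<inter> Q))}"
  have fCC: "finite CC" using X by (auto simp: CC_def)
  define F where "F = (\<lambda>C u. indicator {u. \<exists>x\<in>X. cluster (st u) X x = C} u :: ennreal)"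
  have Fm[measurable]: "F C \<in> borel_measurable M" if "C \<subseteq> X" for C
  proof -
    have [measurable]: "Measurable.pred M (\<lambda>u. \<exists>x\<in>X. cluster (st u) X x = C)" by (rule meas[OF that])
    have "F C = (\<lambda>u. if (\<exists>x\<in>X. cluster (st u) X x = C) then 1 else 0)"
      by (auto simp: F_def fun_eq_iff)
    thus ?thesis by simp
  qed
  have pm: "(\<lambda>u. \<Prod>x\<in>S. tilt \<sigma> (u x)) \<in> borel_measurable M" if "S \<subseteq> X" for S
    unfolding M_def
  proof (rule borel_measurable_prod_ennreal)
    fix y assume "y \<in> S"
    hence [measurable]: "y \<in> X" using that by auto
    show "(\<lambda>u. tilt \<sigma> (u y)) \<in> borel_measurable (Pi\<^sub>M X (\<lambda>_. uniform01))" by measurable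
  qed
  have p1: "(\<Prod>x\<in>S. tilt \<sigma> (u x)) \<le> 1" for S u
    using tilt_le_1 by (intro prod_le_1) auto
  define I1 where "I1 = (\<lambda>C. \<integral>\<^sup>+u. F C u * (\<Prod>x\<in>C\<inter>Q. tilt \<sigma> (u x)) \<partial>M)"
  define I2 where "I2 = (\<lambda>C. \<integral>\<^sup>+u. F C u * (\<Prod>x\<in>Q. tilt \<sigma> (u x)) \<partial>M)"
  have Fanti: "F C (u(x := s)) \<le> F C (u(x := t))" if "s \<le> t" "x \<in> X - C" for C u x s t
  proof -
    have "cluster (st (u(x := t))) X y = C" if y: "cluster (st (u(x := s))) X y = C" for y
    proof (rule cluster_anti_outside[OF y])
      fix e assume e: "e \<in> pairs X"
      show "st (u(x := s)) e" if "st (u(x := t)) e" using mono[OF e _ \<open>s \<le> t\<close> that] \<open>x \<in> X - C\<close> by auto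
      show "st (u(x := t)) e" if "e \<subseteq> C" "st (u(x := s)) e"
        using loc[OF e, of x u s] loc[OF e, of x u t] that \<open>x \<in> X - C\<close> by auto
    qed
    thus ?thesis by (auto simp: F_def indicator_def)
  qed
  have I12: "ennreal \<gamma> ^ n * I1 C \<le> ennreal (\<gamma> powr N) * I2 C" if C: "C \<in> CC" for C
  proof -
    have CX: "C \<subseteq> X" and CN: "N \<le> real (card (C \<inter> Q))" using C by (auto simp: CC_def)
    have "ennreal \<gamma> ^ card (Q - C) * I1 C
      \<le> (\<integral>\<^sup>+u. F C u * (\<Prod>x\<in>C\<inter>Q. tilt \<sigma> (u x)) * (\<Prod>x\<in>Q-C. tilt \<sigma> (u x)) \<partial>M)"
      unfolding I1_def \<gamma>_def M_def
    proof (rule PiM_tilt[OF X])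
      show "(\<lambda>u. F C u * (\<Prod>x\<in>C\<inter>Q. tilt \<sigma> (u x))) \<in> borel_measurable (Pi\<^sub>M X (\<lambda>_. uniform01))"
        using borel_measurable_times_ennreal[OF Fm[OF CX] pm[of "C \<inter> Q"]] Q unfolding M_def by blast
      show "F C u * (\<Prod>x\<in>C\<inter>Q. tilt \<sigma> (u x)) \<le> 1" for u
        using p1[of u "C \<inter> Q"] by (auto simp: F_def indicator_def)
      fix u x and s t :: real assume x: "x \<in> Q - C" and st: "s \<le> t"
      have "(\<Prod>y\<in>C\<inter>Q. tilt \<sigma> ((u(x := s)) y)) = (\<Prod>y\<in>C\<inter>Q. tilt \<sigma> ((u(x := t)) y))"
        using x by (intro prod.cong) auto
      thus "F C (u(x := s)) * (\<Prod>y\<in>C\<inter>Q. tilt \<sigma> ((u(x := s)) y)) \<le> F C (u(x := t)) * (\<Prod>y\<in>C\<inter>Q. tilt \<sigma> ((u(x := t)) y))"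
        using Fanti[OF st, of x C u] x Q by (auto intro!: mult_right_mono)
    qed (use Q \<sigma> in auto)
    also have "\<dots> = I2 C"
      unfolding I2_def mult.assoc
      by (intro nn_integral_cong arg_cong2[where f = "(*)"] refl)
        (subst prod.union_disjoint[symmetric], use fQ in \<open>auto intro!: prod.cong\<close>)
    finally have 1: "ennreal \<gamma> ^ card (Q - C) * I1 C \<le> I2 C" .
    have n: "n = card (C \<inter> Q) + card (Q - C)"
      unfolding n_def using fQ by (subst card_Un_disjoint[symmetric]) (auto intro: arg_cong[where f = card])
    have "\<gamma> ^ card (C \<inter> Q) = \<gamma> powr real (card (C \<inter> Q))" using \<gamma> by (simp add: powr_realpow)
    also have "\<dots> \<le> \<gamma> powr N" using \<gamma> CN by (intro powr_mono') auto
    finally have 2: "ennreal \<gamma> ^ card (C \<inter> Q) \<le> ennreal (\<gamma> powr N)"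
      using \<gamma> by (simp add: ennreal_power ennreal_leI)
    have "ennreal \<gamma> ^ n * I1 C = ennreal \<gamma> ^ card (C \<inter> Q) * (ennreal \<gamma> ^ card (Q - C) * I1 C)"
      unfolding n by (simp add: power_add mult.assoc)
    also have "\<dots> \<le> ennreal (\<gamma> powr N) * I2 C" using 2 1 by (rule mult_mono) auto
    finally show ?thesis .
  qed
  \<comment> \<open>Distinct clusters are disjoint, so at most \<open>n / N\<close> of them have
    \<open>N\<close> points in \<open>Q\<close>. The full product of tilts in \<open>I2\<close> does
    not depend on \<open>C\<close>, hence the sum over \<open>C\<close> can be taken under the
    integral.\<close>
  have cnt: "(\<Sum>C\<in>CC. F C u) \<le> ennreal (real n / N)" for u
  proof -
    define D where "D = {C\<in>CC. \<exists>x\<in>X. cluster (st u) X x = C}"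
    have fD: "finite D" using fCC by (auto simp: D_def)
    have dj: "C \<inter> C' = {}" if "C \<in> D" "C' \<in> D" "C \<noteq> C'" for C C'
    proof (rule ccontr)
      assume "C \<inter> C' \<noteq> {}"
      then obtain z where "z \<in> C" "z \<in> C'" by auto
      moreover obtain x x' where "cluster (st u) X x = C" "cluster (st u) X x' = C'" using \<open>C \<in> D\<close> \<open>C' \<in> D\<close> by (auto simp: D_def)
      ultimately show False using cluster_eq[of z "st u" X x] cluster_eq[of z "st u" X x'] \<open>C \<noteq> C'\<close> by auto
    qed
    have "real (card D) * N = (\<Sum>C\<in>D. N)" by simp
    also have "\<dots> \<le> (\<Sum>C\<in>D. real (card (C \<inter> Q)))" by (intro sum_mono) (auto simp: D_def CC_def)
    also have "\<dots> = real (card (\<Union>C\<in>D. C \<inter> Q))"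
      using fD fQ dj by (subst card_UN_disjoint) auto
    also have "\<dots> \<le> real n" unfolding n_def using fQ by (intro of_nat_mono card_mono) auto
    finally have *: "real (card D) \<le> real n / N" using N by (simp add: field_simps)
    have "(\<Sum>C\<in>CC. F C u) = (\<Sum>C\<in>D. 1)"
      using fCC by (intro sum.mono_neutral_cong_right) (auto simp: D_def F_def)
    also have "\<dots> = ennreal (real (card D))" by (simp add: ennreal_of_nat_eq_real_of_nat)
    also have "\<dots> \<le> ennreal (real n / N)" using * by (rule ennreal_leI)
    finally show ?thesis .
  qed
  have prodint: "(\<integral>\<^sup>+u. (\<Prod>x\<in>Q. tilt \<sigma> (u x)) \<partial>M) = ennreal \<gamma> ^ n"
  proof -
    have t: "(\<integral>\<^sup>+t. tilt \<sigma> t \<partial>uniform01) = ennreal \<gamma>"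
    proof -
      have "(\<integral>\<^sup>+t. tilt \<sigma> t \<partial>uniform01) = (\<integral>\<^sup>+t. ennreal (1/2) * indicator {..\<sigma>} t + indicator {\<sigma><..} t \<partial>uniform01)"
        by (intro nn_integral_cong) (auto simp: tilt_def indicator_def)
      also have "\<dots> = ennreal (1/2) * ennreal \<sigma> + ennreal (1 - \<sigma>)"
        by (subst nn_integral_add) (auto simp: nn_integral_cmult_indicator uniform01_low[OF \<sigma>])
      also have "\<dots> = ennreal (1/2 * \<sigma> + (1 - \<sigma>))"
        using \<sigma> ennreal_mult[of "1/2" \<sigma>] ennreal_plus[of "1/2 * \<sigma>" "1 - \<sigma>"]
        by (simp only: zero_le_divide_1_iff zero_le_numeral mult_nonneg_nonneg diff_ge_0_iff_ge)
      also have "1/2 * \<sigma> + (1 - \<sigma>) = \<gamma>" by (simp add: \<gamma>_def)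
      finally show ?thesis .
    qed
    have "(\<integral>\<^sup>+u. (\<Prod>x\<in>Q. tilt \<sigma> (u x)) \<partial>M) = (\<integral>\<^sup>+u. (\<Prod>x\<in>X. (if x \<in> Q then tilt \<sigma> (u x) else 1)) \<partial>M)"
      using Q X by (intro nn_integral_cong) (simp add: prod.If_cases Int_absorb1)
    also have "\<dots> = (\<Prod>x\<in>X. \<integral>\<^sup>+t. (if x \<in> Q then tilt \<sigma> t else 1) \<partial>uniform01)"
      unfolding M_def by (rule UP.product_nn_integral_prod[OF X]) measurable
    also have "\<dots> = (\<Prod>x\<in>X. if x \<in> Q then ennreal \<gamma> else 1)"
      by (intro prod.cong) (auto simp: t U.emeasure_space_1[simplified])
    also have "\<dots> = ennreal \<gamma> ^ n" using Q X by (simp add: prod.If_cases Int_absorb1 n_def)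
    finally show ?thesis .
  qed
  have "(\<Sum>C\<in>CC. I2 C) = (\<integral>\<^sup>+u. (\<Sum>C\<in>CC. F C u) * (\<Prod>x\<in>Q. tilt \<sigma> (u x)) \<partial>M)"
    unfolding I2_def sum_distrib_right using pm[OF Q] Fm
    by (subst nn_integral_sum) (auto simp: CC_def)
  also have "\<dots> \<le> (\<integral>\<^sup>+u. ennreal (real n / N) * (\<Prod>x\<in>Q. tilt \<sigma> (u x)) \<partial>M)"
    using cnt by (intro nn_integral_mono mult_right_mono) auto
  also have "\<dots> = ennreal (real n / N) * ennreal \<gamma> ^ n"
    using pm[OF Q] by (simp add: nn_integral_cmult prodint)
  finally have I2: "(\<Sum>C\<in>CC. I2 C) \<le> ennreal (real n / N) * ennreal \<gamma> ^ n" .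
  have "ennreal \<gamma> ^ n * (\<Sum>C\<in>CC. I1 C) \<le> ennreal (\<gamma> powr N) * (\<Sum>C\<in>CC. I2 C)"
    unfolding sum_distrib_left by (intro sum_mono I12)
  also have "\<dots> \<le> ennreal (\<gamma> powr N) * (ennreal (real n / N) * ennreal \<gamma> ^ n)"
    using I2 by (rule mult_left_mono) simp
  also have "\<dots> = ennreal \<gamma> ^ n * ennreal (real n / N * \<gamma> powr N)"
    using N ennreal_mult[of "real n / N" "\<gamma> powr N"] by (simp only: mult_ac) (simp add: mult_ac)
  finally have sumI1: "(\<Sum>C\<in>CC. I1 C) \<le> ennreal (real n / N * \<gamma> powr N)"
    using \<gamma> by (subst (asm) ennreal_mult_le_mult_iff) (auto simp: ennreal_power)
  \<comment> \<open>On the bad event some \<open>C\<close> in \<open>CC\<close> has fewer than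
    \<open>k\<close> low marks in \<open>Q\<close>, hence weight at least
    \<open>2 powr (-k)\<close>; this is Markov's inequality for the sum of the weights. A set
    outside \<open>sets M\<close> has measure 0 by convention, which settles the other case.\<close>
  have "ennreal (2 powr (-k)) * emeasure M ?bad \<le> (\<Sum>C\<in>CC. I1 C)"
  proof (cases "?bad \<in> sets M")
    case True
    have "ennreal (2 powr (-k)) * emeasure M ?bad = (\<integral>\<^sup>+u. ennreal (2 powr (-k)) * indicator ?bad u \<partial>M)"
      using True by (simp add: nn_integral_cmult_indicator)
    also have "\<dots> \<le> (\<integral>\<^sup>+u. (\<Sum>C\<in>CC. F C u * (\<Prod>x\<in>C\<inter>Q. tilt \<sigma> (u x))) \<partial>M)"
    proof (rule nn_integral_mono)
      fix u
      show "ennreal (2 powr (-k)) * indicator ?bad u \<le> (\<Sum>C\<in>CC. F C u * (\<Prod>x\<in>C\<inter>Q. tilt \<sigma> (u x)))"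
      proof (cases "u \<in> ?bad")
        case True
        then obtain x where x: "x \<in> X" "N \<le> real (card (cluster (st u) X x \<inter> Q))"
          "real (card (cluster (st u) X x \<inter> Q \<inter> {y. u y \<le> \<sigma>})) < k" by auto
        define C where "C = cluster (st u) X x"
        define l where "l = card (C \<inter> Q \<inter> {y. u y \<le> \<sigma>})"
        have C: "C \<in> CC" using x cluster_subset[of x X "st u"] by (auto simp: CC_def C_def)
        have "2 powr (-k) \<le> 2 powr (- real l)" using x(3) by (simp add: l_def C_def)
        also have "\<dots> = (1/2) ^ l" by (simp add: powr_minus powr_realpow power_one_over inverse_eq_divide)
        finally have "ennreal (2 powr (-k)) \<le> ennreal ((1/2) ^ l)" by (rule ennreal_leI)
        also have "\<dots> = ennreal (1/2) ^ l" by (rule ennreal_power[symmetric]) simp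
        also have "\<dots> = (\<Prod>x\<in>C\<inter>Q. tilt \<sigma> (u x))"
          using fQ unfolding tilt_def l_def by (subst prod.If_cases) auto
        also have "\<dots> = F C u * (\<Prod>x\<in>C\<inter>Q. tilt \<sigma> (u x))"
        proof -
          have "F C u = 1" using x(1) unfolding F_def C_def indicator_def by auto
          thus ?thesis by simp
        qed
        also have "\<dots> \<le> (\<Sum>C\<in>CC. F C u * (\<Prod>x\<in>C\<inter>Q. tilt \<sigma> (u x)))"
          by (rule member_le_sum[OF C]) (use fCC in auto)
        finally show ?thesis using True by simp
      next
        case False
        hence z: "indicator ?bad u = (0::ennreal)" by (rule indicator_simps(2))
        show ?thesis unfolding z by simp
      qed
    qed
    also have "\<dots> = (\<Sum>C\<in>CC. I1 C)"
    proof -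
      have "(\<lambda>u. F C u * (\<Prod>x\<in>C\<inter>Q. tilt \<sigma> (u x))) \<in> borel_measurable M" if "C \<in> CC" for C
      proof (rule borel_measurable_times_ennreal[OF Fm pm])
        show "C \<subseteq> X" "C \<inter> Q \<subseteq> X" using that Q by (auto simp: CC_def)
      qed
      thus ?thesis unfolding I1_def by (intro nn_integral_sum) auto
    qed
    finally show ?thesis .
  qed (simp add: emeasure_notin_sets)
  hence "ennreal (2 powr k) * (ennreal (2 powr (-k)) * emeasure M ?bad)
      \<le> ennreal (2 powr k) * ennreal (real n / N * \<gamma> powr N)"
    using sumI1 by (intro mult_left_mono) auto
  moreover have "ennreal (2 powr k) * (ennreal (2 powr (-k)) * emeasure M ?bad) = emeasure M ?bad"
    by (simp add: mult.assoc[symmetric] powr_minus flip: ennreal_mult)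
  moreover have "ennreal (2 powr k) * ennreal (real n / N * \<gamma> powr N) = ennreal (real n / N * 2 powr k * \<gamma> powr N)"
    using N by (simp add: mult_ac flip: ennreal_mult)
  ultimately show ?thesis unfolding n_def \<gamma>_def by simp
qed

section \<open>One merging step\<close>

text \<open>Marks indexed directly by the points and pairs of a finite window. Ranks are avoided
  until \<open>quenched_big\<close>, where these marks turn out to be a relabelling of finitely many
  coordinates of the realisation.\<close>

definition qm :: "'a set \<Rightarrow> (('a \<Rightarrow> real) \<times> ('a set \<Rightarrow> real)) measure" where
  "qm X = Pi\<^sub>M X (\<lambda>_. uniform01) \<Otimes>\<^sub>M Pi\<^sub>M (pairs X) (\<lambda>_. uniform01)"

lemma prob_space_PiM_uniform01: "prob_space (Pi\<^sub>M X (\<lambda>_. uniform01))"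
  by (intro prob_space_PiM U.prob_space_axioms)

lemma prob_space_qm: "prob_space (qm X)"
  unfolding qm_def by (intro prob_space_pair prob_space_PiM_uniform01)

text \<open>The state of an edge as a function of an unordered pair. \<open>\<rho>\<close> needs an
  order of the two ends, and its symmetry makes the choice immaterial; the same holds for the edge
  probability \<open>weight\<close>.\<close>

definition stat :: "(real \<Rightarrow> real \<Rightarrow> real \<Rightarrow> real) \<Rightarrow> ('a::metric_space \<Rightarrow> real) \<Rightarrow> ('a set \<Rightarrow> real) \<Rightarrow> 'a set \<Rightarrow> bool" where
  "stat \<rho> u v e \<longleftrightarrow> (\<exists>x y. e = {x, y} \<and> x \<noteq> y \<and> v e \<le> \<rho> (u x) (u y) (dist x y))"

definition weight :: "(real \<Rightarrow> real \<Rightarrow> real \<Rightarrow> real) \<Rightarrow> ('a::metric_space \<Rightarrow> real) \<Rightarrow> 'a set \<Rightarrow> real" where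
  "weight \<rho> u e = (SOME p. \<exists>x y. e = {x, y} \<and> x \<noteq> y \<and> p = \<rho> (u x) (u y) (dist x y))"

text \<open>Range and monotonicity are required for all real marks, not only for those in the unit
  interval, so that a mark can be replaced freely in monotonicity arguments. The instance used in
  the end is \<open>edge_lo\<close>.\<close>

locale conn_prob =
  fixes \<rho> :: "real \<Rightarrow> real \<Rightarrow> real \<Rightarrow> real"
  assumes rho_range: "0 \<le> \<rho> s t r" "\<rho> s t r \<le> 1"
    and rho_sym: "\<rho> s t r = \<rho> t s r"
    and rho_anti: "s \<le> s' \<Longrightarrow> \<rho> s' t r \<le> \<rho> s t r"
    and rho_anti_r: "0 < r \<Longrightarrow> r \<le> r' \<Longrightarrow> \<rho> s t r' \<le> \<rho> s t r"
    and rho_meas: "(\<lambda>(s, t, r). \<rho> s t r) \<in> borel_measurable (borel \<Otimes>\<^sub>M borel \<Otimes>\<^sub>M borel)"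
begin

lemma rho_anti2: "t \<le> t' \<Longrightarrow> \<rho> s t' r \<le> \<rho> s t r"
  using rho_anti[of t t' s r] by (simp add: rho_sym[of s])

lemma measurable_rho [measurable (raw)]:
  assumes [measurable]: "f \<in> borel_measurable M" "g \<in> borel_measurable M" "h \<in> borel_measurable M"
  shows "(\<lambda>x. \<rho> (f x) (g x) (h x)) \<in> borel_measurable M"
proof -
  have "(\<lambda>x. (f x, g x, h x)) \<in> measurable M (borel \<Otimes>\<^sub>M borel \<Otimes>\<^sub>M borel)" by measurable
  thus ?thesis using measurable_compose[OF _ rho_meas, of "\<lambda>x. (f x, g x, h x)" M] by simp
qed

lemma stat_pair: "x \<noteq> y \<Longrightarrow> stat \<rho> u v {x, y} \<longleftrightarrow> v {x, y} \<le> \<rho> (u x) (u y) (dist x y)"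
  unfolding stat_def by (auto simp: doubleton_eq_iff rho_sym[of "u y" "u x"] dist_commute)

lemma weight_pair: "x \<noteq> y \<Longrightarrow> weight \<rho> u {x, y} = \<rho> (u x) (u y) (dist x y)"
  unfolding weight_def
  by (rule some_equality) (auto simp: doubleton_eq_iff rho_sym[of "u y" "u x"] dist_commute)

lemma pairsE: assumes "e \<in> pairs X" obtains x y where "e = {x, y}" "x \<noteq> y" "x \<in> X" "y \<in> X"
  using assms by (auto simp: pairs_def card_2_iff)

lemma stat_weight: "e \<in> pairs X \<Longrightarrow> stat \<rho> u v e \<longleftrightarrow> v e \<le> weight \<rho> u e"
  by (elim pairsE) (simp add: stat_pair weight_pair)

lemma weight_range: "e \<in> pairs X \<Longrightarrow> 0 \<le> weight \<rho> u e \<and> weight \<rho> u e \<le> 1"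
  by (elim pairsE) (simp add: weight_pair rho_range)

lemma stat_fun_upd: "e \<in> pairs X \<Longrightarrow> x \<in> X - e \<Longrightarrow> stat \<rho> (u(x := s)) v e = stat \<rho> u v e"
  by (elim pairsE) (auto simp: stat_pair)

lemma stat_anti:
  assumes "e \<in> pairs X" "s \<le> t" "stat \<rho> (u(x := t)) v e"
  shows "stat \<rho> (u(x := s)) v e"
  using assms(1)
proof (rule pairsE)
  fix y z assume e: "e = {y, z}" "y \<noteq> z"
  have "\<rho> ((u(x := t)) y) ((u(x := t)) z) (dist y z) \<le> \<rho> ((u(x := s)) y) ((u(x := s)) z) (dist y z)"
    using e(2) assms(2) by (auto intro: rho_anti rho_anti2)
  thus ?thesis using assms(3) e by (auto simp: stat_pair intro: order_trans)
qed

lemma pred_stat: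
  assumes "e \<in> pairs X"
  shows "Measurable.pred (qm X) (\<lambda>z. stat \<rho> (fst z) (snd z) e)"
  using assms
proof (rule pairsE)
  fix x y assume e: "e = {x, y}" "x \<noteq> y" and [measurable]: "x \<in> X" "y \<in> X"
  have [measurable]: "{x, y} \<in> pairs X" using assms e by simp
  show ?thesis unfolding e stat_pair[OF e(2)] qm_def by measurable
qed

end

section \<open>Measurability and discrete laws for finite graphs\<close>

lemma measurable_finite_Collect:
  assumes "finite X" "\<And>x. x \<in> X \<Longrightarrow> Measurable.pred M (P x)"
  shows "(\<lambda>z. {x\<in>X. P x z}) \<in> measurable M (count_space (Pow X))"
proof (subst measurable_count_space_eq2)
  show "finite (Pow X)" using assms by simp
  have "(\<lambda>z. {x\<in>X. P x z}) -` {A} \<inter> space M \<in> sets M" if "A \<in> Pow X" for A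
  proof -
    have "(\<lambda>z. {x\<in>X. P x z}) -` {A} \<inter> space M = {z\<in>space M. \<forall>x\<in>X. P x z \<longleftrightarrow> x \<in> A}"
      using that by auto
    also have "\<dots> \<in> sets M"
      using assms by (intro sets.sets_Collect_finite_All sets.sets_Collect) (auto simp: pred_def)
    finally show ?thesis .
  qed
  thus "(\<lambda>z. {x\<in>X. P x z}) \<in> space M \<rightarrow> Pow X \<and>
    (\<forall>A\<in>Pow X. (\<lambda>z. {x\<in>X. P x z}) -` {A} \<inter> space M \<in> sets M)" by auto
qed

text \<open>Source of the measurability of finite-graph events: an event that depends on the marks
  only through a random subset of a finite set is measurable for every \<open>\<Phi>\<close>, as
  this subset takes finitely many values.\<close>

lemma pred_finite_Collect:
  assumes "finite X" "\<And>x. x \<in> X \<Longrightarrow> Measurable.pred M (P x)"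
  shows "Measurable.pred M (\<lambda>z. \<Phi> {x\<in>X. P x z})"
  using measurable_compose[OF measurable_finite_Collect[OF assms], where g = \<Phi> and L = "count_space UNIV"] by simp

lemma linked_cong:
  assumes "\<And>e. e \<in> pairs X \<Longrightarrow> b e = c e"
  shows "linked b X = linked c X"
  using assms by (auto simp: linked_def pairs_iff)

text \<open>Reading a cluster off the set of open pairs brings its events into the form treated by
  \<open>pred_finite_Collect\<close>.\<close>

lemma cluster_restrict: "cluster b X x = cluster (\<lambda>e. e \<in> {e\<in>pairs X. b e}) X x"
  unfolding cluster_def by (subst linked_cong[of X b "\<lambda>e. e \<in> {e\<in>pairs X. b e}"]) auto

lemma big_restrict: "big b X B N = big (\<lambda>e. e \<in> {e\<in>pairs X. b e}) X B N"
  unfolding big_def by (subst cluster_restrict) (rule refl)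

text \<open>Passage from uniform edge marks to the discrete law of \<open>sprinkle\<close>. Both
  sides are sums over the finitely many possible sets of open edges, and each atom
  \<open>VA A\<close> is a product of intervals with the matching product probability.\<close>

lemma PiM_uniform01_Pi_pmf:
  assumes E: "finite E" and w: "\<And>e. e \<in> E \<Longrightarrow> 0 \<le> w e \<and> w e \<le> 1"
  shows "measure (Pi\<^sub>M E (\<lambda>_. uniform01)) {v\<in>space (Pi\<^sub>M E (\<lambda>_. uniform01)). \<Phi> {e\<in>E. v e \<le> w e}}
    = measure_pmf.prob (Pi_pmf E False (\<lambda>e. bernoulli_pmf (w e))) {b. \<Phi> {e\<in>E. b e}}"
proof -
  let ?V = "Pi\<^sub>M E (\<lambda>_. uniform01)" and ?Z = "Pi_pmf E False (\<lambda>e. bernoulli_pmf (w e))"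
  interpret V: prob_space ?V by (rule prob_space_PiM_uniform01)
  define S where "S = {A\<in>Pow E. \<Phi> A}"
  have fS: "finite S" using E by (auto simp: S_def)
  define VA where "VA = (\<lambda>A. {v\<in>space ?V. {e\<in>E. v e \<le> w e} = A})"
  have VA: "VA A = PiE E (\<lambda>e. if e \<in> A then {..w e} else {w e<..})" if "A \<in> S" for A
    using that by (auto simp: VA_def S_def space_PiM PiE_def Pi_def not_le split: if_splits)
  have VAs: "VA A \<in> sets ?V" if "A \<in> S" for A
    unfolding VA[OF that] by (intro sets_PiM_I_finite E) auto
  have 1: "measure ?V (VA A) = (\<Prod>e\<in>E. if e \<in> A then w e else 1 - w e)" if "A \<in> S" for A
  proof -
    have "emeasure ?V (VA A) = (\<Prod>e\<in>E. emeasure uniform01 (if e \<in> A then {..w e} else {w e<..}))"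
      unfolding VA[OF that] by (intro UP.emeasure_PiM E) auto
    also have "\<dots> = (\<Prod>e\<in>E. ennreal (if e \<in> A then w e else 1 - w e))"
      using w by (intro prod.cong) (auto simp: uniform01_low)
    also have "\<dots> = ennreal (\<Prod>e\<in>E. if e \<in> A then w e else 1 - w e)"
      using w by (intro prod_ennreal) auto
    finally show ?thesis using w by (simp add: measure_def prod_nonneg)
  qed
  have 2: "measure_pmf.prob ?Z {b. {e\<in>E. b e} = A} = (\<Prod>e\<in>E. if e \<in> A then w e else 1 - w e)" if "A \<in> S" for A
  proof -
    have "{b. {e\<in>E. b e} = A} = Pi E (\<lambda>e. {e \<in> A})"
      using that by (auto simp: S_def Pi_def)
    hence "measure_pmf.prob ?Z {b. {e\<in>E. b e} = A} = (\<Prod>e\<in>E. measure_pmf.prob (bernoulli_pmf (w e)) {e \<in> A})"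
      using E by (simp add: measure_Pi_pmf_Pi)
    also have "\<dots> = (\<Prod>e\<in>E. if e \<in> A then w e else 1 - w e)"
      using w by (intro prod.cong) (auto simp: measure_pmf_single)
    finally show ?thesis .
  qed
  have "{v\<in>space ?V. \<Phi> {e\<in>E. v e \<le> w e}} = (\<Union>A\<in>S. VA A)"
    by (auto simp: S_def VA_def)
  hence "measure ?V {v\<in>space ?V. \<Phi> {e\<in>E. v e \<le> w e}} = (\<Sum>A\<in>S. measure ?V (VA A))"
    using fS VAs by (simp only:) (intro V.finite_measure_finite_Union, auto simp: disjoint_family_on_def VA_def)
  also have "\<dots> = (\<Sum>A\<in>S. measure_pmf.prob ?Z {b. {e\<in>E. b e} = A})"
    using 1 2 by simp
  also have "\<dots> = measure_pmf.prob ?Z (\<Union>A\<in>S. {b. {e\<in>E. b e} = A})"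
    using fS by (intro measure_pmf.finite_measure_finite_Union[symmetric]) (auto simp: disjoint_family_on_def)
  also have "(\<Union>A\<in>S. {b. {e\<in>E. b e} = A}) = {b. \<Phi> {e\<in>E. b e}}"
    by (auto simp: S_def)
  finally show ?thesis .
qed

lemma PiM_uniform01_low_pair:
  assumes X: "finite X" "x \<in> X" "y \<in> X" "x \<noteq> y" and \<sigma>: "0 \<le> \<sigma>" "\<sigma> \<le> 1" and \<tau>: "0 \<le> \<tau>" "\<tau> \<le> 1"
  shows "(\<integral>\<^sup>+u. indicator {..\<sigma>} (u x) * indicator {..\<tau>} (u y) \<partial>Pi\<^sub>M X (\<lambda>_. uniform01)) = ennreal (\<sigma> * \<tau>)"
proof -
  have "(\<integral>\<^sup>+u. indicator {..\<sigma>} (u x) * indicator {..\<tau>} (u y) \<partial>Pi\<^sub>M X (\<lambda>_. uniform01))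
    = (\<integral>\<^sup>+u. (\<Prod>z\<in>X. if z = x then indicator {..\<sigma>} (u z) else if z = y then indicator {..\<tau>} (u z) else 1) \<partial>Pi\<^sub>M X (\<lambda>_. uniform01))"
  proof (rule nn_integral_cong)
    fix u :: "'a \<Rightarrow> real"
    have "(\<Prod>z\<in>X. if z = x then indicator {..\<sigma>} (u z) else if z = y then indicator {..\<tau>} (u z) else 1)
        = (\<Prod>z\<in>{x, y}. if z = x then indicator {..\<sigma>} (u z) else if z = y then indicator {..\<tau>} (u z) else (1::ennreal))"
      using X by (intro prod.mono_neutral_right) auto
    thus "indicator {..\<sigma>} (u x) * indicator {..\<tau>} (u y) =
       (\<Prod>z\<in>X. if z = x then indicator {..\<sigma>} (u z) else if z = y then indicator {..\<tau>} (u z) else (1::ennreal))"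
      using X(4) by simp
  qed
  also have "\<dots> = (\<Prod>z\<in>X. \<integral>\<^sup>+t. (if z = x then indicator {..\<sigma>} t else if z = y then indicator {..\<tau>} t else 1) \<partial>uniform01)"
    by (rule UP.product_nn_integral_prod[OF X(1)]) measurable
  also have "\<dots> = (\<Prod>z\<in>X. if z = x then ennreal \<sigma> else if z = y then ennreal \<tau> else 1)"
    using \<sigma> \<tau> by (intro prod.cong) (auto simp: uniform01_low U.emeasure_space_1[simplified])
  also have "\<dots> = (\<Prod>z\<in>{x, y}. if z = x then ennreal \<sigma> else if z = y then ennreal \<tau> else 1)"
    using X by (intro prod.mono_neutral_right) auto
  also have "\<dots> = ennreal (\<sigma> * \<tau>)" using X(4) \<sigma> \<tau> by (simp add: ennreal_mult)
  finally show ?thesis .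
qed

section \<open>Failure probability of a box and the merging of its cells\<close>

context conn_prob
begin

definition pbad :: "'a::metric_space set \<Rightarrow> 'a set \<Rightarrow> real \<Rightarrow> real" where
  "pbad X B N = measure (qm X) {z\<in>space (qm X). \<not> big (stat \<rho> (fst z) (snd z)) X B N}"

lemma pred_stat_Collect:
  assumes "finite X"
  shows "Measurable.pred (qm X) (\<lambda>z. \<Phi> {e\<in>pairs X. stat \<rho> (fst z) (snd z) e})"
  by (rule pred_finite_Collect) (use assms pred_stat in auto)

lemma pred_big:
  assumes "finite X"
  shows "Measurable.pred (qm X) (\<lambda>z. big (stat \<rho> (fst z) (snd z)) X B N)"
  by (subst big_restrict) (rule pred_stat_Collect[OF assms])

lemma pred_stat_low_Collect:
  assumes "finite X"
  shows "Measurable.pred (qm X) (\<lambda>z. \<Phi> {e\<in>pairs X. stat \<rho> (fst z) (snd z) e} {x\<in>X. fst z x \<le> \<sigma>} {x\<in>X. fst z x \<le> \<tau>})"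
proof -
  let ?E = "\<lambda>z. {e\<in>pairs X. stat \<rho> (fst z) (snd z) e}" and ?L = "\<lambda>\<sigma> z. {x\<in>X. fst z x \<le> \<sigma>}"
  have 1: "?E \<in> measurable (qm X) (count_space (Pow (pairs X)))"
    using assms by (intro measurable_finite_Collect pred_stat) auto
  have 2: "?L s \<in> measurable (qm X) (count_space (Pow X))" for s
  proof (rule measurable_finite_Collect[OF assms])
    fix x assume [measurable]: "x \<in> X"
    show "Measurable.pred (qm X) (\<lambda>z. fst z x \<le> s)" unfolding qm_def by measurable
  qed
  have c: "countable (Pow X)" "countable (Pow (pairs X))" using assms by (auto intro!: countable_finite)
  show ?thesis
    by (rule measurable_compose_countable'[OF _ 1 c(2)], rule measurable_compose_countable'[OF _ 2 c(1)],
        rule measurable_compose_countable'[OF _ 2 c(1)]) simp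
qed

text \<open>The edge marks are frozen and \<open>cluster_low_marks\<close> is applied to the vertex
  marks. Only a quarter of the expected number \<open>\<sigma> * N\<close> of low marks is asked
  for, because then \<open>2 powr (\<sigma> * N / 4)\<close> is beaten by
  \<open>(1 - \<sigma>/2) powr N\<close>, which is at most
  \<open>exp (- (\<sigma> * N / 2))\<close>.\<close>

lemma low_mark_error:
  assumes X: "finite X" "Q \<subseteq> X" and \<sigma>: "0 \<le> \<sigma>" "\<sigma> \<le> 1" and N: "0 < N"
  defines "A \<equiv> {z\<in>space (qm X). \<exists>x\<in>X. N \<le> real (card (cluster (stat \<rho> (fst z) (snd z)) X x \<inter> Q)) \<and>
       real (card (cluster (stat \<rho> (fst z) (snd z)) X x \<inter> Q \<inter> {y. fst z y \<le> \<sigma>})) < \<sigma> * N / 4}"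
  shows "A \<in> sets (qm X)" "measure (qm X) A \<le> real (card Q) / N * exp (- (\<sigma> * N / 4))"
proof -
  let ?M = "Pi\<^sub>M X (\<lambda>_. uniform01)" and ?V = "Pi\<^sub>M (pairs X) (\<lambda>_. uniform01)"
  interpret M: prob_space ?M by (rule prob_space_PiM_uniform01)
  interpret V: prob_space ?V by (rule prob_space_PiM_uniform01)
  interpret MV: pair_prob_space ?M ?V ..
  define c where "c = real (card Q) / N * exp (- (\<sigma> * N / 4))"
  have low: "cluster b X x \<inter> Q \<inter> {y. u y \<le> \<sigma>} = cluster b X x \<inter> Q \<inter> {y\<in>X. u y \<le> \<sigma>}" for b x u
    using X(2) by auto
  show A: "A \<in> sets (qm X)"
    using pred_stat_low_Collect[OF X(1), of "\<lambda>E L _. \<exists>x\<in>X. N \<le> real (card (cluster (\<lambda>e. e \<in> E) X x \<inter> Q)) \<and>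
       real (card (cluster (\<lambda>e. e \<in> E) X x \<inter> Q \<inter> L)) < \<sigma> * N / 4" \<sigma> \<sigma>]
    unfolding A_def low cluster_restrict[symmetric] pred_def .
  have "emeasure ?M ((\<lambda>u. (u, v)) -` A) \<le> ennreal c" if v: "v \<in> space ?V" for v
  proof -
    have eq: "(\<lambda>u. (u, v)) -` A = {u\<in>space ?M. \<exists>x\<in>X. N \<le> real (card (cluster (stat \<rho> u v) X x \<inter> Q)) \<and>
       real (card (cluster (stat \<rho> u v) X x \<inter> Q \<inter> {y. u y \<le> \<sigma>})) < \<sigma> * N / 4}"
      using v by (auto simp: A_def qm_def space_pair_measure)
    have "emeasure ?M ((\<lambda>u. (u, v)) -` A) \<le> ennreal (real (card Q) / N * 2 powr (\<sigma> * N / 4) * (1 - \<sigma>/2) powr N)"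
      unfolding eq
    proof (rule cluster_low_marks[OF X \<sigma> N])
      show "stat \<rho> (u(x := s)) v e" if "e \<in> pairs X" "s \<le> t" "stat \<rho> (u(x := t)) v e" for u x s t e
        using stat_anti that by blast
      show "stat \<rho> (u(x := s)) v e = stat \<rho> u v e" if "e \<in> pairs X" "x \<in> X - e" for u x s e
        using stat_fun_upd that by blast
      fix C assume "C \<subseteq> X"
      have "Measurable.pred (qm X) (\<lambda>z. \<exists>x\<in>X. cluster (\<lambda>e. e \<in> {e\<in>pairs X. stat \<rho> (fst z) (snd z) e}) X x = C)"
        by (rule pred_stat_Collect[OF X(1)])
      hence "Measurable.pred (qm X) (\<lambda>z. \<exists>x\<in>X. cluster (stat \<rho> (fst z) (snd z)) X x = C)"
        unfolding cluster_restrict[symmetric] .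
      from measurable_compose[OF _ this, of "\<lambda>u. (u, v)" ?M]
      show "Measurable.pred ?M (\<lambda>u. \<exists>x\<in>X. cluster (stat \<rho> u v) X x = C)"
        using v unfolding qm_def by simp
    qed
    also have "real (card Q) / N * 2 powr (\<sigma> * N / 4) * (1 - \<sigma>/2) powr N \<le> c"
    proof -
      have "2 powr (\<sigma> * N / 4) \<le> exp 1 powr (\<sigma> * N / 4)"
        using \<sigma> N exp_ge_add_one_self[of 1] by (intro powr_mono2) auto
      hence 1: "2 powr (\<sigma> * N / 4) \<le> exp (\<sigma> * N / 4)" by (simp add: powr_def)
      have "(1 - \<sigma>/2) powr N \<le> exp (- \<sigma>/2) powr N"
        using \<sigma> N exp_ge_add_one_self[of "-\<sigma>/2"] by (intro powr_mono2) auto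
      hence 2: "(1 - \<sigma>/2) powr N \<le> exp (- (\<sigma> * N / 2))" by (simp add: powr_def mult.commute)
      have "2 powr (\<sigma> * N / 4) * (1 - \<sigma>/2) powr N \<le> exp (\<sigma> * N / 4) * exp (- (\<sigma> * N / 2))"
        using 1 2 by (intro mult_mono) auto
      also have "\<dots> = exp (- (\<sigma> * N / 4))" by (simp flip: exp_add)
      finally show ?thesis unfolding c_def mult.assoc using N by (intro mult_left_mono) auto
    qed
    finally show ?thesis by (simp add: ennreal_leI order_trans)
  qed
  hence "(\<integral>\<^sup>+v. emeasure ?M ((\<lambda>u. (u, v)) -` A) \<partial>?V) \<le> (\<integral>\<^sup>+v. ennreal c \<partial>?V)"
    by (rule nn_integral_mono)
  hence "emeasure (qm X) A \<le> (\<integral>\<^sup>+v. ennreal c \<partial>?V)"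
    using MV.emeasure_pair_measure_alt2[of A] A unfolding qm_def by simp
  hence "emeasure (qm X) A \<le> ennreal c" by (simp add: V.emeasure_space_1)
  thus "measure (qm X) A \<le> real (card Q) / N * exp (- (\<sigma> * N / 4))"
    using N unfolding c_def measure_def by (intro enn2real_leI) auto
qed

lemma big2_restrict:
  assumes "finite X" "Q \<subseteq> X"
  shows "big2 b X Q N {x. u x \<le> \<sigma>} k1 {x. u x \<le> \<tau>} k2 \<longleftrightarrow>
    big2 (\<lambda>e. e \<in> {e\<in>pairs X. b e}) X Q N {x\<in>X. u x \<le> \<sigma>} k1 {x\<in>X. u x \<le> \<tau>} k2"
proof -
  have eq: "cluster b X x \<inter> Q \<inter> {x. u x \<le> \<sigma>} = cluster b X x \<inter> Q \<inter> {x\<in>X. u x \<le> \<sigma>}" for x \<sigma>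
    using assms(2) by auto
  show ?thesis unfolding big2_def cluster_restrict[of b X, symmetric] eq ..
qed

text \<open>The first summand is Markov's inequality for the number of sub-boxes without a large
  cluster rich in low marks; it uses expectations only, so dependence between sub-boxes is harmless.
  The other summands come from \<open>sprinkle\<close> given the vertex marks, with the number of
  edges in \<open>L\<close> replaced by a bound for its mean,
  \<open>\<sigma> * \<tau> * (card B)^2\<close>.\<close>

lemma one_step:
  assumes X: "finite X" and I: "finite I" "I \<noteq> {}" and disj: "disjoint_family_on Q I"
    and sub: "\<And>i. i \<in> I \<Longrightarrow> Q i \<subseteq> B" and B: "B \<subseteq> X"
    and diam: "\<And>x y. x \<in> B \<Longrightarrow> y \<in> B \<Longrightarrow> dist x y \<le> r"
    and \<sigma>: "0 < \<sigma>" "\<sigma> \<le> 1" and \<tau>: "0 < \<tau>" "\<tau> \<le> 1" and p: "0 < \<rho> \<sigma> \<tau> r"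
    and q: "0 \<le> q" "q \<le> 1/2" "q \<le> \<rho> \<sigma> \<tau> r" and s: "0 < s" "s \<le> 1"
    and \<theta>: "0 < \<theta>" "\<theta> < 1" and N: "0 < N"
  shows "pbad X B (\<theta> * real (card I) * N) \<le>
     ((\<Sum>i\<in>I. pbad X (Q i) N) + real (card I) * (real (card B) / N * (exp (- (\<sigma> * N / 4)) + exp (- (\<tau> * N / 4)))))
        / ((1 - \<theta>) * real (card I))
     + s / 2 + 4 * q^2 / \<rho> \<sigma> \<tau> r / s * (\<sigma> * \<tau> * (real (card B))^2)
     + (real (card I))^2 * exp (- (q * ((\<sigma> * N / 4) * (\<tau> * N / 4))))"
proof -
  let ?M = "Pi\<^sub>M X (\<lambda>_. uniform01)" and ?V = "Pi\<^sub>M (pairs X) (\<lambda>_. uniform01)"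
  interpret M: prob_space ?M by (rule prob_space_PiM_uniform01)
  interpret V: prob_space ?V by (rule prob_space_PiM_uniform01)
  interpret qm: prob_space "qm X" by (rule prob_space_qm)
  define m where "m = real (card I)"
  have m: "0 < m" using I by (simp add: m_def card_gt_0_iff)
  define k1 where "k1 = \<sigma> * N / 4"
  define k2 where "k2 = \<tau> * N / 4"
  define b2 where "b2 = (\<lambda>i (z :: ('a \<Rightarrow> real) \<times> ('a set \<Rightarrow> real)).
    big2 (stat \<rho> (fst z) (snd z)) X (Q i) N {x. fst z x \<le> \<sigma>} k1 {x. fst z x \<le> \<tau>} k2)"
  define A where "A = {z\<in>space (qm X). \<theta> * m \<le> real (card {i\<in>I. b2 i z})}"
  define G where "G = {z\<in>space (qm X). big (stat \<rho> (fst z) (snd z)) X B (\<theta> * m * N)}"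
  have fB: "finite B" using B X finite_subset by auto
  have QX: "Q i \<subseteq> X" if "i \<in> I" for i using sub[OF that] B by auto
  have b2m: "Measurable.pred (qm X) (b2 i)" if "i \<in> I" for i
    using pred_stat_low_Collect[OF X, of "\<lambda>E L1 L2. big2 (\<lambda>e. e \<in> E) X (Q i) N L1 k1 L2 k2" \<sigma> \<tau>]
    unfolding b2_def big2_restrict[OF X QX[OF that]] .
  have Am: "A \<in> sets (qm X)"
    using pred_finite_Collect[OF I(1), where M = "qm X" and P = b2 and \<Phi> = "\<lambda>J. \<theta> * m \<le> real (card J)"] b2m
    by (simp add: A_def pred_def)
  have Gm: "G \<in> sets (qm X)" using pred_big[OF X, of B "\<theta> * m * N"] by (simp add: G_def pred_def)
  define L where "L = (\<lambda>u. {{x, y} | x y. x \<in> {x. u x \<le> \<sigma>} \<inter> B \<inter> X \<and> y \<in> {x. u x \<le> \<tau>} \<inter> B \<inter> X \<and> x \<noteq> y})"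
  define c where "c = 4 * q^2 / \<rho> \<sigma> \<tau> r / s"
  have c0: "0 \<le> c" using p s by (simp add: c_def)
  define \<epsilon> where "\<epsilon> = s / 2 + m^2 * exp (- (q * (k1 * k2)))"
  have \<epsilon>0: "0 \<le> \<epsilon>" using s by (simp add: \<epsilon>_def)
  \<comment> \<open>With the vertex marks \<open>u\<close> fixed the edges are independent with
    probabilities \<open>weight \<rho> u\<close>. Monotonicity of \<open>\<rho>\<close> and the
    diameter bound give every pair with low marks at least the probability
    \<open>\<rho> \<sigma> \<tau> r\<close>.\<close>
  have sec: "emeasure ?V (Pair u -` A) \<le> emeasure ?V (Pair u -` G) + (ennreal \<epsilon> + ennreal c * of_nat (card (L u)))"
    if u: "u \<in> space ?M" for u
  proof -
    let ?Z = "Pi_pmf (pairs X) False (\<lambda>e. bernoulli_pmf (weight \<rho> u e))"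
    have cs: "{e\<in>pairs X. stat \<rho> u v e} = {e\<in>pairs X. v e \<le> weight \<rho> u e}" for v
      using stat_weight by auto
    have cb: "{i\<in>I. big2 b X (Q i) N {x. u x \<le> \<sigma>} k1 {x. u x \<le> \<tau>} k2}
        = {i\<in>I. big2 (\<lambda>e. e \<in> {e\<in>pairs X. b e}) X (Q i) N {x\<in>X. u x \<le> \<sigma>} k1 {x\<in>X. u x \<le> \<tau>} k2}" for b
      by (rule Collect_cong, rule conj_cong[OF refl], rule big2_restrict[OF X QX])
    have toZ: "measure ?V {v\<in>space ?V. \<Phi> {e\<in>pairs X. stat \<rho> u v e}} = measure_pmf.prob ?Z {b. \<Phi> {e\<in>pairs X. b e}}" for \<Phi>
      unfolding cs by (rule PiM_uniform01_Pi_pmf) (use X weight_range in auto)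
    have "Pair u -` A = {v\<in>space ?V. \<theta> * m \<le> real (card {i\<in>I. big2 (stat \<rho> u v) X (Q i) N {x. u x \<le> \<sigma>} k1 {x. u x \<le> \<tau>} k2})}"
      using u by (auto simp: A_def qm_def space_pair_measure b2_def)
    also have "\<dots> = {v\<in>space ?V. \<theta> * m \<le> real (card {i\<in>I. big2 (\<lambda>e. e \<in> {e\<in>pairs X. stat \<rho> u v e}) X (Q i) N {x\<in>X. u x \<le> \<sigma>} k1 {x\<in>X. u x \<le> \<tau>} k2})}"
      unfolding cb ..
    finally have "measure ?V (Pair u -` A) = measure_pmf.prob ?Z {b. \<theta> * m \<le> real (card {i\<in>I. big2 (\<lambda>e. e \<in> {e\<in>pairs X. b e}) X (Q i) N {x\<in>X. u x \<le> \<sigma>} k1 {x\<in>X. u x \<le> \<tau>} k2})}"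
      using toZ[of "\<lambda>E. \<theta> * m \<le> real (card {i\<in>I. big2 (\<lambda>e. e \<in> E) X (Q i) N {x\<in>X. u x \<le> \<sigma>} k1 {x\<in>X. u x \<le> \<tau>} k2})"] by simp
    also have "\<dots> = measure_pmf.prob ?Z {b. \<theta> * real (card I) \<le> real (card {i\<in>I. big2 b X (Q i) N {x. u x \<le> \<sigma>} k1 {x. u x \<le> \<tau>} k2})}"
      unfolding m_def cb ..
    also have "\<dots> \<le> measure_pmf.prob ?Z {b. big b X B (\<theta> * real (card I) * N)}
        + s / 2 + 4 * q^2 / \<rho> \<sigma> \<tau> r * card (L u) / s + (real (card I))^2 * exp (- (q * (k1 * k2)))"
      unfolding L_def
    proof (rule sprinkle[OF X I disj sub])
      fix x y assume xy: "x \<in> {x. u x \<le> \<sigma>} \<inter> B \<inter> X" "y \<in> {x. u x \<le> \<tau>} \<inter> B \<inter> X" "x \<noteq> y"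
      have "\<rho> \<sigma> \<tau> r \<le> \<rho> \<sigma> \<tau> (dist x y)" using xy diam by (intro rho_anti_r) auto
      also have "\<dots> \<le> \<rho> (u x) \<tau> (dist x y)" using xy by (intro rho_anti) auto
      also have "\<dots> \<le> \<rho> (u x) (u y) (dist x y)" using xy by (intro rho_anti2) auto
      finally show "\<rho> \<sigma> \<tau> r \<le> weight \<rho> u {x, y}" using xy by (simp add: weight_pair)
    qed (use weight_range p q s \<theta> N \<sigma> \<tau> in \<open>auto simp: k1_def k2_def\<close>)
    also have "measure_pmf.prob ?Z {b. big b X B (\<theta> * real (card I) * N)}
        = measure_pmf.prob ?Z {b. big (\<lambda>e. e \<in> {e\<in>pairs X. b e}) X B (\<theta> * m * N)}"
      unfolding m_def by (subst big_restrict) (rule refl)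
    also have "\<dots> = measure ?V {v\<in>space ?V. big (\<lambda>e. e \<in> {e\<in>pairs X. stat \<rho> u v e}) X B (\<theta> * m * N)}"
      using toZ[of "\<lambda>E. big (\<lambda>e. e \<in> E) X B (\<theta> * m * N)"] by simp
    also have "\<dots> = measure ?V (Pair u -` G)"
      unfolding big_restrict[symmetric] using u by (intro arg_cong[where f = "measure ?V"]) (auto simp: G_def qm_def space_pair_measure)
    finally have "measure ?V (Pair u -` A) \<le> measure ?V (Pair u -` G) + (\<epsilon> + c * real (card (L u)))"
      by (simp add: \<epsilon>_def c_def m_def)
    hence "ennreal (measure ?V (Pair u -` A)) \<le> ennreal (measure ?V (Pair u -` G) + (\<epsilon> + c * real (card (L u))))"
      by (rule ennreal_leI)
    thus ?thesis using \<epsilon>0 c0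
      by (simp add: V.emeasure_eq_measure ennreal_mult ennreal_of_nat_eq_real_of_nat)
  qed
  \<comment> \<open>The sum is over ordered pairs, because the two ends are held to different
    thresholds; their marks are independent.\<close>
  have Lint: "(\<integral>\<^sup>+u. of_nat (card (L u)) \<partial>?M) \<le> ennreal (\<sigma> * \<tau> * (real (card B))^2)"
  proof -
    define P where "P = {(x, y). x \<in> B \<and> y \<in> B \<and> x \<noteq> y}"
    have "P \<subseteq> B \<times> B" by (auto simp: P_def)
    hence P: "finite P" "card P \<le> card B * card B"
      using fB finite_subset[of P "B \<times> B"] card_mono[of "B \<times> B" P] by (auto simp: card_cartesian_product)
    have "of_nat (card (L u)) \<le> (\<Sum>(x, y)\<in>P. indicator {..\<sigma>} (u x) * indicator {..\<tau>} (u y) :: ennreal)" for u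
    proof -
      define R where "R = {(x, y)\<in>P. u x \<le> \<sigma> \<and> u y \<le> \<tau>}"
      have R: "finite R" "R \<subseteq> P" using P by (auto simp: R_def elim: rev_finite_subset)
      have "L u \<subseteq> (\<lambda>(x, y). {x, y}) ` R" by (auto simp: L_def R_def P_def)
      hence "card (L u) \<le> card R" using R by (meson card_image_le card_mono finite_imageI order_trans)
      hence "of_nat (card (L u)) \<le> (of_nat (card R) :: ennreal)" by simp
      also have "\<dots> = (\<Sum>(x, y)\<in>R. 1)" by simp
      also have "\<dots> = (\<Sum>(x, y)\<in>P. indicator {..\<sigma>} (u x) * indicator {..\<tau>} (u y))"
        using P(1) R by (intro sum.mono_neutral_cong_left) (auto simp: R_def indicator_def)
      finally show ?thesis .
    qed
    hence "(\<integral>\<^sup>+u. of_nat (card (L u)) \<partial>?M) \<le> (\<integral>\<^sup>+u. (\<Sum>(x, y)\<in>P. indicator {..\<sigma>} (u x) * indicator {..\<tau>} (u y)) \<partial>?M)"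
      by (intro nn_integral_mono) auto
    also have "\<dots> = (\<Sum>(x, y)\<in>P. \<integral>\<^sup>+u. indicator {..\<sigma>} (u x) * indicator {..\<tau>} (u y) \<partial>?M)"
    proof -
      have "(\<lambda>u. indicator {..\<sigma>} (u x) * indicator {..\<tau>} (u y) :: ennreal) \<in> borel_measurable ?M" if "x \<in> B" "y \<in> B" for x y
      proof -
        have [measurable]: "x \<in> X" "y \<in> X" using that B by auto
        show ?thesis by measurable
      qed
      thus ?thesis unfolding case_prod_unfold by (intro nn_integral_sum) (auto simp: P_def)
    qed
    also have "\<dots> = (\<Sum>(x, y)\<in>P. ennreal (\<sigma> * \<tau>))"
      using B \<sigma> \<tau> X by (intro sum.cong) (auto simp: P_def intro!: PiM_uniform01_low_pair)
    also have "\<dots> = ennreal (\<sigma> * \<tau> * real (card P))"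
      using \<sigma> \<tau> by (simp add: ennreal_mult'' ennreal_of_nat_eq_real_of_nat mult.commute)
    also have "\<dots> \<le> ennreal (\<sigma> * \<tau> * (real (card B))^2)"
      using P(2) \<sigma> \<tau> by (intro ennreal_leI mult_left_mono) (auto simp: power2_eq_square simp flip: of_nat_mult)
    finally show ?thesis .
  qed
  have Lm: "(\<lambda>u. of_nat (card (L u)) :: ennreal) \<in> borel_measurable ?M"
  proof -
    have 2: "(\<lambda>u. {x\<in>X. u x \<le> s}) \<in> measurable ?M (count_space (Pow X))" for s :: real
    proof (rule measurable_finite_Collect[OF X])
      fix x assume [measurable]: "x \<in> X"
      show "Measurable.pred ?M (\<lambda>u. u x \<le> s)" by measurable
    qed
    have eq: "L u = (\<lambda>L1 L2. {{x, y} | x y. x \<in> L1 \<inter> B \<and> y \<in> L2 \<inter> B \<and> x \<noteq> y}) {x\<in>X. u x \<le> \<sigma>} {x\<in>X. u x \<le> \<tau>}" for u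
      by (auto simp: L_def)
    have cX: "countable (Pow X)" using X by (auto intro!: countable_finite)
    show ?thesis unfolding eq
      by (rule measurable_compose_countable'[OF _ 2 cX], rule measurable_compose_countable'[OF _ 2 cX]) simp
  qed
  have AG: "measure (qm X) A \<le> measure (qm X) G + (\<epsilon> + c * (\<sigma> * \<tau> * (real (card B))^2))"
  proof -
    have Gs: "(\<lambda>u. emeasure ?V (Pair u -` G)) \<in> borel_measurable ?M"
      using Gm unfolding qm_def by (rule V.measurable_emeasure_Pair)
    have "emeasure (qm X) A = (\<integral>\<^sup>+u. emeasure ?V (Pair u -` A) \<partial>?M)"
      using Am unfolding qm_def by (rule V.emeasure_pair_measure_alt)
    also have "\<dots> \<le> (\<integral>\<^sup>+u. emeasure ?V (Pair u -` G) + (ennreal \<epsilon> + ennreal c * of_nat (card (L u))) \<partial>?M)"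
      by (intro nn_integral_mono sec)
    also have "\<dots> = emeasure (qm X) G + (ennreal \<epsilon> + ennreal c * (\<integral>\<^sup>+u. of_nat (card (L u)) \<partial>?M))"
      using Gs Lm V.emeasure_pair_measure_alt[of G ?M] Gm unfolding qm_def
      by (simp add: nn_integral_add nn_integral_cmult M.emeasure_space_1)
    also have "\<dots> \<le> emeasure (qm X) G + (ennreal \<epsilon> + ennreal c * ennreal (\<sigma> * \<tau> * (real (card B))^2))"
      using Lint by (intro add_left_mono mult_left_mono) auto
    also have "\<dots> = ennreal (measure (qm X) G + (\<epsilon> + c * (\<sigma> * \<tau> * (real (card B))^2)))"
      using \<epsilon>0 c0 \<sigma> \<tau> by (simp add: qm.emeasure_eq_measure ennreal_mult)
    finally have "ennreal (measure (qm X) A) \<le> ennreal (measure (qm X) G + (\<epsilon> + c * (\<sigma> * \<tau> * (real (card B))^2)))"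
      by (simp only: qm.emeasure_eq_measure)
    thus ?thesis using \<epsilon>0 c0 \<sigma> \<tau> by (subst (asm) ennreal_le_iff) auto
  qed
  have pb2: "measure (qm X) {z\<in>space (qm X). \<not> b2 i z}
      \<le> pbad X (Q i) N + real (card B) / N * (exp (- (\<sigma> * N / 4)) + exp (- (\<tau> * N / 4)))" if i: "i \<in> I" for i
  proof -
    define E where "E = (\<lambda>\<sigma>. {z\<in>space (qm X). \<exists>x\<in>X. N \<le> real (card (cluster (stat \<rho> (fst z) (snd z)) X x \<inter> Q i)) \<and>
       real (card (cluster (stat \<rho> (fst z) (snd z)) X x \<inter> Q i \<inter> {y. fst z y \<le> \<sigma>})) < \<sigma> * N / 4})"
    define E0 where "E0 = {z\<in>space (qm X). \<not> big (stat \<rho> (fst z) (snd z)) X (Q i) N}"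
    have E0m: "E0 \<in> sets (qm X)" using pred_big[OF X, of "Q i" N] unfolding E0_def pred_def by auto
    have cQ: "real (card (Q i)) / N \<le> real (card B) / N"
      using N card_mono[OF fB sub[OF i]] by (simp add: divide_right_mono)
    have E: "E s \<in> sets (qm X)" "measure (qm X) (E s) \<le> real (card B) / N * exp (- (s * N / 4))"
      if "0 < s" "s \<le> 1" for s
    proof -
      show "E s \<in> sets (qm X)" unfolding E_def using low_mark_error(1)[OF X QX[OF i] _ _ N, of s] that by auto
      have "measure (qm X) (E s) \<le> real (card (Q i)) / N * exp (- (s * N / 4))"
        unfolding E_def using low_mark_error(2)[OF X QX[OF i] _ _ N, of s] that by auto
      also have "\<dots> \<le> real (card B) / N * exp (- (s * N / 4))" using cQ by (rule mult_right_mono) simp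
      finally show "measure (qm X) (E s) \<le> real (card B) / N * exp (- (s * N / 4))" .
    qed
    have "{z\<in>space (qm X). \<not> b2 i z} \<subseteq> E0 \<union> (E \<sigma> \<union> E \<tau>)"
    proof
      fix z assume z: "z \<in> {z\<in>space (qm X). \<not> b2 i z}"
      show "z \<in> E0 \<union> (E \<sigma> \<union> E \<tau>)"
      proof (cases "z \<in> E0")
        case False
        then obtain x where "x \<in> X" "N \<le> real (card (cluster (stat \<rho> (fst z) (snd z)) X x \<inter> Q i))"
          using z by (auto simp: E0_def big_def)
        thus ?thesis using z unfolding b2_def big2_def E_def k1_def k2_def not_le[symmetric] by auto
      qed simp
    qed
    hence "measure (qm X) {z\<in>space (qm X). \<not> b2 i z} \<le> measure (qm X) (E0 \<union> (E \<sigma> \<union> E \<tau>))"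
      using E0m E(1) \<sigma> \<tau> by (intro qm.finite_measure_mono) auto
    also have "\<dots> \<le> measure (qm X) E0 + (measure (qm X) (E \<sigma>) + measure (qm X) (E \<tau>))"
      using E0m E(1) \<sigma> \<tau> by (intro order_trans[OF measure_Un_le] add_mono measure_Un_le order_refl) auto
    also have "\<dots> \<le> pbad X (Q i) N + (real (card B) / N * exp (- (\<sigma> * N / 4)) + real (card B) / N * exp (- (\<tau> * N / 4)))"
      using E(2) \<sigma> \<tau> by (intro add_mono) (auto simp: E0_def pbad_def)
    finally show ?thesis by (simp add: distrib_left)
  qed
  have mk: "(1 - \<theta>) * m * measure (qm X) (space (qm X) - A) \<le> (\<Sum>i\<in>I. measure (qm X) {z\<in>space (qm X). \<not> b2 i z})"
  proof -
    have nb: "{z\<in>space (qm X). \<not> b2 i z} \<in> sets (qm X)" if "i \<in> I" for i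
      using b2m[OF that] unfolding pred_def by auto
    have "(1 - \<theta>) * m * measure (qm X) (space (qm X) - A) = (\<integral>z. (1 - \<theta>) * m * indicator (space (qm X) - A) z \<partial>qm X)"
      using Am by simp
    also have "\<dots> \<le> (\<integral>z. (\<Sum>i\<in>I. indicator {z\<in>space (qm X). \<not> b2 i z} z) \<partial>qm X)"
    proof (rule integral_mono)
      show "integrable (qm X) (\<lambda>z. (1 - \<theta>) * m * indicator (space (qm X) - A) z)"
        using Am by (intro integrable_mult_right) (auto simp: qm.emeasure_eq_measure)
      show "integrable (qm X) (\<lambda>z. \<Sum>i\<in>I. indicat_real {z\<in>space (qm X). \<not> b2 i z} z)"
        using nb by (intro Bochner_Integration.integrable_sum) (auto simp: qm.emeasure_eq_measure)
      fix z assume z: "z \<in> space (qm X)"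
      show "(1 - \<theta>) * m * indicator (space (qm X) - A) z \<le> (\<Sum>i\<in>I. indicat_real {z\<in>space (qm X). \<not> b2 i z} z)"
      proof (cases "z \<in> A")
        case False
        have "card I = card {i\<in>I. b2 i z} + card {i\<in>I. \<not> b2 i z}"
          using I by (subst card_Un_disjoint[symmetric]) (auto intro: arg_cong[where f = card])
        hence "m = real (card {i\<in>I. b2 i z}) + real (card {i\<in>I. \<not> b2 i z})" unfolding m_def by simp
        moreover have "real (card {i\<in>I. b2 i z}) < \<theta> * m" using False z by (auto simp: A_def)
        ultimately have "(1 - \<theta>) * m \<le> real (card {i\<in>I. \<not> b2 i z})" by (simp add: algebra_simps)
        also have "\<dots> = (\<Sum>i\<in>{i\<in>I. \<not> b2 i z}. 1)" by simp
        also have "\<dots> = (\<Sum>i\<in>I. indicat_real {z\<in>space (qm X). \<not> b2 i z} z)"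
          using I z by (intro sum.mono_neutral_cong_left) auto
        finally show ?thesis using False z by simp
      qed (auto intro!: sum_nonneg)
    qed
    also have "\<dots> = (\<Sum>i\<in>I. measure (qm X) {z\<in>space (qm X). \<not> b2 i z})"
      using nb by (subst Bochner_Integration.integral_sum) (auto simp: qm.emeasure_eq_measure)
    finally show ?thesis .
  qed
  define W where "W = (\<Sum>i\<in>I. pbad X (Q i) N) + m * (real (card B) / N * (exp (- (\<sigma> * N / 4)) + exp (- (\<tau> * N / 4))))"
  have "(1 - \<theta>) * m * measure (qm X) (space (qm X) - A) \<le> W"
  proof -
    have "(\<Sum>i\<in>I. measure (qm X) {z\<in>space (qm X). \<not> b2 i z}) \<le>
       (\<Sum>i\<in>I. pbad X (Q i) N + real (card B) / N * (exp (- (\<sigma> * N / 4)) + exp (- (\<tau> * N / 4))))"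
      by (intro sum_mono pb2)
    also have "\<dots> = W" by (simp add: W_def sum.distrib m_def)
    finally show ?thesis using mk by simp
  qed
  hence A': "measure (qm X) (space (qm X) - A) \<le> W / ((1 - \<theta>) * m)"
    using \<theta> m by (simp add: field_simps)
  have "pbad X B (\<theta> * m * N) = measure (qm X) (space (qm X) - G)"
    unfolding pbad_def G_def by (intro arg_cong[where f = "measure (qm X)"]) auto
  also have "\<dots> \<le> measure (qm X) (space (qm X) - A) + (\<epsilon> + c * (\<sigma> * \<tau> * (real (card B))^2))"
    using AG Am Gm by (simp add: qm.prob_compl)
  also have "\<dots> \<le> W / ((1 - \<theta>) * m) + (\<epsilon> + c * (\<sigma> * \<tau> * (real (card B))^2))"
    using A' by simp
  finally show ?thesis unfolding W_def \<epsilon>_def c_def m_def k1_def k2_def by simp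
qed

end

section \<open>Tilings of boxes and the multi-scale bound\<close>

definition box_at :: "real^'d \<Rightarrow> real \<Rightarrow> (real^'d) set" where
  "box_at z R = {x. x - z \<in> cube R}"

definition int_vec :: "int^'d \<Rightarrow> real^'d" where
  "int_vec i = (\<chi> j. of_int (i $ j))"

text \<open>With an odd number \<open>2 * k + 1\<close> of cells per direction, the cells of a
  centred tiling have their centres at integer multiples of the cell side.\<close>

definition offsets :: "nat \<Rightarrow> (int^'d) set" where
  "offsets k = {i. \<forall>j. i $ j \<in> {- int k..int k}}"

lemma offsets_eq:
  "(offsets k :: (int^'d) set) = (\<lambda>f. \<chi> j. f j) ` (PiE UNIV (\<lambda>_. {- int k..int k}))" (is "_ = ?S")
proof
  show "(offsets k :: (int^'d) set) \<subseteq> ?S"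
  proof
    fix i :: "int^'d" assume "i \<in> offsets k"
    hence "(\<lambda>j. i $ j) \<in> PiE UNIV (\<lambda>_. {- int k..int k})" by (auto simp: offsets_def)
    thus "i \<in> ?S"
      by (rule rev_image_eqI) (simp add: vec_eq_iff)
  qed
qed (auto simp: offsets_def)

lemma offsets: "finite (offsets k :: (int^'d) set)" "card (offsets k :: (int^'d) set) = (2 * k + 1) ^ CARD('d)"
proof -
  have inj: "inj_on (\<lambda>f. \<chi> j. f j) (PiE (UNIV :: 'd set) (\<lambda>_. {- int k..int k}))"
    by (auto simp: inj_on_def vec_eq_iff fun_eq_iff)
  show "finite (offsets k :: (int^'d) set)"
    unfolding offsets_eq by (intro finite_imageI finite_PiE) auto
  show "card (offsets k :: (int^'d) set) = (2 * k + 1) ^ CARD('d)"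
    unfolding offsets_eq by (subst card_image[OF inj]) (simp add: card_PiE nat_add_distrib nat_mult_distrib)
qed

lemma zero_in_offsets: "0 \<in> offsets k"
  by (simp add: offsets_def)

lemma tiling_disjoint:
  assumes "0 < R"
  shows "disjoint_family_on (\<lambda>i. box_at (z + R *\<^sub>R int_vec i) R) J"
  unfolding disjoint_family_on_def
proof (intro ballI impI)
  fix i i' :: "int^'a" assume "i \<noteq> i'"
  then obtain j where j: "i $ j \<noteq> i' $ j" by (auto simp: vec_eq_iff)
  show "box_at (z + R *\<^sub>R int_vec i) R \<inter> box_at (z + R *\<^sub>R int_vec i') R = {}"
  proof (rule ccontr)
    assume "box_at (z + R *\<^sub>R int_vec i) R \<inter> box_at (z + R *\<^sub>R int_vec i') R \<noteq> {}"
    then obtain x where "x \<in> box_at (z + R *\<^sub>R int_vec i) R" "x \<in> box_at (z + R *\<^sub>R int_vec i') R" by auto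
    hence 1: "- R / 2 < x $ j - z $ j - R * of_int (i $ j)" "x $ j - z $ j - R * of_int (i $ j) \<le> R / 2"
      "- R / 2 < x $ j - z $ j - R * of_int (i' $ j)" "x $ j - z $ j - R * of_int (i' $ j) \<le> R / 2"
      by (auto simp: box_at_def cube_def int_vec_def algebra_simps dest!: spec[of _ j])
    have "R * of_int (i $ j - i' $ j) < R * 1" "R * (-1) < R * of_int (i $ j - i' $ j)"
      using 1 by (auto simp: algebra_simps)
    hence "real_of_int (i $ j - i' $ j) < of_int 1" "of_int (-1) < real_of_int (i $ j - i' $ j)"
      using assms by (simp_all only: mult_less_cancel_left_pos of_int_1 of_int_minus)
    hence "i $ j - i' $ j < 1" "-1 < i $ j - i' $ j" by (simp_all only: of_int_less_iff)
    thus False using j by simp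
  qed
qed

lemma tiling:
  assumes R: "0 < R"
  shows "box_at z (real (2 * k + 1) * R) = (\<Union>i\<in>offsets k. box_at (z + R *\<^sub>R int_vec i) R)"
proof (intro set_eqI iffI)
  fix x assume x: "x \<in> box_at z (real (2 * k + 1) * R)"
  \<comment> \<open>The ceiling of \<open>y - 1/2\<close> is the right cell index because cells are
    open on the left and closed on the right.\<close>
  define i :: "int^'a" where "i = (\<chi> j. \<lceil>(x $ j - z $ j) / R - 1/2\<rceil>)"
  have b: "- (real (2 * k + 1) * R) / 2 < x $ j - z $ j" "x $ j - z $ j \<le> real (2 * k + 1) * R / 2" for j
    using x by (auto simp: box_at_def cube_def)
  have "i \<in> offsets k" unfolding offsets_def
  proof (intro CollectI allI)
    fix j
    define y where "y = (x $ j - z $ j) / R"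
    have "- real (2 * k + 1) / 2 < y" "y \<le> real (2 * k + 1) / 2"
      using b[of j] R unfolding y_def by (simp_all add: field_simps)
    hence "- real k - 1 < y - 1/2" "y - 1/2 \<le> real k" by (auto simp: field_simps)
    hence "\<lceil>y - 1/2\<rceil> \<le> int k" "- int k \<le> \<lceil>y - 1/2\<rceil>" by linarith+
    thus "i $ j \<in> {- int k..int k}" by (simp add: i_def y_def)
  qed
  moreover have "x \<in> box_at (z + R *\<^sub>R int_vec i) R"
    unfolding box_at_def cube_def
  proof (intro CollectI allI)
    fix j
    define y where "y = (x $ j - z $ j) / R"
    have xy: "x $ j - z $ j = R * y" using R by (simp add: y_def)
    have ij: "i $ j = \<lceil>y - 1/2\<rceil>" by (simp add: i_def y_def)
    have "-1/2 < y - of_int (i $ j)" "y - of_int (i $ j) \<le> 1/2"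
      unfolding ij by linarith+
    hence "R * (-1/2) < R * (y - of_int (i $ j))" "R * (y - of_int (i $ j)) \<le> R * (1/2)"
      using R by (simp_all only: mult_less_cancel_left_pos mult_le_cancel_left_pos)
    moreover have "(x - (z + R *\<^sub>R int_vec i)) $ j = R * (y - of_int (i $ j))"
      using xy by (simp add: int_vec_def algebra_simps)
    ultimately show "- R / 2 < (x - (z + R *\<^sub>R int_vec i)) $ j \<and> (x - (z + R *\<^sub>R int_vec i)) $ j \<le> R / 2"
      by simp
  qed
  ultimately show "x \<in> (\<Union>i\<in>offsets k. box_at (z + R *\<^sub>R int_vec i) R)" by blast
next
  fix x assume "x \<in> (\<Union>i\<in>offsets k. box_at (z + R *\<^sub>R int_vec i) R)"
  then obtain i where i: "i \<in> offsets k" "x \<in> box_at (z + R *\<^sub>R int_vec i) R" by auto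
  show "x \<in> box_at z (real (2 * k + 1) * R)"
    unfolding box_at_def cube_def
  proof (intro CollectI allI)
    fix j
    have 1: "- R / 2 < x $ j - z $ j - R * of_int (i $ j)" "x $ j - z $ j - R * of_int (i $ j) \<le> R / 2"
      using i(2) by (auto simp: box_at_def cube_def int_vec_def algebra_simps dest!: spec[of _ j])
    have "- int k \<le> i $ j" "i $ j \<le> int k" using i(1) by (auto simp: offsets_def)
    hence "of_int (- int k) \<le> (of_int (i $ j) :: real)" "of_int (i $ j) \<le> (of_int (int k) :: real)"
      by (simp_all only: of_int_le_iff)
    hence "R * (- real k) \<le> R * of_int (i $ j)" "R * of_int (i $ j) \<le> R * real k"
      using R by (simp_all only: mult_le_cancel_left_pos of_int_minus of_int_of_nat_eq)
    thus "- (real (2 * k + 1) * R) / 2 < (x - z) $ j \<and> (x - z) $ j \<le> real (2 * k + 1) * R / 2"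
    proof -
      assume a: "R * (- real k) \<le> R * of_int (i $ j)" "R * of_int (i $ j) \<le> R * real k"
      define A where "A = R * real k"
      define b where "b = R * of_int (i $ j)"
      have e: "(x - z) $ j = x $ j - z $ j" "real (2 * k + 1) * R = 2 * A + R" "R * (- real k) = - A"
        by (simp_all add: algebra_simps A_def)
      have "- A \<le> b" "b \<le> A" using a e(3) unfolding A_def b_def by simp_all
      moreover have "- (R / 2) < x $ j - z $ j - b" "x $ j - z $ j - b \<le> R / 2"
        using 1 by (simp_all add: b_def)
      ultimately have "- (A + R / 2) < x $ j - z $ j" "x $ j - z $ j \<le> A + R / 2" by linarith+
      moreover have "- (2 * A + R) / 2 = - (A + R / 2)" "(2 * A + R) / 2 = A + R / 2" by (simp_all add: field_simps)
      ultimately show ?thesis unfolding e by (simp only: conj_absorb simp_thms)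
    qed
  qed
qed

text \<open>The crude \<open>l1\<close> bound on the diameter. It is the reason why connection
  probabilities are evaluated at the distance \<open>D * S\<close> for a box of side
  \<open>S\<close>.\<close>

lemma dist_box_at:
  fixes x y z :: "real^'d"
  assumes "x \<in> box_at z S" "y \<in> box_at z S"
  shows "dist x y \<le> real CARD('d) * S"
proof -
  have "\<bar>(x - y) $ j\<bar> \<le> S" for j
    using assms by (auto simp: box_at_def cube_def abs_le_iff dest!: spec[of _ j])
  hence "(\<Sum>j\<in>UNIV. \<bar>(x - y) $ j\<bar>) \<le> (\<Sum>j\<in>(UNIV::'d set). S)" by (intro sum_mono)
  thus ?thesis using norm_le_l1_cart[of "x - y"] by (simp add: dist_norm)
qed

text \<open>The four summands are the errors of one merging step in terms of the new side
  \<open>S\<close>: too few low marks, the term \<open>s / 2\<close> and the change of law, both at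
  \<open>s = S powr (- (\<kappa> * D))\<close>, and pairs of clusters left unlinked. Half of the
  exponent of \<open>s\<close> is given away to absorb the constants.\<close>

lemma error_asymp:
  fixes D \<kappa> \<epsilon> :: real
  assumes "1 \<le> D" "0 < \<kappa>" "0 < \<epsilon>"
  shows "eventually (\<lambda>S. 4 * S powr (2 * D) * exp (- (S powr (D * \<epsilon> / 2) / 4)) + S powr (- (\<kappa> * D)) / 2
    + 4 * S powr (- (\<kappa> * D)) + S powr (2 * D) * exp (- (S powr (D * \<epsilon> / 4) / 16)) \<le> S powr (- (\<kappa> * D / 2))) at_top"
proof -
  have D: "0 < D" using assms by simp
  have a: "0 < D * \<epsilon> / 2" "0 < D * \<epsilon> / 4" "0 < \<kappa> * D" using assms by auto
  define x where "x = D * \<epsilon> / 2"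
  define y where "y = D * \<epsilon> / 4"
  define w where "w = \<kappa> * D"
  have p: "0 < x" "0 < y" "0 < w" using a by (auto simp: x_def y_def w_def)
  have 1: "eventually (\<lambda>S. 4 * S powr (2 * D) * exp (- (S powr x / 4)) \<le> S powr (- (w / 2)) / 4) at_top"
    using p D by real_asymp
  have 2: "eventually (\<lambda>S. S powr (2 * D) * exp (- (S powr y / 16)) \<le> S powr (- (w / 2)) / 4) at_top"
    using p D by real_asymp
  have 3: "eventually (\<lambda>S. S powr (- w) / 2 + 4 * S powr (- w) \<le> S powr (- (w / 2)) / 4) at_top"
    using p by real_asymp
  show ?thesis using 1 2 3
    unfolding x_def y_def w_def
  proof eventually_elim
    case (elim S)
    have "0 \<le> S powr (- (\<kappa> * D / 2))" by simp
    thus ?case using elim by linarith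
  qed
qed

text \<open>\<open>2 * branch \<kappa> R + 1\<close> is an odd number of the order of
  \<open>R powr \<kappa>\<close>, so a box built from that many cells of side \<open>R\<close> per
  direction has side about \<open>R powr (1 + \<kappa>)\<close>.\<close>

definition branch :: "real \<Rightarrow> real \<Rightarrow> nat" where
  "branch \<kappa> R = nat \<lfloor>R powr \<kappa> / 2\<rfloor>"

lemma branch_bounds:
  assumes "4 \<le> R powr \<kappa>"
  shows "R powr \<kappa> / 2 \<le> real (2 * branch \<kappa> R + 1)" "real (2 * branch \<kappa> R + 1) \<le> 2 * R powr \<kappa>"
    "3 \<le> real (2 * branch \<kappa> R + 1)"
proof -
  define x where "x = R powr \<kappa> / 2"
  have x: "2 \<le> x" using assms by (simp add: x_def)
  hence "2 \<le> \<lfloor>x\<rfloor>" by linarith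
  hence f: "real (branch \<kappa> R) = of_int \<lfloor>x\<rfloor>" unfolding branch_def x_def[symmetric] by (simp add: of_nat_nat)
  have "of_int \<lfloor>x\<rfloor> \<le> x" "x < of_int \<lfloor>x\<rfloor> + 1" by linarith+
  thus "R powr \<kappa> / 2 \<le> real (2 * branch \<kappa> R + 1)" "real (2 * branch \<kappa> R + 1) \<le> 2 * R powr \<kappa>"
    "3 \<le> real (2 * branch \<kappa> R + 1)"
    using x f unfolding x_def[symmetric] by (simp_all add: x_def field_simps)
qed

text \<open>\<open>one_step\<close> asks for a subset of \<open>X\<close>, while boxes contain all
  points of space; intersecting them with \<open>X\<close> changes no cluster count.\<close>

lemma cluster_Int: "x \<in> X \<Longrightarrow> cluster b X x \<inter> (B \<inter> X) = cluster b X x \<inter> B"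
  using cluster_subset[of x X b] by auto

lemma big_Int: "big b X (B \<inter> X) N = big b X B N"
  unfolding big_def by (simp add: cluster_Int)

context conn_prob
begin

lemma pbad_Int: "pbad X (B \<inter> X) N = pbad X B N"
  by (simp add: pbad_def big_Int)

lemma pbad_nonneg: "0 \<le> pbad X B N" and pbad_le_1: "pbad X B N \<le> 1"
  using prob_space.prob_le_1[OF prob_space_qm] by (auto simp: pbad_def)

text \<open>Here the exponents are balanced. \<open>N\<close> and \<open>nb\<close>, the cluster
  size in a cell and the allowed number of points in the new box, are both \<open>S powr D\<close>
  up to powers of order \<open>\<kappa>\<close>, and \<open>F\<close> is at least
  \<open>S powr (- (D * (2 - \<epsilon>)))\<close>. The essential feature of the conclusion is the
  factor in front of the average failure of the cells: it is so close to 1 that its product over all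
  scales stays bounded.\<close>

lemma level_step:
  fixes \<epsilon> \<kappa> S0 :: real
  defines "D \<equiv> real CARD('d::finite)"
  assumes \<epsilon>: "0 < \<epsilon>" "\<epsilon> < 1" and \<kappa>: "0 < \<kappa>" "\<kappa> \<le> \<epsilon> / 32"
    and decay: "\<And>S. S0 \<le> S \<Longrightarrow> \<exists>\<sigma> \<tau>. 0 < \<sigma> \<and> \<sigma> \<le> 1 \<and> 0 < \<tau> \<and> \<tau> \<le> 1 \<and> S powr (- (D * (1 - \<epsilon>))) \<le> \<sigma> \<and>
       S powr (- (D * (1 - \<epsilon>))) \<le> \<tau> \<and> S powr (- (D * (2 - \<epsilon>))) \<le> \<rho> \<sigma> \<tau> (D * S) * (\<sigma> * \<tau>)"
  shows "\<exists>R0\<ge>1. \<forall>R\<ge>R0. 4 \<le> R powr \<kappa> \<and> (\<forall>X z. finite X \<longrightarrow>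
     real (card (box_at z (real (2 * branch \<kappa> R + 1) * R) \<inter> X)) \<le> (real (2 * branch \<kappa> R + 1) * R) powr (D * (1 + \<kappa>)) \<longrightarrow>
     pbad X (box_at (z::real^'d) (real (2 * branch \<kappa> R + 1) * R)) ((real (2 * branch \<kappa> R + 1) * R) powr (D * (1 - \<kappa>)))
       \<le> (1 + R powr (- (D * \<kappa>^2 / 2))) * ((\<Sum>i\<in>offsets (branch \<kappa> R). pbad X (box_at (z + R *\<^sub>R int_vec i) R) (R powr (D * (1 - \<kappa>))))
            / real (card (offsets (branch \<kappa> R) :: (int^'d) set))) + R powr (- (D * \<kappa>^2 / 2)))"
proof -
  have D1: "1 \<le> D" unfolding D_def by (simp add: Suc_leI)
  have D0: "0 < D" using D1 by simp
  have e1: "0 < D * (\<epsilon>/2 + 2*\<kappa>)" "0 < D * \<kappa>^2" using D0 \<epsilon> \<kappa> by auto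
  obtain S1 where S1: "\<And>S. S1 \<le> S \<Longrightarrow> 4 * S powr (2 * D) * exp (- (S powr (D * \<epsilon> / 2) / 4)) + S powr (- (\<kappa> * D)) / 2
    + 4 * S powr (- (\<kappa> * D)) + S powr (2 * D) * exp (- (S powr (D * \<epsilon> / 4) / 16)) \<le> S powr (- (\<kappa> * D / 2))"
    using error_asymp[OF D1 \<kappa>(1) \<epsilon>(1)] unfolding eventually_at_top_linorder by auto
  obtain S2 where S2: "\<And>S. S2 \<le> S \<Longrightarrow> S powr (- (D * (\<epsilon>/2 + 2*\<kappa>))) \<le> 1/2"
  proof -
    define a where "a = D * (\<epsilon>/2 + 2*\<kappa>)"
    have "eventually (\<lambda>S. S powr (- a) \<le> 1/2) at_top" using e1(1) unfolding a_def[symmetric] by real_asymp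
    thus ?thesis using that unfolding a_def eventually_at_top_linorder by auto
  qed
  obtain R1 where R1: "\<And>R. R1 \<le> R \<Longrightarrow> 2 * (2 powr (D * \<kappa>) * R powr (- (D * \<kappa>^2))) \<le> R powr (- (D * \<kappa>^2 / 2))"
  proof -
    define a b where "a = D * \<kappa>^2" and "b = 2 powr (D * \<kappa>)"
    have "0 < b" by (simp add: b_def)
    hence "eventually (\<lambda>R. 2 * (b * R powr (- a)) \<le> R powr (- (a / 2))) at_top"
      using e1(2) unfolding a_def[symmetric] by real_asymp
    thus ?thesis using that unfolding a_def b_def eventually_at_top_linorder by auto
  qed
  obtain R2 where R2: "\<And>R. R2 \<le> R \<Longrightarrow> 4 \<le> R powr \<kappa>"
  proof -
    have "eventually (\<lambda>R. 4 \<le> R powr \<kappa>) at_top" using \<kappa>(1) by real_asymp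
    thus ?thesis using that unfolding eventually_at_top_linorder by auto
  qed
  define R0 where "R0 = Max {1, S0, S1, S2, R1, R2}"
  have R0: "1 \<le> R0" "S0 \<le> R0" "S1 \<le> R0" "S2 \<le> R0" "R1 \<le> R0" "R2 \<le> R0" by (auto simp: R0_def)
  have main: "pbad X (box_at z (C * R)) ((C * R) powr (D * (1 - \<kappa>)))
       \<le> (1 + R powr (- (D * \<kappa>^2 / 2))) * ((\<Sum>i\<in>offsets (branch \<kappa> R). pbad X (box_at (z + R *\<^sub>R int_vec i) R) (R powr (D * (1 - \<kappa>))))
            / real (card (offsets (branch \<kappa> R) :: (int^'d) set))) + R powr (- (D * \<kappa>^2 / 2))"
    if R: "R0 \<le> R" and X: "finite X" and C: "C = real (2 * branch \<kappa> R + 1)"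
      and cB: "real (card (box_at z (C * R) \<inter> X)) \<le> (C * R) powr (D * (1 + \<kappa>))" for R C X and z :: "real^'d"
  proof -
    define S where "S = C * R"
    define k where "k = branch \<kappa> R"
    have Rge: "1 \<le> R" "S0 \<le> R" "S1 \<le> R" "S2 \<le> R" "R1 \<le> R" "R2 \<le> R" using R R0 by linarith+
    have R4: "4 \<le> R powr \<kappa>" by (rule R2[OF Rge(6)])
    have Cb: "R powr \<kappa> / 2 \<le> C" "C \<le> 2 * R powr \<kappa>" "3 \<le> C"
      unfolding C by (rule branch_bounds[OF R4])+
    have SR: "R \<le> S" using Cb Rge(1) mult_mono[of 1 C R R] unfolding S_def by simp
    hence SR: "R \<le> S" "0 < S" "1 \<le> S" using Rge(1) by linarith+
    obtain \<sigma> \<tau> where st: "0 < \<sigma>" "\<sigma> \<le> 1" "0 < \<tau>" "\<tau> \<le> 1" "S powr (- (D * (1 - \<epsilon>))) \<le> \<sigma>"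
       "S powr (- (D * (1 - \<epsilon>))) \<le> \<tau>" "S powr (- (D * (2 - \<epsilon>))) \<le> \<rho> \<sigma> \<tau> (D * S) * (\<sigma> * \<tau>)"
      using decay[of S] SR Rge by auto
    define p where "p = \<rho> \<sigma> \<tau> (D * S)"
    define F where "F = p * (\<sigma> * \<tau>)"
    have F: "S powr (- (D * (2 - \<epsilon>))) \<le> F" using st by (simp add: F_def p_def)
    hence F0: "0 < F" using SR by (auto intro: less_le_trans[rotated])
    have p0: "0 < p"
    proof (rule ccontr)
      assume "\<not> 0 < p"
      hence "p = 0" using rho_range[of \<sigma> \<tau> "D * S"] by (simp add: p_def)
      thus False using F0 by (simp add: F_def)
    qed
    have p1: "p \<le> 1" using rho_range by (simp add: p_def)
    define N where "N = R powr (D * (1 - \<kappa>))"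
    define nb where "nb = S powr (D * (1 + \<kappa>))"
    define I where "I = (offsets k :: (int^'d) set)"
    define m where "m = real (card I)"
    have I: "finite I" "I \<noteq> {}" using offsets(1)[of k] zero_in_offsets[of k] by (auto simp: I_def)
    have mC: "m = C powr D"
      using Cb unfolding m_def I_def k_def C by (subst offsets(2)) (simp add: D_def powr_realpow)
    have m1: "1 \<le> m" unfolding mC using Cb D0 by (intro ge_one_powr_ge_zero) auto
    have \<kappa>1: "\<kappa> < 1/32" using \<kappa> \<epsilon> by linarith
    have N1: "1 \<le> N" unfolding N_def using Rge D0 \<kappa>1 by (intro ge_one_powr_ge_zero) auto
    have nb1: "1 \<le> nb" unfolding nb_def using SR D0 \<kappa> by (intro ge_one_powr_ge_zero) auto
    \<comment> \<open>The old side in terms of the new one: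
      \<open>S \<le> 2 * R powr (1 + \<kappa>)\<close>, and \<open>(1 + \<kappa>) * (1 - 3 *
      \<kappa>) + \<kappa> \<le> 1 - \<kappa>\<close>. The spare \<open>\<kappa>\<close> pays for
      the constant 2, as \<open>4 \<le> R powr \<kappa>\<close>.\<close>
    have NS: "S powr (D * (1 - 3 * \<kappa>)) \<le> N"
    proof -
      have "S \<le> 2 * R powr (1 + \<kappa>)"
        using Cb(2) Rge(1) mult_right_mono[of C "2 * R powr \<kappa>" R] by (simp add: S_def powr_add mult_ac)
      hence "S powr (D * (1 - 3 * \<kappa>)) \<le> (2 * R powr (1 + \<kappa>)) powr (D * (1 - 3 * \<kappa>))"
        using SR D0 \<kappa>1 by (intro powr_mono2) auto
      also have "\<dots> = 2 powr (D * (1 - 3 * \<kappa>)) * R powr ((1 + \<kappa>) * (D * (1 - 3 * \<kappa>)))"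
        by (simp add: powr_mult powr_powr)
      also have "\<dots> \<le> R powr (\<kappa> * D) * R powr ((1 + \<kappa>) * (D * (1 - 3 * \<kappa>)))"
      proof (rule mult_right_mono)
        have "(2::real) powr (D * (1 - 3 * \<kappa>)) \<le> 2 powr D" using D0 \<kappa> by (intro powr_mono) (auto simp: algebra_simps)
        also have "\<dots> \<le> (R powr \<kappa>) powr D" using R4 D0 by (intro powr_mono2) auto
        finally show "(2::real) powr (D * (1 - 3 * \<kappa>)) \<le> R powr (\<kappa> * D)" by (simp add: powr_powr)
      qed simp
      also have "\<dots> = R powr (D * (1 - \<kappa>) - 3 * (D * \<kappa>^2))"
        by (simp add: powr_add[symmetric] power2_eq_square algebra_simps)
      also have "\<dots> \<le> N" unfolding N_def using Rge(1) e1 by (intro powr_mono) auto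
      finally show ?thesis .
    qed
    \<comment> \<open>Chosen so that \<open>\<theta> * m * N\<close> is exactly the target size
      \<open>S powr (D * (1 - \<kappa>))\<close>. Only a vanishing fraction of good cells is asked
      for, hence Markov's factor \<open>1 / (1 - \<theta>)\<close> is nearly 1.\<close>
    define \<theta> where "\<theta> = C powr (- (D * \<kappa>))"
    have \<theta>b: "2 * \<theta> \<le> R powr (- (D * \<kappa>^2 / 2))"
    proof -
      have "\<theta> \<le> (R powr \<kappa> / 2) powr (- (D * \<kappa>))"
        unfolding \<theta>_def using Cb R4 D0 \<kappa> by (intro powr_mono2') auto
      also have "\<dots> = 2 powr (D * \<kappa>) * R powr (- (D * \<kappa>^2))"
        by (simp add: powr_divide powr_powr powr_minus_divide power2_eq_square mult_ac)
      finally show ?thesis using R1[OF Rge(5)] by linarith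
    qed
    moreover have "R powr (- (D * \<kappa>^2 / 2)) \<le> 1" using Rge(1) e1 by (simp add: powr_minus_divide ge_one_powr_ge_zero)
    ultimately have \<theta>: "0 < \<theta>" "\<theta> \<le> 1/2" using Cb by (auto simp: \<theta>_def)
    have \<theta>N: "\<theta> * m * N = S powr (D * (1 - \<kappa>))"
      unfolding \<theta>_def mC N_def S_def using Cb Rge(1)
      by (simp add: powr_mult powr_add[symmetric] right_diff_distrib)
    have sqF: "S powr (- (D * (1 - \<epsilon>/2))) \<le> sqrt F"
    proof -
      have "S powr (- (D * (1 - \<epsilon>/2))) = sqrt (S powr (- (D * (2 - \<epsilon>))))"
        using SR by (simp add: powr_half_sqrt[symmetric] powr_powr algebra_simps)
      thus ?thesis using F by simp
    qed
    have sF0: "0 < sqrt F" using F0 by simp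
    \<comment> \<open>Tuned so that
      \<open>\<delta> * sqrt F * nb = S powr (- (\<kappa> * D))\<close>. The change of law then
      costs at most 4 times this number, while the exponent in the error for unlinked clusters is
      \<open>\<delta> * F * N^2 / 16\<close>, still a positive power of \<open>S\<close>.\<close>
    define \<delta> where "\<delta> = S powr (- (\<kappa> * D)) / (sqrt F * nb)"
    have \<delta>0: "0 < \<delta>" using SR sF0 nb1 by (auto simp: \<delta>_def)
    have \<delta>2: "\<delta> \<le> 1/2"
    proof -
      have "\<delta> \<le> S powr (- (\<kappa> * D)) / (S powr (- (D * (1 - \<epsilon>/2))) * nb)"
        unfolding \<delta>_def using sqF sF0 SR nb1 by (intro divide_left_mono mult_right_mono mult_pos_pos) auto
      also have "\<dots> = S powr (- (D * (\<epsilon>/2 + 2*\<kappa>)))"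
        unfolding nb_def by (simp add: powr_add[symmetric] powr_diff[symmetric] algebra_simps)
      also have "\<dots> \<le> 1/2" using S2[of S] SR Rge by auto
      finally show ?thesis .
    qed
    define q where "q = \<delta> * p"
    define s where "s = S powr (- (\<kappa> * D))"
    have s: "0 < s" "s \<le> 1" using SR D0 \<kappa> by (auto simp: s_def powr_minus_divide ge_one_powr_ge_zero)
    have q: "0 \<le> q" "q \<le> 1/2" "q \<le> p"
    proof -
      show "0 \<le> q" using \<delta>0 p0 by (simp add: q_def)
      have "q \<le> 1/2 * 1" unfolding q_def using \<delta>2 p1 p0 \<delta>0 by (intro mult_mono) auto
      thus "q \<le> 1/2" by simp
      have "q \<le> 1 * p" unfolding q_def using \<delta>2 p0 by (intro mult_right_mono) auto
      thus "q \<le> p" by simp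
    qed
    define B where "B = box_at z S \<inter> X"
    have cB': "real (card B) \<le> nb" using cB by (simp add: B_def nb_def S_def)
    have "pbad X B (\<theta> * real (card I) * N) \<le>
     ((\<Sum>i\<in>I. pbad X (box_at (z + R *\<^sub>R int_vec i) R \<inter> X) N) + real (card I) * (real (card B) / N * (exp (- (\<sigma> * N / 4)) + exp (- (\<tau> * N / 4)))))
        / ((1 - \<theta>) * real (card I))
     + s / 2 + 4 * q^2 / \<rho> \<sigma> \<tau> (D * S) / s * (\<sigma> * \<tau> * (real (card B))^2)
     + (real (card I))^2 * exp (- (q * ((\<sigma> * N / 4) * (\<tau> * N / 4))))"
    proof (rule one_step[OF X I])
      show "disjoint_family_on (\<lambda>i. box_at (z + R *\<^sub>R int_vec i) R \<inter> X) I"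
        using tiling_disjoint[of R z I] Rge by (auto simp: disjoint_family_on_def)
      show "box_at (z + R *\<^sub>R int_vec i) R \<inter> X \<subseteq> B" if "i \<in> I" for i
        using tiling[of R z k] Rge that unfolding B_def S_def C k_def I_def by auto
      show "dist x y \<le> D * S" if "x \<in> B" "y \<in> B" for x y
        using dist_box_at[of x z S y] that by (simp add: B_def D_def)
    qed (use st p0 p_def q s \<theta> N1 B_def in auto)
    also have "pbad X B (\<theta> * real (card I) * N) = pbad X (box_at z (C * R)) ((C * R) powr (D * (1 - \<kappa>)))"
      using \<theta>N by (simp add: B_def pbad_Int S_def m_def)
    also have "(\<Sum>i\<in>I. pbad X (box_at (z + R *\<^sub>R int_vec i) R \<inter> X) N) = (\<Sum>i\<in>I. pbad X (box_at (z + R *\<^sub>R int_vec i) R) N)"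
      by (simp add: pbad_Int)
    finally have step: "pbad X (box_at z (C * R)) ((C * R) powr (D * (1 - \<kappa>))) \<le>
      ((\<Sum>i\<in>I. pbad X (box_at (z + R *\<^sub>R int_vec i) R) N) + m * (real (card B) / N * (exp (- (\<sigma> * N / 4)) + exp (- (\<tau> * N / 4)))))
        / ((1 - \<theta>) * m)
     + s / 2 + 4 * q^2 / p / s * (\<sigma> * \<tau> * (real (card B))^2)
     + m^2 * exp (- (q * ((\<sigma> * N / 4) * (\<tau> * N / 4))))" by (simp add: m_def p_def)
    define P where "P = (\<Sum>i\<in>I. pbad X (box_at (z + R *\<^sub>R int_vec i) R) N) / m"
    have P0: "0 \<le> P" using m1 by (auto simp: P_def intro!: divide_nonneg_nonneg sum_nonneg pbad_nonneg)
    define x where "x = real (card B) / N * (exp (- (\<sigma> * N / 4)) + exp (- (\<tau> * N / 4)))"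
    have x0: "0 \<le> x" using N1 by (auto simp: x_def intro!: mult_nonneg_nonneg add_nonneg_nonneg)
    have t1: "((\<Sum>i\<in>I. pbad X (box_at (z + R *\<^sub>R int_vec i) R) N) + m * x) / ((1 - \<theta>) * m) = (P + x) / (1 - \<theta>)"
      using m1 \<theta> by (simp add: P_def field_simps)
    have inv: "1 / (1 - \<theta>) \<le> 1 + 2 * \<theta>" "1 / (1 - \<theta>) \<le> 2"
    proof -
      have "0 \<le> \<theta> * (1 - 2 * \<theta>)" using \<theta> by (intro mult_nonneg_nonneg) auto
      thus "1 / (1 - \<theta>) \<le> 1 + 2 * \<theta>" using \<theta> by (simp add: field_simps)
      thus "1 / (1 - \<theta>) \<le> 2" using \<theta> by linarith
    qed
    have t2: "(P + x) / (1 - \<theta>) \<le> (1 + R powr (- (D * \<kappa>^2 / 2))) * P + 2 * x"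
    proof -
      have "P * (1 / (1 - \<theta>)) \<le> P * (1 + R powr (- (D * \<kappa>^2 / 2)))"
        using inv(1) \<theta>b P0 by (intro mult_left_mono) auto
      moreover have "x * (1 / (1 - \<theta>)) \<le> x * 2" using inv(2) x0 by (intro mult_left_mono)
      ultimately show ?thesis by (simp add: add_divide_distrib mult.commute)
    qed
    have low: "exp (- (t * N / 4)) \<le> exp (- (S powr (D * \<epsilon> / 2) / 4))" if t: "S powr (- (D * (1 - \<epsilon>))) \<le> t" for t
    proof -
      have "S powr (D * \<epsilon> / 2) \<le> S powr (- (D * (1 - \<epsilon>)) + D * (1 - 3 * \<kappa>))"
      proof (rule powr_mono)
        have "D * (3 * \<kappa>) \<le> D * (\<epsilon> / 2)" using D0 \<kappa> \<epsilon> by (intro mult_left_mono) auto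
        thus "D * \<epsilon> / 2 \<le> - (D * (1 - \<epsilon>)) + D * (1 - 3 * \<kappa>)" by (simp add: algebra_simps)
      qed (use SR in auto)
      also have "\<dots> = S powr (- (D * (1 - \<epsilon>))) * S powr (D * (1 - 3 * \<kappa>))" by (rule powr_add)
      also have "\<dots> \<le> t * N" using t NS by (intro mult_mono) (auto intro: order_trans[OF powr_ge_zero])
      finally show ?thesis by simp
    qed
    have nbS: "nb \<le> S powr (2 * D)" unfolding nb_def using SR D0 \<kappa>1 by (intro powr_mono) auto
    have t3: "2 * x \<le> 4 * S powr (2 * D) * exp (- (S powr (D * \<epsilon> / 2) / 4))"
    proof -
      have "real (card B) / N \<le> S powr (2 * D)"
        using cB' nbS N1 frac_le[of "real (card B)" "real (card B)" 1 N] by simp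
      moreover have "exp (- (\<sigma> * N / 4)) + exp (- (\<tau> * N / 4)) \<le> 2 * exp (- (S powr (D * \<epsilon> / 2) / 4))"
        using low[OF st(5)] low[OF st(6)] by linarith
      ultimately have "x \<le> S powr (2 * D) * (2 * exp (- (S powr (D * \<epsilon> / 2) / 4)))"
        unfolding x_def by (intro mult_mono) (auto intro: add_nonneg_nonneg)
      thus ?thesis by simp
    qed
    have t4: "4 * q^2 / p / s * (\<sigma> * \<tau> * (real (card B))^2) \<le> 4 * S powr (- (\<kappa> * D))"
    proof -
      have "4 * q^2 / p / s * (\<sigma> * \<tau> * (real (card B))^2) \<le> 4 * q^2 / p / s * (\<sigma> * \<tau> * nb^2)"
        using cB' st p0 s by (intro mult_left_mono power_mono) auto
      also have "\<dots> = 4 * (\<delta>^2 * F * nb^2) / s"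
        using p0 by (simp add: q_def F_def power2_eq_square)
      also have "\<delta>^2 * F * nb^2 = s^2"
      proof -
        have "(\<delta> * sqrt F * nb) = s" unfolding \<delta>_def s_def using sF0 nb1 by simp
        hence "(\<delta> * sqrt F * nb)^2 = s^2" by simp
        thus ?thesis using F0 by (simp add: power_mult_distrib)
      qed
      also have "4 * s^2 / s = 4 * S powr (- (\<kappa> * D))" using s by (simp add: power2_eq_square s_def)
      finally show ?thesis .
    qed
    have gain: "S powr (D * \<epsilon> / 4) / 16 \<le> q * ((\<sigma> * N / 4) * (\<tau> * N / 4))"
    proof -
      have "S powr (D * \<epsilon> / 4) \<le> S powr (- (\<kappa> * D) - D * (1 - \<epsilon>/2) + 2 * (D * (1 - 3 * \<kappa>)) - D * (1 + \<kappa>))"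
      proof (rule powr_mono)
        \<comment> \<open>The losses add up to \<open>8 * \<kappa>\<close>: one from
          \<open>s\<close>, six from \<open>N^2\<close>, one from \<open>nb\<close>. This is the
          origin of the bound \<open>\<kappa> \<le> \<epsilon> / 32\<close>.\<close>
        have "D * (8 * \<kappa>) \<le> D * (\<epsilon> / 4)" using D0 \<kappa> by (intro mult_left_mono) auto
        thus "D * \<epsilon> / 4 \<le> - (\<kappa> * D) - D * (1 - \<epsilon>/2) + 2 * (D * (1 - 3 * \<kappa>)) - D * (1 + \<kappa>)"
          by (simp add: algebra_simps)
      qed (use SR in auto)
      also have "\<dots> = s * S powr (- (D * (1 - \<epsilon>/2))) * (S powr (D * (1 - 3 * \<kappa>)))^2 / nb"
      proof -
        have "S powr (2 * (D * (1 - 3 * \<kappa>))) = (S powr (D * (1 - 3 * \<kappa>)))^2"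
          by (simp add: power2_eq_square powr_add[symmetric])
        moreover have "S powr (- (\<kappa> * D) - D * (1 - \<epsilon>/2) + 2 * (D * (1 - 3 * \<kappa>)) - D * (1 + \<kappa>))
            = S powr (- (\<kappa> * D)) * S powr (- (D * (1 - \<epsilon>/2))) * S powr (2 * (D * (1 - 3 * \<kappa>))) / S powr (D * (1 + \<kappa>))"
          by (simp add: powr_add[symmetric] powr_diff[symmetric] del: mult_minus_right)
        ultimately show ?thesis by (simp add: s_def nb_def)
      qed
      also have "\<dots> \<le> s * sqrt F * N^2 / nb"
        using sqF NS s nb1 SR sF0 by (intro divide_right_mono mult_mono power_mono) auto
      also have "s * sqrt F * N^2 / nb = \<delta> * F * N^2"
      proof -
        have e: "s / nb = \<delta> * sqrt F" unfolding \<delta>_def s_def using sF0 by simp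
        have ff: "sqrt F * sqrt F = F" using F0 by simp
        have "s * sqrt F * N^2 / nb = s / nb * (sqrt F * N^2)" by simp
        also have "\<dots> = \<delta> * (sqrt F * sqrt F) * N^2" unfolding e by (simp only: mult_ac)
        finally show ?thesis unfolding ff .
      qed
      also have "\<dots> = 16 * (q * ((\<sigma> * N / 4) * (\<tau> * N / 4)))"
        by (simp add: q_def F_def power2_eq_square)
      finally show ?thesis by simp
    qed
    have t5: "m^2 * exp (- (q * ((\<sigma> * N / 4) * (\<tau> * N / 4)))) \<le> S powr (2 * D) * exp (- (S powr (D * \<epsilon> / 4) / 16))"
    proof (rule mult_mono)
      have "C \<le> S" using Rge(1) Cb mult_left_mono[of 1 R C] by (simp add: S_def)
      hence "m \<le> S powr D" unfolding mC using Cb D0 by (intro powr_mono2) auto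
      hence "m^2 \<le> (S powr D)^2" using m1 by (intro power_mono) auto
      thus "m^2 \<le> S powr (2 * D)" by (simp add: power2_eq_square powr_add[symmetric])
    qed (use gain in auto)
    have "pbad X (box_at z (C * R)) ((C * R) powr (D * (1 - \<kappa>))) \<le> (1 + R powr (- (D * \<kappa>^2 / 2))) * P
      + (4 * S powr (2 * D) * exp (- (S powr (D * \<epsilon> / 2) / 4)) + S powr (- (\<kappa> * D)) / 2
    + 4 * S powr (- (\<kappa> * D)) + S powr (2 * D) * exp (- (S powr (D * \<epsilon> / 4) / 16)))"
      using step t1 t2 t3 t4 t5 unfolding x_def[symmetric] s_def by linarith
    also have "\<dots> \<le> (1 + R powr (- (D * \<kappa>^2 / 2))) * P + S powr (- (\<kappa> * D / 2))"
      using S1[of S] SR Rge by (intro add_left_mono) auto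
    also have "\<dots> \<le> (1 + R powr (- (D * \<kappa>^2 / 2))) * P + R powr (- (D * \<kappa>^2 / 2))"
    proof (rule add_left_mono)
      have "S powr (- (\<kappa> * D / 2)) \<le> R powr (- (\<kappa> * D / 2))"
        using SR Rge(1) D0 \<kappa> by (intro powr_mono2') auto
      also have "\<dots> \<le> R powr (- (D * \<kappa>^2 / 2))"
      proof (rule powr_mono)
        have "D * (\<kappa> * \<kappa>) \<le> D * (\<kappa> * 1)" using D0 \<kappa> \<kappa>1 by (intro mult_left_mono) auto
        thus "- (\<kappa> * D / 2) \<le> - (D * \<kappa>^2 / 2)" by (simp add: power2_eq_square mult_ac)
      qed (use Rge in auto)
      finally show "S powr (- (\<kappa> * D / 2)) \<le> R powr (- (D * \<kappa>^2 / 2))" .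
    qed
    finally show ?thesis unfolding P_def m_def I_def k_def N_def .
  qed
  show ?thesis
  proof (intro exI[of _ R0] conjI allI impI)
    show "1 \<le> R0" by (rule R0)
    fix R assume R: "R0 \<le> R"
    show "4 \<le> R powr \<kappa>" using R2[of R] R R0 by auto
    fix X and z :: "real^'d"
    assume X: "finite X" and c: "real (card (box_at z (real (2 * branch \<kappa> R + 1) * R) \<inter> X)) \<le> (real (2 * branch \<kappa> R + 1) * R) powr (D * (1 + \<kappa>))"
    show "pbad X (box_at z (real (2 * branch \<kappa> R + 1) * R)) ((real (2 * branch \<kappa> R + 1) * R) powr (D * (1 - \<kappa>)))
       \<le> (1 + R powr (- (D * \<kappa>^2 / 2))) * ((\<Sum>i\<in>offsets (branch \<kappa> R). pbad X (box_at (z + R *\<^sub>R int_vec i) R) (R powr (D * (1 - \<kappa>))))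
            / real (card (offsets (branch \<kappa> R) :: (int^'d) set))) + R powr (- (D * \<kappa>^2 / 2))"
      by (rule main[OF R X refl c])
  qed
qed

end

text \<open>Sides are integers so that cells are centred at integer points, where stationarity is
  available on both ground sets, and each side is an odd multiple of the previous one, as
  \<open>tiling\<close> requires.\<close>

fun scale :: "real \<Rightarrow> nat \<Rightarrow> nat \<Rightarrow> nat" where
  "scale \<kappa> M 0 = M"
| "scale \<kappa> M (Suc k) = (2 * branch \<kappa> (real (scale \<kappa> M k)) + 1) * scale \<kappa> M k"

lemma scale_ge:
  assumes "1 \<le> M" "\<And>R. real M \<le> R \<Longrightarrow> 4 \<le> R powr \<kappa>"
  shows "2 ^ k * M \<le> scale \<kappa> M k"
proof (induction k)
  case (Suc k)
  have "M \<le> scale \<kappa> M k" using Suc by (metis le_trans mult_le_mono1 mult_1 one_le_numeral one_le_power)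
  hence "4 \<le> real (scale \<kappa> M k) powr \<kappa>" using assms(2) by simp
  from branch_bounds(3)[OF this] have "2 \<le> 2 * branch \<kappa> (real (scale \<kappa> M k)) + 1" by linarith
  hence "2 * scale \<kappa> M k \<le> scale \<kappa> M (Suc k)" by (simp only: scale.simps mult_le_mono1)
  moreover have "2 ^ Suc k * M \<le> 2 * scale \<kappa> M k" using Suc by simp
  ultimately show ?case by (rule le_trans[rotated])
qed simp

lemma scale_ge_base:
  assumes "1 \<le> M" "\<And>R. real M \<le> R \<Longrightarrow> 4 \<le> R powr \<kappa>"
  shows "M \<le> scale \<kappa> M k"
  using scale_ge[OF assms, of k] by (metis le_trans mult_le_mono1 mult_1 one_le_numeral one_le_power)

lemma scale_Suc_le:
  assumes "1 \<le> M" "\<And>R. real M \<le> R \<Longrightarrow> 4 \<le> R powr \<kappa>"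
  shows "real (scale \<kappa> M (Suc k)) \<le> 2 * real (scale \<kappa> M k) powr (1 + \<kappa>)"
proof -
  define R where "R = real (scale \<kappa> M k)"
  have R: "real M \<le> R" "1 \<le> R" using scale_ge_base[OF assms, of k] assms(1) by (auto simp: R_def)
  have "real (2 * branch \<kappa> R + 1) * R \<le> 2 * R powr \<kappa> * R"
    using branch_bounds(2)[OF assms(2)[OF R(1)]] R by (intro mult_right_mono) auto
  also have "\<dots> = 2 * R powr (1 + \<kappa>)" using R by (simp add: powr_add)
  finally show ?thesis unfolding scale.simps of_nat_mult R_def[symmetric] .
qed

lemma int_vec_add: "int_vec (i + j) = int_vec i + int_vec j"
  by (simp add: int_vec_def vec_eq_iff)

lemma int_vec_scale: "int_vec (\<chi> j. int n * i $ j) = real n *\<^sub>R int_vec i"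
  by (simp add: int_vec_def vec_eq_iff)

lemma int_vec_0 [simp]: "int_vec 0 = 0"
  by (simp add: int_vec_def vec_eq_iff)

definition level_err :: "'d::finite itself \<Rightarrow> real \<Rightarrow> nat \<Rightarrow> real" where
  "level_err _ \<kappa> R = real R powr (- (real CARD('d) * \<kappa>^2 / 2))"

text \<open>A bound, through all levels, for the quenched probability that the box of side \<open>scale \<kappa> M k\<close> centred at
  \<open>int_vec j\<close> carries no large cluster, in terms of a bound \<open>g\<close> for the boxes of side \<open>M\<close>.\<close>

primrec level_bound :: "real \<Rightarrow> nat \<Rightarrow> (int^'d \<Rightarrow> real) \<Rightarrow> (real^'d) set \<Rightarrow> nat \<Rightarrow> int^'d \<Rightarrow> real" where
  "level_bound \<kappa> M g \<omega> 0 j = g j"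
| "level_bound \<kappa> M g \<omega> (Suc k) j =
     (1 + level_err TYPE('d) \<kappa> (scale \<kappa> M k)) *
       ((\<Sum>i\<in>offsets (branch \<kappa> (real (scale \<kappa> M k))). level_bound \<kappa> M g \<omega> k (j + (\<chi> l. int (scale \<kappa> M k) * i $ l)))
          / real (card (offsets (branch \<kappa> (real (scale \<kappa> M k))) :: (int^'d) set)))
     + level_err TYPE('d) \<kappa> (scale \<kappa> M k)
     + (if real (card (\<omega> \<inter> box_at (int_vec j) (real (scale \<kappa> M (Suc k)))))
          \<le> real (scale \<kappa> M (Suc k)) powr (real CARD('d) * (1 + \<kappa>)) then 0 else 1)"

lemma bounded_box_at: "bounded (box_at z R)"
proof -
  have "box_at z R \<subseteq> cbox (z - (\<chi> j. R / 2)) (z + (\<chi> j. R / 2))"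
    by (auto simp: box_at_def cube_def mem_box_cart algebra_simps less_imp_le) (smt (verit) field_sum_of_halves)+
  thus ?thesis using bounded_cbox bounded_subset by blast
qed

lemma finite_config_Int: "\<omega> \<in> configurations \<Lambda> \<Longrightarrow> bounded B \<Longrightarrow> finite (\<omega> \<inter> B)"
  unfolding configurations_def bounded_iff
  by (clarsimp, metis (no_types, lifting) Int_mono finite_subset mem_cball_0 order_refl subsetI)

context conn_prob
begin

text \<open>All boxes of the recursion share one window \<open>W\<close>, so the clusters of
  different cells belong to the same graph and can be merged. The base bound is asked for only
  inside \<open>W'\<close>, which later is the part of the window that keeps a distance from its
  boundary.\<close>

lemma pbad_level_bound:
  fixes \<omega> W :: "(real^'d) set" and g :: "int^'d \<Rightarrow> real"
  defines "D \<equiv> real CARD('d)"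
  assumes \<omega>: "\<omega> \<in> configurations \<Lambda>" and W: "bounded W"
    and M: "1 \<le> M" "\<And>R. real M \<le> R \<Longrightarrow> 4 \<le> R powr \<kappa>"
    and step: "\<And>R X z. real M \<le> R \<Longrightarrow> finite X \<Longrightarrow>
     real (card (box_at z (real (2 * branch \<kappa> R + 1) * R) \<inter> X)) \<le> (real (2 * branch \<kappa> R + 1) * R) powr (D * (1 + \<kappa>)) \<Longrightarrow>
     pbad X (box_at (z::real^'d) (real (2 * branch \<kappa> R + 1) * R)) ((real (2 * branch \<kappa> R + 1) * R) powr (D * (1 - \<kappa>)))
       \<le> (1 + R powr (- (D * \<kappa>^2 / 2))) * ((\<Sum>i\<in>offsets (branch \<kappa> R). pbad X (box_at (z + R *\<^sub>R int_vec i) R) (R powr (D * (1 - \<kappa>))))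
            / real (card (offsets (branch \<kappa> R) :: (int^'d) set))) + R powr (- (D * \<kappa>^2 / 2))"
    and base: "\<And>j. box_at (int_vec j) (real M) \<subseteq> W' \<Longrightarrow> pbad (\<omega> \<inter> W) (box_at (int_vec j) (real M)) (real M powr (D * (1 - \<kappa>))) \<le> g j"
    and g0: "\<And>j. 0 \<le> g j"
  shows "box_at (int_vec j) (real (scale \<kappa> M k)) \<subseteq> W' \<Longrightarrow>
    pbad (\<omega> \<inter> W) (box_at (int_vec j) (real (scale \<kappa> M k))) (real (scale \<kappa> M k) powr (D * (1 - \<kappa>))) \<le> level_bound \<kappa> M g \<omega> k j"
    and "0 \<le> level_bound \<kappa> M g \<omega> k j"
proof -
  have nn: "0 \<le> level_bound \<kappa> M g \<omega> k j" for k j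
    by (induction k arbitrary: j)
      (auto simp: g0 level_err_def intro!: add_nonneg_nonneg mult_nonneg_nonneg divide_nonneg_nonneg sum_nonneg)
  show "0 \<le> level_bound \<kappa> M g \<omega> k j" by (rule nn)
  show "box_at (int_vec j) (real (scale \<kappa> M k)) \<subseteq> W' \<Longrightarrow>
    pbad (\<omega> \<inter> W) (box_at (int_vec j) (real (scale \<kappa> M k))) (real (scale \<kappa> M k) powr (D * (1 - \<kappa>))) \<le> level_bound \<kappa> M g \<omega> k j"
  proof (induction k arbitrary: j)
    case 0
    thus ?case using base by simp
  next
    case (Suc k)
    define R where "R = scale \<kappa> M k"
    define C where "C = 2 * branch \<kappa> (real R) + 1"
    have R: "M \<le> R" unfolding R_def by (rule scale_ge_base[OF M])
    have S: "scale \<kappa> M (Suc k) = C * R" by (simp add: C_def R_def)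
    have CR: "real (scale \<kappa> M (Suc k)) = real C * real R" by (simp only: S of_nat_mult)
    let ?z = "int_vec j :: real^'d"
    have fX: "finite (\<omega> \<inter> W)" by (rule finite_config_Int[OF \<omega> W])
    have c: "real (card (box_at ?z (real C * real R) \<inter> (\<omega> \<inter> W))) \<le> real (card (\<omega> \<inter> box_at ?z (real C * real R)))"
      by (intro of_nat_mono card_mono finite_config_Int[OF \<omega>] bounded_box_at) auto
    show ?case
    proof (cases "real (card (\<omega> \<inter> box_at ?z (real (scale \<kappa> M (Suc k))))) \<le> real (scale \<kappa> M (Suc k)) powr (D * (1 + \<kappa>))")
      case True
      have sub: "box_at (?z + real R *\<^sub>R int_vec i) (real R) \<subseteq> W'" if "i \<in> offsets (branch \<kappa> (real R))" for i
      proof -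
        have "box_at (?z + real R *\<^sub>R int_vec i) (real R) \<subseteq> box_at ?z (real C * real R)"
          using tiling[of "real R" ?z "branch \<kappa> (real R)"] that R M(1) unfolding C_def by auto
        thus ?thesis using Suc.prems unfolding S by simp
      qed
      have "pbad (\<omega> \<inter> W) (box_at ?z (real C * real R)) ((real C * real R) powr (D * (1 - \<kappa>)))
       \<le> (1 + real R powr (- (D * \<kappa>^2 / 2))) * ((\<Sum>i\<in>offsets (branch \<kappa> (real R)). pbad (\<omega> \<inter> W) (box_at (?z + real R *\<^sub>R int_vec i) (real R)) (real R powr (D * (1 - \<kappa>))))
            / real (card (offsets (branch \<kappa> (real R)) :: (int^'d) set))) + real R powr (- (D * \<kappa>^2 / 2))"
        unfolding C_def
      proof (rule step[OF _ fX])
        show "real (card (box_at ?z (real (2 * branch \<kappa> (real R) + 1) * real R) \<inter> (\<omega> \<inter> W))) \<le> (real (2 * branch \<kappa> (real R) + 1) * real R) powr (D * (1 + \<kappa>))"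
          using c True unfolding C_def[symmetric] S of_nat_mult by linarith
      qed (use R in auto)
      also have "(\<Sum>i\<in>offsets (branch \<kappa> (real R)). pbad (\<omega> \<inter> W) (box_at (?z + real R *\<^sub>R int_vec i) (real R)) (real R powr (D * (1 - \<kappa>))))
        \<le> (\<Sum>i\<in>offsets (branch \<kappa> (real R)). level_bound \<kappa> M g \<omega> k (j + (\<chi> l. int R * i $ l)))"
      proof (rule sum_mono)
        fix i :: "int^'d" assume i: "i \<in> offsets (branch \<kappa> (real R))"
        have e: "?z + real R *\<^sub>R int_vec i = int_vec (j + (\<chi> l. int R * i $ l))"
          by (simp add: int_vec_add int_vec_scale)
        show "pbad (\<omega> \<inter> W) (box_at (?z + real R *\<^sub>R int_vec i) (real R)) (real R powr (D * (1 - \<kappa>)))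
          \<le> level_bound \<kappa> M g \<omega> k (j + (\<chi> l. int R * i $ l))"
          using Suc.IH[of "j + (\<chi> l. int R * i $ l)"] sub[OF i] unfolding e R_def[symmetric] by simp
      qed
      finally show ?thesis
        using True unfolding level_bound.simps CR R_def[symmetric]
        by (simp add: level_err_def D_def mult_left_mono divide_right_mono)
    next
      \<comment> \<open>A crowded box is not covered by \<open>step\<close>; the last summand of the
        recursion is then 1 and makes the bound trivial.\<close>
      case False
      have "pbad (\<omega> \<inter> W) (box_at ?z (real (scale \<kappa> M (Suc k)))) (real (scale \<kappa> M (Suc k)) powr (D * (1 - \<kappa>))) \<le> 1"
        by (rule pbad_le_1)
      also have "\<dots> \<le> level_bound \<kappa> M g \<omega> (Suc k) j"
      proof -
        have "0 \<le> (1 + level_err TYPE('d) \<kappa> (scale \<kappa> M k)) *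
       ((\<Sum>i\<in>offsets (branch \<kappa> (real (scale \<kappa> M k))). level_bound \<kappa> M g \<omega> k (j + (\<chi> l. int (scale \<kappa> M k) * i $ l)))
          / real (card (offsets (branch \<kappa> (real (scale \<kappa> M k))) :: (int^'d) set))) + level_err TYPE('d) \<kappa> (scale \<kappa> M k)"
          by (auto simp: level_err_def nn intro!: add_nonneg_nonneg mult_nonneg_nonneg divide_nonneg_nonneg sum_nonneg)
        thus ?thesis using False unfolding level_bound.simps D_def by simp
      qed
      finally show ?thesis .
    qed
  qed
qed

end

section \<open>Measurability of cluster events\<close>

lemma space_configs [simp]: "space (configs \<Lambda>) = configurations \<Lambda>"
  unfolding configs_def by (rule space_measure_of) auto

lemma measurable_card_Int:
  assumes "B \<in> sets borel" "bounded B"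
  shows "(\<lambda>\<omega>. card (\<omega> \<inter> B)) \<in> measurable (configs \<Lambda>) (count_space UNIV)"
proof (subst measurable_count_space_eq2_countable)
  have "(\<lambda>\<omega>. card (\<omega> \<inter> B)) -` {k} \<inter> configurations \<Lambda> \<in> sets (configs \<Lambda>)" for k
  proof -
    have "(\<lambda>\<omega>. card (\<omega> \<inter> B)) -` {k} \<inter> configurations \<Lambda> = {\<omega> \<in> configurations \<Lambda>. card (\<omega> \<inter> B) = k}" by auto
    thus ?thesis unfolding configs_def using assms by (auto intro!: in_measure_of)
  qed
  thus "(\<lambda>\<omega>. card (\<omega> \<inter> B)) \<in> space (configs \<Lambda>) \<rightarrow> UNIV \<and>
    (\<forall>k\<in>UNIV. (\<lambda>\<omega>. card (\<omega> \<inter> B)) -` {k} \<inter> space (configs \<Lambda>) \<in> sets (configs \<Lambda>))"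
    by simp
qed

text \<open>Extended from rectangles by induction over disjoint unions. Counting with
  \<open>emeasure\<close> instead of \<open>card\<close> keeps countable sums available, and
  finiteness of the count in the bounded set \<open>B\<close> allows complements to be treated by
  subtraction.\<close>

lemma measurable_count_points_aux:
  assumes f: "f \<in> measurable M (configs \<Lambda>)" and B: "B \<in> sets borel" "bounded B"
    and D: "D \<in> sets (borel \<Otimes>\<^sub>M M)"
  shows "(\<lambda>z. emeasure (count_space UNIV) {x\<in>f z \<inter> B. (x, z) \<in> D}) \<in> borel_measurable M"
proof -
  have fin: "finite (f z \<inter> B)" if "z \<in> space M" for z
    using measurable_space[OF f that] finite_config_Int[OF _ B(2)] by simp
  have finS: "finite {x\<in>f z \<inter> B. Q x}" if "z \<in> space M" for z Q
    using fin[OF that] by (rule rev_finite_subset) auto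
  have rect: "(\<lambda>z. emeasure (count_space UNIV) (f z \<inter> (B \<inter> A))) \<in> borel_measurable M" if A: "A \<in> sets borel" for A
  proof -
    have m: "(\<lambda>z. card (f z \<inter> (B \<inter> A))) \<in> measurable M (count_space UNIV)"
      using A B by (intro measurable_compose[OF f measurable_card_Int]) (auto intro: bounded_subset)
    have "(\<lambda>z. emeasure (count_space UNIV) (f z \<inter> (B \<inter> A))) \<in> borel_measurable M \<longleftrightarrow>
      (\<lambda>z. of_nat (card (f z \<inter> (B \<inter> A))) :: ennreal) \<in> borel_measurable M"
    proof (rule measurable_cong)
      fix z assume "z \<in> space M"
      hence "finite (f z \<inter> (B \<inter> A))" using fin by (auto intro: finite_subset[rotated])
      thus "emeasure (count_space UNIV) (f z \<inter> (B \<inter> A)) = of_nat (card (f z \<inter> (B \<inter> A)))" by simp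
    qed
    also have "\<dots>" using m by measurable
    finally show ?thesis .
  qed
  have D': "D \<in> sigma_sets (space borel \<times> space M) {a \<times> b | a b. a \<in> sets borel \<and> b \<in> sets M}"
    using D by (simp add: sets_pair_measure)
  show ?thesis
    using Int_stable_pair_measure_generator pair_measure_closed D'
  proof (induction D rule: sigma_sets_induct_disjoint)
    case (basic D)
    then obtain A C where AC: "D = A \<times> C" "A \<in> sets borel" "C \<in> sets M" by auto
    have eq: "emeasure (count_space UNIV) {x\<in>f z \<inter> B. (x, z) \<in> D} = indicator C z * emeasure (count_space UNIV) (f z \<inter> (B \<inter> A))" for z
      by (cases "z \<in> C") (auto simp: AC intro!: arg_cong[where f = "emeasure (count_space UNIV)"])
    show ?case unfolding eq using rect[OF AC(2)] AC(3) by measurable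
  next
    case empty
    show ?case by simp
  next
    case (compl D)
    have "(\<lambda>z. emeasure (count_space UNIV) {x\<in>f z \<inter> B. (x, z) \<in> space borel \<times> space M - D}) \<in> borel_measurable M \<longleftrightarrow>
      (\<lambda>z. emeasure (count_space UNIV) (f z \<inter> (B \<inter> UNIV)) - emeasure (count_space UNIV) {x\<in>f z \<inter> B. (x, z) \<in> D}) \<in> borel_measurable M"
    proof (rule measurable_cong)
      fix z assume z: "z \<in> space M"
      have "{x\<in>f z \<inter> B. (x, z) \<in> space borel \<times> space M - D} = f z \<inter> (B \<inter> UNIV) - {x\<in>f z \<inter> B. (x, z) \<in> D}"
        using z by auto
      thus "emeasure (count_space UNIV) {x\<in>f z \<inter> B. (x, z) \<in> space borel \<times> space M - D}
        = emeasure (count_space UNIV) (f z \<inter> (B \<inter> UNIV)) - emeasure (count_space UNIV) {x\<in>f z \<inter> B. (x, z) \<in> D}"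
        using finS[OF z, of "\<lambda>x. (x, z) \<in> D"] by (simp only:) (rule emeasure_Diff, auto)
    qed
    thus ?case using compl rect[of UNIV] by simp
  next
    case (union D)
    have "(\<lambda>z. emeasure (count_space UNIV) {x\<in>f z \<inter> B. (x, z) \<in> (\<Union>i. D i)})
      = (\<lambda>z. \<Sum>i. emeasure (count_space UNIV) {x\<in>f z \<inter> B. (x, z) \<in> D i})"
    proof
      fix z
      have "{x\<in>f z \<inter> B. (x, z) \<in> (\<Union>i. D i)} = (\<Union>i. {x\<in>f z \<inter> B. (x, z) \<in> D i})" by auto
      moreover have "disjoint_family (\<lambda>i. {x\<in>f z \<inter> B. (x, z) \<in> D i})"
        using union(1) by (auto simp: disjoint_family_on_def)
      ultimately show "emeasure (count_space UNIV) {x\<in>f z \<inter> B. (x, z) \<in> (\<Union>i. D i)}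
        = (\<Sum>i. emeasure (count_space UNIV) {x\<in>f z \<inter> B. (x, z) \<in> D i})"
        by (simp add: suminf_emeasure)
    qed
    thus ?case using union by simp
  qed
qed

lemma measurable_count_points:
  assumes f: "f \<in> measurable M (configs \<Lambda>)" and B: "B \<in> sets borel" "bounded B"
    and \<Phi>: "Measurable.pred (borel \<Otimes>\<^sub>M M) (\<lambda>(x, z). \<Phi> x z)"
  shows "(\<lambda>z. card {x\<in>f z \<inter> B. \<Phi> x z}) \<in> measurable M (count_space UNIV)"
proof -
  define D where "D = {w\<in>space (borel \<Otimes>\<^sub>M M). \<Phi> (fst w) (snd w)}"
  have "D \<in> sets (borel \<Otimes>\<^sub>M M)" using \<Phi> by (simp add: D_def pred_def case_prod_unfold)
  from measurable_count_points_aux[OF f B this]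
  have [measurable]: "(\<lambda>z. emeasure (count_space UNIV) {x\<in>f z \<inter> B. (x, z) \<in> D}) \<in> borel_measurable M" .
  have eq: "{z\<in>space M. card {x\<in>f z \<inter> B. \<Phi> x z} = n}
    = {z\<in>space M. emeasure (count_space UNIV) {x\<in>f z \<inter> B. (x, z) \<in> D} = of_nat n}" for n
  proof (rule Collect_cong, rule conj_cong[OF refl])
    fix z assume z: "z \<in> space M"
    have "finite (f z \<inter> B)" using measurable_space[OF f z] finite_config_Int[OF _ B(2)] by simp
    hence "finite {x\<in>f z \<inter> B. \<Phi> x z}" by (rule rev_finite_subset) auto
    moreover have "{x\<in>f z \<inter> B. (x, z) \<in> D} = {x\<in>f z \<inter> B. \<Phi> x z}"
      using z by (auto simp: D_def space_pair_measure)
    ultimately show "(card {x\<in>f z \<inter> B. \<Phi> x z} = n) = (emeasure (count_space UNIV) {x\<in>f z \<inter> B. (x, z) \<in> D} = of_nat n)"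
      by simp
  qed
  show ?thesis
  proof (subst measurable_count_space_eq2_countable)
    have "(\<lambda>z. card {x\<in>f z \<inter> B. \<Phi> x z}) -` {n} \<inter> space M \<in> sets M" for n
    proof -
      have "(\<lambda>z. card {x\<in>f z \<inter> B. \<Phi> x z}) -` {n} \<inter> space M = {z\<in>space M. card {x\<in>f z \<inter> B. \<Phi> x z} = n}" by auto
      also have "\<dots> \<in> sets M" unfolding eq by measurable
      finally show ?thesis .
    qed
    thus "(\<lambda>z. card {x\<in>f z \<inter> B. \<Phi> x z}) \<in> space M \<rightarrow> UNIV \<and>
      (\<forall>n\<in>UNIV. (\<lambda>z. card {x\<in>f z \<inter> B. \<Phi> x z}) -` {n} \<inter> space M \<in> sets M)" by simp
  qed
qed

text \<open>An existential quantifier over random points is not a union over a fixed countable index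
  set. It becomes one by counting the points with the property in balls of integer radius; nested
  uses of this lemma give the path events.\<close>

lemma pred_bex_points:
  assumes f: "f \<in> measurable M (configs \<Lambda>)" and \<Phi>: "Measurable.pred (borel \<Otimes>\<^sub>M M) (\<lambda>(x, z). \<Phi> x z)"
  shows "Measurable.pred M (\<lambda>z. \<exists>x\<in>f z. \<Phi> x z)"
proof -
  define c where "c = (\<lambda>(k::nat) z. card {x\<in>f z \<inter> cball 0 (real k). \<Phi> x z})"
  have [measurable]: "c k \<in> measurable M (count_space UNIV)" for k :: nat
    unfolding c_def by (rule measurable_count_points[OF f _ _ \<Phi>]) auto
  have "(\<exists>x\<in>f z. \<Phi> x z) \<longleftrightarrow> (\<exists>k::nat. 0 < card {x\<in>f z \<inter> cball 0 (real k). \<Phi> x z})" if z: "z \<in> space M" for z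
  proof
    assume "\<exists>x\<in>f z. \<Phi> x z"
    then obtain x where x: "x \<in> f z" "\<Phi> x z" by auto
    obtain k :: nat where "norm x \<le> real k" using real_arch_simple by blast
    hence "x \<in> {x\<in>f z \<inter> cball 0 (real k). \<Phi> x z}" using x by simp
    moreover have "finite (f z \<inter> cball 0 (real k))"
      using measurable_space[OF f z] finite_config_Int by (metis bounded_cball space_configs)
    ultimately have "0 < card {x\<in>f z \<inter> cball 0 (real k). \<Phi> x z}"
      by (subst card_gt_0_iff) (auto intro: rev_finite_subset)
    thus "\<exists>k::nat. 0 < card {x\<in>f z \<inter> cball 0 (real k). \<Phi> x z}" ..
  next
    assume "\<exists>k::nat. 0 < card {x\<in>f z \<inter> cball 0 (real k). \<Phi> x z}"
    thus "\<exists>x\<in>f z. \<Phi> x z" by (auto simp: card_gt_0_iff)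
  qed
  moreover have "Measurable.pred M (\<lambda>z. \<exists>k::nat. 0 < c k z)" unfolding c_def[symmetric] by measurable
  ultimately show ?thesis unfolding c_def by (subst measurable_cong) auto
qed

section \<open>Ranks of points\<close>

lemma precedes_norm: "precedes x y \<Longrightarrow> norm x \<le> norm y"
  by (auto simp: precedes_def)

lemma pred_precedes [measurable]:
  "Measurable.pred (borel \<Otimes>\<^sub>M borel) (\<lambda>(y :: real^'d, x). precedes y x)"
proof -
  have [measurable]: "(\<lambda>w :: (real^'d) \<times> (real^'d). fst w $ i) \<in> borel_measurable (borel \<Otimes>\<^sub>M borel)"
    "(\<lambda>w :: (real^'d) \<times> (real^'d). snd w $ i) \<in> borel_measurable (borel \<Otimes>\<^sub>M borel)" for i
    by (auto intro!: measurable_compose[OF measurable_fst] measurable_compose[OF measurable_snd] borel_measurable_nth)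
  show ?thesis unfolding precedes_def case_prod_unfold by measurable
qed

lemma measurable_point_rank:
  assumes f: "f \<in> measurable M (configs (\<Lambda> :: (real^'d) set))"
  shows "(\<lambda>(x, z). point_rank (f z) x) \<in> measurable (borel \<Otimes>\<^sub>M M) (count_space UNIV)"
proof -
  have f': "(\<lambda>w. f (snd w)) \<in> measurable (borel \<Otimes>\<^sub>M M :: ((real^'d) \<times> _) measure) (configs \<Lambda>)"
    using f by measurable
  have p: "Measurable.pred (borel \<Otimes>\<^sub>M (borel \<Otimes>\<^sub>M M)) (\<lambda>(y, w). precedes y (fst w :: real^'d))"
    using measurable_compose[of "\<lambda>(y, w). (y, fst w)" "borel \<Otimes>\<^sub>M (borel \<Otimes>\<^sub>M M)" "borel \<Otimes>\<^sub>M borel" _ "count_space UNIV", OF _ pred_precedes]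
    by (simp add: case_prod_unfold)
  define c where "c = (\<lambda>(k::nat) w. card {y\<in>f (snd w) \<inter> cball 0 (real k). precedes y (fst w)})"
  have [measurable]: "c k \<in> measurable (borel \<Otimes>\<^sub>M M) (count_space UNIV)" for k :: nat
    unfolding c_def by (rule measurable_count_points[OF f' _ _ p]) auto
  have eq: "point_rank (f (snd w)) (fst w) = n \<longleftrightarrow> (\<exists>k::nat. norm (fst w) \<le> real k \<and> c k w = n)" for w n
  proof -
    have r: "point_rank (f (snd w)) (fst w) = c k w" if "norm (fst w) \<le> real k" for k :: nat
      unfolding point_rank_def c_def using precedes_norm[of _ "fst w"] that
      by (intro arg_cong[where f = card]) (auto intro: order_trans)
    obtain k0 :: nat where k0: "norm (fst w) \<le> real k0" using real_arch_simple by blast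
    show ?thesis
    proof
      assume "point_rank (f (snd w)) (fst w) = n"
      thus "\<exists>k::nat. norm (fst w) \<le> real k \<and> c k w = n"
        using k0 r[OF k0] by (intro exI[of _ k0]) simp
    next
      assume "\<exists>k::nat. norm (fst w) \<le> real k \<and> c k w = n"
      then obtain k where "norm (fst w) \<le> real k" "c k w = n" by blast
      thus "point_rank (f (snd w)) (fst w) = n" using r[of k] by simp
    qed
  qed
  show ?thesis
  proof (subst measurable_count_space_eq2_countable)
    have "{w\<in>space (borel \<Otimes>\<^sub>M M). point_rank (f (snd w)) (fst w) = n} \<in> sets (borel \<Otimes>\<^sub>M M)" for n
      unfolding eq by measurable
    moreover have "(\<lambda>(x, z). point_rank (f z) x) -` {n} \<inter> space (borel \<Otimes>\<^sub>M M) = {w\<in>space (borel \<Otimes>\<^sub>M M). point_rank (f (snd w)) (fst w) = n}" for n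
      by auto
    ultimately show "(\<lambda>(x, z). point_rank (f z) x) \<in> space (borel \<Otimes>\<^sub>M M) \<rightarrow> UNIV \<and>
      (\<forall>n\<in>UNIV. (\<lambda>(x, z). point_rank (f z) x) -` {n} \<inter> space (borel \<Otimes>\<^sub>M M) \<in> sets (borel \<Otimes>\<^sub>M M))" by simp
  qed
qed

section \<open>Cluster events on the realisation space\<close>

abbreviation vmarks :: "(nat \<Rightarrow> real) measure" where
  "vmarks \<equiv> Pi\<^sub>M UNIV (\<lambda>_. uniform01)"

abbreviation emarks :: "(nat set \<Rightarrow> real) measure" where
  "emarks \<equiv> Pi\<^sub>M {e. card e = 2} (\<lambda>_. uniform01)"

text \<open>The space of realisations before completion, on which product formulas are available.
  The completion returns only when clusters are compared with
  \<open>percolation_graph\<close>.\<close>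

definition rspace :: "(real^'d) set measure \<Rightarrow> 'd realisation measure" where
  "rspace P = P \<Otimes>\<^sub>M vmarks \<Otimes>\<^sub>M emarks"

definition umark :: "'d realisation \<Rightarrow> real^'d \<Rightarrow> real" where
  "umark z x = fst (snd z) (point_rank (fst z) x)"

definition emark :: "'d realisation \<Rightarrow> (real^'d) set \<Rightarrow> real" where
  "emark z e = snd (snd z) (point_rank (fst z) ` e)"

definition rstat :: "(real \<Rightarrow> real \<Rightarrow> real \<Rightarrow> real) \<Rightarrow> 'd realisation \<Rightarrow> (real^'d) set \<Rightarrow> bool" where
  "rstat \<rho> z = stat \<rho> (umark z) (emark z)"

lemma rtrancl_bounded_relpow: "(x, y) \<in> R\<^sup>* \<longleftrightarrow> (\<exists>n. (x, y) \<in> R ^^ n)"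
  by (simp add: rtrancl_is_UN_relpow)

lemma precedes_total:
  fixes x y :: "real^'d"
  assumes "x \<noteq> y" shows "precedes x y \<or> precedes y x"
proof (cases "norm x = norm y")
  case True
  define S where "S = {i. x $ i \<noteq> y $ i}"
  have "S \<noteq> {}" using assms by (auto simp: S_def vec_eq_iff)
  then obtain i where i: "i \<in> S" "\<And>j. j \<in> S \<Longrightarrow> to_nat i \<le> to_nat j"
    using ex_has_least_nat[of "\<lambda>i. i \<in> S" _ to_nat] by blast
  have "x $ j = y $ j" if "to_nat j < to_nat i" for j using i(2)[of j] that by (auto simp: S_def)
  thus ?thesis using True i(1) by (auto simp: precedes_def S_def neq_iff)
qed (auto simp: precedes_def)

lemma precedes_irrefl: "\<not> precedes x x"
  by (simp add: precedes_def)

lemma precedes_trans: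
  assumes "precedes x y" "precedes y z" shows "precedes x z"
proof (cases "norm x < norm y \<or> norm y < norm z")
  case True
  thus ?thesis using precedes_norm[OF assms(1)] precedes_norm[OF assms(2)] by (auto simp: precedes_def)
next
  case False
  then obtain i i' where i: "norm x = norm y" "x $ i < y $ i" "\<forall>j. to_nat j < to_nat i \<longrightarrow> x $ j = y $ j"
    "norm y = norm z" "y $ i' < z $ i'" "\<forall>j. to_nat j < to_nat i' \<longrightarrow> y $ j = z $ j"
    using assms by (auto simp: precedes_def)
  consider "i = i'" | "to_nat i < to_nat i'" | "to_nat i' < to_nat i"
    by (metis linorder_less_linear to_nat_split)
  thus ?thesis
  proof cases
    case 1
    thus ?thesis using i by (auto simp: precedes_def intro!: exI[of _ i])
  next
    case 2
    hence "y $ i = z $ i" "\<forall>j. to_nat j < to_nat i \<longrightarrow> x $ j = z $ j" using i by auto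
    thus ?thesis using i by (auto simp: precedes_def intro!: exI[of _ i])
  next
    case 3
    hence "x $ i' = y $ i'" "\<forall>j. to_nat j < to_nat i' \<longrightarrow> x $ j = z $ j" using i by auto
    thus ?thesis using i by (auto simp: precedes_def intro!: exI[of _ i'])
  qed
qed

lemma finite_preceding:
  assumes "\<omega> \<in> configurations \<Lambda>" shows "finite {y\<in>\<omega>. precedes y x}"
proof -
  have "finite (\<omega> \<inter> cball 0 (norm x))" using assms by (simp add: configurations_def)
  thus ?thesis by (rule rev_finite_subset) (auto dest: precedes_norm)
qed

lemma point_rank_less:
  assumes \<omega>: "\<omega> \<in> configurations \<Lambda>" and "x \<in> \<omega>" "precedes x y"
  shows "point_rank \<omega> x < point_rank \<omega> y"
  unfolding point_rank_def
proof (rule psubset_card_mono[OF finite_preceding[OF \<omega>]])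
  show "{y \<in> \<omega>. precedes y x} \<subset> {z \<in> \<omega>. precedes z y}"
    using assms precedes_trans precedes_irrefl by blast
qed

lemma inj_on_point_rank:
  assumes "\<omega> \<in> configurations \<Lambda>" shows "inj_on (point_rank \<omega>) \<omega>"
proof (rule inj_onI, rule ccontr)
  fix x y assume xy: "x \<in> \<omega>" "y \<in> \<omega>" "point_rank \<omega> x = point_rank \<omega> y" "x \<noteq> y"
  thus False using precedes_total[OF xy(4)] point_rank_less[OF assms] by (metis less_irrefl)
qed

lemma cluster_image:
  assumes f: "inj_on f X" and b: "\<And>e. e \<in> pairs X \<Longrightarrow> b' (f ` e) = b e" and x: "x \<in> X"
  shows "cluster b' (f ` X) (f x) = f ` cluster b X x"
proof -
  have l: "linked b' (f ` X) = (\<lambda>(x, y). (f x, f y)) ` linked b X"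
  proof (intro set_eqI iffI)
    fix p assume "p \<in> linked b' (f ` X)"
    then obtain x y where xy: "p = (f x, f y)" "x \<in> X" "y \<in> X" "f x \<noteq> f y" "b' {f x, f y}"
      by (auto simp: linked_def)
    hence "x \<noteq> y" by auto
    hence "b {x, y}" using b[of "{x, y}"] xy by (simp add: pairs_iff)
    thus "p \<in> (\<lambda>(x, y). (f x, f y)) ` linked b X" using xy \<open>x \<noteq> y\<close> by (force simp: linked_def)
  next
    fix p assume "p \<in> (\<lambda>(x, y). (f x, f y)) ` linked b X"
    then obtain x y where xy: "p = (f x, f y)" "x \<in> X" "y \<in> X" "x \<noteq> y" "b {x, y}"
      by (auto simp: linked_def)
    hence "b' {f x, f y}" using b[of "{x, y}"] by (simp add: pairs_iff)
    moreover have "f x \<noteq> f y" using f xy by (auto dest: inj_onD)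
    ultimately show "p \<in> linked b' (f ` X)" using xy by (auto simp: linked_def)
  qed
  have 1: "y \<in> X \<and> (f x, f y) \<in> (linked b' (f ` X))\<^sup>*" if "(x, y) \<in> (linked b X)\<^sup>*" for y
    using that
  proof (induction rule: rtrancl_induct)
    case (step y w)
    hence "(f y, f w) \<in> linked b' (f ` X)" unfolding l by force
    thus ?case using step by (auto simp: linked_def intro: rtrancl_into_rtrancl)
  qed (use x in auto)
  have 2: "\<exists>y. w = f y \<and> (x, y) \<in> (linked b X)\<^sup>*" if "(f x, w) \<in> (linked b' (f ` X))\<^sup>*" for w
    using that
  proof (induction rule: rtrancl_induct)
    case (step w w')
    then obtain y where y: "w = f y" "(x, y) \<in> (linked b X)\<^sup>*" by auto
    obtain y' y'' where y': "w = f y'" "w' = f y''" "(y', y'') \<in> linked b X" using step(2) unfolding l by auto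
    have "y' \<in> X" using y'(3) by (auto simp: linked_def)
    hence "y' = y" using f y y' 1[OF y(2)] by (metis inj_onD)
    thus ?case using y y' by (auto intro: rtrancl_into_rtrancl)
  qed auto
  show ?thesis unfolding cluster_def using 1 2 by blast
qed

lemma pred_eq_borel:
  fixes f g :: "'a \<Rightarrow> 'b::{second_countable_topology, t2_space}"
  assumes "f \<in> borel_measurable M" "g \<in> borel_measurable M"
  shows "Measurable.pred M (\<lambda>x. f x = g x)"
  unfolding pred_def by (rule measurable_equality_set[OF assms])

locale conn_process = conn_prob +
  fixes \<Lambda> :: "(real^'d) set" and P :: "(real^'d) set measure"
  assumes sets_P: "sets P = sets (configs \<Lambda>)" and prob_P: "prob_space P"
begin

sublocale P: prob_space P by (rule prob_P)

lemma space_P: "space P = configurations \<Lambda>"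
  using sets_eq_imp_space_eq[OF sets_P] by simp

lemma space_rspace: "space (rspace P) = configurations \<Lambda> \<times> (UNIV \<rightarrow>\<^sub>E UNIV) \<times> ({e. card e = 2} \<rightarrow>\<^sub>E UNIV)"
  by (simp add: rspace_def space_pair_measure space_P space_PiM)

lemma fst_measurable [measurable]: "fst \<in> measurable (rspace P) (configs \<Lambda>)"
proof -
  have "fst \<in> measurable (rspace P) P" unfolding rspace_def by measurable
  thus ?thesis using sets_P by (simp cong: measurable_cong_sets)
qed

lemma config_of: "z \<in> space (rspace P) \<Longrightarrow> fst z \<in> configurations \<Lambda>"
  by (auto simp: space_rspace)

abbreviation (input) "R \<equiv> rspace P"

lemma measurable_rank [measurable]:
  "(\<lambda>w. point_rank (fst (snd w)) (fst w)) \<in> measurable (borel \<Otimes>\<^sub>M R) (count_space UNIV)"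
  using measurable_point_rank[OF fst_measurable] by (simp add: case_prod_unfold)

lemma measurable_umark: "(\<lambda>w. umark (snd w) (fst w)) \<in> borel_measurable (borel \<Otimes>\<^sub>M R)"
proof -
  have "(\<lambda>w. fst (snd (snd w)) i) \<in> borel_measurable (borel \<Otimes>\<^sub>M R)" for i
    unfolding rspace_def by measurable
  thus ?thesis unfolding umark_def by (rule measurable_compose_countable) measurable
qed

lemma pred_member: "Measurable.pred (borel \<Otimes>\<^sub>M R) (\<lambda>w. fst w \<in> fst (snd w))"
proof -
  have "Measurable.pred (borel \<Otimes>\<^sub>M R) (\<lambda>w. \<exists>y\<in>fst (snd w). y = fst w)"
  proof (rule pred_bex_points)
    show "Measurable.pred (borel \<Otimes>\<^sub>M (borel \<Otimes>\<^sub>M R)) (\<lambda>(y :: real^'d, w). y = fst w)"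
      unfolding case_prod_unfold by (rule pred_eq_borel) measurable
  qed measurable
  thus ?thesis by simp
qed

lemma rstat_pair:
  assumes "\<omega> \<in> configurations \<Lambda>" "x \<noteq> y"
  shows "rstat \<rho> (\<omega>, \<xi>) {x, y} \<longleftrightarrow> snd \<xi> {point_rank \<omega> x, point_rank \<omega> y} \<le> \<rho> (umark (\<omega>, \<xi>) x) (umark (\<omega>, \<xi>) y) (dist x y)"
  by (simp add: rstat_def stat_pair[OF assms(2)] emark_def)

lemma pred_link:
  assumes [measurable]: "W \<in> sets borel"
  shows "Measurable.pred (borel \<Otimes>\<^sub>M (borel \<Otimes>\<^sub>M R))
    (\<lambda>w. (fst (snd w), fst w) \<in> linked (rstat \<rho> (snd (snd w))) (fst (snd (snd w)) \<inter> W))"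
proof -
  define ei where "ei = (\<lambda>(w :: (real^'d) \<times> (real^'d) \<times> 'd realisation) i j. snd (snd (snd (snd w))) {i, j :: nat})"
  \<comment> \<open>Edge marks are coordinates only for two-element indices, so
    \<open>i \<noteq> j\<close> is kept in the event. For points of the configuration this is the
    same as \<open>x \<noteq> y\<close>, since the rank is injective. The random index is then
    resolved by splitting over its countably many values.\<close>
  have ei: "Measurable.pred (borel \<Otimes>\<^sub>M (borel \<Otimes>\<^sub>M R)) (\<lambda>w. i \<noteq> j \<and> ei w i j \<le> f w)"
    if [measurable]: "f \<in> borel_measurable (borel \<Otimes>\<^sub>M (borel \<Otimes>\<^sub>M R))" for i j f
  proof (cases "i = j")
    case False
    hence [measurable]: "{i, j} \<in> {e. card e = 2}" by simp
    show ?thesis using that unfolding ei_def rspace_def by measurable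
  qed simp
  have r1: "(\<lambda>w. point_rank (fst (snd (snd w))) (fst w)) \<in> measurable (borel \<Otimes>\<^sub>M (borel \<Otimes>\<^sub>M R)) (count_space UNIV)"
    by (rule measurable_compose[OF _ measurable_rank, of "\<lambda>w. (fst w, snd (snd w))", simplified]) measurable
  have r2: "(\<lambda>w. point_rank (fst (snd (snd w))) (fst (snd w))) \<in> measurable (borel \<Otimes>\<^sub>M (borel \<Otimes>\<^sub>M R)) (count_space UNIV)"
    by (rule measurable_compose[OF _ measurable_rank, of snd, simplified]) measurable
  have [measurable]: "Measurable.pred (borel \<Otimes>\<^sub>M (borel \<Otimes>\<^sub>M R)) (\<lambda>w. fst w \<in> fst (snd (snd w)))"
    by (rule measurable_compose[OF _ pred_member, of "\<lambda>w. (fst w, snd (snd w))", simplified]) measurable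
  have [measurable]: "Measurable.pred (borel \<Otimes>\<^sub>M (borel \<Otimes>\<^sub>M R)) (\<lambda>w. fst (snd w) \<in> fst (snd (snd w)))"
    by (rule measurable_compose[OF _ pred_member, of snd, simplified]) measurable
  have [measurable]: "(\<lambda>w. umark (snd (snd w)) (fst w)) \<in> borel_measurable (borel \<Otimes>\<^sub>M (borel \<Otimes>\<^sub>M R))"
    by (rule measurable_compose[OF _ measurable_umark, of "\<lambda>w. (fst w, snd (snd w))", simplified]) measurable
  have [measurable]: "(\<lambda>w. umark (snd (snd w)) (fst (snd w))) \<in> borel_measurable (borel \<Otimes>\<^sub>M (borel \<Otimes>\<^sub>M R))"
    by (rule measurable_compose[OF _ measurable_umark, of snd, simplified]) measurable
  define pr where "pr = (\<lambda>w. \<rho> (umark (snd (snd w)) (fst (snd w))) (umark (snd (snd w)) (fst w)) (dist (fst (snd w)) (fst w :: real^'d)))"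
  have prm: "pr \<in> borel_measurable (borel \<Otimes>\<^sub>M (borel \<Otimes>\<^sub>M R))" unfolding pr_def by measurable
  have [measurable]: "Measurable.pred (borel \<Otimes>\<^sub>M (borel \<Otimes>\<^sub>M R)) (\<lambda>w. point_rank (fst (snd (snd w))) (fst (snd w)) \<noteq> point_rank (fst (snd (snd w))) (fst w) \<and>
     ei w (point_rank (fst (snd (snd w))) (fst (snd w))) (point_rank (fst (snd (snd w))) (fst w)) \<le> pr w)"
    by (rule measurable_compose_countable[OF _ r1], rule measurable_compose_countable[OF _ r2], rule ei[OF prm])
  have "(fst (snd w), fst w) \<in> linked (rstat \<rho> (snd (snd w))) (fst (snd (snd w)) \<inter> W) \<longleftrightarrow>
     fst w \<in> W \<and> fst (snd w) \<in> W \<and> fst w \<in> fst (snd (snd w)) \<and> fst (snd w) \<in> fst (snd (snd w)) \<and>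
     point_rank (fst (snd (snd w))) (fst (snd w)) \<noteq> point_rank (fst (snd (snd w))) (fst w) \<and>
     ei w (point_rank (fst (snd (snd w))) (fst (snd w))) (point_rank (fst (snd (snd w))) (fst w)) \<le> pr w"
    if w: "w \<in> space (borel \<Otimes>\<^sub>M (borel \<Otimes>\<^sub>M R))" for w
  proof -
    obtain y x \<omega> \<xi> where e: "w = (y, x, \<omega>, \<xi>)" by (metis prod.collapse)
    have \<omega>: "\<omega> \<in> configurations \<Lambda>" using w by (simp add: e space_pair_measure space_rspace)
    have inj: "x \<in> \<omega> \<Longrightarrow> y \<in> \<omega> \<Longrightarrow> point_rank \<omega> x = point_rank \<omega> y \<longleftrightarrow> x = y"
      using inj_on_point_rank[OF \<omega>] by (auto dest: inj_onD)
    have "(x, y) \<in> linked (rstat \<rho> (\<omega>, \<xi>)) (\<omega> \<inter> W) \<longleftrightarrow> y \<in> W \<and> x \<in> W \<and> y \<in> \<omega> \<and> x \<in> \<omega> \<and>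
      point_rank \<omega> x \<noteq> point_rank \<omega> y \<and> snd \<xi> {point_rank \<omega> x, point_rank \<omega> y} \<le> \<rho> (umark (\<omega>, \<xi>) x) (umark (\<omega>, \<xi>) y) (dist x y)"
      using inj rstat_pair[OF \<omega>, of x y \<xi>] by (auto simp: linked_def)
    thus ?thesis by (simp add: e ei_def pr_def)
  qed
  thus ?thesis by (subst measurable_cong) measurable
qed

text \<open>Paths of length \<open>n\<close>, extended by one intermediate point with
  \<open>pred_bex_points\<close>. Connection by any path is the countable union over
  \<open>n\<close>.\<close>

lemma pred_relpow:
  assumes W: "W \<in> sets borel"
  shows "Measurable.pred (borel \<Otimes>\<^sub>M (borel \<Otimes>\<^sub>M R))
    (\<lambda>w. (fst (snd w), fst w) \<in> linked (rstat \<rho> (snd (snd w))) (fst (snd (snd w)) \<inter> W) ^^ n)"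
proof (induction n)
  case (Suc n)
  let ?L = "\<lambda>z. linked (rstat \<rho> z) (fst z \<inter> W)"
  have "Measurable.pred (borel \<Otimes>\<^sub>M (borel \<Otimes>\<^sub>M R))
    (\<lambda>w. \<exists>x'\<in>fst (snd (snd w)). (fst (snd w), x') \<in> ?L (snd (snd w)) ^^ n \<and> (x', fst w) \<in> ?L (snd (snd w)))"
  proof (rule pred_bex_points)
    have "Measurable.pred (borel \<Otimes>\<^sub>M (borel \<Otimes>\<^sub>M (borel \<Otimes>\<^sub>M R))) (\<lambda>q. (fst (snd (snd q)), fst q) \<in> ?L (snd (snd (snd q))) ^^ n)"
      by (rule measurable_compose[OF _ Suc, of "\<lambda>q. (fst q, snd (snd q))", simplified]) measurable
    moreover have "Measurable.pred (borel \<Otimes>\<^sub>M (borel \<Otimes>\<^sub>M (borel \<Otimes>\<^sub>M R))) (\<lambda>q. (fst q, fst (snd q)) \<in> ?L (snd (snd (snd q))))"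
      by (rule measurable_compose[OF _ pred_link[OF W], of "\<lambda>q. (fst (snd q), fst q, snd (snd (snd q)))", simplified]) measurable
    ultimately show "Measurable.pred (borel \<Otimes>\<^sub>M (borel \<Otimes>\<^sub>M (borel \<Otimes>\<^sub>M R)))
      (\<lambda>(x', w). (fst (snd w), x') \<in> ?L (snd (snd w)) ^^ n \<and> (x', fst w) \<in> ?L (snd (snd w)))"
      unfolding case_prod_unfold by (rule pred_intros_logic)
  qed measurable
  also have "(\<lambda>w. \<exists>x'\<in>fst (snd (snd w)). (fst (snd w), x') \<in> ?L (snd (snd w)) ^^ n \<and> (x', fst w) \<in> ?L (snd (snd w)))
    = (\<lambda>w. (fst (snd w), fst w) \<in> ?L (snd (snd w)) ^^ Suc n)"
    by (auto simp: fun_eq_iff linked_def relcomp_unfold)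
  finally show ?case .
next
  case 0
  have "Measurable.pred (borel \<Otimes>\<^sub>M (borel \<Otimes>\<^sub>M R)) (\<lambda>w. fst (snd w) = (fst w :: real^'d))"
    by (rule pred_eq_borel) measurable
  thus ?case by simp
qed

lemma pred_cluster:
  assumes W: "W \<in> sets borel"
  shows "Measurable.pred (borel \<Otimes>\<^sub>M (borel \<Otimes>\<^sub>M R))
    (\<lambda>(y, w). y \<in> cluster (rstat \<rho> (snd w)) (fst (snd w) \<inter> W) (fst w))"
proof -
  have "Measurable.pred (borel \<Otimes>\<^sub>M (borel \<Otimes>\<^sub>M R))
    (\<lambda>w. \<exists>n. (fst (snd w), fst w) \<in> linked (rstat \<rho> (snd (snd w))) (fst (snd (snd w)) \<inter> W) ^^ n)"
    using pred_relpow[OF W] by measurable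
  thus ?thesis by (simp add: cluster_def case_prod_unfold rtrancl_bounded_relpow)
qed

lemma pred_rbig:
  assumes W: "W \<in> sets borel" "bounded W" and B: "B \<in> sets borel"
  shows "Measurable.pred R (\<lambda>z. big (rstat \<rho> z) (fst z \<inter> W) B N)"
proof -
  have m: "(\<lambda>w. card {y\<in>fst (snd w) \<inter> W. y \<in> B \<and> y \<in> cluster (rstat \<rho> (snd w)) (fst (snd w) \<inter> W) (fst w)})
      \<in> measurable (borel \<Otimes>\<^sub>M R) (count_space UNIV)"
  proof (rule measurable_count_points[OF _ W])
    have [measurable]: "Measurable.pred (borel \<Otimes>\<^sub>M (borel \<Otimes>\<^sub>M R)) (\<lambda>p. fst p \<in> cluster (rstat \<rho> (snd (snd p))) (fst (snd (snd p)) \<inter> W) (fst (snd p)))"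
      using pred_cluster[OF W(1)] by (simp add: case_prod_unfold)
    show "Measurable.pred (borel \<Otimes>\<^sub>M (borel \<Otimes>\<^sub>M R)) (\<lambda>(y, w). y \<in> B \<and> y \<in> cluster (rstat \<rho> (snd w)) (fst (snd w) \<inter> W) (fst w))"
      unfolding case_prod_unfold using B by measurable
  qed measurable
  have "Measurable.pred R (\<lambda>z. \<exists>x\<in>fst z. x \<in> W \<and> N \<le> real (card {y\<in>fst z \<inter> W. y \<in> B \<and> y \<in> cluster (rstat \<rho> z) (fst z \<inter> W) x}))"
  proof (rule pred_bex_points)
    show "Measurable.pred (borel \<Otimes>\<^sub>M R) (\<lambda>(x, z). x \<in> W \<and> N \<le> real (card {y\<in>fst z \<inter> W. y \<in> B \<and> y \<in> cluster (rstat \<rho> z) (fst z \<inter> W) x}))"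
      unfolding case_prod_unfold using m W(1) by measurable
  qed measurable
  also have "(\<lambda>z. \<exists>x\<in>fst z. x \<in> W \<and> N \<le> real (card {y\<in>fst z \<inter> W. y \<in> B \<and> y \<in> cluster (rstat \<rho> z) (fst z \<inter> W) x}))
      = (\<lambda>z. big (rstat \<rho> z) (fst z \<inter> W) B N)"
  proof
    fix z :: "'d realisation"
    have "{y\<in>fst z \<inter> W. y \<in> B \<and> y \<in> cluster (rstat \<rho> z) (fst z \<inter> W) x} = cluster (rstat \<rho> z) (fst z \<inter> W) x \<inter> B"
      if "x \<in> fst z \<inter> W" for x
      using cluster_subset[OF that, of "rstat \<rho> z"] by auto
    thus "(\<exists>x\<in>fst z. x \<in> W \<and> N \<le> real (card {y\<in>fst z \<inter> W. y \<in> B \<and> y \<in> cluster (rstat \<rho> z) (fst z \<inter> W) x}))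
      = big (rstat \<rho> z) (fst z \<inter> W) B N"
      unfolding big_def by auto
  qed
  finally show ?thesis .
qed

definition hits :: "'d realisation \<Rightarrow> (real^'d) set \<Rightarrow> bool" where
  "hits z B \<longleftrightarrow> (\<exists>x\<in>fst z. x \<in> B \<and> infinite (cluster (rstat \<rho> z) (fst z) x))"

lemma pred_hits:
  assumes B: "B \<in> sets borel"
  shows "Measurable.pred R (\<lambda>z. hits z B)"
proof -
  define c where "c = (\<lambda>(k::nat) (w :: (real^'d) \<times> 'd realisation). card {y\<in>fst (snd w) \<inter> cball 0 (real k). y \<in> cluster (rstat \<rho> (snd w)) (fst (snd w) \<inter> UNIV) (fst w)})"
  have [measurable]: "c k \<in> measurable (borel \<Otimes>\<^sub>M R) (count_space UNIV)" for k
    unfolding c_def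
  proof (rule measurable_count_points[where \<Lambda> = \<Lambda>])
    show "(\<lambda>w. fst (snd w)) \<in> measurable (borel \<Otimes>\<^sub>M R) (configs \<Lambda>)" by measurable
    show "Measurable.pred (borel \<Otimes>\<^sub>M (borel \<Otimes>\<^sub>M R)) (\<lambda>(y, w). y \<in> cluster (rstat \<rho> (snd w)) (fst (snd w) \<inter> UNIV) (fst w))"
      by (rule pred_cluster) auto
  qed auto
  have p: "Measurable.pred R (\<lambda>z. \<exists>x\<in>fst z. x \<in> B \<and> (\<forall>n. \<exists>k. n \<le> c k (x, z)))"
  proof (rule pred_bex_points)
    have "Measurable.pred (borel \<Otimes>\<^sub>M R) (\<lambda>w. fst w \<in> B \<and> (\<forall>n. \<exists>k. n \<le> c k w))"
      using B by measurable
    thus "Measurable.pred (borel \<Otimes>\<^sub>M R) (\<lambda>(x, z). x \<in> B \<and> (\<forall>n. \<exists>k. n \<le> c k (x, z)))"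
      by (simp add: case_prod_unfold)
  qed measurable
  \<comment> \<open>A cluster in a locally finite configuration is infinite iff its counts in balls
    are unbounded, which is a countable condition.\<close>
  have inf: "infinite (cluster (rstat \<rho> z) (fst z) x) \<longleftrightarrow> (\<forall>n. \<exists>k. n \<le> c k (x, z))"
    if z: "z \<in> space R" and x: "x \<in> fst z" for z x
  proof -
    define K where "K = cluster (rstat \<rho> z) (fst z) x"
    have KX: "K \<subseteq> fst z" unfolding K_def by (rule cluster_subset[OF x])
    have ck: "c k (x, z) = card (K \<inter> cball 0 (real k))" for k
      unfolding c_def K_def[symmetric] using KX by (auto simp: K_def intro!: arg_cong[where f = card])
    have fin: "finite (K \<inter> cball 0 (real k))" for k
      using finite_config_Int[OF config_of[OF z], of "cball 0 (real k)"] KX by (auto intro: rev_finite_subset)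
    show ?thesis
    proof
      assume i: "infinite (cluster (rstat \<rho> z) (fst z) x)"
      show "\<forall>n. \<exists>k. n \<le> c k (x, z)"
      proof
        fix n
        obtain T where T: "T \<subseteq> K" "finite T" "card T = n"
          using i unfolding K_def[symmetric] by (metis infinite_arbitrarily_large)
        obtain r where "\<forall>t\<in>T. norm t \<le> r" using finite_imp_bounded[OF T(2)] by (auto simp: bounded_iff)
        moreover obtain k :: nat where "r \<le> real k" using real_arch_simple by blast
        ultimately have "T \<subseteq> K \<inter> cball 0 (real k)" using T(1) by auto
        hence "n \<le> c k (x, z)" unfolding ck T(3)[symmetric] by (rule card_mono[OF fin])
        thus "\<exists>k. n \<le> c k (x, z)" ..
      qed
    next
      assume a: "\<forall>n. \<exists>k. n \<le> c k (x, z)"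
      show "infinite (cluster (rstat \<rho> z) (fst z) x)"
      proof
        assume f: "finite (cluster (rstat \<rho> z) (fst z) x)"
        obtain k where "Suc (card K) \<le> c k (x, z)" using a by blast
        moreover have "c k (x, z) \<le> card K" unfolding ck using f by (intro card_mono) (auto simp: K_def)
        ultimately show False by simp
      qed
    qed
  qed
  have "hits z B \<longleftrightarrow> (\<exists>x\<in>fst z. x \<in> B \<and> (\<forall>n. \<exists>k. n \<le> c k (x, z)))" if "z \<in> space R" for z
    using inf[OF that] unfolding hits_def by blast
  thus ?thesis using p by (subst measurable_cong) auto
qed

end

section \<open>Relabelling of marks and shifts\<close>

abbreviation mk :: "((nat \<Rightarrow> real) \<times> (nat set \<Rightarrow> real)) measure" where
  "mk \<equiv> vmarks \<Otimes>\<^sub>M emarks"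

interpretation vmarks: prob_space vmarks by (rule prob_space_PiM_uniform01)
interpretation emarks: prob_space emarks by (rule prob_space_PiM_uniform01)
interpretation mk: pair_prob_space vmarks emarks ..

definition reindex :: "'i set \<Rightarrow> ('i \<Rightarrow> 'k) \<Rightarrow> 'j set \<Rightarrow> ('j \<Rightarrow> 'l) \<Rightarrow> ('k \<Rightarrow> real) \<times> ('l \<Rightarrow> real) \<Rightarrow> ('i \<Rightarrow> real) \<times> ('j \<Rightarrow> real)" where
  "reindex I f J g = (\<lambda>(u, v). (\<lambda>i\<in>I. u (f i), \<lambda>j\<in>J. v (g j)))"

lemma distr_reindex:
  assumes f: "inj_on f I" "f \<in> I \<rightarrow> K" and g: "inj_on g J" "g \<in> J \<rightarrow> L"
  shows "reindex I f J g \<in> measurable (Pi\<^sub>M K (\<lambda>_. uniform01) \<Otimes>\<^sub>M Pi\<^sub>M L (\<lambda>_. uniform01)) (Pi\<^sub>M I (\<lambda>_. uniform01) \<Otimes>\<^sub>M Pi\<^sub>M J (\<lambda>_. uniform01))"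
    and "distr (Pi\<^sub>M K (\<lambda>_. uniform01) \<Otimes>\<^sub>M Pi\<^sub>M L (\<lambda>_. uniform01)) (Pi\<^sub>M I (\<lambda>_. uniform01) \<Otimes>\<^sub>M Pi\<^sub>M J (\<lambda>_. uniform01)) (reindex I f J g)
      = Pi\<^sub>M I (\<lambda>_. uniform01) \<Otimes>\<^sub>M Pi\<^sub>M J (\<lambda>_. uniform01)"
proof -
  let ?K = "Pi\<^sub>M K (\<lambda>_. uniform01)" and ?L = "Pi\<^sub>M L (\<lambda>_. uniform01)"
  let ?I = "Pi\<^sub>M I (\<lambda>_. uniform01)" and ?J = "Pi\<^sub>M J (\<lambda>_. uniform01)"
  have mf: "(\<lambda>u. \<lambda>i\<in>I. u (f i)) \<in> measurable ?K ?I"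
    using f(2) by (intro measurable_restrict measurable_component_singleton) auto
  have mg: "(\<lambda>u. \<lambda>i\<in>J. u (g i)) \<in> measurable ?L ?J"
    using g(2) by (intro measurable_restrict measurable_component_singleton) auto
  have df: "distr ?K ?I (\<lambda>u. \<lambda>i\<in>I. u (f i)) = ?I"
    using distr_PiM_reindex[of K "\<lambda>_. uniform01" f I] f U.prob_space_axioms by simp
  have dg: "distr ?L ?J (\<lambda>u. \<lambda>i\<in>J. u (g i)) = ?J"
    using distr_PiM_reindex[of L "\<lambda>_. uniform01" g J] g U.prob_space_axioms by simp
  interpret J: prob_space ?J by (rule prob_space_PiM_uniform01)
  show "reindex I f J g \<in> measurable (?K \<Otimes>\<^sub>M ?L) (?I \<Otimes>\<^sub>M ?J)"
    unfolding reindex_def using mf mg by measurable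
  have "sigma_finite_measure (distr ?L ?J (\<lambda>u. \<lambda>i\<in>J. u (g i)))" unfolding dg by unfold_locales
  from pair_measure_distr[OF mf mg this] show "distr (?K \<Otimes>\<^sub>M ?L) (?I \<Otimes>\<^sub>M ?J) (reindex I f J g) = ?I \<Otimes>\<^sub>M ?J"
    unfolding df dg reindex_def by simp
qed

text \<open>Splicing two independent copies along \<open>I\<close> gives a copy again. Independence
  of functions of disjoint sets of coordinates then follows by letting each function read its own
  copy.\<close>

lemma PiM_mix:
  fixes K I :: "'k set"
  defines "M \<equiv> Pi\<^sub>M K (\<lambda>_. uniform01)"
  shows "distr (M \<Otimes>\<^sub>M M) M (\<lambda>(u, u'). \<lambda>i\<in>K. if i \<in> I then u' i else u i) = M"
    and "(\<lambda>(u, u'). \<lambda>i\<in>K. if i \<in> I then u' i else u i) \<in> measurable (M \<Otimes>\<^sub>M M) M"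
proof -
  let ?h = "\<lambda>(u, u'). \<lambda>i\<in>K. if i \<in> I then u' i else u i :: real"
  interpret M: prob_space M unfolding M_def by (rule prob_space_PiM_uniform01)
  show h: "?h \<in> measurable (M \<Otimes>\<^sub>M M) M"
    unfolding M_def case_prod_unfold
  proof (rule measurable_restrict)
    fix i assume [measurable]: "i \<in> K"
    show "(\<lambda>p. if i \<in> I then snd p i else fst p i) \<in> measurable (Pi\<^sub>M K (\<lambda>_. uniform01) \<Otimes>\<^sub>M Pi\<^sub>M K (\<lambda>_. uniform01)) uniform01"
      by (cases "i \<in> I") (simp_all, measurable)
  qed
  have "distr (M \<Otimes>\<^sub>M M) M ?h = Pi\<^sub>M K (\<lambda>_. uniform01)"
  proof (rule measure_eqI_PiM_infinite[symmetric])
    show "sets (distr (M \<Otimes>\<^sub>M M) M ?h) = sets (Pi\<^sub>M K (\<lambda>_. uniform01))" by (simp add: M_def)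
    show "finite_measure (Pi\<^sub>M K (\<lambda>_. uniform01))" unfolding M_def[symmetric] by unfold_locales
    fix J A assume J: "finite J" "J \<subseteq> K" and A: "\<And>i. i \<in> J \<Longrightarrow> A i \<in> sets uniform01"
    let ?e = "\<lambda>J. prod_emb K (\<lambda>_. uniform01) J (Pi\<^sub>E J A)"
    have se: "?e J' \<in> sets M" if "J' \<subseteq> J" for J'
      unfolding M_def using J A that by (intro sets_PiM_I) (auto intro: finite_subset)
    have em: "emeasure M (?e J') = (\<Prod>i\<in>J'. emeasure uniform01 (A i))" if "J' \<subseteq> J" for J'
      unfolding M_def using J A that by (intro emeasure_PiM_emb U.prob_space_axioms) (auto intro: finite_subset)
    have "?h -` ?e J \<inter> space (M \<Otimes>\<^sub>M M) = ?e (J - I) \<times> ?e (J \<inter> I)"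
    proof -
      have JK: "i \<in> K" if "i \<in> J" for i using J that by auto
      have he: "f \<in> ?e J' \<longleftrightarrow> f \<in> extensional K \<and> (\<forall>i\<in>J'. f i \<in> A i)" for f J'
        by (auto simp: prod_emb_iff restrict_PiE_iff)
      have "(a, b) \<in> ?h -` ?e J \<inter> space (M \<Otimes>\<^sub>M M) \<longleftrightarrow> (a, b) \<in> ?e (J - I) \<times> ?e (J \<inter> I)" for a b
      proof -
        have "(\<forall>i\<in>J. ?h (a, b) i \<in> A i) \<longleftrightarrow> (\<forall>i\<in>J - I. a i \<in> A i) \<and> (\<forall>i\<in>J \<inter> I. b i \<in> A i)"
        proof -
          have "?h (a, b) i = (if i \<in> I then b i else a i)" if "i \<in> J" for i using JK[OF that] by simp
          hence "(\<forall>i\<in>J. ?h (a, b) i \<in> A i) \<longleftrightarrow> (\<forall>i\<in>J. (if i \<in> I then b i else a i) \<in> A i)" by (intro ball_cong) simp_all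
          thus ?thesis by auto
        qed
        thus ?thesis by (auto simp: he M_def space_pair_measure space_PiM PiE_iff)
      qed
      thus ?thesis by (intro set_eqI) (simp only: split_paired_all)
    qed
    hence "emeasure (distr (M \<Otimes>\<^sub>M M) M ?h) (?e J) = emeasure (M \<Otimes>\<^sub>M M) (?e (J - I) \<times> ?e (J \<inter> I))"
      using h se[of J] by (simp add: emeasure_distr)
    also have "\<dots> = emeasure M (?e (J - I)) * emeasure M (?e (J \<inter> I))"
      using se by (intro M.emeasure_pair_measure_Times) auto
    also have "\<dots> = (\<Prod>i\<in>(J - I) \<union> (J \<inter> I). emeasure uniform01 (A i))"
      using J by (subst prod.union_disjoint) (auto simp: em)
    also have "(J - I) \<union> (J \<inter> I) = J" by auto
    finally have "emeasure (distr (M \<Otimes>\<^sub>M M) M ?h) (?e J) = emeasure M (?e J)"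
      using em[OF order_refl] by (simp only:)
    thus "emeasure (Pi\<^sub>M K (\<lambda>_. uniform01)) (?e J) = emeasure (distr (M \<Otimes>\<^sub>M M) M ?h) (?e J)"
      unfolding M_def by (rule sym)
  qed simp
  thus "distr (M \<Otimes>\<^sub>M M) M ?h = M" by (simp add: M_def)
qed

lemma PiM_disjoint_coordinates:
  fixes f g :: "('k \<Rightarrow> real) \<Rightarrow> ennreal" and K :: "'k set"
  defines "M \<equiv> Pi\<^sub>M K (\<lambda>_. uniform01)"
  assumes fm: "f \<in> borel_measurable M" and gm: "g \<in> borel_measurable M" and disj: "I \<inter> I' = {}"
    and f: "\<And>u u'. u \<in> space M \<Longrightarrow> u' \<in> space M \<Longrightarrow> (\<And>i. i \<in> I \<inter> K \<Longrightarrow> u i = u' i) \<Longrightarrow> f u = f u'"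
    and g: "\<And>u u'. u \<in> space M \<Longrightarrow> u' \<in> space M \<Longrightarrow> (\<And>i. i \<in> I' \<inter> K \<Longrightarrow> u i = u' i) \<Longrightarrow> g u = g u'"
  shows "(\<integral>\<^sup>+u. f u * g u \<partial>M) = (\<integral>\<^sup>+u. f u \<partial>M) * (\<integral>\<^sup>+u. g u \<partial>M)"
proof -
  interpret M: prob_space M unfolding M_def by (rule prob_space_PiM_uniform01)
  let ?h = "\<lambda>(u, u'). \<lambda>i\<in>K. if i \<in> I' then u' i else u i :: real"
  have h: "?h \<in> measurable (M \<Otimes>\<^sub>M M) M" "distr (M \<Otimes>\<^sub>M M) M ?h = M"
    unfolding M_def by (rule PiM_mix)+
  have "(\<integral>\<^sup>+u. f u * g u \<partial>M) = (\<integral>\<^sup>+u. f u * g u \<partial>distr (M \<Otimes>\<^sub>M M) M ?h)" by (simp add: h(2))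
  also have "\<dots> = (\<integral>\<^sup>+p. f (?h p) * g (?h p) \<partial>(M \<Otimes>\<^sub>M M))"
    using h(1) fm gm by (subst nn_integral_distr) auto
  also have "\<dots> = (\<integral>\<^sup>+p. f (fst p) * g (snd p) \<partial>(M \<Otimes>\<^sub>M M))"
  proof (rule nn_integral_cong)
    fix p assume p: "p \<in> space (M \<Otimes>\<^sub>M M)"
    have hp: "?h p \<in> space M" by (rule measurable_space[OF h(1) p])
    have s: "fst p \<in> space M" "snd p \<in> space M" using p by (auto simp: space_pair_measure)
    have "f (?h p) = f (fst p)" using disj by (intro f[OF hp s(1)]) (auto simp: case_prod_unfold)
    moreover have "g (?h p) = g (snd p)" by (intro g[OF hp s(2)]) (auto simp: case_prod_unfold)
    ultimately show "f (?h p) * g (?h p) = f (fst p) * g (snd p)" by simp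
  qed
  also have "\<dots> = (\<integral>\<^sup>+u. (\<integral>\<^sup>+u'. f u * g u' \<partial>M) \<partial>M)"
    using fm gm M.nn_integral_fst[of "\<lambda>p. f (fst p) * g (snd p)" M] by simp
  also have "\<dots> = (\<integral>\<^sup>+u. f u * (\<integral>\<^sup>+u'. g u' \<partial>M) \<partial>M)" using gm by (simp add: nn_integral_cmult)
  also have "\<dots> = (\<integral>\<^sup>+u. f u \<partial>M) * (\<integral>\<^sup>+u. g u \<partial>M)" using fm by (simp add: nn_integral_multc)
  finally show ?thesis .
qed

definition determined_by :: "nat set \<Rightarrow> ((nat \<Rightarrow> real) \<times> (nat set \<Rightarrow> real)) set \<Rightarrow> bool" where
  "determined_by I E \<longleftrightarrow> (\<forall>\<xi>\<in>space mk. \<forall>\<xi>'\<in>space mk.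
     (\<forall>i\<in>I. fst \<xi> i = fst \<xi>' i) \<and> (\<forall>e. card e = 2 \<and> e \<subseteq> I \<longrightarrow> snd \<xi> e = snd \<xi>' e) \<longrightarrow> (\<xi> \<in> E \<longleftrightarrow> \<xi>' \<in> E))"

text \<open>An edge with one end in \<open>I\<close> and the other in \<open>I'\<close> is read by
  neither event, so the two families of edges are disjoint as soon as \<open>I\<close> and
  \<open>I'\<close> are. Vertex marks are separated first, with the edge marks fixed, and the edge
  marks afterwards.\<close>

lemma determined_independent:
  assumes E: "E \<in> sets mk" "E' \<in> sets mk" and d: "determined_by I E" "determined_by I' E'" and disj: "I \<inter> I' = {}"
  shows "measure mk (E \<inter> E') = measure mk E * measure mk E'"
proof -
  have sp: "space mk = space vmarks \<times> space emarks" by (simp add: space_pair_measure)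
  have em: "emeasure mk A = (\<integral>\<^sup>+v. (\<integral>\<^sup>+u. indicator A (u, v) \<partial>vmarks) \<partial>emarks)" if "A \<in> sets mk" for A
    using that mk.nn_integral_snd[of "indicator A"] by simp
  define F where "F = (\<lambda>(A :: ((nat \<Rightarrow> real) \<times> (nat set \<Rightarrow> real)) set) v. \<integral>\<^sup>+u. indicator A (u, v) \<partial>vmarks :: ennreal)"
  have Fm: "F A \<in> borel_measurable emarks" if "A \<in> sets mk" for A
    unfolding F_def using that by (intro vmarks.borel_measurable_nn_integral) (auto simp: case_prod_unfold)
  have sec: "(\<lambda>u. indicator A (u, v)) \<in> borel_measurable vmarks" if "A \<in> sets mk" "v \<in> space emarks" for A v
    using that by measurable
  have Fd: "F A v = F A v'" if A: "determined_by I A" and v: "v \<in> space emarks" "v' \<in> space emarks"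
    "\<And>e. e \<in> {e. e \<subseteq> I} \<inter> {e. card e = 2} \<Longrightarrow> v e = v' e" for A I v v'
    unfolding F_def
  proof (rule nn_integral_cong)
    fix u assume u: "u \<in> space vmarks"
    have "(u, v) \<in> A \<longleftrightarrow> (u, v') \<in> A"
      using A[unfolded determined_by_def, rule_format, of "(u, v)" "(u, v')"] u v sp by auto
    thus "indicator A (u, v) = (indicator A (u, v') :: ennreal)" by (simp add: indicator_def)
  qed
  have "emeasure mk (E \<inter> E') = (\<integral>\<^sup>+v. (\<integral>\<^sup>+u. indicator E (u, v) * indicator E' (u, v) \<partial>vmarks) \<partial>emarks)"
    using E em[of "E \<inter> E'"] by (simp add: indicator_inter_arith)
  also have "\<dots> = (\<integral>\<^sup>+v. F E v * F E' v \<partial>emarks)"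
  proof (rule nn_integral_cong)
    fix v assume v: "v \<in> space emarks"
    show "(\<integral>\<^sup>+u. indicator E (u, v) * indicator E' (u, v) \<partial>vmarks) = F E v * F E' v"
      unfolding F_def
    proof (rule PiM_disjoint_coordinates[OF sec sec disj])
      fix u u' :: "nat \<Rightarrow> real" assume u: "u \<in> space vmarks" "u' \<in> space vmarks"
      show "indicator E (u, v) = (indicator E (u', v) :: ennreal)" if "\<And>i. i \<in> I \<inter> UNIV \<Longrightarrow> u i = u' i"
        using d(1)[unfolded determined_by_def, rule_format, of "(u, v)" "(u', v)"] u v sp that by (auto simp: indicator_def)
      show "indicator E' (u, v) = (indicator E' (u', v) :: ennreal)" if "\<And>i. i \<in> I' \<inter> UNIV \<Longrightarrow> u i = u' i"
        using d(2)[unfolded determined_by_def, rule_format, of "(u, v)" "(u', v)"] u v sp that by (auto simp: indicator_def)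
    qed (use E v in auto)
  qed
  also have "\<dots> = (\<integral>\<^sup>+v. F E v \<partial>emarks) * (\<integral>\<^sup>+v. F E' v \<partial>emarks)"
  proof -
    have "\<integral>\<^sup>+v. F E v * F E' v \<partial>emarks = (\<integral>\<^sup>+v. F E v \<partial>emarks) * (\<integral>\<^sup>+v. F E' v \<partial>emarks)"
    \<comment> \<open>The empty set is the only common subset of \<open>I\<close> and
      \<open>I'\<close>; it is no edge and is removed.\<close>
    proof (rule PiM_disjoint_coordinates[where I = "{e. e \<subseteq> I} - {{}}" and I' = "{e. e \<subseteq> I'} - {{}}"])
      show "({e. e \<subseteq> I} - {{}}) \<inter> ({e. e \<subseteq> I'} - {{}}) = {}" using disj by blast
      fix v v' :: "nat set \<Rightarrow> real" assume v: "v \<in> space emarks" "v' \<in> space emarks"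
      show "F E v = F E v'" if "\<And>e. e \<in> ({e. e \<subseteq> I} - {{}}) \<inter> {e. card e = 2} \<Longrightarrow> v e = v' e"
        by (rule Fd[OF d(1) v]) (rule that, auto)
      show "F E' v = F E' v'" if "\<And>e. e \<in> ({e. e \<subseteq> I'} - {{}}) \<inter> {e. card e = 2} \<Longrightarrow> v e = v' e"
        by (rule Fd[OF d(2) v]) (rule that, auto)
    qed (use Fm E in auto)
    thus ?thesis .
  qed
  also have "\<dots> = emeasure mk E * emeasure mk E'" using E em by (simp add: F_def)
  finally show ?thesis by (simp add: mk.emeasure_eq_measure ennreal_mult[symmetric])
qed

text \<open>A point of rank \<open>n\<close> is preceded by exactly \<open>n\<close> points, whose
  ranks are distinct and smaller, so no rank is skipped.\<close>

lemma point_rank_initial: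
  assumes \<omega>: "\<omega> \<in> configurations \<Lambda>"
  shows "point_rank \<omega> ` \<omega> = (if finite \<omega> then {..<card \<omega>} else UNIV)"
proof -
  have init: "n \<in> point_rank \<omega> ` \<omega>" if x: "x \<in> \<omega>" "n < point_rank \<omega> x" for x n
  proof -
    define S where "S = {y\<in>\<omega>. precedes y x}"
    have fS: "finite S" unfolding S_def by (rule finite_preceding[OF \<omega>])
    have "point_rank \<omega> ` S \<subseteq> {..<point_rank \<omega> x}"
      using point_rank_less[OF \<omega>] by (auto simp: S_def)
    moreover have "card (point_rank \<omega> ` S) = card {..<point_rank \<omega> x}"
      using inj_on_point_rank[OF \<omega>] by (subst card_image) (auto simp: S_def point_rank_def intro: inj_on_subset)
    ultimately have "point_rank \<omega> ` S = {..<point_rank \<omega> x}" by (intro card_subset_eq) auto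
    hence "n \<in> point_rank \<omega> ` S" using x by auto
    thus ?thesis by (auto simp: S_def)
  qed
  have inj: "inj_on (point_rank \<omega>) \<omega>" by (rule inj_on_point_rank[OF \<omega>])
  show ?thesis
  proof (cases "finite \<omega>")
    case True
    have "m < card \<omega>" if "m \<in> point_rank \<omega> ` \<omega>" for m
    proof -
      have "{..m} \<subseteq> point_rank \<omega> ` \<omega>" using that init by (auto simp: le_less)
      hence "card {..m} \<le> card (point_rank \<omega> ` \<omega>)" using True by (intro card_mono) auto
      thus ?thesis using card_image[OF inj] by simp
    qed
    hence "point_rank \<omega> ` \<omega> \<subseteq> {..<card \<omega>}" by auto
    hence "point_rank \<omega> ` \<omega> = {..<card \<omega>}" using card_image[OF inj] by (intro card_subset_eq) auto
    thus ?thesis using True by simp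
  next
    case False
    have "n \<in> point_rank \<omega> ` \<omega>" for n
    proof -
      have "infinite (point_rank \<omega> ` \<omega>)" using False inj by (simp add: finite_image_iff)
      then obtain m where "m \<in> point_rank \<omega> ` \<omega>" "n < m" using infinite_nat_iff_unbounded by blast
      thus ?thesis using init by auto
    qed
    thus ?thesis using False by auto
  qed
qed

lemma shift_inj: "inj_on (\<lambda>y. y + z) (X :: (real^'d) set)"
  by (simp add: inj_on_def)

text \<open>A shift reorders the points by norm. Both rank sets are the same initial segment of the
  naturals, so the reordering is a bijection of it; the identity extends it to all naturals, so that
  it acts on the whole family of marks.\<close>

lemma rank_shift_bij:
  assumes \<omega>: "\<omega> \<in> configurations \<Lambda>" "shift z \<omega> \<in> configurations \<Lambda>"
  shows "\<exists>\<sigma>. bij \<sigma> \<and> (\<forall>x\<in>\<omega>. \<sigma> (point_rank \<omega> x) = point_rank (shift z \<omega>) (x + z))"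
proof -
  define A where "A = point_rank \<omega> ` \<omega>"
  have fin: "finite (shift z \<omega>) = finite \<omega>" "card (shift z \<omega>) = card \<omega>"
    unfolding shift_def by (auto simp: finite_image_iff shift_inj card_image)
  have A': "point_rank (shift z \<omega>) ` shift z \<omega> = A"
    unfolding A_def point_rank_initial[OF \<omega>(1)] point_rank_initial[OF \<omega>(2)] fin ..
  define f where "f = (\<lambda>n. point_rank (shift z \<omega>) (the_inv_into \<omega> (point_rank \<omega>) n + z))"
  have inj: "inj_on (point_rank \<omega>) \<omega>" "inj_on (point_rank (shift z \<omega>)) (shift z \<omega>)"
    using inj_on_point_rank \<omega> by auto
  have f: "f (point_rank \<omega> x) = point_rank (shift z \<omega>) (x + z)" if "x \<in> \<omega>" for x
    unfolding f_def using the_inv_into_f_f[OF inj(1) that] by simp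
  have fA: "bij_betw f A A"
    unfolding bij_betw_def
  proof
    show "inj_on f A"
    proof (rule inj_onI)
      fix a b assume "a \<in> A" "b \<in> A" "f a = f b"
      then obtain x y where xy: "x \<in> \<omega>" "a = point_rank \<omega> x" "y \<in> \<omega>" "b = point_rank \<omega> y" by (auto simp: A_def)
      hence "point_rank (shift z \<omega>) (x + z) = point_rank (shift z \<omega>) (y + z)" using \<open>f a = f b\<close> f by simp
      hence "x + z = y + z" using inj(2) xy by (elim inj_onD) (auto simp: shift_def)
      thus "a = b" using xy by simp
    qed
    have "f ` A = (\<lambda>x. point_rank (shift z \<omega>) (x + z)) ` \<omega>" using f by (force simp: A_def)
    thus "f ` A = A" using A' by (simp add: shift_def image_image)
  qed
  define \<sigma> where "\<sigma> = (\<lambda>n. if n \<in> A then f n else n)"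
  have "bij_betw \<sigma> (A \<union> - A) (A \<union> - A)"
  proof (rule bij_betw_combine)
    show "bij_betw \<sigma> A A" using fA by (subst bij_betw_cong[of A \<sigma> f]) (auto simp: \<sigma>_def)
    show "bij_betw \<sigma> (- A) (- A)" by (subst bij_betw_cong[of "- A" \<sigma> id]) (auto simp: \<sigma>_def)
  qed auto
  hence "bij \<sigma>" by (simp add: Un_commute)
  moreover have "\<sigma> (point_rank \<omega> x) = point_rank (shift z \<omega>) (x + z)" if "x \<in> \<omega>" for x
    using that f by (simp add: \<sigma>_def A_def)
  ultimately show ?thesis by blast
qed

definition permute :: "(nat \<Rightarrow> nat) \<Rightarrow> (nat \<Rightarrow> real) \<times> (nat set \<Rightarrow> real) \<Rightarrow> (nat \<Rightarrow> real) \<times> (nat set \<Rightarrow> real)" where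
  "permute \<sigma> = reindex UNIV \<sigma> {e. card e = 2} (image \<sigma>)"

lemma permute:
  assumes "bij \<sigma>"
  shows "permute \<sigma> \<in> measurable mk mk" "distr mk mk (permute \<sigma>) = mk"
proof -
  have i: "inj \<sigma>" using assms by (rule bij_is_inj)
  have 1: "inj_on (image \<sigma>) {e. card e = 2}" using i by (auto simp: inj_on_def inj_image_eq_iff)
  have 2: "image \<sigma> \<in> {e. card e = 2} \<rightarrow> {e. card e = 2}"
    using i by (auto simp: card_image inj_on_subset)
  show "permute \<sigma> \<in> measurable mk mk" "distr mk mk (permute \<sigma>) = mk"
    unfolding permute_def using i 1 2 by (intro distr_reindex; simp)+
qed

lemma shift_iff: "y \<in> shift z X \<longleftrightarrow> y - z \<in> X"
  by (force simp: shift_def)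

lemma shift_Int: "shift z (X \<inter> Y) = shift z X \<inter> shift z Y"
  by (auto simp: shift_iff)

lemma shift_UNIV [simp]: "shift z UNIV = UNIV"
  by (auto simp: shift_iff)

lemma shift_shift: "shift z (shift w X) = shift (z + w) X"
  by (auto simp: shift_iff algebra_simps)

lemma shift_0 [simp]: "shift 0 X = X"
  by (auto simp: shift_iff)

lemma shift_box_at: "shift z (box_at w R) = box_at (w + z) R"
  by (auto simp: shift_iff box_at_def algebra_simps)

lemma card_shift: "card (shift z X) = card X"
  unfolding shift_def by (rule card_image) (simp add: inj_on_def)

lemma infinite_shift: "finite (shift z X) = finite X"
  unfolding shift_def by (rule finite_image_iff) (simp add: inj_on_def)

lemma int_vec_lattice: "int_vec i \<in> integer_lattice"
  by (simp add: int_vec_def integer_lattice_def)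

locale stat_process = conn_process \<rho> \<Lambda> P for \<rho> and \<Lambda> :: "(real^'d) set" and P +
  assumes Lam: "\<Lambda> = UNIV \<or> \<Lambda> = integer_lattice" and stat: "stationary \<Lambda> P"
begin

lemma Lam_add: "x \<in> \<Lambda> \<Longrightarrow> y \<in> \<Lambda> \<Longrightarrow> x + y \<in> \<Lambda>"
  using Lam by (auto simp: integer_lattice_def)

lemma Lam_uminus: "x \<in> \<Lambda> \<Longrightarrow> - x \<in> \<Lambda>"
  using Lam by (auto simp: integer_lattice_def)

lemma int_vec_Lam: "int_vec i \<in> \<Lambda>"
  using Lam int_vec_lattice by auto

lemma shift_config:
  assumes "\<omega> \<in> configurations \<Lambda>" "z \<in> \<Lambda>"
  shows "shift z \<omega> \<in> configurations \<Lambda>"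
proof -
  have "finite (shift z \<omega> \<inter> cball 0 r)" for r
  proof -
    have "shift z \<omega> \<inter> cball 0 r \<subseteq> shift z (\<omega> \<inter> cball 0 (r + norm z))"
    proof
      fix y assume y: "y \<in> shift z \<omega> \<inter> cball 0 r"
      have "norm (y - z) \<le> norm y + norm z" by (rule norm_triangle_ineq4)
      thus "y \<in> shift z (\<omega> \<inter> cball 0 (r + norm z))" using y by (auto simp: shift_iff)
    qed
    moreover have "finite (shift z (\<omega> \<inter> cball 0 (r + norm z)))"
      using assms(1) by (simp add: infinite_shift configurations_def)
    ultimately show ?thesis by (rule finite_subset)
  qed
  moreover have "shift z \<omega> \<subseteq> \<Lambda>"
    using assms Lam_add by (auto simp: configurations_def shift_def)
  ultimately show ?thesis by (simp add: configurations_def)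
qed

lemma shift_measurable:
  assumes z: "z \<in> \<Lambda>" shows "shift z \<in> measurable (configs \<Lambda>) (configs \<Lambda>)"
  unfolding configs_def
proof (rule measurable_measure_of)
  show "shift z \<in> space (sigma (configurations \<Lambda>) {{\<omega> \<in> configurations \<Lambda>. card (\<omega> \<inter> B) = k} |B k. B \<in> sets borel \<and> bounded B}) \<rightarrow> configurations \<Lambda>"
    using shift_config[OF _ z] by (auto simp: space_measure_of_conv)
  fix S assume "S \<in> {{\<omega> \<in> configurations \<Lambda>. card (\<omega> \<inter> B) = k} |B k. B \<in> sets borel \<and> bounded B}"
  then obtain B k where S: "S = {\<omega> \<in> configurations \<Lambda>. card (\<omega> \<inter> B) = k}" "B \<in> sets borel" "bounded B" by auto
  have "shift z \<omega> \<inter> B = shift z (\<omega> \<inter> shift (- z) B)" for \<omega>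
    by (simp add: shift_Int shift_shift)
  hence c: "card (shift z \<omega> \<inter> B) = card (\<omega> \<inter> shift (- z) B)" for \<omega> by (simp add: card_shift)
  have bB: "bounded (shift (- z) B)" unfolding shift_def using bounded_translation[OF S(3), of "- z"] by (simp add: add.commute)
  have "shift (- z) B = (\<lambda>y. y + z) -` B \<inter> space borel" by (auto simp: shift_iff)
  also have "\<dots> \<in> sets borel"
  proof (rule measurable_sets[OF _ S(2)])
    show "(\<lambda>y. y + z) \<in> borel_measurable borel" by measurable
  qed
  finally have B: "shift (- z) B \<in> sets borel" .
  have "shift z -` S \<inter> configurations \<Lambda> = {\<omega> \<in> configurations \<Lambda>. card (\<omega> \<inter> shift (- z) B) = k}"
    using shift_config[OF _ z] by (auto simp: S c)
  thus "shift z -` S \<inter> space (sigma (configurations \<Lambda>) {{\<omega> \<in> configurations \<Lambda>. card (\<omega> \<inter> B) = k} |B k. B \<in> sets borel \<and> bounded B})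
      \<in> sets (sigma (configurations \<Lambda>) {{\<omega> \<in> configurations \<Lambda>. card (\<omega> \<inter> B) = k} |B k. B \<in> sets borel \<and> bounded B})"
    using B bB by (subst space_measure_of, blast) (auto intro!: in_measure_of)
qed auto

lemma shift_measurable_P: "z \<in> \<Lambda> \<Longrightarrow> shift z \<in> measurable P (configs \<Lambda>)"
  using shift_measurable by (simp cong: measurable_cong_sets add: measurable_cong_sets[OF sets_P refl])

lemma nn_integral_shift:
  assumes "z \<in> \<Lambda>" "g \<in> borel_measurable P"
  shows "(\<integral>\<^sup>+\<omega>. g (shift z \<omega>) \<partial>P) = (\<integral>\<^sup>+\<omega>. g \<omega> \<partial>P)"
proof -
  have g: "g \<in> borel_measurable (configs \<Lambda>)" using assms(2) measurable_cong_sets[OF sets_P refl] by auto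
  have "distr P (configs \<Lambda>) (shift z) = P" using stat assms(1) by (auto simp: stationary_def)
  hence "(\<integral>\<^sup>+\<omega>. g \<omega> \<partial>P) = (\<integral>\<^sup>+\<omega>. g \<omega> \<partial>distr P (configs \<Lambda>) (shift z))" by simp
  also have "\<dots> = (\<integral>\<^sup>+\<omega>. g (shift z \<omega>) \<partial>P)"
    by (rule nn_integral_distr[OF shift_measurable_P[OF assms(1)] ]) (use g in simp)
  finally show ?thesis by simp
qed

end

context conn_process
begin

text \<open>The graph of a shifted configuration is the shifted graph, provided the marks are
  permuted along with the ranks. The permutation depends on the configuration, so it is only used
  with the configuration fixed.\<close>

lemma rstat_shift:
  assumes \<sigma>: "bij \<sigma>" "\<And>x. x \<in> \<omega> \<Longrightarrow> \<sigma> (point_rank \<omega> x) = point_rank (shift z \<omega>) (x + z)"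
    and \<omega>: "\<omega> \<in> configurations \<Lambda>" "shift z \<omega> \<in> configurations \<Lambda>" and e: "e \<in> pairs \<omega>"
  shows "rstat \<rho> (shift z \<omega>, \<xi>) ((\<lambda>y. y + z) ` e) = rstat \<rho> (\<omega>, permute \<sigma> \<xi>) e"
  using e
proof (rule pairsE)
  fix x y assume xy: "e = {x, y}" "x \<noteq> y" "x \<in> \<omega>" "y \<in> \<omega>"
  have r: "point_rank \<omega> x \<noteq> point_rank \<omega> y" using inj_on_point_rank[OF \<omega>(1)] xy by (auto dest: inj_onD)
  have c: "card {point_rank \<omega> x, point_rank \<omega> y} = 2" using r by simp
  have p: "snd (permute \<sigma> \<xi>) {point_rank \<omega> x, point_rank \<omega> y} = snd \<xi> {point_rank (shift z \<omega>) (x + z), point_rank (shift z \<omega>) (y + z)}"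
    using c by (cases \<xi>) (simp add: permute_def reindex_def \<sigma>(2)[OF xy(3), symmetric] \<sigma>(2)[OF xy(4), symmetric])
  have u: "umark (\<omega>, permute \<sigma> \<xi>) w = umark (shift z \<omega>, \<xi>) (w + z)" if "w \<in> \<omega>" for w
    by (cases \<xi>) (simp add: umark_def permute_def reindex_def \<sigma>(2)[OF that, symmetric])
  have i: "(\<lambda>y. y + z) ` e = {x + z, y + z}" by (simp add: xy(1))
  have n: "x + z \<noteq> y + z" using xy by simp
  show ?thesis unfolding i rstat_pair[OF \<omega>(2) n] unfolding xy(1) rstat_pair[OF \<omega>(1) xy(2)] p u[OF xy(3)] u[OF xy(4)]
    by (simp add: dist_norm)
qed

lemma cluster_shift:
  assumes \<sigma>: "bij \<sigma>" "\<And>x. x \<in> \<omega> \<Longrightarrow> \<sigma> (point_rank \<omega> x) = point_rank (shift z \<omega>) (x + z)"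
    and \<omega>: "\<omega> \<in> configurations \<Lambda>" "shift z \<omega> \<in> configurations \<Lambda>" and X: "X \<subseteq> \<omega>" "x \<in> X"
  shows "cluster (rstat \<rho> (shift z \<omega>, \<xi>)) (shift z X) (x + z) = shift z (cluster (rstat \<rho> (\<omega>, permute \<sigma> \<xi>)) X x)"
  unfolding shift_def
proof (rule cluster_image[OF shift_inj])
  fix e assume "e \<in> pairs X"
  hence "e \<in> pairs \<omega>" using X by (auto simp: pairs_def)
  from rstat_shift[OF \<sigma> \<omega> this] show "rstat \<rho> ((\<lambda>y. y + z) ` \<omega>, \<xi>) ((\<lambda>y. y + z) ` e) = rstat \<rho> (\<omega>, permute \<sigma> \<xi>) e"
    by (simp add: shift_def)
qed (rule X)

lemma hits_shift:
  assumes \<sigma>: "bij \<sigma>" "\<And>x. x \<in> \<omega> \<Longrightarrow> \<sigma> (point_rank \<omega> x) = point_rank (shift z \<omega>) (x + z)"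
    and \<omega>: "\<omega> \<in> configurations \<Lambda>" "shift z \<omega> \<in> configurations \<Lambda>"
  shows "hits (shift z \<omega>, \<xi>) (shift z B) = hits (\<omega>, permute \<sigma> \<xi>) B"
proof -
  have "infinite (cluster (rstat \<rho> (shift z \<omega>, \<xi>)) (shift z \<omega>) (x + z)) = infinite (cluster (rstat \<rho> (\<omega>, permute \<sigma> \<xi>)) \<omega> x)"
    if "x \<in> \<omega>" for x
    using cluster_shift[OF \<sigma> \<omega> subset_refl that, of \<xi>] by (simp add: infinite_shift)
  hence "(\<exists>x\<in>\<omega>. x \<in> B \<and> infinite (cluster (rstat \<rho> (\<omega>, permute \<sigma> \<xi>)) \<omega> x))
    = (\<exists>x\<in>\<omega>. x + z \<in> shift z B \<and> infinite (cluster (rstat \<rho> (shift z \<omega>, \<xi>)) (shift z \<omega>) (x + z)))"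
    by (auto simp: shift_iff)
  also have "\<dots> = (\<exists>y\<in>shift z \<omega>. y \<in> shift z B \<and> infinite (cluster (rstat \<rho> (shift z \<omega>, \<xi>)) (shift z \<omega>) y))"
    by (auto simp: shift_def)
  finally show ?thesis by (simp add: hits_def)
qed

lemma big_shift:
  assumes \<sigma>: "bij \<sigma>" "\<And>x. x \<in> \<omega> \<Longrightarrow> \<sigma> (point_rank \<omega> x) = point_rank (shift z \<omega>) (x + z)"
    and \<omega>: "\<omega> \<in> configurations \<Lambda>" "shift z \<omega> \<in> configurations \<Lambda>"
  shows "big (rstat \<rho> (shift z \<omega>, \<xi>)) (shift z \<omega> \<inter> shift z W) (shift z B) N = big (rstat \<rho> (\<omega>, permute \<sigma> \<xi>)) (\<omega> \<inter> W) B N"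
proof -
  have "card (cluster (rstat \<rho> (shift z \<omega>, \<xi>)) (shift z (\<omega> \<inter> W)) (x + z) \<inter> shift z B) = card (cluster (rstat \<rho> (\<omega>, permute \<sigma> \<xi>)) (\<omega> \<inter> W) x \<inter> B)"
    if "x \<in> \<omega> \<inter> W" for x
    by (subst cluster_shift[OF \<sigma> \<omega> _ that]) (auto simp: shift_Int[symmetric] card_shift)
  hence "(\<exists>x\<in>\<omega> \<inter> W. N \<le> real (card (cluster (rstat \<rho> (\<omega>, permute \<sigma> \<xi>)) (\<omega> \<inter> W) x \<inter> B)))
    = (\<exists>x\<in>\<omega> \<inter> W. N \<le> real (card (cluster (rstat \<rho> (shift z \<omega>, \<xi>)) (shift z (\<omega> \<inter> W)) (x + z) \<inter> shift z B)))"
    by auto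
  also have "\<dots> = (\<exists>y\<in>shift z (\<omega> \<inter> W). N \<le> real (card (cluster (rstat \<rho> (shift z \<omega>, \<xi>)) (shift z (\<omega> \<inter> W)) y \<inter> shift z B)))"
    unfolding shift_def by blast
  finally show ?thesis by (simp add: big_def shift_Int)
qed

section \<open>Quenched probabilities and their behaviour under shifts\<close>

lemma section_sets:
  assumes "Measurable.pred (rspace P) A" "\<omega> \<in> configurations \<Lambda>"
  shows "{\<xi>\<in>space mk. A (\<omega>, \<xi>)} \<in> sets mk"
proof -
  have "{z\<in>space (rspace P). A z} \<in> sets (P \<Otimes>\<^sub>M mk)" using assms(1) by (simp add: pred_def rspace_def)
  hence "Pair \<omega> -` {z\<in>space (rspace P). A z} \<in> sets mk" by (rule sets_Pair1)
  also have "Pair \<omega> -` {z\<in>space (rspace P). A z} = {\<xi>\<in>space mk. A (\<omega>, \<xi>)}"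
    using assms(2) by (auto simp: rspace_def space_pair_measure space_P)
  finally show ?thesis .
qed

definition quenched :: "('d realisation \<Rightarrow> bool) \<Rightarrow> (real^'d) set \<Rightarrow> real" where
  "quenched A \<omega> = measure mk {\<xi>\<in>space mk. A (\<omega>, \<xi>)}"

lemma quenched_range: "0 \<le> quenched A \<omega>" "quenched A \<omega> \<le> 1"
  by (simp_all add: quenched_def)

lemma measurable_quenched:
  assumes "Measurable.pred (rspace P) A" shows "quenched A \<in> borel_measurable P"
    and "(\<integral>\<^sup>+\<omega>. quenched A \<omega> \<partial>P) = emeasure (rspace P) {z\<in>space (rspace P). A z}"
proof -
  let ?A = "{z\<in>space (rspace P). A z}"
  have A: "?A \<in> sets (P \<Otimes>\<^sub>M mk)" using assms by (simp add: pred_def rspace_def)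
  have q: "quenched A \<omega> = enn2real (emeasure mk (Pair \<omega> -` ?A))" "ennreal (quenched A \<omega>) = emeasure mk (Pair \<omega> -` ?A)"
    if "\<omega> \<in> space P" for \<omega>
  proof -
    have "Pair \<omega> -` ?A = {\<xi>\<in>space mk. A (\<omega>, \<xi>)}"
      using that by (auto simp: rspace_def space_pair_measure)
    thus "quenched A \<omega> = enn2real (emeasure mk (Pair \<omega> -` ?A))" "ennreal (quenched A \<omega>) = emeasure mk (Pair \<omega> -` ?A)"
      by (simp_all add: quenched_def measure_def[symmetric] mk.emeasure_eq_measure)
  qed
  have m: "(\<lambda>\<omega>. emeasure mk (Pair \<omega> -` ?A)) \<in> borel_measurable P"
    by (rule mk.measurable_emeasure_Pair[OF A])
  hence "(\<lambda>\<omega>. enn2real (emeasure mk (Pair \<omega> -` ?A))) \<in> borel_measurable P" by measurable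
  thus "quenched A \<in> borel_measurable P" using q(1) by (subst measurable_cong) auto
  have "(\<integral>\<^sup>+\<omega>. quenched A \<omega> \<partial>P) = (\<integral>\<^sup>+\<omega>. emeasure mk (Pair \<omega> -` ?A) \<partial>P)"
    using q(2) by (intro nn_integral_cong)
  also have "\<dots> = emeasure (P \<Otimes>\<^sub>M mk) ?A" by (rule mk.emeasure_pair_measure_alt[OF A, symmetric])
  finally show "(\<integral>\<^sup>+\<omega>. quenched A \<omega> \<partial>P) = emeasure (rspace P) ?A" by (simp add: rspace_def)
qed

lemma quenched_permute:
  assumes A: "Measurable.pred (rspace P) A" and \<sigma>: "bij \<sigma>" and \<omega>: "\<omega> \<in> configurations \<Lambda>"
  shows "measure mk {\<xi>\<in>space mk. A (\<omega>, permute \<sigma> \<xi>)} = quenched A \<omega>"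
proof -
  have "quenched A \<omega> = measure (distr mk mk (permute \<sigma>)) {\<xi>\<in>space mk. A (\<omega>, \<xi>)}"
    by (simp add: permute[OF \<sigma>] quenched_def)
  also have "\<dots> = measure mk (permute \<sigma> -` {\<xi>\<in>space mk. A (\<omega>, \<xi>)} \<inter> space mk)"
    by (rule measure_distr[OF permute(1)[OF \<sigma>] section_sets[OF A \<omega>]])
  also have "permute \<sigma> -` {\<xi>\<in>space mk. A (\<omega>, \<xi>)} \<inter> space mk = {\<xi>\<in>space mk. A (\<omega>, permute \<sigma> \<xi>)}"
    using measurable_space[OF permute(1)[OF \<sigma>]] by auto
  finally show ?thesis by simp
qed

text \<open>Permuting i.i.d. marks does not change their law, so the permutation that comes with a
  shift disappears from the quenched probability. This is how stationarity of \<open>P\<close>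
  reaches graph events, although the numbering of the points is not shift-invariant.\<close>

lemma quenched_shift:
  assumes A: "Measurable.pred (rspace P) A" and \<omega>: "\<omega> \<in> configurations \<Lambda>" "shift z \<omega> \<in> configurations \<Lambda>"
    and eq: "\<And>\<sigma> \<xi>. bij \<sigma> \<Longrightarrow> (\<And>x. x \<in> \<omega> \<Longrightarrow> \<sigma> (point_rank \<omega> x) = point_rank (shift z \<omega>) (x + z)) \<Longrightarrow>
      A' (shift z \<omega>, \<xi>) = A (\<omega>, permute \<sigma> \<xi>)"
  shows "quenched A' (shift z \<omega>) = quenched A \<omega>"
proof -
  obtain \<sigma> where \<sigma>: "bij \<sigma>" "\<And>x. x \<in> \<omega> \<Longrightarrow> \<sigma> (point_rank \<omega> x) = point_rank (shift z \<omega>) (x + z)"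
    using rank_shift_bij[OF \<omega>] by blast
  have "{\<xi>\<in>space mk. A' (shift z \<omega>, \<xi>)} = {\<xi>\<in>space mk. A (\<omega>, permute \<sigma> \<xi>)}"
    using eq[OF \<sigma>] by auto
  hence "quenched A' (shift z \<omega>) = measure mk {\<xi>\<in>space mk. A (\<omega>, permute \<sigma> \<xi>)}"
    by (simp add: quenched_def)
  thus ?thesis using quenched_permute[OF A \<sigma>(1) \<omega>(1)] by simp
qed

text \<open>Restricting the marks to the window and renaming ranks into points maps the law of the
  marks to \<open>qm\<close>, because the rank is injective. The estimates for finite graphs
  therefore apply to the quenched probability.\<close>

lemma quenched_big:
  assumes \<omega>: "\<omega> \<in> configurations \<Lambda>" and W: "bounded W"
  shows "quenched (\<lambda>z. \<not> big (rstat \<rho> z) (fst z \<inter> W) B N) \<omega> = pbad (\<omega> \<inter> W) B N"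
proof -
  define X where "X = \<omega> \<inter> W"
  have fX: "finite X" unfolding X_def by (rule finite_config_Int[OF \<omega> W])
  let ?r = "point_rank \<omega>"
  have inj: "inj_on ?r X" using inj_on_point_rank[OF \<omega>] by (rule inj_on_subset) (auto simp: X_def)
  define T where "T = reindex X ?r (pairs X) (image ?r)"
  have sub: "e \<subseteq> X" if "e \<in> pairs X" for e using that by (auto simp: pairs_def)
  have 1: "inj_on (image ?r) (pairs X)"
    using inj_on_image_Pow[OF inj] by (rule inj_on_subset) (auto simp: pairs_def)
  have 2: "image ?r \<in> pairs X \<rightarrow> {e. card e = 2}"
    using inj by (auto simp: pairs_def card_image inj_on_subset)
  have T: "T \<in> measurable mk (qm X)" "distr mk (qm X) T = qm X"
    unfolding T_def qm_def using inj 1 2 by (intro distr_reindex; simp)+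
  have eq: "big (rstat \<rho> (\<omega>, \<xi>)) X B N = big (stat \<rho> (fst (T \<xi>)) (snd (T \<xi>))) X B N" for \<xi>
  proof -
    have "rstat \<rho> (\<omega>, \<xi>) e = stat \<rho> (fst (T \<xi>)) (snd (T \<xi>)) e" if e: "e \<in> pairs X" for e
      using e
    proof (rule pairsE)
      fix x y assume xy: "e = {x, y}" "x \<noteq> y" "x \<in> X" "y \<in> X"
      show ?thesis using xy e unfolding rstat_def xy(1) stat_pair[OF xy(2)]
        by (cases \<xi>) (simp add: T_def reindex_def umark_def emark_def)
    qed
    hence "{e\<in>pairs X. rstat \<rho> (\<omega>, \<xi>) e} = {e\<in>pairs X. stat \<rho> (fst (T \<xi>)) (snd (T \<xi>)) e}" by auto
    thus ?thesis using big_restrict[of "rstat \<rho> (\<omega>, \<xi>)" X B N] big_restrict[of "stat \<rho> (fst (T \<xi>)) (snd (T \<xi>))" X B N] by simp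
  qed
  have s: "{z\<in>space (qm X). \<not> big (stat \<rho> (fst z) (snd z)) X B N} \<in> sets (qm X)"
    using pred_big[OF fX, of B N] by (simp add: pred_def)
  have "pbad X B N = measure (distr mk (qm X) T) {z\<in>space (qm X). \<not> big (stat \<rho> (fst z) (snd z)) X B N}"
    by (simp add: T pbad_def)
  also have "\<dots> = measure mk (T -` {z\<in>space (qm X). \<not> big (stat \<rho> (fst z) (snd z)) X B N} \<inter> space mk)"
    by (rule measure_distr[OF T(1) s])
  also have "T -` {z\<in>space (qm X). \<not> big (stat \<rho> (fst z) (snd z)) X B N} \<inter> space mk = {\<xi>\<in>space mk. \<not> big (rstat \<rho> (\<omega>, \<xi>)) X B N}"
    using measurable_space[OF T(1)] by (auto simp: eq)
  finally show ?thesis by (simp add: quenched_def X_def)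
qed

end

section \<open>The zero-one law\<close>

lemma determined_by_mono: "determined_by I E \<Longrightarrow> I \<subseteq> I' \<Longrightarrow> determined_by I' E"
proof -
  assume E: "determined_by I E" and I: "I \<subseteq> I'"
  show ?thesis
    unfolding determined_by_def
  proof (intro ballI impI)
    fix \<xi> \<xi>' assume x: "\<xi> \<in> space mk" "\<xi>' \<in> space mk"
      and eq: "(\<forall>i\<in>I'. fst \<xi> i = fst \<xi>' i) \<and> (\<forall>e. card e = 2 \<and> e \<subseteq> I' \<longrightarrow> snd \<xi> e = snd \<xi>' e)"
    show "\<xi> \<in> E \<longleftrightarrow> \<xi>' \<in> E"
      by (rule E[unfolded determined_by_def, rule_format, OF x]) (use eq I in auto)
  qed
qed

lemma determined_by_section:
  assumes d: "determined_by I (Pair \<omega> -` A)"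
  shows "determined_by I {\<xi>\<in>space mk. (\<omega>, \<xi>) \<in> A}"
  unfolding determined_by_def
proof (intro ballI impI)
  fix \<xi> \<xi>' assume x: "\<xi> \<in> space mk" "\<xi>' \<in> space mk"
    and eq: "(\<forall>i\<in>I. fst \<xi> i = fst \<xi>' i) \<and> (\<forall>e. card e = 2 \<and> e \<subseteq> I \<longrightarrow> snd \<xi> e = snd \<xi>' e)"
  show "\<xi> \<in> {\<xi>\<in>space mk. (\<omega>, \<xi>) \<in> A} \<longleftrightarrow> \<xi>' \<in> {\<xi>\<in>space mk. (\<omega>, \<xi>) \<in> A}"
    using d[unfolded determined_by_def, rule_format, OF x eq] x by simp
qed

context conn_process
begin

lemma prob_space_rspace: "prob_space (rspace P)"
  unfolding rspace_def by (intro prob_space_pair prob_P mk.prob_space_axioms)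

sublocale N: prob_space "rspace P" by (rule prob_space_rspace)

text \<open>A cylinder in the marks only: one \<open>m\<close> serves all configurations, and the
  dependence on the configuration is unrestricted.\<close>

definition cyl :: "nat \<Rightarrow> 'd realisation set \<Rightarrow> bool" where
  "cyl m A \<longleftrightarrow> (\<forall>\<omega>\<in>space P. determined_by {..<m} (Pair \<omega> -` A))"

definition cyl_approx :: "'d realisation set set" where
  "cyl_approx = {A\<in>sets (rspace P). \<forall>\<delta>>0. \<exists>m. \<exists>A'\<in>sets (rspace P). cyl m A' \<and> measure (rspace P) ((A - A') \<union> (A' - A)) < \<delta>}"

lemma cyl_mono: "cyl m A \<Longrightarrow> m \<le> m' \<Longrightarrow> cyl m' A"
  unfolding cyl_def using determined_by_mono[of "{..<m}" _ "{..<m'}"] by auto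

lemma cyl_approxI: "A \<in> sets (rspace P) \<Longrightarrow> cyl m A \<Longrightarrow> A \<in> cyl_approx"
  unfolding cyl_approx_def by (intro CollectI conjI allI impI exI[of _ m] bexI[of _ A]) simp_all

text \<open>For a countable union, finitely many sets already exhaust the measure up to
  \<open>\<delta> / 2\<close>, and these are approximated one by one. Symmetric differences are
  unchanged by complements.\<close>

lemma sigma_algebra_cyl_approx: "sigma_algebra (space (rspace P)) cyl_approx"
  unfolding sigma_algebra_iff2
proof (intro conjI ballI allI impI)
  show "cyl_approx \<subseteq> Pow (space (rspace P))" using sets.sets_into_space by (auto simp: cyl_approx_def)
  show "{} \<in> cyl_approx" by (rule cyl_approxI[of _ 0]) (auto simp: cyl_def determined_by_def)
next
  fix A assume A: "A \<in> cyl_approx"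
  show "space (rspace P) - A \<in> cyl_approx"
    unfolding cyl_approx_def
  proof (intro CollectI conjI allI impI)
    show "space (rspace P) - A \<in> sets (rspace P)" using A by (auto simp: cyl_approx_def)
    fix \<delta> :: real assume "0 < \<delta>"
    then obtain m A' where A': "A' \<in> sets (rspace P)" "cyl m A'" "measure (rspace P) ((A - A') \<union> (A' - A)) < \<delta>"
      using A by (auto simp: cyl_approx_def)
    have "(space (rspace P) - A - (space (rspace P) - A')) \<union> (space (rspace P) - A' - (space (rspace P) - A)) = (A - A') \<union> (A' - A)"
      using A A'(1) sets.sets_into_space by (auto simp: cyl_approx_def)
    moreover have "cyl m (space (rspace P) - A')"
      unfolding cyl_def
    proof
      fix \<omega> assume \<omega>: "\<omega> \<in> space P"
      have "determined_by {..<m} (Pair \<omega> -` A')" using A'(2) \<omega> by (simp add: cyl_def)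
      thus "determined_by {..<m} (Pair \<omega> -` (space (rspace P) - A'))"
      proof -
        assume d: "determined_by {..<m} (Pair \<omega> -` A')"
        have m: "\<xi> \<in> Pair \<omega> -` (space (rspace P) - A') \<longleftrightarrow> \<xi> \<notin> Pair \<omega> -` A'" if "\<xi> \<in> space mk" for \<xi>
          using that \<omega> by (simp add: rspace_def space_pair_measure[of P])
        show ?thesis unfolding determined_by_def
        proof (intro ballI impI)
          fix \<xi> \<xi>' assume x: "\<xi> \<in> space mk" "\<xi>' \<in> space mk"
            and eq: "(\<forall>i\<in>{..<m}. fst \<xi> i = fst \<xi>' i) \<and> (\<forall>e. card e = 2 \<and> e \<subseteq> {..<m} \<longrightarrow> snd \<xi> e = snd \<xi>' e)"
          show "\<xi> \<in> Pair \<omega> -` (space (rspace P) - A') \<longleftrightarrow> \<xi>' \<in> Pair \<omega> -` (space (rspace P) - A')"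
            unfolding m[OF x(1)] m[OF x(2)] by (subst d[unfolded determined_by_def, rule_format, OF x eq]) simp
        qed
      qed
    qed
    ultimately show "\<exists>m. \<exists>A'\<in>sets (rspace P). cyl m A' \<and> measure (rspace P) ((space (rspace P) - A - A') \<union> (A' - (space (rspace P) - A))) < \<delta>"
      using A' by (intro exI[of _ m] bexI[of _ "space (rspace P) - A'"]) auto
  qed
next
  fix A :: "nat \<Rightarrow> 'd realisation set" assume "range A \<subseteq> cyl_approx"
  hence A: "A i \<in> cyl_approx" for i by auto
  have As: "A i \<in> sets (rspace P)" for i using A[of i] by (simp add: cyl_approx_def)
  show "(\<Union>i. A i) \<in> cyl_approx"
    unfolding cyl_approx_def
  proof (intro CollectI conjI allI impI)
    show Us: "(\<Union>i. A i) \<in> sets (rspace P)" using As by auto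
    fix \<delta> :: real assume \<delta>: "0 < \<delta>"
    define V where "V = (\<lambda>n. \<Union>i<n. A i)"
    have Vs: "V n \<in> sets (rspace P)" for n using As by (auto simp: V_def)
    have "(\<lambda>n. measure (rspace P) (V n)) \<longlonglongrightarrow> measure (rspace P) (\<Union>n. V n)"
    proof (rule N.finite_Lim_measure_incseq)
      show "incseq V" by (rule incseq_SucI) (auto simp: V_def less_Suc_eq)
    qed (use Vs in auto)
    moreover have UV: "(\<Union>n. V n) = (\<Union>i. A i)" by (auto simp: V_def)
    ultimately have "eventually (\<lambda>n. measure (rspace P) (\<Union>i. A i) - \<delta> / 2 < measure (rspace P) (V n)) sequentially"
      using \<delta> by (intro order_tendstoD(1)) auto
    then obtain n where n: "measure (rspace P) (\<Union>i. A i) - \<delta> / 2 < measure (rspace P) (V n)"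
      by (auto simp: eventually_sequentially)
    \<comment> \<open>The denominator has \<open>n + 1\<close> in place of \<open>n\<close>, which
      avoids division by 0 and makes \<open>real n * \<eta> < \<delta> / 2\<close> strict.\<close>
    define \<eta> where "\<eta> = \<delta> / (2 * real (n + 1))"
    have \<eta>: "0 < \<eta>" "real n * \<eta> < \<delta> / 2" using \<delta> by (auto simp: \<eta>_def field_simps)
    have "\<forall>i. \<exists>p. snd p \<in> sets (rspace P) \<and> cyl (fst p) (snd p) \<and> measure (rspace P) ((A i - snd p) \<union> (snd p - A i)) < \<eta>"
    proof
      fix i
      obtain m A' where "A' \<in> sets (rspace P)" "cyl m A'" "measure (rspace P) ((A i - A') \<union> (A' - A i)) < \<eta>"
        using A[of i] \<eta>(1) by (auto simp: cyl_approx_def)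
      thus "\<exists>p. snd p \<in> sets (rspace P) \<and> cyl (fst p) (snd p) \<and> measure (rspace P) ((A i - snd p) \<union> (snd p - A i)) < \<eta>"
        by (intro exI[of _ "(m, A')"]) simp
    qed
    then obtain p where p: "\<forall>i. snd (p i) \<in> sets (rspace P) \<and> cyl (fst (p i)) (snd (p i)) \<and> measure (rspace P) ((A i - snd (p i)) \<union> (snd (p i) - A i)) < \<eta>"
      by (rule choice[THEN exE])
    define m where "m = (\<lambda>i. fst (p i))"
    define A' where "A' = (\<lambda>i. snd (p i))"
    have A': "A' i \<in> sets (rspace P)" "cyl (m i) (A' i)" "measure (rspace P) ((A i - A' i) \<union> (A' i - A i)) < \<eta>" for i
      using p by (simp_all add: m_def A'_def)
    define B where "B = (\<Union>i<n. A' i)"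
    have Bs: "B \<in> sets (rspace P)" using A' by (auto simp: B_def)
    have "cyl (\<Sum>i<n. m i) B"
      unfolding cyl_def
    proof
      fix \<omega> assume \<omega>: "\<omega> \<in> space P"
      have dd: "determined_by {..<\<Sum>i<n. m i} (Pair \<omega> -` A' i)" if "i < n" for i
      proof -
        have "m i \<le> (\<Sum>i<n. m i)" using that by (intro member_le_sum) auto
        thus ?thesis using cyl_mono[OF A'(2)[of i]] \<omega> by (simp add: cyl_def)
      qed
      show "determined_by {..<\<Sum>i<n. m i} (Pair \<omega> -` B)"
        unfolding determined_by_def
      proof (intro ballI impI)
        fix \<xi> \<xi>' assume x: "\<xi> \<in> space mk" "\<xi>' \<in> space mk"
          and eq: "(\<forall>i\<in>{..<\<Sum>i<n. m i}. fst \<xi> i = fst \<xi>' i) \<and> (\<forall>e. card e = 2 \<and> e \<subseteq> {..<\<Sum>i<n. m i} \<longrightarrow> snd \<xi> e = snd \<xi>' e)"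
        have "(\<omega>, \<xi>) \<in> A' i \<longleftrightarrow> (\<omega>, \<xi>') \<in> A' i" if "i < n" for i
          using dd[OF that, unfolded determined_by_def, rule_format, OF x eq] by simp
        thus "\<xi> \<in> Pair \<omega> -` B \<longleftrightarrow> \<xi>' \<in> Pair \<omega> -` B" by (simp add: B_def)
      qed
    qed
    moreover have "measure (rspace P) (((\<Union>i. A i) - B) \<union> (B - (\<Union>i. A i))) < \<delta>"
    proof -
      have "((\<Union>i. A i) - B) \<union> (B - (\<Union>i. A i)) \<subseteq> ((\<Union>i. A i) - V n) \<union> (\<Union>i<n. (A i - A' i) \<union> (A' i - A i))"
        by (auto simp: B_def V_def)
      hence "measure (rspace P) (((\<Union>i. A i) - B) \<union> (B - (\<Union>i. A i))) \<le> measure (rspace P) (((\<Union>i. A i) - V n) \<union> (\<Union>i<n. (A i - A' i) \<union> (A' i - A i)))"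
        using Us Vs As A'(1) by (intro N.finite_measure_mono) auto
      also have "\<dots> \<le> measure (rspace P) ((\<Union>i. A i) - V n) + measure (rspace P) (\<Union>i<n. (A i - A' i) \<union> (A' i - A i))"
        using Us Vs As A'(1) by (intro measure_Un_le) auto
      also have "measure (rspace P) ((\<Union>i. A i) - V n) < \<delta> / 2"
        using n Us Vs UV by (subst N.finite_measure_Diff) (auto simp: V_def)
      also have "measure (rspace P) (\<Union>i<n. (A i - A' i) \<union> (A' i - A i)) \<le> (\<Sum>i<n. measure (rspace P) ((A i - A' i) \<union> (A' i - A i)))"
        using As A'(1) by (intro measure_UNION_le) auto
      also have "\<dots> \<le> (\<Sum>i<n. \<eta>)" using A'(3) by (intro sum_mono less_imp_le)
      also have "\<dots> = real n * \<eta>" by simp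
      also have "\<dots> < \<delta> / 2" by (rule \<eta>(2))
      finally show ?thesis by simp
    qed
    ultimately show "\<exists>m. \<exists>A'\<in>sets (rspace P). cyl m A' \<and> measure (rspace P) (((\<Union>i. A i) - A') \<union> (A' - (\<Union>i. A i))) < \<delta>"
      using Bs by (intro exI[of _ "\<Sum>i<n. m i"] bexI[of _ B] conjI)
  qed
qed

text \<open>All coordinate maps are measurable with respect to the \<sigma>-algebra of approximable
  sets, hence so is the identity map into \<open>rspace P\<close>; its preimages are the measurable
  sets themselves.\<close>

lemma sets_cyl_approx:
  assumes "A \<in> sets (rspace P)" shows "A \<in> cyl_approx"
proof -
  interpret L: sigma_algebra "space (rspace P)" cyl_approx by (rule sigma_algebra_cyl_approx)
  define L where "L = sigma (space (rspace P)) cyl_approx"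
  have L: "space L = space (rspace P)" "sets L = cyl_approx"
    using L.space_closed by (auto simp: L_def L.sets_measure_of_eq)
  have sp: "space (rspace P) = space P \<times> space vmarks \<times> space emarks"
    by (simp add: rspace_def space_pair_measure)
  have 1: "fst \<in> measurable L P"
  proof (rule measurableI)
    show "fst z \<in> space P" if "z \<in> space L" for z using that by (auto simp: L sp)
    fix B assume B: "B \<in> sets P"
    have "fst -` B \<inter> space L \<in> sets (rspace P)"
      unfolding L using B by (intro measurable_sets[of _ _ P]) (simp_all add: rspace_def)
    thus "fst -` B \<inter> space L \<in> sets L"
      unfolding L(2) by (rule cyl_approxI[of _ 0]) (auto simp: cyl_def determined_by_def L sp space_pair_measure)
  qed
  have 2: "(\<lambda>z. fst (snd z)) \<in> measurable L vmarks"
  proof (rule measurable_PiM_single'[of UNIV "\<lambda>i z. fst (snd z) i"])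
    show "(\<lambda>z i. fst (snd z) i) \<in> space L \<rightarrow> (\<Pi>\<^sub>E i\<in>UNIV. space uniform01)" by (auto simp: L sp space_PiM)
    fix i :: nat
    show "(\<lambda>z. fst (snd z) i) \<in> measurable L uniform01"
    proof (rule measurableI)
      fix B assume B: "B \<in> sets uniform01"
      have "(\<lambda>z. fst (snd z) i) -` B \<inter> space L \<in> sets (rspace P)"
        unfolding L
      proof (rule measurable_sets[OF _ B])
        show "(\<lambda>z. fst (snd z) i) \<in> measurable (rspace P) uniform01" unfolding rspace_def by measurable
      qed
      thus "(\<lambda>z. fst (snd z) i) -` B \<inter> space L \<in> sets L"
        unfolding L(2) by (rule cyl_approxI[of _ "Suc i"]) (auto simp: cyl_def determined_by_def L sp space_pair_measure)
    qed simp
  qed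
  have 3: "(\<lambda>z. snd (snd z)) \<in> measurable L emarks"
  proof (rule measurable_PiM_single'[of "{e. card e = 2}" "\<lambda>e z. snd (snd z) e"])
    show "(\<lambda>z e. snd (snd z) e) \<in> space L \<rightarrow> (\<Pi>\<^sub>E e\<in>{e. card e = 2}. space uniform01)" by (auto simp: L sp space_PiM)
    fix e :: "nat set" assume e: "e \<in> {e. card e = 2}"
    hence "finite e" by (auto intro: card_ge_0_finite)
    then obtain m where m: "e \<subseteq> {..<m}" by (auto simp: finite_nat_iff_bounded)
    show "(\<lambda>z. snd (snd z) e) \<in> measurable L uniform01"
    proof (rule measurableI)
      fix B assume B: "B \<in> sets uniform01"
      have "(\<lambda>z. snd (snd z) e) -` B \<inter> space L \<in> sets (rspace P)"
        unfolding L
      proof (rule measurable_sets[OF _ B])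
        show "(\<lambda>z. snd (snd z) e) \<in> measurable (rspace P) uniform01" unfolding rspace_def using e by measurable
      qed
      thus "(\<lambda>z. snd (snd z) e) -` B \<inter> space L \<in> sets L"
        unfolding L(2)
      proof (rule cyl_approxI[of _ m])
        show "cyl m ((\<lambda>z. snd (snd z) e) -` B \<inter> space L)"
          using m e by (auto simp: cyl_def determined_by_def L sp space_pair_measure)
      qed
    qed simp
  qed
  have "(\<lambda>z. (fst z, fst (snd z), snd (snd z))) \<in> measurable L (rspace P)"
    unfolding rspace_def using 1 2 3 by (intro measurable_Pair) auto
  hence "(\<lambda>z. z) -` A \<inter> space L \<in> sets L" using assms by (intro measurable_sets) simp_all
  thus ?thesis using sets.sets_into_space[OF assms] by (simp add: L Int_absorb2)
qed

end

section \<open>Percolation given the configuration\<close>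

context stat_process
begin

lemma quenched_hits_shift:
  assumes "\<omega> \<in> configurations \<Lambda>" "z \<in> \<Lambda>" "B \<in> sets borel"
  shows "quenched (\<lambda>w. hits w (shift z B)) (shift z \<omega>) = quenched (\<lambda>w. hits w B) \<omega>"
  by (rule quenched_shift[OF pred_hits[OF assms(3)] assms(1) shift_config[OF assms(1,2)]])
    (rule hits_shift[OF _ _ assms(1) shift_config[OF assms(1,2)]], auto)

definition perc :: "(real^'d) set \<Rightarrow> real" where
  "perc = quenched (\<lambda>w. hits w UNIV)"

lemma perc_shift: "\<omega> \<in> configurations \<Lambda> \<Longrightarrow> z \<in> \<Lambda> \<Longrightarrow> perc (shift z \<omega>) = perc \<omega>"
  using quenched_hits_shift[of \<omega> z UNIV] by (simp add: perc_def)

lemma perc_finite: "finite \<omega> \<Longrightarrow> perc \<omega> = 0"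
proof -
  assume f: "finite \<omega>"
  have "\<not> hits (\<omega>, \<xi>) UNIV" for \<xi>
    unfolding hits_def using f cluster_subset[of _ \<omega> "rstat \<rho> (\<omega>, \<xi>)"] by (auto dest: finite_subset)
  thus ?thesis by (simp add: perc_def quenched_def)
qed

text \<open>A point outside the ball is preceded by all points inside it.\<close>

lemma point_rank_far:
  assumes \<omega>: "\<omega> \<in> configurations \<Lambda>" and r: "m \<le> card (\<omega> \<inter> cball 0 r)" and x: "x \<in> \<omega>" "point_rank \<omega> x < m"
  shows "norm x \<le> r"
proof (rule ccontr)
  assume "\<not> norm x \<le> r"
  hence "\<omega> \<inter> cball 0 r \<subseteq> {y\<in>\<omega>. precedes y x}" by (auto simp: precedes_def)
  hence "card (\<omega> \<inter> cball 0 r) \<le> point_rank \<omega> x"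
    unfolding point_rank_def by (intro card_mono finite_preceding[OF \<omega>])
  thus False using r x by simp
qed

lemma measure_symdiff:
  assumes "A \<in> sets mk" "B \<in> sets mk"
  shows "\<bar>measure mk A - measure mk B\<bar> \<le> measure mk ((A - B) \<union> (B - A))"
proof -
  have "measure mk A \<le> measure mk (B \<union> ((A - B) \<union> (B - A)))" "measure mk B \<le> measure mk (A \<union> ((A - B) \<union> (B - A)))"
    using assms by (auto intro!: mk.finite_measure_mono)
  moreover have "measure mk (B \<union> ((A - B) \<union> (B - A))) \<le> measure mk B + measure mk ((A - B) \<union> (B - A))"
    "measure mk (A \<union> ((A - B) \<union> (B - A))) \<le> measure mk A + measure mk ((A - B) \<union> (B - A))"
    using assms by (auto intro!: measure_Un_le)
  ultimately show ?thesis by linarith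
qed

text \<open>Given the configuration, a translation-invariant event is approximated by events determined by the first
  \<open>m\<close> points as seen from two far apart locations, and these are independent.\<close>

lemma perc_almost_idempotent:
  assumes A': "A' \<in> sets (rspace P)" "cyl m A'" and \<omega>: "\<omega> \<in> configurations \<Lambda>" and z: "z \<in> \<Lambda>" "2 * r < norm z"
    and inf: "infinite \<omega>" and r: "m \<le> card (\<omega> \<inter> cball 0 r)" "m \<le> card (shift z \<omega> \<inter> cball 0 r)"
  defines "sd \<equiv> quenched (\<lambda>w. hits w UNIV \<and> w \<notin> A' \<or> w \<in> A' \<and> \<not> hits w UNIV)"
  shows "\<bar>perc \<omega> - (perc \<omega>)^2\<bar> \<le> 2 * (sd \<omega> + sd (shift z \<omega>))"
proof -
  let ?\<omega>' = "shift z \<omega>"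
  have \<omega>': "?\<omega>' \<in> configurations \<Lambda>" by (rule shift_config[OF \<omega> z(1)])
  obtain \<sigma> where \<sigma>: "bij \<sigma>" "\<And>x. x \<in> \<omega> \<Longrightarrow> \<sigma> (point_rank \<omega> x) = point_rank ?\<omega>' (x + z)"
    using rank_shift_bij[OF \<omega> \<omega>'] by blast
  have hp: "Measurable.pred (rspace P) (\<lambda>w. hits w UNIV)" by (rule pred_hits) simp
  have A'p: "Measurable.pred (rspace P) (\<lambda>w. w \<in> A')" using A'(1) by simp
  have ef: "\<xi> \<in> space mk \<Longrightarrow> permute \<sigma> \<xi> \<in> space mk" for \<xi> using measurable_space[OF permute(1)[OF \<sigma>(1)]] by auto
  \<comment> \<open>\<open>D\<close> is the shift-invariant event, written in the marks of the
    shifted configuration. \<open>E1\<close> approximates it through the first points around the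
    origin of \<open>\<omega>\<close>, \<open>E2\<close> through those around the origin of the
    shifted configuration.\<close>
  define D where "D = {\<xi>\<in>space mk. hits (?\<omega>', \<xi>) UNIV}"
  define E1 where "E1 = {\<xi>\<in>space mk. (\<omega>, permute \<sigma> \<xi>) \<in> A'}"
  define E2 where "E2 = {\<xi>\<in>space mk. (?\<omega>', \<xi>) \<in> A'}"
  have Ds: "D \<in> sets mk" unfolding D_def by (rule section_sets[OF hp \<omega>'])
  have E2s: "E2 \<in> sets mk" unfolding E2_def by (rule section_sets[OF A'p \<omega>'])
  have E1s: "E1 \<in> sets mk"
  proof -
    have "E1 = permute \<sigma> -` {\<xi>\<in>space mk. (\<omega>, \<xi>) \<in> A'} \<inter> space mk" using ef by (auto simp: E1_def)
    thus ?thesis using measurable_sets[OF permute(1)[OF \<sigma>(1)] section_sets[OF A'p \<omega>]] by simp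
  qed
  have Dh: "D = {\<xi>\<in>space mk. hits (\<omega>, permute \<sigma> \<xi>) UNIV}"
    unfolding D_def using hits_shift[OF \<sigma> \<omega> \<omega>', of _ UNIV] by simp
  have q: "measure mk D = perc \<omega>"
    using quenched_permute[OF hp \<sigma>(1) \<omega>] unfolding Dh perc_def by simp
  have sdp: "Measurable.pred (rspace P) (\<lambda>w. hits w UNIV \<and> w \<notin> A' \<or> w \<in> A' \<and> \<not> hits w UNIV)"
    using hp A'p by measurable
  have s1: "measure mk ((E1 - D) \<union> (D - E1)) = sd \<omega>"
  proof -
    have "(E1 - D) \<union> (D - E1) = {\<xi>\<in>space mk. hits (\<omega>, permute \<sigma> \<xi>) UNIV \<and> (\<omega>, permute \<sigma> \<xi>) \<notin> A' \<or> (\<omega>, permute \<sigma> \<xi>) \<in> A' \<and> \<not> hits (\<omega>, permute \<sigma> \<xi>) UNIV}"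
      by (auto simp: E1_def Dh)
    thus ?thesis using quenched_permute[OF sdp \<sigma>(1) \<omega>] by (simp add: sd_def)
  qed
  have s2: "measure mk ((E2 - D) \<union> (D - E2)) = sd ?\<omega>'"
    unfolding sd_def quenched_def by (rule arg_cong[where f = "measure mk"]) (auto simp: E2_def D_def)
  have d2: "determined_by {..<m} E2"
  proof -
    have "determined_by {..<m} (Pair ?\<omega>' -` A')" using A'(2) \<omega>' by (simp add: cyl_def space_P)
    thus ?thesis unfolding E2_def by (rule determined_by_section)
  qed
  have d1: "determined_by (\<sigma> ` {..<m}) E1"
    unfolding determined_by_def
  proof (intro ballI impI)
    fix \<xi> \<xi>' assume x: "\<xi> \<in> space mk" "\<xi>' \<in> space mk"
      and eq: "(\<forall>i\<in>\<sigma> ` {..<m}. fst \<xi> i = fst \<xi>' i) \<and> (\<forall>e. card e = 2 \<and> e \<subseteq> \<sigma> ` {..<m} \<longrightarrow> snd \<xi> e = snd \<xi>' e)"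
    have "determined_by {..<m} (Pair \<omega> -` A')" using A'(2) \<omega> by (simp add: cyl_def space_P)
    moreover have f: "fst (permute \<sigma> \<xi>) i = fst (permute \<sigma> \<xi>') i" if "i \<in> {..<m}" for i
      using eq that by (simp add: permute_def reindex_def split_beta)
    moreover have s: "snd (permute \<sigma> \<xi>) e = snd (permute \<sigma> \<xi>') e" if "card e = 2 \<and> e \<subseteq> {..<m}" for e
    proof -
      have "card (\<sigma> ` e) = card e" by (rule card_image, rule inj_on_subset[OF bij_is_inj[OF \<sigma>(1)]]) simp
      hence "card (\<sigma> ` e) = 2" using that by simp
      moreover have "\<sigma> ` e \<subseteq> \<sigma> ` {..<m}" using that by (intro image_mono) simp
      ultimately have "snd \<xi> (\<sigma> ` e) = snd \<xi>' (\<sigma> ` e)" using eq by blast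
      thus ?thesis using that by (simp add: permute_def reindex_def split_beta)
    qed
    ultimately have "permute \<sigma> \<xi> \<in> Pair \<omega> -` A' \<longleftrightarrow> permute \<sigma> \<xi>' \<in> Pair \<omega> -` A'"
    proof -
      assume d: "determined_by {..<m} (Pair \<omega> -` A')"
      show ?thesis
        by (rule d[unfolded determined_by_def, rule_format, OF ef[OF x(1)] ef[OF x(2)]]) (use f s in auto)
    qed
    thus "\<xi> \<in> E1 \<longleftrightarrow> \<xi>' \<in> E1" using x by (simp add: E1_def)
  qed
  \<comment> \<open>A point among the first \<open>m\<close> in both rankings would be within
    \<open>r\<close> of both origins, which \<open>2 * r < norm z\<close> forbids.\<close>
  have disj: "\<sigma> ` {..<m} \<inter> {..<m} = {}"
  proof (rule ccontr)
    assume "\<sigma> ` {..<m} \<inter> {..<m} \<noteq> {}"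
    then obtain i where i: "i < m" "\<sigma> i < m" by auto
    have "i \<in> point_rank \<omega> ` \<omega>" using point_rank_initial[OF \<omega>] inf by simp
    then obtain x where x: "x \<in> \<omega>" "i = point_rank \<omega> x" by auto
    have 1: "norm x \<le> r" using point_rank_far[OF \<omega> r(1) x(1)] x i by simp
    have "x + z \<in> ?\<omega>'" using x by (simp add: shift_iff)
    hence 2: "norm (x + z) \<le> r" using point_rank_far[OF \<omega>' r(2)] \<sigma>(2)[OF x(1)] x i by simp
    have "norm z \<le> norm (x + z) + norm x" using norm_triangle_ineq4[of "x + z" x] by simp
    thus False using 1 2 z(2) by simp
  qed
  have ind: "measure mk (E1 \<inter> E2) = measure mk E1 * measure mk E2"
    by (rule determined_independent[OF E1s E2s d1 d2 disj])
  have b1: "\<bar>measure mk E1 - perc \<omega>\<bar> \<le> sd \<omega>" using measure_symdiff[OF E1s Ds] unfolding q s1 .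
  have b2: "\<bar>measure mk E2 - perc \<omega>\<bar> \<le> sd ?\<omega>'" using measure_symdiff[OF E2s Ds] unfolding q s2 .
  have b12: "\<bar>measure mk (E1 \<inter> E2) - perc \<omega>\<bar> \<le> sd \<omega> + sd ?\<omega>'"
  proof -
    have "\<bar>measure mk (E1 \<inter> E2) - measure mk D\<bar> \<le> measure mk (((E1 \<inter> E2) - D) \<union> (D - (E1 \<inter> E2)))"
      by (rule measure_symdiff) (use E1s E2s Ds in auto)
    also have "\<dots> \<le> measure mk (((E1 - D) \<union> (D - E1)) \<union> ((E2 - D) \<union> (D - E2)))"
      using E1s E2s Ds by (intro mk.finite_measure_mono) auto
    also have "\<dots> \<le> sd \<omega> + sd ?\<omega>'"
      unfolding s1[symmetric] s2[symmetric] using E1s E2s Ds by (intro measure_Un_le) auto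
    finally show ?thesis unfolding q .
  qed
  \<comment> \<open>By independence the intersection has probability \<open>a * b\<close>. It is
    close to \<open>p\<close>, as both events approximate \<open>D\<close>, and close to
    \<open>p^2\<close>, as \<open>a\<close> and \<open>b\<close> are both close to
    \<open>p\<close>.\<close>
  define a b p where "a = measure mk E1" and "b = measure mk E2" and "p = perc \<omega>"
  have rg: "0 \<le> a" "a \<le> 1" "0 \<le> p" "p \<le> 1"
    using mk.prob_le_1[of E1] quenched_range by (auto simp: a_def p_def perc_def)
  have "a * b - p^2 = a * (b - p) + p * (a - p)" by (simp add: power2_eq_square algebra_simps)
  hence "\<bar>a * b - p^2\<bar> \<le> \<bar>a * (b - p)\<bar> + \<bar>p * (a - p)\<bar>" by (metis abs_triangle_ineq)
  also have "\<dots> \<le> \<bar>b - p\<bar> + \<bar>a - p\<bar>"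
    unfolding abs_mult using rg by (intro add_mono mult_left_le_one_le) auto
  finally have "\<bar>a * b - p^2\<bar> \<le> sd ?\<omega>' + sd \<omega>"
    using add_mono[OF b2 b1] unfolding a_def b_def p_def by (rule order_trans)
  moreover have "\<bar>a * b - p\<bar> \<le> sd \<omega> + sd ?\<omega>'" using b12 unfolding ind a_def b_def p_def .
  moreover have "\<bar>p - p^2\<bar> \<le> \<bar>a * b - p^2\<bar> + \<bar>a * b - p\<bar>"
    using abs_triangle_ineq4[of "a * b - p^2" "a * b - p"] by simp
  ultimately have "\<bar>p - p^2\<bar> \<le> (sd ?\<omega>' + sd \<omega>) + (sd \<omega> + sd ?\<omega>')"
    by (meson add_mono order_trans)
  thus ?thesis unfolding p_def[symmetric] by (simp add: algebra_simps)
qed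

end

lemma integer_lattice_unbounded: "\<exists>i :: int^'d. r < norm (int_vec i)"
proof -
  obtain n :: nat where n: "r < real n" using reals_Archimedean2 by blast
  define i :: "int^'d" where "i = (\<chi> j. int n)"
  obtain j :: 'd where True by simp
  have "real n = \<bar>int_vec i $ j\<bar>" by (simp add: int_vec_def i_def)
  also have "\<dots> \<le> norm (int_vec i)" by (rule component_le_norm_cart)
  finally show ?thesis using n by (intro exI[of _ i]) simp
qed

context stat_process
begin

lemma perc_measurable: "perc \<in> borel_measurable P"
  unfolding perc_def by (intro measurable_quenched pred_hits) simp

lemma perc_range: "0 \<le> perc \<omega>" "perc \<omega> \<le> 1"
  unfolding perc_def by (rule quenched_range)+

lemma measurable_card_P: "B \<in> sets borel \<Longrightarrow> bounded B \<Longrightarrow> (\<lambda>\<omega>. card (\<omega> \<inter> B)) \<in> measurable P (count_space UNIV)"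
  using measurable_card_Int measurable_cong_sets[OF sets_P refl] by blast

text \<open>The percolation event is nearly independent of itself, so the integral of the distance
  between \<open>perc\<close> and its square is arbitrarily small. In the constant 6, two
  approximation errors count twice, and \<open>m\<close> points may be missing within radius
  \<open>k\<close> at either of the two origins.\<close>

lemma perc_zero_one: "AE \<omega> in P. perc \<omega> = 0 \<or> perc \<omega> = 1"
proof -
  have hp: "Measurable.pred (rspace P) (\<lambda>w. hits w UNIV)" by (rule pred_hits) simp
  note [measurable] = perc_measurable
  let ?f = "\<lambda>\<omega>. ennreal \<bar>perc \<omega> - (perc \<omega>)^2\<bar>"
  have bound: "(\<integral>\<^sup>+\<omega>. ?f \<omega> \<partial>P) \<le> ennreal (6 * \<delta>)" if \<delta>: "0 < \<delta>" for \<delta> :: real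
  proof -
    have "{z\<in>space (rspace P). hits z UNIV} \<in> cyl_approx" using hp by (intro sets_cyl_approx) (simp add: pred_def)
    then obtain m A' where A': "A' \<in> sets (rspace P)" "cyl m A'"
      "measure (rspace P) (({z\<in>space (rspace P). hits z UNIV} - A') \<union> (A' - {z\<in>space (rspace P). hits z UNIV})) < \<delta>"
      using \<delta> unfolding cyl_approx_def by blast
    define S where "S = (\<lambda>w. hits w UNIV \<and> w \<notin> A' \<or> w \<in> A' \<and> \<not> hits w UNIV)"
    have A'p: "Measurable.pred (rspace P) (\<lambda>w. w \<in> A')" using A'(1) by simp
    have Sp: "Measurable.pred (rspace P) S" unfolding S_def using hp A'p by measurable
    have Sm: "quenched S \<in> borel_measurable P" by (rule measurable_quenched(1)[OF Sp])
    have "({z\<in>space (rspace P). hits z UNIV} - A') \<union> (A' - {z\<in>space (rspace P). hits z UNIV}) = {z\<in>space (rspace P). S z}"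
      using sets.sets_into_space[OF A'(1)] by (auto simp: S_def)
    hence "(\<integral>\<^sup>+\<omega>. quenched S \<omega> \<partial>P) < ennreal \<delta>"
      using A'(3) measurable_quenched(2)[OF Sp] \<delta> by (simp add: N.emeasure_eq_measure ennreal_lessI)
    hence ES: "(\<integral>\<^sup>+\<omega>. quenched S \<omega> \<partial>P) \<le> ennreal \<delta>" by simp
    \<comment> \<open>The radius needed to find \<open>m\<close> points is random; on
      \<open>F k\<close> the radius \<open>k\<close> is too small although the configuration is
      infinite. The measure of \<open>F k\<close> tends to 0 by continuity from above. Finite
      configurations are harmless because \<open>perc\<close> vanishes there.\<close>
    define F where "F = (\<lambda>(k::nat). {\<omega>\<in>space P. infinite \<omega> \<and> card (\<omega> \<inter> cball 0 (real k)) < m})"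
    have inf: "infinite \<omega> \<longleftrightarrow> (\<forall>n. \<exists>k::nat. n \<le> card (\<omega> \<inter> cball 0 (real k)))" if \<omega>: "\<omega> \<in> space P" for \<omega>
    proof
      assume i: "infinite \<omega>"
      show "\<forall>n. \<exists>k::nat. n \<le> card (\<omega> \<inter> cball 0 (real k))"
      proof
        fix n
        obtain T where T: "T \<subseteq> \<omega>" "finite T" "card T = n" using i by (metis infinite_arbitrarily_large)
        obtain r where "\<forall>t\<in>T. norm t \<le> r" using finite_imp_bounded[OF T(2)] by (auto simp: bounded_iff)
        moreover obtain k :: nat where "r \<le> real k" using real_arch_simple by blast
        ultimately have "T \<subseteq> \<omega> \<inter> cball 0 (real k)" using T(1) by auto
        moreover have "finite (\<omega> \<inter> cball 0 (real k))" using \<omega> by (simp add: space_P configurations_def)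
        ultimately show "\<exists>k::nat. n \<le> card (\<omega> \<inter> cball 0 (real k))" using card_mono T(3) by blast
      qed
    next
      assume a: "\<forall>n. \<exists>k::nat. n \<le> card (\<omega> \<inter> cball 0 (real k))"
      show "infinite \<omega>"
      proof
        assume f: "finite \<omega>"
        obtain k :: nat where "Suc (card \<omega>) \<le> card (\<omega> \<inter> cball 0 (real k))" using a by blast
        moreover have "card (\<omega> \<inter> cball 0 (real k)) \<le> card \<omega>" using f by (intro card_mono) auto
        ultimately show False by simp
      qed
    qed
    have cm [measurable]: "(\<lambda>\<omega>. card (\<omega> \<inter> cball 0 (real k))) \<in> measurable P (count_space UNIV)" for k :: nat
      by (rule measurable_card_P) auto
    have Fs: "F k \<in> sets P" for k
    proof -
      have "F k = {\<omega>\<in>space P. (\<forall>n. \<exists>k::nat. n \<le> card (\<omega> \<inter> cball 0 (real k))) \<and> card (\<omega> \<inter> cball 0 (real k)) < m}"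
        using inf by (auto simp: F_def)
      also have "\<dots> \<in> sets P" by measurable
      finally show ?thesis .
    qed
    have "(\<lambda>k. measure P (F k)) \<longlonglongrightarrow> measure P (\<Inter>k. F k)"
    proof (rule P.finite_Lim_measure_decseq)
      show "decseq F"
      proof (rule decseq_SucI, rule subsetI)
        fix k \<omega> assume \<omega>: "\<omega> \<in> F (Suc k)"
        have "card (\<omega> \<inter> cball 0 (real k)) \<le> card (\<omega> \<inter> cball 0 (real (Suc k)))"
          using \<omega> by (intro card_mono) (auto simp: F_def space_P configurations_def)
        thus "\<omega> \<in> F k" using \<omega> by (auto simp: F_def)
      qed
    qed (use Fs in auto)
    moreover have "(\<Inter>k. F k) = {}"
    proof (rule ccontr)
      assume "(\<Inter>k. F k) \<noteq> {}"
      then obtain \<omega> where w: "\<omega> \<in> F k" for k by blast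
      hence "\<omega> \<in> space P" "infinite \<omega>" by (auto simp: F_def)
      then obtain k :: nat where "m \<le> card (\<omega> \<inter> cball 0 (real k))" using inf by blast
      thus False using w[of k] by (simp add: F_def)
    qed
    ultimately have "eventually (\<lambda>k. measure P (F k) < \<delta>) sequentially"
      using \<delta> by (intro order_tendstoD(2)[where y = "measure P (\<Inter>k. F k)"]) auto
    then obtain k where k: "measure P (F k) < \<delta>" by (auto simp: eventually_sequentially)
    obtain i :: "int^'d" where i: "2 * real k < norm (int_vec i :: real^'d)" using integer_lattice_unbounded by blast
    define z :: "real^'d" where "z = int_vec i"
    have z: "z \<in> \<Lambda>" "2 * real k < norm z" using i int_vec_Lam by (auto simp: z_def)
    have pt: "\<bar>perc \<omega> - (perc \<omega>)^2\<bar> \<le> 2 * (quenched S \<omega> + quenched S (shift z \<omega>)) + (indicator (F k) \<omega> + indicator (F k) (shift z \<omega>))"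
      if \<omega>: "\<omega> \<in> space P" for \<omega>
    proof (cases "infinite \<omega> \<and> \<omega> \<notin> F k \<and> shift z \<omega> \<notin> F k")
      case True
      have w: "\<omega> \<in> configurations \<Lambda>" using \<omega> by (simp add: space_P)
      have w': "shift z \<omega> \<in> space P" using shift_config[OF w z(1)] by (simp add: space_P)
      have "\<bar>perc \<omega> - (perc \<omega>)^2\<bar> \<le> 2 * (quenched S \<omega> + quenched S (shift z \<omega>))"
        unfolding S_def
        by (rule perc_almost_idempotent[OF A'(1,2) w z(1) z(2)])
          (use True \<omega> w' in \<open>auto simp: F_def infinite_shift not_less\<close>)
      thus ?thesis using True by simp
    next
      case False
      have rg: "\<bar>perc \<omega> - (perc \<omega>)^2\<bar> \<le> 1"
        using perc_range[of \<omega>] by (simp add: abs_le_iff power2_eq_square) (smt (verit) mult_left_le mult_nonneg_nonneg)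
      have q0: "0 \<le> quenched S \<omega> + quenched S (shift z \<omega>)" using quenched_range by (intro add_nonneg_nonneg) auto
      show ?thesis
      proof (cases "finite \<omega>")
        case True
        thus ?thesis using perc_finite[OF True] q0 by (simp add: indicator_def)
      next
        case inf: False
        hence "1 \<le> indicator (F k) \<omega> + (indicator (F k) (shift z \<omega>) :: real)" using False by (auto simp: indicator_def)
        moreover have "1 \<le> 2 * a + c" if "0 \<le> a" "1 \<le> c" for a c :: real using that by linarith
        ultimately have "1 \<le> 2 * (quenched S \<omega> + quenched S (shift z \<omega>)) + (indicator (F k) \<omega> + indicator (F k) (shift z \<omega>))"
          using q0 by blast
        with rg show ?thesis by (rule order_trans)
      qed
    qed
    have sh: "(\<integral>\<^sup>+\<omega>. h (shift z \<omega>) \<partial>P) = (\<integral>\<^sup>+\<omega>. h \<omega> \<partial>P)" and shm: "(\<lambda>\<omega>. h (shift z \<omega>)) \<in> borel_measurable P"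
      if h: "h \<in> borel_measurable P" for h :: "_ \<Rightarrow> ennreal"
    proof -
      show "(\<integral>\<^sup>+\<omega>. h (shift z \<omega>) \<partial>P) = (\<integral>\<^sup>+\<omega>. h \<omega> \<partial>P)" by (rule nn_integral_shift[OF z(1) h])
      have "h \<in> borel_measurable (configs \<Lambda>)" using h measurable_cong_sets[OF sets_P refl] by auto
      thus "(\<lambda>\<omega>. h (shift z \<omega>)) \<in> borel_measurable P" by (rule measurable_compose[OF shift_measurable_P[OF z(1)]])
    qed
    have m1: "(\<lambda>\<omega>. ennreal (quenched S \<omega>)) \<in> borel_measurable P" using Sm by measurable
    have m2: "(\<lambda>\<omega>. indicator (F k) \<omega> :: ennreal) \<in> borel_measurable P" using Fs[of k] by measurable
    have EF: "(\<integral>\<^sup>+\<omega>. indicator (F k) \<omega> \<partial>P) \<le> ennreal \<delta>"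
      using k Fs[of k] by (simp add: P.emeasure_eq_measure ennreal_leI)
    have "(\<integral>\<^sup>+\<omega>. ?f \<omega> \<partial>P) \<le> (\<integral>\<^sup>+\<omega>. 2 * (ennreal (quenched S \<omega>) + ennreal (quenched S (shift z \<omega>))) + (indicator (F k) \<omega> + indicator (F k) (shift z \<omega>)) \<partial>P)"
    proof (rule nn_integral_mono)
      fix \<omega> assume "\<omega> \<in> space P"
      from ennreal_leI[OF pt[OF this]]
      have "?f \<omega> \<le> ennreal (2 * (quenched S \<omega> + quenched S (shift z \<omega>)) + (indicator (F k) \<omega> + indicator (F k) (shift z \<omega>)))" .
      also have "\<dots> = 2 * (ennreal (quenched S \<omega>) + ennreal (quenched S (shift z \<omega>))) + (indicator (F k) \<omega> + indicator (F k) (shift z \<omega>))"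
        using quenched_range(1) by (simp add: ennreal_mult add_nonneg_nonneg ennreal_indicator)
      finally show "?f \<omega> \<le> \<dots>" .
    qed
    also have "\<dots> = 2 * ((\<integral>\<^sup>+\<omega>. quenched S \<omega> \<partial>P) + (\<integral>\<^sup>+\<omega>. quenched S (shift z \<omega>) \<partial>P)) + ((\<integral>\<^sup>+\<omega>. indicator (F k) \<omega> \<partial>P) + (\<integral>\<^sup>+\<omega>. indicator (F k) (shift z \<omega>) \<partial>P))"
      using m1 m2 shm[OF m1] shm[OF m2] by (simp add: nn_integral_add nn_integral_cmult)
    also have "\<dots> \<le> 2 * (ennreal \<delta> + ennreal \<delta>) + (ennreal \<delta> + ennreal \<delta>)"
      unfolding sh[OF m1] sh[OF m2] using ES EF by (intro add_mono mult_left_mono) auto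
    also have "\<dots> = ennreal (6 * \<delta>)"
    proof -
      have "ennreal (6 * \<delta>) = ennreal (2 * (\<delta> + \<delta>) + (\<delta> + \<delta>))" by simp
      also have "\<dots> = 2 * (ennreal \<delta> + ennreal \<delta>) + (ennreal \<delta> + ennreal \<delta>)" using \<delta>
        by (simp only: ennreal_plus ennreal_mult add_nonneg_nonneg mult_nonneg_nonneg less_imp_le zero_le_numeral ennreal_numeral)
      finally show ?thesis by simp
    qed
    finally show ?thesis .
  qed
  have "(\<integral>\<^sup>+\<omega>. ?f \<omega> \<partial>P) \<le> 0"
  proof (rule ennreal_le_epsilon)
    fix e :: real assume "0 < e"
    thus "(\<integral>\<^sup>+\<omega>. ?f \<omega> \<partial>P) \<le> 0 + ennreal e" using bound[of "e / 6"] by simp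
  qed
  hence "AE \<omega> in P. ?f \<omega> = 0" by (subst (asm) le_zero_eq, subst (asm) nn_integral_0_iff_AE) auto
  thus ?thesis
  proof eventually_elim
    case (elim \<omega>)
    hence "perc \<omega> * (1 - perc \<omega>) = 0" by (simp add: power2_eq_square algebra_simps)
    thus ?case by auto
  qed
qed

text \<open>\<open>ergodic\<close> speaks of strictly invariant sets. The level set qualifies
  because \<open>perc\<close> is unchanged by shifts for every configuration, not just almost
  surely.\<close>

lemma perc_ergodic:
  assumes "ergodic \<Lambda> P"
  shows "(AE \<omega> in P. perc \<omega> = 0) \<or> (AE \<omega> in P. perc \<omega> = 1)"
proof -
  note [measurable] = perc_measurable
  define A where "A = {\<omega>\<in>space P. perc \<omega> = 1}"
  have A: "A \<in> sets P" unfolding A_def by measurable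
  have "shift z -` A \<inter> space P = A" if z: "z \<in> \<Lambda>" for z
    using shift_config[OF _ z] perc_shift[OF _ z] by (auto simp: A_def space_P)
  hence "measure P A = 0 \<or> measure P A = 1" using assms A by (auto simp: ergodic_def)
  thus ?thesis
  proof
    assume "measure P A = 0"
    hence "AE \<omega> in P. \<omega> \<notin> A" using A by (intro AE_not_in) (auto simp: null_sets_def P.emeasure_eq_measure)
    hence "AE \<omega> in P. perc \<omega> = 0" using perc_zero_one AE_space by eventually_elim (auto simp: A_def)
    thus ?thesis ..
  next
    assume "measure P A = 1"
    hence "AE \<omega> in P. \<omega> \<in> A" using A by (simp add: P.AE_in_set_eq_1)
    hence "AE \<omega> in P. perc \<omega> = 1" by eventually_elim (simp add: A_def)
    thus ?thesis ..
  qed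
qed

end

section \<open>Large clusters in boxes\<close>

lemma in_box_at: "2 * norm p < K \<Longrightarrow> p \<in> box_at 0 K"
proof -
  assume a: "2 * norm p < K"
  have "- (K / 2) < p $ i \<and> p $ i \<le> K / 2" for i using component_le_norm_cart[of p i] a by linarith
  thus ?thesis by (simp add: box_at_def cube_def)
qed

lemma box_at_mono: "K \<le> K' \<Longrightarrow> box_at z K \<subseteq> box_at z K'"
proof
  fix x assume K: "K \<le> K'" and x: "x \<in> box_at z K"
  have "- K' / 2 < (x - z) $ i \<and> (x - z) $ i \<le> K' / 2" for i
  proof -
    have "- K / 2 < (x - z) $ i \<and> (x - z) $ i \<le> K / 2" using x unfolding box_at_def cube_def by simp
    thus ?thesis using K by linarith
  qed
  thus "x \<in> box_at z K'" unfolding box_at_def cube_def by simp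
qed

lemma box_at_borel: "box_at z K \<in> sets borel"
proof -
  have "box_at z K = (\<Inter>i. {x. - K / 2 < (x - z) $ i} \<inter> {x. (x - z) $ i \<le> K / 2})"
    by (auto simp: box_at_def cube_def)
  also have "\<dots> \<in> sets borel" by measurable
  finally show ?thesis .
qed

text \<open>A path is finite and therefore fits into a bounded window.\<close>

lemma cluster_window:
  assumes "y \<in> cluster b X x"
  shows "\<exists>K0::nat. \<forall>K\<ge>K0. y \<in> cluster b (X \<inter> box_at 0 (real K)) x"
proof -
  have "(x, y) \<in> (linked b X)\<^sup>*" using assms by (simp add: cluster_def)
  thus ?thesis
  proof (induction rule: rtrancl_induct)
    case base
    show ?case by (intro exI[of _ 0]) (simp add: cluster_refl)
  next
    case (step y w)
    then obtain K0 :: nat where K0: "\<forall>K\<ge>K0. y \<in> cluster b (X \<inter> box_at 0 (real K)) x" by auto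
    obtain K1 :: nat where K1: "2 * norm y < real K1" using reals_Archimedean2 by blast
    obtain K2 :: nat where K2: "2 * norm w < real K2" using reals_Archimedean2 by blast
    have "w \<in> cluster b (X \<inter> box_at 0 (real K)) x" if K: "max K0 (max K1 K2) \<le> K" for K
    proof -
      have "y \<in> box_at 0 (real K)" "w \<in> box_at 0 (real K)" using K K1 K2 by (auto intro!: in_box_at)
      hence "(y, w) \<in> linked b (X \<inter> box_at 0 (real K))" using step(2) by (auto simp: linked_def)
      moreover have "y \<in> cluster b (X \<inter> box_at 0 (real K)) x" using K0 K by simp
      ultimately show ?thesis unfolding cluster_def by (auto intro: rtrancl_into_rtrancl)
    qed
    thus ?case by blast
  qed
qed

context stat_process
begin

lemma pred_not_hits: "B \<in> sets borel \<Longrightarrow> Measurable.pred (rspace P) (\<lambda>w. \<not> hits w B)"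
  by (intro pred_intros_logic pred_hits)

lemma measure_not_hits_shift:
  assumes z: "z \<in> \<Lambda>" and B: "B \<in> sets borel" "shift z B \<in> sets borel"
  shows "measure (rspace P) {w\<in>space (rspace P). \<not> hits w (shift z B)} = measure (rspace P) {w\<in>space (rspace P). \<not> hits w B}"
proof -
  have "quenched (\<lambda>w. \<not> hits w (shift z B)) (shift z \<omega>) = quenched (\<lambda>w. \<not> hits w B) \<omega>" if \<omega>: "\<omega> \<in> space P" for \<omega>
  proof -
    have c: "\<omega> \<in> configurations \<Lambda>" "shift z \<omega> \<in> configurations \<Lambda>" using \<omega> shift_config[OF _ z] by (auto simp: space_P)
    show ?thesis
      by (rule quenched_shift[OF pred_not_hits[OF B(1)] c]) (use hits_shift[OF _ _ c] in blast)
  qed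
  hence "(\<integral>\<^sup>+\<omega>. quenched (\<lambda>w. \<not> hits w B) \<omega> \<partial>P) = (\<integral>\<^sup>+\<omega>. quenched (\<lambda>w. \<not> hits w (shift z B)) (shift z \<omega>) \<partial>P)"
    by (intro nn_integral_cong) simp
  also have "\<dots> = (\<integral>\<^sup>+\<omega>. quenched (\<lambda>w. \<not> hits w (shift z B)) \<omega> \<partial>P)"
    by (rule nn_integral_shift[OF z]) (use measurable_quenched(1)[OF pred_not_hits[OF B(2)]] in measurable)
  finally show ?thesis
    unfolding measurable_quenched(2)[OF pred_not_hits[OF B(1)]] measurable_quenched(2)[OF pred_not_hits[OF B(2)]]
    by (simp add: N.emeasure_eq_measure)
qed

text \<open>\<open>j\<close> is fixed before \<open>k\<close>, so that half of the cells,
  contributing one point each, give a cluster of positive density at every size. Uniqueness puts all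
  these points into one cluster. The window \<open>K\<close> may depend on \<open>k\<close>, since
  it has to contain the paths between them.\<close>

lemma base_box:
  assumes perc: "AE \<omega> in P. perc \<omega> = 1"
    and uniq: "AE z in rspace P. \<forall>x\<in>fst z. \<forall>y\<in>fst z. infinite (cluster (rstat \<rho> z) (fst z) x) \<and>
       infinite (cluster (rstat \<rho> z) (fst z) y) \<longrightarrow> cluster (rstat \<rho> z) (fst z) x = cluster (rstat \<rho> z) (fst z) y"
    and \<epsilon>: "0 < \<epsilon>"
  shows "\<exists>j. \<forall>k. \<exists>K::nat. (\<integral>\<^sup>+\<omega>. quenched (\<lambda>z. \<not> big (rstat \<rho> z) (fst z \<inter> box_at 0 (real K))
      (box_at 0 (real (2 * k + 1) * real (2 * j + 1))) (real ((2 * k + 1) ^ CARD('d)) / 2)) \<omega> \<partial>P) \<le> ennreal (3 * \<epsilon>)"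
proof -
  let ?b = "\<lambda>j. box_at (0 :: real^'d) (real (2 * j + 1))"
  define H where "H = (\<lambda>j. {w\<in>space (rspace P). \<not> hits w (?b j)})"
  have Hs: "H j \<in> sets (rspace P)" for j
    using pred_not_hits[OF box_at_borel] by (simp add: H_def pred_def)
  have "(\<lambda>j. measure (rspace P) (H j)) \<longlonglongrightarrow> measure (rspace P) (\<Inter>j. H j)"
  proof (rule N.finite_Lim_measure_decseq)
    show "decseq H"
    proof (rule decseq_SucI, rule subsetI)
      fix j z assume "z \<in> H (Suc j)"
      moreover have "?b j \<subseteq> ?b (Suc j)" by (rule box_at_mono) simp
      ultimately show "z \<in> H j" by (auto simp: H_def hits_def)
    qed
  qed (use Hs in auto)
  moreover have "measure (rspace P) (\<Inter>j. H j) = 0"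
  proof -
    have "(\<Inter>j. H j) \<subseteq> {w\<in>space (rspace P). \<not> hits w UNIV}"
    proof
      fix z assume z: "z \<in> (\<Inter>j. H j)"
      have "\<not> hits z UNIV"
      proof
        assume "hits z UNIV"
        then obtain x where x: "x \<in> fst z" "infinite (cluster (rstat \<rho> z) (fst z) x)" by (auto simp: hits_def)
        obtain j :: nat where "2 * norm x < real j" using reals_Archimedean2 by blast
        hence "x \<in> ?b j" by (intro in_box_at) simp
        hence "hits z (?b j)" using x by (auto simp: hits_def)
        thus False using z by (auto simp: H_def)
      qed
      thus "z \<in> {w\<in>space (rspace P). \<not> hits w UNIV}" using z by (auto simp: H_def)
    qed
    moreover have "measure (rspace P) {w\<in>space (rspace P). \<not> hits w UNIV} = 0"
    proof -
      have "emeasure (rspace P) {w\<in>space (rspace P). hits w UNIV} = (\<integral>\<^sup>+\<omega>. perc \<omega> \<partial>P)"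
        unfolding perc_def using pred_hits[of UNIV] by (subst measurable_quenched(2)) auto
      also have "\<dots> = (\<integral>\<^sup>+\<omega>. 1 \<partial>P)" using perc by (intro nn_integral_cong_AE) auto
      finally have "measure (rspace P) {w\<in>space (rspace P). hits w UNIV} = 1"
        by (simp add: P.emeasure_space_1 measure_def)
      moreover have "{w\<in>space (rspace P). \<not> hits w UNIV} = space (rspace P) - {w\<in>space (rspace P). hits w UNIV}" by auto
      ultimately show ?thesis using pred_hits[of UNIV] N.prob_compl[of "{w\<in>space (rspace P). hits w UNIV}"] by (simp add: pred_def)
    qed
    ultimately show ?thesis
      using pred_not_hits[of UNIV] N.finite_measure_mono[of "\<Inter>j. H j" "{w\<in>space (rspace P). \<not> hits w UNIV}"]
      by (simp add: pred_def measure_le_0_iff)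
  qed
  ultimately have "eventually (\<lambda>j. measure (rspace P) (H j) < \<epsilon>) sequentially"
    using \<epsilon> by (intro order_tendstoD(2)[where y = "measure (rspace P) (\<Inter>j. H j)"]) auto
  then obtain j where j: "measure (rspace P) (H j) < \<epsilon>" by (auto simp: eventually_sequentially)
  define J where "J = real (2 * j + 1)"
  have J: "0 < J" by (simp add: J_def)
  have "\<exists>K::nat. (\<integral>\<^sup>+\<omega>. quenched (\<lambda>z. \<not> big (rstat \<rho> z) (fst z \<inter> box_at 0 (real K))
      (box_at 0 (real (2 * k + 1) * J)) (real ((2 * k + 1) ^ CARD('d)) / 2)) \<omega> \<partial>P) \<le> ennreal (3 * \<epsilon>)" for k
  proof -
    define I where "I = (offsets k :: (int^'d) set)"
    define m where "m = real (card I)"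
    have I: "finite I" "card I = (2 * k + 1) ^ CARD('d)" unfolding I_def by (rule offsets)+
    have m: "0 < m" by (simp add: m_def I(2))
    define b where "b = (\<lambda>i. box_at (0 + J *\<^sub>R int_vec i :: real^'d) J)"
    have bsub: "b i \<subseteq> box_at 0 (real (2 * k + 1) * J)" if "i \<in> I" for i
      using tiling[OF J, of 0 k] that unfolding b_def I_def by blast
    have bdisj: "b i \<inter> b i' = {}" if "i \<noteq> i'" for i i'
      using tiling_disjoint[OF J, of 0 UNIV] that unfolding b_def by (auto simp: disjoint_family_on_def)
    have bh: "measure (rspace P) {w\<in>space (rspace P). \<not> hits w (b i)} \<le> \<epsilon>" for i
    proof -
      have z: "(0 + J *\<^sub>R int_vec i :: real^'d) = int_vec (\<chi> l. int (2 * j + 1) * i $ l)"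
        unfolding J_def int_vec_scale by simp
      have e: "b i = shift (int_vec (\<chi> l. int (2 * j + 1) * i $ l)) (?b j)"
        unfolding b_def z shift_box_at by (simp add: J_def)
      have "measure (rspace P) {w\<in>space (rspace P). \<not> hits w (b i)} = measure (rspace P) {w\<in>space (rspace P). \<not> hits w (?b j)}"
        unfolding e by (rule measure_not_hits_shift[OF int_vec_Lam box_at_borel]) (simp add: shift_box_at box_at_borel)
      thus ?thesis using j by (simp add: H_def)
    qed
    have bhs: "{w\<in>space (rspace P). \<not> hits w (b i)} \<in> sets (rspace P)" for i
      using pred_not_hits[OF box_at_borel] unfolding pred_def b_def by blast
    define T where "T = {w\<in>space (rspace P). m / 2 \<le> real (card {i\<in>I. hits w (b i)})}"
    have Ts: "T \<in> sets (rspace P)"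
    proof -
      have "Measurable.pred (rspace P) (\<lambda>w. m / 2 \<le> real (card {i\<in>I. hits w (b i)}))"
        by (rule pred_finite_Collect[OF I(1), where P = "\<lambda>i w. hits w (b i)" and \<Phi> = "\<lambda>S. m / 2 \<le> real (card S)"])
          (auto intro!: pred_hits simp: b_def box_at_borel)
      thus ?thesis by (simp add: T_def pred_def)
    qed
    have TC: "measure (rspace P) (space (rspace P) - T) \<le> 2 * \<epsilon>"
    proof -
      have "m / 2 * measure (rspace P) (space (rspace P) - T) = (\<integral>w. m / 2 * indicator (space (rspace P) - T) w \<partial>rspace P)"
        using Ts by simp
      also have "\<dots> \<le> (\<integral>w. (\<Sum>i\<in>I. indicator {w\<in>space (rspace P). \<not> hits w (b i)} w) \<partial>rspace P)"
      proof (rule integral_mono)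
        show "integrable (rspace P) (\<lambda>w. m / 2 * indicator (space (rspace P) - T) w)"
          using Ts by (intro integrable_mult_right) (auto simp: N.emeasure_eq_measure)
        show "integrable (rspace P) (\<lambda>w. \<Sum>i\<in>I. indicat_real {w\<in>space (rspace P). \<not> hits w (b i)} w)"
          using bhs by (intro Bochner_Integration.integrable_sum) (auto simp: N.emeasure_eq_measure)
        fix w assume w: "w \<in> space (rspace P)"
        show "m / 2 * indicator (space (rspace P) - T) w \<le> (\<Sum>i\<in>I. indicat_real {w\<in>space (rspace P). \<not> hits w (b i)} w)"
        proof (cases "w \<in> T")
          case False
          have "card I = card {i\<in>I. hits w (b i)} + card {i\<in>I. \<not> hits w (b i)}"
            using I(1) by (subst card_Un_disjoint[symmetric]) (auto intro: arg_cong[where f = card])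
          hence "m = real (card {i\<in>I. hits w (b i)}) + real (card {i\<in>I. \<not> hits w (b i)})" unfolding m_def by simp
          moreover have "real (card {i\<in>I. hits w (b i)}) < m / 2" using False w by (auto simp: T_def)
          ultimately have "m / 2 \<le> real (card {i\<in>I. \<not> hits w (b i)})" by simp
          also have "\<dots> = (\<Sum>i\<in>{i\<in>I. \<not> hits w (b i)}. 1)" by simp
          also have "\<dots> = (\<Sum>i\<in>I. indicat_real {w\<in>space (rspace P). \<not> hits w (b i)} w)"
            using I(1) w by (intro sum.mono_neutral_cong_left) auto
          finally show ?thesis using False w by simp
        qed (auto intro!: sum_nonneg)
      qed
      also have "\<dots> = (\<Sum>i\<in>I. measure (rspace P) {w\<in>space (rspace P). \<not> hits w (b i)})"
        using bhs by (subst Bochner_Integration.integral_sum) (auto simp: N.emeasure_eq_measure)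
      also have "\<dots> \<le> (\<Sum>i\<in>I. \<epsilon>)" by (intro sum_mono bh)
      also have "\<dots> = m / 2 * (2 * \<epsilon>)" by (simp add: m_def)
      finally show ?thesis using m by (subst (asm) mult_le_cancel_left_pos) auto
    qed
    let ?M = "real (2 * k + 1) * J"
    define G where "G = (\<lambda>K::nat. {w\<in>space (rspace P). big (rstat \<rho> w) (fst w \<inter> box_at 0 (real K)) (box_at 0 ?M) (m / 2)})"
    have Gp: "Measurable.pred (rspace P) (\<lambda>w. big (rstat \<rho> w) (fst w \<inter> box_at 0 (real K)) (box_at 0 ?M) (m / 2))" for K
      by (intro pred_rbig box_at_borel bounded_box_at)
    have Gs: "G K \<in> sets (rspace P)" for K using Gp by (simp add: G_def pred_def)
    have "incseq G"
    proof (rule incseq_SucI, rule subsetI)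
      fix K w assume w: "w \<in> G K"
      have "box_at 0 (real K) \<subseteq> box_at (0::real^'d) (real (Suc K))" by (rule box_at_mono) simp
      moreover have "finite (fst w \<inter> box_at 0 (real (Suc K)))"
        using w config_of by (intro finite_config_Int[of _ \<Lambda>] bounded_box_at) (auto simp: G_def)
      moreover have "big (rstat \<rho> w) (fst w \<inter> box_at 0 (real K)) (box_at 0 ?M) (m / 2)" using w by (simp add: G_def)
      ultimately have "big (rstat \<rho> w) (fst w \<inter> box_at 0 (real (Suc K))) (box_at 0 ?M) (m / 2)"
        by (elim big_mono) auto
      thus "w \<in> G (Suc K)" using w by (simp add: G_def)
    qed
    hence lim: "(\<lambda>K. measure (rspace P) (G K)) \<longlonglongrightarrow> measure (rspace P) (\<Union>K. G K)"
      using Gs by (intro N.finite_Lim_measure_incseq) auto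
    have "AE w in rspace P. w \<in> T \<longrightarrow> w \<in> (\<Union>K. G K)"
      using uniq AE_space
    proof eventually_elim
      case (elim w)
      show ?case
      proof
        assume w: "w \<in> T"
        define I' where "I' = {i\<in>I. hits w (b i)}"
        have c: "m / 2 \<le> real (card I')" using w by (simp add: T_def I'_def)
        have fI': "finite I'" using I(1) by (simp add: I'_def)
        have "I' \<noteq> {}" using c m by auto
        then obtain i0 where i0: "i0 \<in> I'" by auto
        have "\<forall>i. \<exists>x. i \<in> I' \<longrightarrow> x \<in> fst w \<and> x \<in> b i \<and> infinite (cluster (rstat \<rho> w) (fst w) x)"
          by (auto simp: I'_def hits_def)
        then obtain x where x: "\<forall>i. i \<in> I' \<longrightarrow> x i \<in> fst w \<and> x i \<in> b i \<and> infinite (cluster (rstat \<rho> w) (fst w) (x i))"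
          by (rule choice[THEN exE])
        have xin: "x i \<in> cluster (rstat \<rho> w) (fst w) (x i0)" if "i \<in> I'" for i
        proof -
          have "cluster (rstat \<rho> w) (fst w) (x i) = cluster (rstat \<rho> w) (fst w) (x i0)" using elim(1) x that i0 by simp
          thus ?thesis using cluster_refl[of "x i" "rstat \<rho> w" "fst w"] by simp
        qed
        have "\<forall>i. \<exists>K0::nat. i \<in> I' \<longrightarrow> (\<forall>K\<ge>K0. x i \<in> cluster (rstat \<rho> w) (fst w \<inter> box_at 0 (real K)) (x i0))"
          using cluster_window[OF xin] by blast
        then obtain K0 where K0: "\<forall>i. i \<in> I' \<longrightarrow> (\<forall>K\<ge>K0 i. x i \<in> cluster (rstat \<rho> w) (fst w \<inter> box_at 0 (real K)) (x i0))"
          by (rule choice[THEN exE])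
        obtain K1 :: nat where K1: "?M \<le> real K1" using real_arch_simple by blast
        \<comment> \<open>The sum serves as an upper bound for the finitely many thresholds
          \<open>K0 i\<close>.\<close>
        define K where "K = max K1 (\<Sum>i\<in>I'. K0 i)"
        have KK: "K0 i \<le> K" if "i \<in> I'" for i
          using member_le_sum[OF that, of K0] fI' by (simp add: K_def)
        have MK: "box_at 0 ?M \<subseteq> box_at (0::real^'d) (real K)" using K1 by (intro box_at_mono) (simp add: K_def)
        have xM: "x i \<in> box_at 0 ?M" if "i \<in> I'" for i using x that bsub[of i] by (auto simp: I'_def)
        have inj: "inj_on x I'"
        proof (rule inj_onI, rule ccontr)
          fix i i' assume "i \<in> I'" "i' \<in> I'" "x i = x i'" "i \<noteq> i'"
          thus False using x bdisj[of i i'] by (metis IntI empty_iff)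
        qed
        have "x ` I' \<subseteq> cluster (rstat \<rho> w) (fst w \<inter> box_at 0 (real K)) (x i0) \<inter> box_at 0 ?M"
          using K0 KK xM by auto
        moreover have x0: "x i0 \<in> fst w \<inter> box_at 0 (real K)" using x i0 xM MK by auto
        moreover have "finite (cluster (rstat \<rho> w) (fst w \<inter> box_at 0 (real K)) (x i0) \<inter> box_at 0 ?M)"
          using cluster_subset[OF x0, of "rstat \<rho> w"] finite_config_Int[OF config_of[OF elim(2)] bounded_box_at, of 0 "real K"]
          by (intro finite_Int disjI1) (auto intro!: finite_subset[where B = "fst w \<inter> box_at 0 (real K)"])
        ultimately have "card (x ` I') \<le> card (cluster (rstat \<rho> w) (fst w \<inter> box_at 0 (real K)) (x i0) \<inter> box_at 0 ?M)"
          by (intro card_mono)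
        hence "m / 2 \<le> real (card (cluster (rstat \<rho> w) (fst w \<inter> box_at 0 (real K)) (x i0) \<inter> box_at 0 ?M))"
          using c card_image[OF inj] by simp
        hence "w \<in> G K" using x0 elim(2) unfolding G_def big_def by blast
        thus "w \<in> (\<Union>K. G K)" by blast
      qed
    qed
    hence "measure (rspace P) T \<le> measure (rspace P) (\<Union>K. G K)"
      using Gs by (intro N.finite_measure_mono_AE) auto
    moreover have "1 - 2 * \<epsilon> \<le> measure (rspace P) T" using TC N.prob_compl[OF Ts] by simp
    \<comment> \<open>Two parts of \<open>\<epsilon>\<close> come from Markov's inequality for the
      missed cells, the third is room for the passage to a finite window.\<close>
    ultimately have "1 - 3 * \<epsilon> < measure (rspace P) (\<Union>K. G K)" using \<epsilon> by simp
    from order_tendstoD(1)[OF lim this] obtain K where K: "1 - 3 * \<epsilon> < measure (rspace P) (G K)"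
      by (auto simp: eventually_sequentially)
    have np: "Measurable.pred (rspace P) (\<lambda>w. \<not> big (rstat \<rho> w) (fst w \<inter> box_at 0 (real K)) (box_at 0 ?M) (m / 2))"
      using Gp[of K] by measurable
    have "{w\<in>space (rspace P). \<not> big (rstat \<rho> w) (fst w \<inter> box_at 0 (real K)) (box_at 0 ?M) (m / 2)} = space (rspace P) - G K"
      by (auto simp: G_def)
    hence "(\<integral>\<^sup>+\<omega>. quenched (\<lambda>w. \<not> big (rstat \<rho> w) (fst w \<inter> box_at 0 (real K)) (box_at 0 ?M) (m / 2)) \<omega> \<partial>P)
        = ennreal (1 - measure (rspace P) (G K))"
      unfolding measurable_quenched(2)[OF np] using N.prob_compl[OF Gs] by (simp add: N.emeasure_eq_measure)
    also have "\<dots> \<le> ennreal (3 * \<epsilon>)" using K by (intro ennreal_leI) simp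
    finally show ?thesis unfolding m_def I(2) by blast
  qed
  thus ?thesis unfolding J_def by blast
qed

end

section \<open>Averaging the recursion over the configuration\<close>

lemma odd_scale: "odd M \<Longrightarrow> odd (scale \<kappa> M k)"
  by (induction k) auto

text \<open>The scales at least double, so the errors are dominated by a geometric series. What
  matters is that the bound tends to 0 as \<open>M\<close> grows, uniformly in the number of
  levels.\<close>

lemma level_err_sum:
  fixes T :: "'d::finite itself"
  assumes M: "1 \<le> M" "\<And>R. real M \<le> R \<Longrightarrow> 4 \<le> R powr \<kappa>" and \<kappa>: "0 < \<kappa>"
  shows "(\<Sum>i<k. level_err T \<kappa> (scale \<kappa> M i))
    \<le> real M powr (- (real CARD('d) * \<kappa>^2 / 2)) / (1 - 2 powr (- (real CARD('d) * \<kappa>^2 / 2)))"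
proof -
  define c where "c = real CARD('d) * \<kappa>^2 / 2"
  define q where "q = (2::real) powr (- c)"
  have c: "0 < c" using \<kappa> by (simp add: c_def)
  have q: "0 < q" "q < 1" using c by (auto simp: q_def powr_less_one)
  have "level_err T \<kappa> (scale \<kappa> M i) \<le> real M powr (- c) * q ^ i" for i
  proof -
    have "real (2 ^ i * M) \<le> real (scale \<kappa> M i)" using scale_ge[OF M] by (simp only: of_nat_le_iff)
    moreover have p: "0 < real (2 ^ i * M)" using M(1) by simp
    ultimately have "real (scale \<kappa> M i) powr (- c) \<le> real (2 ^ i * M) powr (- c)"
      using c by (intro powr_mono2') auto
    also have "\<dots> = real M powr (- c) * q ^ i"
      using M(1) by (simp add: powr_mult q_def powr_powr mult.commute flip: powr_realpow)
    finally show ?thesis by (simp add: level_err_def c_def)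
  qed
  hence "(\<Sum>i<k. level_err T \<kappa> (scale \<kappa> M i)) \<le> real M powr (- c) * (\<Sum>i<k. q ^ i)"
    unfolding sum_distrib_left by (intro sum_mono)
  also have "(\<Sum>i<k. q ^ i) \<le> 1 / (1 - q)"
    using q by (simp add: sum_gp_strict divide_right_mono)
  finally show ?thesis using q by (simp add: c_def q_def mult_left_mono)
qed

context stat_process
begin

lemma measurable_card_box: "(\<lambda>\<omega>. card (\<omega> \<inter> box_at z r)) \<in> measurable P (count_space UNIV)"
  by (rule measurable_card_P[OF box_at_borel bounded_box_at])

text \<open>A box of odd integer side centred at an integer point splits into unit boxes with
  integer centres, for which stationarity is available on both ground sets.\<close>

lemma intensity_box:
  "(\<integral>\<^sup>+\<omega>. of_nat (card (\<omega> \<inter> box_at (int_vec j) (real (2 * k + 1)))) \<partial>P) = of_nat ((2 * k + 1) ^ CARD('d)) * intensity P"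
proof -
  let ?z = "int_vec j :: real^'d"
  have m: "(\<lambda>\<omega>. of_nat (card (\<omega> \<inter> box_at z r)) :: ennreal) \<in> borel_measurable P" for z r
    by (rule measurable_compose[OF measurable_card_box]) simp
  have unit: "(\<integral>\<^sup>+\<omega>. of_nat (card (\<omega> \<inter> box_at (int_vec i) 1)) \<partial>P) = intensity P" for i :: "int^'d"
  proof -
    have "card (shift (int_vec i) \<omega> \<inter> box_at (int_vec i) 1) = card (\<omega> \<inter> cube 1)" for \<omega> :: "(real^'d) set"
    proof -
      have "shift (int_vec i) (\<omega> \<inter> box_at 0 1) = shift (int_vec i) \<omega> \<inter> box_at (int_vec i) 1"
        by (simp add: shift_Int shift_box_at)
      thus ?thesis using card_shift[of "int_vec i" "\<omega> \<inter> box_at 0 1"] by (simp add: box_at_def)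
    qed
    hence "intensity P = (\<integral>\<^sup>+\<omega>. of_nat (card (shift (int_vec i) \<omega> \<inter> box_at (int_vec i) 1)) \<partial>P)"
      by (simp add: intensity_def)
    also have "\<dots> = (\<integral>\<^sup>+\<omega>. of_nat (card (\<omega> \<inter> box_at (int_vec i) 1)) \<partial>P)"
      by (rule nn_integral_shift[OF int_vec_Lam m])
    finally show ?thesis by simp
  qed
  have "(of_nat (card (\<omega> \<inter> box_at ?z (real (2 * k + 1)))) :: ennreal) = (\<Sum>i\<in>offsets k. of_nat (card (\<omega> \<inter> box_at (int_vec (j + i)) 1)))"
    if "\<omega> \<in> space P" for \<omega>
  proof -
    have \<omega>: "\<omega> \<in> configurations \<Lambda>" using that by (simp add: space_P)
    have "\<omega> \<inter> box_at ?z (real (2 * k + 1)) = (\<Union>i\<in>offsets k. \<omega> \<inter> box_at (?z + 1 *\<^sub>R int_vec i) 1)"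
      using tiling[of 1 ?z k] by auto
    moreover have "card (\<Union>i\<in>offsets k. \<omega> \<inter> box_at (?z + 1 *\<^sub>R int_vec i) 1) = (\<Sum>i\<in>offsets k. card (\<omega> \<inter> box_at (?z + 1 *\<^sub>R int_vec i) 1))"
    proof (rule card_UN_disjoint[OF offsets(1)])
      show "\<forall>i\<in>offsets k. finite (\<omega> \<inter> box_at (?z + 1 *\<^sub>R int_vec i) 1)"
        using finite_config_Int[OF \<omega> bounded_box_at] by blast
      show "\<forall>i\<in>offsets k. \<forall>i'\<in>offsets k. i \<noteq> i' \<longrightarrow> \<omega> \<inter> box_at (?z + 1 *\<^sub>R int_vec i) 1 \<inter> (\<omega> \<inter> box_at (?z + 1 *\<^sub>R int_vec i') 1) = {}"
        using tiling_disjoint[of 1 ?z UNIV] by (auto simp: disjoint_family_on_def)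
    qed
    ultimately show ?thesis by (simp add: int_vec_add)
  qed
  hence "(\<integral>\<^sup>+\<omega>. of_nat (card (\<omega> \<inter> box_at ?z (real (2 * k + 1)))) \<partial>P)
    = (\<integral>\<^sup>+\<omega>. (\<Sum>i\<in>offsets k. of_nat (card (\<omega> \<inter> box_at (int_vec (j + i)) 1))) \<partial>P)"
    by (rule nn_integral_cong)
  also have "\<dots> = (\<Sum>i\<in>(offsets k :: (int^'d) set). \<integral>\<^sup>+\<omega>. of_nat (card (\<omega> \<inter> box_at (int_vec (j + i)) 1)) \<partial>P)"
    by (rule nn_integral_sum) (rule m)
  also have "\<dots> = of_nat ((2 * k + 1) ^ CARD('d)) * intensity P" by (simp add: unit offsets)
  finally show ?thesis .
qed

text \<open>Markov's inequality: the threshold exceeds the volume of the box, hence the order of the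
  mean number of points, by the factor
  \<open>real n powr (real CARD('d) * \<kappa>)\<close>.\<close>

lemma crowded_box:
  assumes n: "odd n" and L: "intensity P \<le> ennreal L" "0 \<le> L"
  shows "(\<integral>\<^sup>+\<omega>. (if real (card (\<omega> \<inter> box_at (int_vec j) (real n))) \<le> real n powr (real CARD('d) * (1 + \<kappa>)) then 0 else 1) \<partial>P)
    \<le> ennreal (L * real n powr (- (real CARD('d) * \<kappa>)))"
proof -
  define D where "D = real CARD('d)"
  have n0: "0 < real n" using n by (cases n) auto
  obtain k where k: "n = 2 * k + 1" using n by (rule oddE)
  have m: "(\<lambda>\<omega>. of_nat (card (\<omega> \<inter> box_at z r)) :: ennreal) \<in> borel_measurable P" for z r
    by (rule measurable_compose[OF measurable_card_box]) simp
  have "(\<integral>\<^sup>+\<omega>. (if real (card (\<omega> \<inter> box_at (int_vec j) (real n))) \<le> real n powr (D * (1 + \<kappa>)) then 0 else 1) \<partial>P)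
    \<le> (\<integral>\<^sup>+\<omega>. ennreal (real n powr (- (D * (1 + \<kappa>)))) * of_nat (card (\<omega> \<inter> box_at (int_vec j) (real n))) \<partial>P)"
  proof (rule nn_integral_mono)
    fix \<omega> :: "(real^'d) set"
    define c where "c = real (card (\<omega> \<inter> box_at (int_vec j) (real n)))"
    have "1 \<le> real n powr (- (D * (1 + \<kappa>))) * c" if "\<not> c \<le> real n powr (D * (1 + \<kappa>))"
    proof -
      have "1 = real n powr (- (D * (1 + \<kappa>))) * real n powr (D * (1 + \<kappa>))"
        using n0 by (simp only: powr_add[symmetric]) simp
      also have "\<dots> \<le> real n powr (- (D * (1 + \<kappa>))) * c" using that by (intro mult_left_mono) auto
      finally show ?thesis .
    qed
    hence "(if c \<le> real n powr (D * (1 + \<kappa>)) then 0 else 1) \<le> ennreal (real n powr (- (D * (1 + \<kappa>))) * c)"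
      by (auto simp flip: ennreal_1 intro!: ennreal_leI)
    also have "\<dots> = ennreal (real n powr (- (D * (1 + \<kappa>)))) * of_nat (card (\<omega> \<inter> box_at (int_vec j) (real n)))"
      unfolding c_def by (simp add: ennreal_mult ennreal_of_nat_eq_real_of_nat)
    finally show "(if real (card (\<omega> \<inter> box_at (int_vec j) (real n))) \<le> real n powr (D * (1 + \<kappa>)) then 0 else 1)
      \<le> ennreal (real n powr (- (D * (1 + \<kappa>)))) * of_nat (card (\<omega> \<inter> box_at (int_vec j) (real n)))" unfolding c_def .
  qed
  also have "\<dots> = ennreal (real n powr (- (D * (1 + \<kappa>)))) * (of_nat (n ^ CARD('d)) * intensity P)"
    using intensity_box[of j k] by (subst nn_integral_cmult[OF m]) (simp only: k[symmetric])
  also have "\<dots> \<le> ennreal (real n powr (- (D * (1 + \<kappa>)))) * (of_nat (n ^ CARD('d)) * ennreal L)"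
    by (intro mult_left_mono L) auto
  also have "\<dots> = ennreal (real n powr (- (D * (1 + \<kappa>))) * (real (n ^ CARD('d)) * L))"
    using L(2) by (simp add: ennreal_mult ennreal_of_nat_eq_real_of_nat del: of_nat_power)
  also have "real n powr (- (D * (1 + \<kappa>))) * (real (n ^ CARD('d)) * L) = L * real n powr (- (D * \<kappa>))"
  proof -
    have "real (n ^ CARD('d)) = real n powr D" using n0 by (simp add: D_def powr_realpow)
    moreover have "real n powr (- (D * (1 + \<kappa>))) * real n powr D = real n powr (- (D * \<kappa>))"
      by (simp add: powr_add[symmetric] algebra_simps)
    ultimately show ?thesis by simp
  qed
  finally show ?thesis unfolding D_def .
qed

lemma measurable_level_bound:
  assumes g: "\<And>j. g j \<in> borel_measurable P"
  shows "(\<lambda>\<omega>. level_bound \<kappa> M (\<lambda>j. g j \<omega>) \<omega> k j) \<in> borel_measurable P"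
proof (induction k arbitrary: j)
  case (Suc k)
  note [measurable] = Suc measurable_card_box
  show ?case unfolding level_bound.simps by measurable
qed (simp add: g)

lemma level_bound_nonneg: "(\<And>j. 0 \<le> g j) \<Longrightarrow> 0 \<le> level_bound \<kappa> M g \<omega> k j"
  by (induction k arbitrary: j)
    (auto simp: level_err_def intro!: add_nonneg_nonneg mult_nonneg_nonneg divide_nonneg_nonneg sum_nonneg)

text \<open>With \<open>b\<close> the error of a level and \<open>X\<close> the bound so far, one
  level gives \<open>(1 + b) * X + b + L * b\<close>, so \<open>1 + X\<close> grows at most by the
  factor \<open>1 + (1 + L) * b\<close>. The bound is claimed for all centres \<open>j\<close> at
  once; an average over cells then obeys the same bound, whatever their dependence.\<close>

lemma expected_level_bound:
  fixes g :: "int^'d \<Rightarrow> (real^'d) set \<Rightarrow> real"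
  assumes M: "1 \<le> M" "\<And>R. real M \<le> R \<Longrightarrow> 4 \<le> R powr \<kappa>" "odd M" and \<kappa>: "0 < \<kappa>" "\<kappa> \<le> 1"
    and g: "\<And>j. g j \<in> borel_measurable P" "\<And>j \<omega>. 0 \<le> g j \<omega>" "\<And>j. (\<integral>\<^sup>+\<omega>. g j \<omega> \<partial>P) \<le> ennreal e"
    and e: "0 \<le> e" and L: "intensity P \<le> ennreal L" "0 \<le> L"
  shows "(\<integral>\<^sup>+\<omega>. level_bound \<kappa> M (\<lambda>j. g j \<omega>) \<omega> k j \<partial>P)
    \<le> ennreal ((1 + e) * exp ((1 + L) * (\<Sum>i<k. level_err TYPE('d) \<kappa> (scale \<kappa> M i))) - 1)"
proof (induction k arbitrary: j)
  case 0
  show ?case using g(3) by simp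
next
  case (Suc k)
  define S where "S = scale \<kappa> M k"
  define S' where "S' = scale \<kappa> M (Suc k)"
  define b where "b = level_err TYPE('d) \<kappa> S"
  define I where "I = (offsets (branch \<kappa> (real S)) :: (int^'d) set)"
  define X where "X = (1 + e) * exp ((1 + L) * (\<Sum>i<k. level_err TYPE('d) \<kappa> (scale \<kappa> M i))) - 1"
  define lb where "lb = (\<lambda>i \<omega>. level_bound \<kappa> M (\<lambda>j. g j \<omega>) \<omega> k (j + (\<chi> l. int S * i $ l)))"
  define crowd where "crowd = (\<lambda>\<omega>. if real (card (\<omega> \<inter> box_at (int_vec j) (real S'))) \<le> real S' powr (real CARD('d) * (1 + \<kappa>)) then 0 else (1::real))"
  have b0: "0 \<le> b" by (simp add: b_def level_err_def)
  have X0: "0 \<le> X"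
  proof -
    have "0 \<le> (1 + L) * (\<Sum>i<k. level_err TYPE('d) \<kappa> (scale \<kappa> M i))"
      using L(2) by (intro mult_nonneg_nonneg sum_nonneg) (auto simp: level_err_def)
    hence "1 * 1 \<le> (1 + e) * exp ((1 + L) * (\<Sum>i<k. level_err TYPE('d) \<kappa> (scale \<kappa> M i)))"
      using e by (intro mult_mono) auto
    thus ?thesis by (simp add: X_def)
  qed
  have cI: "0 < real (card I)" by (simp add: I_def offsets)
  have lb0: "0 \<le> lb i \<omega>" for i \<omega> unfolding lb_def by (rule level_bound_nonneg) (rule g)
  have lbm [measurable]: "lb i \<in> borel_measurable P" for i unfolding lb_def by (rule measurable_level_bound) (rule g)
  have lbX: "(\<integral>\<^sup>+\<omega>. lb i \<omega> \<partial>P) \<le> ennreal X" for i unfolding lb_def X_def by (rule Suc)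
  note [measurable] = measurable_card_box
  have cm [measurable]: "crowd \<in> borel_measurable P" unfolding crowd_def by measurable
  have S1: "1 \<le> real S" using scale_ge_base[OF M(1,2), of k] M(1) unfolding S_def by simp
  have SS: "real S \<le> real S'"
  proof -
    have "1 * S \<le> (2 * branch \<kappa> (real S) + 1) * S" by (intro mult_right_mono) auto
    thus ?thesis unfolding S'_def S_def by (simp only: scale.simps of_nat_le_iff mult_1)
  qed
  have crowd: "(\<integral>\<^sup>+\<omega>. crowd \<omega> \<partial>P) \<le> ennreal (L * b)"
  proof -
    have "(\<integral>\<^sup>+\<omega>. crowd \<omega> \<partial>P) = (\<integral>\<^sup>+\<omega>. (if real (card (\<omega> \<inter> box_at (int_vec j) (real S'))) \<le> real S' powr (real CARD('d) * (1 + \<kappa>)) then 0 else 1) \<partial>P)"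
      unfolding crowd_def by (intro nn_integral_cong) auto
    also have "\<dots> \<le> ennreal (L * real S' powr (- (real CARD('d) * \<kappa>)))"
      by (rule crowded_box[OF _ L]) (unfold S'_def, rule odd_scale[OF M(3)])
    also have "\<dots> \<le> ennreal (L * b)"
    proof (intro ennreal_leI mult_left_mono L(2))
      have "real S' powr (- (real CARD('d) * \<kappa>)) \<le> real S powr (- (real CARD('d) * \<kappa>))"
        using S1 SS \<kappa> by (intro powr_mono2') auto
      also have "\<dots> \<le> b"
      proof -
        have "\<kappa>^2 \<le> \<kappa> * 1" unfolding power2_eq_square using \<kappa> by (intro mult_left_mono) auto
        hence "real CARD('d) * (\<kappa>^2 / 2) \<le> real CARD('d) * \<kappa>" using \<kappa> by (intro mult_left_mono) auto
        thus ?thesis unfolding b_def level_err_def using S1 by (intro powr_mono) auto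
      qed
      finally show "real S' powr (- (real CARD('d) * \<kappa>)) \<le> b" .
    qed
    finally show ?thesis .
  qed
  have "(\<integral>\<^sup>+\<omega>. level_bound \<kappa> M (\<lambda>j. g j \<omega>) \<omega> (Suc k) j \<partial>P)
    = (\<integral>\<^sup>+\<omega>. ennreal ((1 + b) / real (card I)) * (\<Sum>i\<in>I. ennreal (lb i \<omega>)) + ennreal b + ennreal (crowd \<omega>) \<partial>P)"
  proof (rule nn_integral_cong)
    fix \<omega> :: "(real^'d) set"
    have lbe: "level_bound \<kappa> M (\<lambda>j. g j \<omega>) \<omega> (Suc k) j = (1 + b) / real (card I) * (\<Sum>i\<in>I. lb i \<omega>) + b + crowd \<omega>"
      unfolding level_bound.simps S_def[symmetric] S'_def[symmetric] b_def[symmetric] I_def[symmetric] lb_def crowd_def by simp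
    have en: "ennreal (p * (\<Sum>i\<in>I. lb i \<omega>) + b + crowd \<omega>) = ennreal p * (\<Sum>i\<in>I. ennreal (lb i \<omega>)) + ennreal b + ennreal (crowd \<omega>)"
      if p: "0 \<le> p" for p
    proof -
      have "0 \<le> crowd \<omega>" by (simp add: crowd_def)
      moreover have "0 \<le> (\<Sum>i\<in>I. lb i \<omega>)" using lb0 by (intro sum_nonneg)
      ultimately show ?thesis using b0 p lb0 by (simp add: ennreal_mult sum_ennreal)
    qed
    show "ennreal (level_bound \<kappa> M (\<lambda>j. g j \<omega>) \<omega> (Suc k) j)
      = ennreal ((1 + b) / real (card I)) * (\<Sum>i\<in>I. ennreal (lb i \<omega>)) + ennreal b + ennreal (crowd \<omega>)"
      unfolding lbe by (rule en) (simp add: b0)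
  qed
  also have "\<dots> = ennreal ((1 + b) / real (card I)) * (\<Sum>i\<in>I. \<integral>\<^sup>+\<omega>. lb i \<omega> \<partial>P) + ennreal b + (\<integral>\<^sup>+\<omega>. crowd \<omega> \<partial>P)"
    by (simp add: nn_integral_add nn_integral_cmult nn_integral_sum P.emeasure_space_1)
  also have "\<dots> \<le> ennreal ((1 + b) / real (card I)) * (\<Sum>i\<in>I. ennreal X) + ennreal b + ennreal (L * b)"
    by (intro add_mono mult_left_mono sum_mono lbX crowd) auto
  also have "\<dots> = ennreal ((1 + b) / real (card I) * (real (card I) * X) + b + L * b)"
  proof -
    have "ennreal p * (\<Sum>i\<in>I. ennreal X) + ennreal b + ennreal (L * b) = ennreal (p * (real (card I) * X) + b + L * b)"
      if p: "0 \<le> p" for p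
      using b0 X0 L(2) p by (simp add: ennreal_mult ennreal_of_nat_eq_real_of_nat)
    thus ?thesis using b0 by auto
  qed
  also have "\<dots> \<le> ennreal ((1 + e) * exp ((1 + L) * (\<Sum>i<Suc k. level_err TYPE('d) \<kappa> (scale \<kappa> M i))) - 1)"
  proof (rule ennreal_leI)
    have "(1 + b) / real (card I) * (real (card I) * X) + b + L * b = (1 + b) * X + b + L * b" using cI by simp
    also have "\<dots> \<le> (1 + (1 + L) * b) * (1 + X) - 1"
    proof -
      have "0 \<le> L * b * X" using L(2) b0 X0 by simp
      thus ?thesis by (simp add: algebra_simps)
    qed
    also have "\<dots> \<le> exp ((1 + L) * b) * (1 + X) - 1"
      using X0 exp_ge_add_one_self[of "(1 + L) * b"] by (intro diff_right_mono mult_right_mono) auto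
    also have "\<dots> = (1 + e) * exp ((1 + L) * (\<Sum>i<Suc k. level_err TYPE('d) \<kappa> (scale \<kappa> M i))) - 1"
      by (simp add: X_def b_def S_def exp_add distrib_left)
    finally show "(1 + b) / real (card I) * (real (card I) * X) + b + L * b
      \<le> (1 + e) * exp ((1 + L) * (\<Sum>i<Suc k. level_err TYPE('d) \<kappa> (scale \<kappa> M i))) - 1" .
  qed
  finally show ?case .
qed

end

text \<open>The three demands on the base side \<open>(2 * k + 1) * J\<close>: it is beyond the
  threshold \<open>R0\<close>; the required cluster size is below half the number of cells, which is
  what \<open>base_box\<close> provides; the total error of all later levels is negligible.\<close>

lemma base_scale_asymp:
  fixes D \<kappa> J R0 L \<eta> c :: real
  assumes "1 \<le> D" "0 < \<kappa>" "1 \<le> J" "0 < \<eta>" "0 < c" "0 \<le> L"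
  shows "eventually (\<lambda>k::nat. R0 \<le> real (2 * k + 1) * J \<and>
    (real (2 * k + 1) * J) powr (D * (1 - \<kappa>)) \<le> real (2 * k + 1) powr D / 2 \<and>
    exp ((1 + L) * ((real (2 * k + 1) * J) powr (- c) / (1 - 2 powr (- c)))) \<le> 1 + \<eta>) sequentially"
proof -
  define a where "a = D * (1 - \<kappa>)"
  have "0 < D * \<kappa>" using assms by simp
  hence a: "a < D" by (simp add: a_def algebra_simps)
  define q where "q = (1 + L) / (1 - 2 powr (- c))"
  have "2 powr (- c) < (1 :: real)" using assms(5) by (simp add: powr_less_one)
  hence q: "0 < q" using assms(6) by (simp add: q_def)
  have J: "0 < J" using assms(3) by simp
  have D: "0 < D" using assms(1) by simp
  have s: "filterlim (\<lambda>k. real (2 * k + 1)) at_top sequentially" by real_asymp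
  have "filterlim (\<lambda>x. x * J) at_top at_top" using J by real_asymp
  hence 1: "eventually (\<lambda>x. R0 \<le> x * J) at_top" by (auto simp: filterlim_at_top)
  have "((\<lambda>x. (x * J) powr a / x powr D) \<longlongrightarrow> 0) at_top" using J a by real_asymp
  hence "eventually (\<lambda>x. (x * J) powr a / x powr D < 1 / 2) at_top" by (rule order_tendstoD) simp
  hence 2: "eventually (\<lambda>x. (x * J) powr a \<le> x powr D / 2) at_top"
    using eventually_gt_at_top[of 0] by eventually_elim (simp add: field_simps)
  have "((\<lambda>x. exp (q * (x * J) powr (- c))) \<longlongrightarrow> 1) at_top" using J q assms(5) by real_asymp
  hence "eventually (\<lambda>x. exp (q * (x * J) powr (- c)) < 1 + \<eta>) at_top" by (rule order_tendstoD) (use assms(4) in simp)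
  hence 3: "eventually (\<lambda>x. exp ((1 + L) * ((x * J) powr (- c) / (1 - 2 powr (- c)))) \<le> 1 + \<eta>) at_top"
    by eventually_elim (simp add: q_def)
  have "eventually (\<lambda>x. R0 \<le> x * J \<and> (x * J) powr a \<le> x powr D / 2 \<and>
     exp ((1 + L) * ((x * J) powr (- c) / (1 - 2 powr (- c)))) \<le> 1 + \<eta>) at_top"
    using 1 2 3 by eventually_elim simp
  from eventually_compose_filterlim[OF this s] show ?thesis unfolding a_def .
qed

context stat_process
begin

lemma quenched_mono:
  assumes "Measurable.pred (rspace P) A'" "\<omega> \<in> configurations \<Lambda>"
    "\<And>\<xi>. \<xi> \<in> space mk \<Longrightarrow> A (\<omega>, \<xi>) \<Longrightarrow> A' (\<omega>, \<xi>)"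
  shows "quenched A \<omega> \<le> quenched A' \<omega>"
  unfolding quenched_def using section_sets[OF assms(1,2)] assms(3)
  by (intro mk.finite_measure_mono) auto

text \<open>The cluster may use a window of side \<open>K\<close> around the centre, chosen after
  \<open>M\<close>, since the large cluster of a base box may owe its existence to connections
  outside the box.\<close>

definition base_fail :: "real \<Rightarrow> real \<Rightarrow> nat \<Rightarrow> nat \<Rightarrow> int^'d \<Rightarrow> 'd realisation \<Rightarrow> bool" where
  "base_fail \<kappa> N M K j z \<longleftrightarrow> \<not> big (rstat \<rho> z) (fst z \<inter> box_at (int_vec j) (real K)) (box_at (int_vec j) (real M)) N"

lemma pred_base_fail: "Measurable.pred (rspace P) (base_fail \<kappa> N M K j)"
  unfolding base_fail_def by (intro pred_intros_logic pred_rbig box_at_borel bounded_box_at)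

lemma base_fail_shift:
  "(\<integral>\<^sup>+\<omega>. quenched (base_fail \<kappa> N M K j) \<omega> \<partial>P) = (\<integral>\<^sup>+\<omega>. quenched (base_fail \<kappa> N M K 0) \<omega> \<partial>P)"
proof -
  let ?z = "int_vec j :: real^'d"
  have "quenched (base_fail \<kappa> N M K j) (shift ?z \<omega>) = quenched (base_fail \<kappa> N M K 0) \<omega>" if \<omega>: "\<omega> \<in> space P" for \<omega>
  proof -
    have c: "\<omega> \<in> configurations \<Lambda>" "shift ?z \<omega> \<in> configurations \<Lambda>" using \<omega> shift_config[OF _ int_vec_Lam] by (auto simp: space_P)
    show ?thesis
    proof (rule quenched_shift[OF pred_base_fail c])
      fix \<sigma> \<xi> assume \<sigma>: "bij \<sigma>" "\<And>x. x \<in> \<omega> \<Longrightarrow> \<sigma> (point_rank \<omega> x) = point_rank (shift ?z \<omega>) (x + ?z)"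
      have e: "box_at ?z r = shift ?z (box_at 0 r)" for r by (simp add: shift_box_at)
      show "base_fail \<kappa> N M K j (shift ?z \<omega>, \<xi>) = base_fail \<kappa> N M K 0 (\<omega>, permute \<sigma> \<xi>)"
        using big_shift[OF \<sigma> c, of \<xi> "box_at 0 (real K)" "box_at 0 (real M)" N]
        unfolding base_fail_def e fst_conv int_vec_0 by (rule arg_cong[where f = Not])
    qed
  qed
  hence "(\<integral>\<^sup>+\<omega>. quenched (base_fail \<kappa> N M K 0) \<omega> \<partial>P) = (\<integral>\<^sup>+\<omega>. quenched (base_fail \<kappa> N M K j) (shift ?z \<omega>) \<partial>P)"
    by (intro nn_integral_cong) simp
  also have "\<dots> = (\<integral>\<^sup>+\<omega>. quenched (base_fail \<kappa> N M K j) \<omega> \<partial>P)"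
    by (rule nn_integral_shift[OF int_vec_Lam]) (use measurable_quenched(1)[OF pred_base_fail] in measurable)
  finally show ?thesis by simp
qed

text \<open>\<open>M\<close> and \<open>K\<close> are chosen once, and the bound then holds for all
  levels \<open>k\<close> and all centres \<open>j\<close>. The starting error is small by
  percolation, the later ones are small because \<open>M\<close> is large.\<close>

lemma good_levels:
  assumes perc: "AE \<omega> in P. perc \<omega> = 1"
    and uniq: "AE z in rspace P. \<forall>x\<in>fst z. \<forall>y\<in>fst z. infinite (cluster (rstat \<rho> z) (fst z) x) \<and>
       infinite (cluster (rstat \<rho> z) (fst z) y) \<longrightarrow> cluster (rstat \<rho> z) (fst z) x = cluster (rstat \<rho> z) (fst z) y"
    and intens: "intensity P < \<infinity>" and \<kappa>: "0 < \<kappa>" "\<kappa> \<le> 1" and R0: "\<And>R. R0 \<le> R \<Longrightarrow> 4 \<le> R powr \<kappa>" and \<epsilon>: "0 < \<epsilon>"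
  shows "\<exists>M K. R0 \<le> real M \<and> 1 \<le> M \<and>
    (\<forall>k j. (\<integral>\<^sup>+\<omega>. level_bound \<kappa> M (\<lambda>j. quenched (base_fail \<kappa> (real M powr (real CARD('d) * (1 - \<kappa>))) M K j) \<omega>) \<omega> k j \<partial>P) \<le> ennreal \<epsilon>)"
proof -
  define D where "D = real CARD('d)"
  have D: "1 \<le> D" unfolding D_def by (simp add: Suc_leI)
  define L where "L = enn2real (intensity P)"
  have L: "intensity P \<le> ennreal L" "0 \<le> L" using intens by (auto simp: L_def)
  \<comment> \<open>With base failure \<open>3 * \<eta>\<close> and total growth factor
    \<open>1 + \<eta>\<close> the final bound is at most \<open>7 * \<eta>\<close>, so an eighth of
    \<open>\<epsilon>\<close> is enough.\<close>
  define \<eta> where "\<eta> = min \<epsilon> 1 / 8"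
  have \<eta>: "0 < \<eta>" "\<eta> \<le> 1 / 8" "\<eta> \<le> \<epsilon> / 8" using \<epsilon> by (auto simp: \<eta>_def)
  obtain j0 where j0: "\<forall>k. \<exists>K::nat. (\<integral>\<^sup>+\<omega>. quenched (\<lambda>z. \<not> big (rstat \<rho> z) (fst z \<inter> box_at 0 (real K))
      (box_at 0 (real (2 * k + 1) * real (2 * j0 + 1))) (real ((2 * k + 1) ^ CARD('d)) / 2)) \<omega> \<partial>P) \<le> ennreal (3 * \<eta>)"
    using base_box[OF perc uniq \<eta>(1)] by blast
  define c where "c = D * \<kappa>^2 / 2"
  have c: "0 < c" using D \<kappa> by (simp add: c_def)
  obtain k0 where k0: "R0 \<le> real (2 * k0 + 1) * real (2 * j0 + 1)"
    "(real (2 * k0 + 1) * real (2 * j0 + 1)) powr (D * (1 - \<kappa>)) \<le> real (2 * k0 + 1) powr D / 2"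
    "exp ((1 + L) * ((real (2 * k0 + 1) * real (2 * j0 + 1)) powr (- c) / (1 - 2 powr (- c)))) \<le> 1 + \<eta>"
    using eventually_happens[OF base_scale_asymp[OF D \<kappa>(1) _ \<eta>(1) c L(2), of "real (2 * j0 + 1)" R0]] by auto
  define M where "M = (2 * k0 + 1) * (2 * j0 + 1)"
  have rM: "real M = real (2 * k0 + 1) * real (2 * j0 + 1)" by (simp only: M_def of_nat_mult)
  have M1: "1 \<le> M" by (simp add: M_def)
  have oM: "odd M" by (simp add: M_def)
  have MR: "R0 \<le> real M" using k0(1) by (simp only: rM)
  have M2: "4 \<le> R powr \<kappa>" if "real M \<le> R" for R using R0 MR that by force
  define N where "N = real M powr (D * (1 - \<kappa>))"
  have N: "N \<le> real ((2 * k0 + 1) ^ CARD('d)) / 2"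
  proof -
    have "real (2 * k0 + 1) powr D = real (2 * k0 + 1) ^ CARD('d)" unfolding D_def by (rule powr_realpow) simp
    thus ?thesis using k0(2) by (simp only: N_def rM of_nat_power)
  qed
  obtain K :: nat where K: "(\<integral>\<^sup>+\<omega>. quenched (\<lambda>z. \<not> big (rstat \<rho> z) (fst z \<inter> box_at 0 (real K))
      (box_at 0 (real (2 * k0 + 1) * real (2 * j0 + 1))) (real ((2 * k0 + 1) ^ CARD('d)) / 2)) \<omega> \<partial>P) \<le> ennreal (3 * \<eta>)"
    using j0 by blast
  have g0: "(\<integral>\<^sup>+\<omega>. quenched (base_fail \<kappa> N M K j) \<omega> \<partial>P) \<le> ennreal (3 * \<eta>)" for j
  proof -
    have "(\<integral>\<^sup>+\<omega>. quenched (base_fail \<kappa> N M K 0) \<omega> \<partial>P) \<le> (\<integral>\<^sup>+\<omega>. quenched (\<lambda>z. \<not> big (rstat \<rho> z) (fst z \<inter> box_at 0 (real K))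
      (box_at 0 (real M)) (real ((2 * k0 + 1) ^ CARD('d)) / 2)) \<omega> \<partial>P)"
    proof (intro nn_integral_mono ennreal_leI quenched_mono)
      fix \<omega> \<xi> assume a: "base_fail \<kappa> N M K 0 (\<omega>, \<xi>)"
      show "\<not> big (rstat \<rho> (\<omega>, \<xi>)) (fst (\<omega>, \<xi>) \<inter> box_at 0 (real K)) (box_at 0 (real M)) (real ((2 * k0 + 1) ^ CARD('d)) / 2)"
        using a N unfolding base_fail_def big_def int_vec_0 by (meson order_trans)
    qed (auto simp: space_P intro!: pred_intros_logic pred_rbig box_at_borel bounded_box_at)
    thus ?thesis using K unfolding base_fail_shift[of \<kappa> N M K j] rM by (rule order_trans)
  qed
  have "(\<integral>\<^sup>+\<omega>. level_bound \<kappa> M (\<lambda>j. quenched (base_fail \<kappa> N M K j) \<omega>) \<omega> k j \<partial>P) \<le> ennreal \<epsilon>" for k j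
  proof -
    have "(\<integral>\<^sup>+\<omega>. level_bound \<kappa> M (\<lambda>j. quenched (base_fail \<kappa> N M K j) \<omega>) \<omega> k j \<partial>P)
      \<le> ennreal ((1 + 3 * \<eta>) * exp ((1 + L) * (\<Sum>i<k. level_err TYPE('d) \<kappa> (scale \<kappa> M i))) - 1)"
      by (rule expected_level_bound[OF M1 M2 oM \<kappa> _ _ g0 _ L])
        (use \<eta> quenched_range(1) measurable_quenched(1)[OF pred_base_fail] in auto)
    also have "\<dots> \<le> ennreal \<epsilon>"
    proof (rule ennreal_leI)
      have "exp ((1 + L) * (\<Sum>i<k. level_err TYPE('d) \<kappa> (scale \<kappa> M i))) \<le> exp ((1 + L) * (real M powr (- c) / (1 - 2 powr (- c))))"
        using level_err_sum[OF M1 M2 \<kappa>(1), where ?'d = 'd, of "TYPE('d)" k] L(2)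
        unfolding exp_le_cancel_iff c_def D_def by (intro mult_left_mono) auto
      also have "\<dots> \<le> 1 + \<eta>" using k0(3) by (simp only: rM)
      finally have "(1 + 3 * \<eta>) * exp ((1 + L) * (\<Sum>i<k. level_err TYPE('d) \<kappa> (scale \<kappa> M i))) \<le> (1 + 3 * \<eta>) * (1 + \<eta>)"
        using \<eta>(1) by (intro mult_left_mono) auto
      also have "\<dots> = 1 + 4 * \<eta> + 3 * (\<eta> * \<eta>)" by (simp add: algebra_simps)
      also have "\<eta> * \<eta> \<le> \<eta> * 1" using \<eta> by (intro mult_left_mono) auto
      finally show "(1 + 3 * \<eta>) * exp ((1 + L) * (\<Sum>i<k. level_err TYPE('d) \<kappa> (scale \<kappa> M i))) - 1 \<le> \<epsilon>" using \<eta> by linarith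
    qed
    finally show ?thesis .
  qed
  thus ?thesis using M1 MR unfolding N_def D_def by blast
qed

text \<open>A side \<open>n\<close> lies between two scales. If \<open>s\<close> is the last scale
  not above \<open>n - K\<close>, then \<open>n < K + 2 * s powr (1 + \<kappa>)\<close>, and the
  loss in the exponent is harmless when \<open>lam < (1 - \<kappa>) / (1 + \<kappa>)\<close>. So the
  growth exponent \<open>\<kappa>\<close> of the scales has to be small compared with
  \<open>1 - lam\<close>.\<close>

lemma final_scale_asymp:
  fixes K D \<kappa> lam :: real
  assumes "1 \<le> D" "0 < \<kappa>" "\<kappa> < 1" "0 < lam" "lam < (1 - \<kappa>) / (1 + \<kappa>)"
  shows "eventually (\<lambda>n::nat. \<forall>s\<ge>1. real n < K + 2 * s powr (1 + \<kappa>) \<longrightarrow> real n powr (lam * D) < s powr (D * (1 - \<kappa>))) sequentially"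
proof -
  define a where "a = D * ((1 - \<kappa>) / (1 + \<kappa>))"
  define b where "b = lam * D"
  have b: "0 < b" using assms by (simp add: b_def)
  have "D * lam < a" unfolding a_def using assms by (intro mult_strict_left_mono) auto
  hence b: "0 < b" "b < a" using b by (simp_all add: b_def mult.commute)
  have "eventually (\<lambda>x::real. x powr b < ((x - K) / 2) powr a) at_top" using b by real_asymp
  moreover have "eventually (\<lambda>x::real. K < x) at_top" by (rule eventually_gt_at_top)
  ultimately have "eventually (\<lambda>x. \<forall>s\<ge>1. x < K + 2 * s powr (1 + \<kappa>) \<longrightarrow> x powr b < s powr (D * (1 - \<kappa>))) at_top"
  proof eventually_elim
    case (elim x)
    show ?case
    proof (intro allI impI)
      fix s :: real assume s: "1 \<le> s" "x < K + 2 * s powr (1 + \<kappa>)"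
      have "((x - K) / 2) powr a \<le> (s powr (1 + \<kappa>)) powr a"
        using s elim(2) b by (intro powr_mono2) auto
      also have "\<dots> = s powr (D * (1 - \<kappa>))"
        unfolding powr_powr a_def using assms by (intro arg_cong[where f = "\<lambda>e. s powr e"]) simp
      finally show "x powr b < s powr (D * (1 - \<kappa>))" using elim(1) by simp
    qed
  qed
  from eventually_compose_filterlim[OF this filterlim_real_sequentially] show ?thesis by (simp add: b_def)
qed

lemma large_clusters:
  fixes \<epsilon> \<kappa> S0 lam \<epsilon>' :: real
  defines "D \<equiv> real CARD('d)"
  assumes perc: "AE \<omega> in P. perc \<omega> = 1"
    and uniq: "AE z in rspace P. \<forall>x\<in>fst z. \<forall>y\<in>fst z. infinite (cluster (rstat \<rho> z) (fst z) x) \<and>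
       infinite (cluster (rstat \<rho> z) (fst z) y) \<longrightarrow> cluster (rstat \<rho> z) (fst z) x = cluster (rstat \<rho> z) (fst z) y"
    and intens: "intensity P < \<infinity>"
    and \<epsilon>: "0 < \<epsilon>" "\<epsilon> < 1"
    and decay: "\<And>S. S0 \<le> S \<Longrightarrow> \<exists>\<sigma> \<tau>. 0 < \<sigma> \<and> \<sigma> \<le> 1 \<and> 0 < \<tau> \<and> \<tau> \<le> 1 \<and> S powr (- (D * (1 - \<epsilon>))) \<le> \<sigma> \<and>
       S powr (- (D * (1 - \<epsilon>))) \<le> \<tau> \<and> S powr (- (D * (2 - \<epsilon>))) \<le> \<rho> \<sigma> \<tau> (D * S) * (\<sigma> * \<tau>)"
    and lam: "0 < lam" "lam < 1" and \<epsilon>': "0 < \<epsilon>'"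
  shows "eventually (\<lambda>n::nat. 1 - \<epsilon>' \<le> measure (rspace P) {z\<in>space (rspace P).
     \<exists>x\<in>fst z \<inter> cube (real n). real n powr (lam * D) < real (card (cluster (rstat \<rho> z) (fst z \<inter> cube (real n)) x))}) sequentially"
proof -
  \<comment> \<open>The first entry serves the balance of exponents in \<open>level_step\<close>,
    the second gives \<open>lam < (1 - \<kappa>) / (1 + \<kappa>)\<close>.\<close>
  define \<kappa> where "\<kappa> = min (\<epsilon> / 32) ((1 - lam) / 4)"
  have \<kappa>0: "0 < \<kappa>" using \<epsilon> lam by (simp add: \<kappa>_def)
  have \<kappa>: "0 < \<kappa>" "\<kappa> \<le> \<epsilon> / 32" "\<kappa> \<le> (1 - lam) / 4" unfolding \<kappa>_def by (rule \<kappa>0[unfolded \<kappa>_def], rule min.cobounded1, rule min.cobounded2)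
  have \<kappa>1: "\<kappa> < 1" "\<kappa> \<le> 1" using \<kappa> lam by auto
  have D1: "1 \<le> D" unfolding D_def by (simp add: Suc_leI)
  have "lam * (1 + \<kappa>) < 1 - \<kappa>"
  proof -
    have "lam * \<kappa> \<le> 1 * \<kappa>" using lam \<kappa> by (intro mult_right_mono) auto
    moreover have "a \<le> k \<Longrightarrow> k \<le> (1 - l) / 4 \<Longrightarrow> l < 1 \<Longrightarrow> l + a < 1 - k" for a k l :: real by argo
    ultimately show ?thesis using \<kappa> lam unfolding distrib_left mult_1_right mult_1 by blast
  qed
  hence lk: "lam < (1 - \<kappa>) / (1 + \<kappa>)" using \<kappa> by (simp add: field_simps)
  obtain R0 where R0: "1 \<le> R0" "\<forall>R\<ge>R0. 4 \<le> R powr \<kappa> \<and> (\<forall>X z. finite X \<longrightarrow>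
     real (card (box_at z (real (2 * branch \<kappa> R + 1) * R) \<inter> X)) \<le> (real (2 * branch \<kappa> R + 1) * R) powr (D * (1 + \<kappa>)) \<longrightarrow>
     pbad X (box_at (z::real^'d) (real (2 * branch \<kappa> R + 1) * R)) ((real (2 * branch \<kappa> R + 1) * R) powr (D * (1 - \<kappa>)))
       \<le> (1 + R powr (- (D * \<kappa>^2 / 2))) * ((\<Sum>i\<in>offsets (branch \<kappa> R). pbad X (box_at (z + R *\<^sub>R int_vec i) R) (R powr (D * (1 - \<kappa>))))
            / real (card (offsets (branch \<kappa> R) :: (int^'d) set))) + R powr (- (D * \<kappa>^2 / 2)))"
    using level_step[where ?'d = 'd, OF \<epsilon> \<kappa>(1,2)] decay unfolding D_def by blast
  have R04: "4 \<le> R powr \<kappa>" if "R0 \<le> R" for R using R0(2) that by blast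
  obtain M K where M: "R0 \<le> real M" "1 \<le> M" and
    lb: "\<And>k j. (\<integral>\<^sup>+\<omega>. level_bound \<kappa> M (\<lambda>j. quenched (base_fail \<kappa> (real M powr (D * (1 - \<kappa>))) M K j) \<omega>) \<omega> k j \<partial>P) \<le> ennreal \<epsilon>'"
    using good_levels[OF perc uniq intens \<kappa>(1) \<kappa>1(2) R04 \<epsilon>'] unfolding D_def by blast
  have M4: "4 \<le> R powr \<kappa>" if "real M \<le> R" for R using R04 M(1) that by force
  define N where "N = real M powr (D * (1 - \<kappa>))"
  have "eventually (\<lambda>n::nat. (\<forall>s\<ge>1. real n < real K + 2 * s powr (1 + \<kappa>) \<longrightarrow> real n powr (lam * D) < s powr (D * (1 - \<kappa>))) \<and> K + M \<le> n) sequentially"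
    using final_scale_asymp[OF D1 \<kappa>(1) \<kappa>1(1) lam(1) lk] eventually_ge_at_top[of "K + M"] by eventually_elim simp
  thus ?thesis
  proof eventually_elim
    case (elim n)
    define W where "W = (cube (real n) :: (real^'d) set)"
    have Wb: "W = box_at 0 (real n)" by (simp add: W_def box_at_def)
    have W: "bounded W" "W \<in> sets borel" unfolding Wb by (rule bounded_box_at, rule box_at_borel)
    \<comment> \<open>A margin of \<open>K / 2\<close> on each side: a base box inside
      \<open>W'\<close> has its centre there, so its window of side \<open>K\<close> stays inside
      \<open>W\<close>.\<close>
    define W' where "W' = box_at (0 :: real^'d) (real (n - K))"
    define Q where "Q = (\<lambda>k. scale \<kappa> M k \<le> n - K)"
    have KM: "K + M \<le> n" using elim by blast
    have Q0: "Q 0" using KM unfolding Q_def scale.simps by linarith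
    have Qb: "k \<le> n" if "Q k" for k
    proof -
      have "k < 2 ^ k" by (rule less_exp)
      also have "\<dots> \<le> 2 ^ k * M" using M(2) by simp
      also have "\<dots> \<le> scale \<kappa> M k" by (rule scale_ge[OF M(2) M4])
      also have "\<dots> \<le> n - K" using that by (simp add: Q_def)
      finally show ?thesis by simp
    qed
    \<comment> \<open>The largest scale that fits into \<open>W'\<close>. It exists because the
      scales grow at least like \<open>2 ^ k\<close>.\<close>
    define k where "k = Greatest Q"
    have Qk: "Q k" unfolding k_def using Q0 Qb by (rule GreatestI_nat[where P = Q and b = n])
    have nQ: "\<not> Q (Suc k)" using Greatest_le_nat[of Q "Suc k" n] Qb unfolding k_def by fastforce
    define s where "s = real (scale \<kappa> M k)"
    have s1: "1 \<le> s" using scale_ge_base[OF M(2) M4, of k] M(2) by (simp add: s_def)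
    have "n - K < scale \<kappa> M (Suc k)" using nQ unfolding Q_def by simp
    hence "real n < real K + real (scale \<kappa> M (Suc k))" using KM by linarith
    hence "real n < real K + 2 * s powr (1 + \<kappa>)" using scale_Suc_le[OF M(2) M4, of k] unfolding s_def by linarith
    hence ns: "real n powr (lam * D) < s powr (D * (1 - \<kappa>))" using elim s1 by blast
    define B where "B = box_at (int_vec 0 :: real^'d) s"
    have BW': "B \<subseteq> W'" using Qk unfolding B_def W'_def Q_def s_def int_vec_0 by (intro box_at_mono) simp
    have W'W: "box_at (int_vec j) (real K) \<subseteq> W" if j: "box_at (int_vec j) (real M) \<subseteq> W'" for j :: "int^'d"
    proof
      fix x assume x: "x \<in> box_at (int_vec j :: real^'d) (real K)"
      have "(int_vec j :: real^'d) \<in> box_at (int_vec j) (real M)" using M(2) by (simp add: box_at_def cube_def)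
      hence z: "(int_vec j :: real^'d) \<in> W'" using j by blast
      have "- real n / 2 < x $ i \<and> x $ i \<le> real n / 2" for i
      proof -
        have "- real K / 2 < x $ i - int_vec j $ i \<and> x $ i - int_vec j $ i \<le> real K / 2"
          using x by (simp add: box_at_def cube_def)
        moreover have "- real (n - K) / 2 < int_vec j $ i \<and> int_vec j $ i \<le> real (n - K) / 2"
          using z by (simp add: W'_def box_at_def cube_def)
        moreover have "real (n - K) = real n - real K" using KM by simp
        ultimately show ?thesis by linarith
      qed
      thus "x \<in> W" by (simp add: W_def cube_def)
    qed
    define bad where "bad = (\<lambda>z. \<not> big (rstat \<rho> z) (fst z \<inter> W) B (s powr (D * (1 - \<kappa>))))"
    have badp: "Measurable.pred (rspace P) bad" unfolding bad_def B_def by (intro pred_intros_logic pred_rbig box_at_borel W)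
    have le: "quenched bad \<omega> \<le> level_bound \<kappa> M (\<lambda>j. quenched (base_fail \<kappa> N M K j) \<omega>) \<omega> k 0" if "\<omega> \<in> space P" for \<omega>
    proof -
      have \<omega>: "\<omega> \<in> configurations \<Lambda>" using that by (simp add: space_P)
      have "pbad (\<omega> \<inter> W) (box_at (int_vec 0) (real (scale \<kappa> M k))) (real (scale \<kappa> M k) powr (D * (1 - \<kappa>)))
        \<le> level_bound \<kappa> M (\<lambda>j. quenched (base_fail \<kappa> N M K j) \<omega>) \<omega> k 0"
        unfolding D_def
      proof (rule pbad_level_bound(1)[OF \<omega> W(1) M(2) M4, where W' = W'])
        fix j :: "int^'d" assume j: "box_at (int_vec j) (real M) \<subseteq> W'"
        have "quenched (\<lambda>z. \<not> big (rstat \<rho> z) (fst z \<inter> W) (box_at (int_vec j) (real M)) N) \<omega> \<le> quenched (base_fail \<kappa> N M K j) \<omega>"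
        proof (rule quenched_mono[OF pred_base_fail \<omega>])
          fix \<xi> assume a: "\<not> big (rstat \<rho> (\<omega>, \<xi>)) (fst (\<omega>, \<xi>) \<inter> W) (box_at (int_vec j) (real M)) N"
          show "base_fail \<kappa> N M K j (\<omega>, \<xi>)"
            unfolding base_fail_def
          proof
            assume "big (rstat \<rho> (\<omega>, \<xi>)) (fst (\<omega>, \<xi>) \<inter> box_at (int_vec j) (real K)) (box_at (int_vec j) (real M)) N"
            hence "big (rstat \<rho> (\<omega>, \<xi>)) (fst (\<omega>, \<xi>) \<inter> W) (box_at (int_vec j) (real M)) N"
              by (rule big_mono) (use W'W[OF j] finite_config_Int[OF \<omega> W(1)] in auto)
            thus False using a by blast
          qed
        qed
        thus "pbad (\<omega> \<inter> W) (box_at (int_vec j) (real M)) (real M powr (real CARD('d) * (1 - \<kappa>))) \<le> quenched (base_fail \<kappa> N M K j) \<omega>"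
          unfolding quenched_big[OF \<omega> W(1)] N_def D_def .
      next
        show "box_at (int_vec 0) (real (scale \<kappa> M k)) \<subseteq> W'" using BW' by (simp add: B_def s_def)
      next
        fix R and X :: "(real^'d) set" and z :: "real^'d" assume a: "real M \<le> R" "finite X"
          "real (card (box_at z (real (2 * branch \<kappa> R + 1) * R) \<inter> X)) \<le> (real (2 * branch \<kappa> R + 1) * R) powr (real CARD('d) * (1 + \<kappa>))"
        have RR: "R0 \<le> R" using a(1) M(1) by simp
        show "pbad X (box_at (z::real^'d) (real (2 * branch \<kappa> R + 1) * R)) ((real (2 * branch \<kappa> R + 1) * R) powr (real CARD('d) * (1 - \<kappa>)))
       \<le> (1 + R powr (- (real CARD('d) * \<kappa>^2 / 2))) * ((\<Sum>i\<in>offsets (branch \<kappa> R). pbad X (box_at (z + R *\<^sub>R int_vec i) R) (R powr (real CARD('d) * (1 - \<kappa>))))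
            / real (card (offsets (branch \<kappa> R) :: (int^'d) set))) + R powr (- (real CARD('d) * \<kappa>^2 / 2))"
          by (rule R0(2)[unfolded D_def, rule_format, OF RR, THEN conjunct2, rule_format, OF a(2,3)])
      qed (auto simp: quenched_range)
      thus ?thesis unfolding bad_def quenched_big[OF \<omega> W(1)] B_def s_def .
    qed
    have "emeasure (rspace P) {z\<in>space (rspace P). bad z} = (\<integral>\<^sup>+\<omega>. quenched bad \<omega> \<partial>P)"
      by (rule measurable_quenched(2)[OF badp, symmetric])
    also have "\<dots> \<le> (\<integral>\<^sup>+\<omega>. level_bound \<kappa> M (\<lambda>j. quenched (base_fail \<kappa> N M K j) \<omega>) \<omega> k 0 \<partial>P)"
      by (intro nn_integral_mono ennreal_leI le)
    also have "\<dots> \<le> ennreal \<epsilon>'" unfolding N_def by (rule lb)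
    finally have m1: "measure (rspace P) {z\<in>space (rspace P). bad z} \<le> \<epsilon>'"
      using \<epsilon>' by (simp add: N.emeasure_eq_measure)
    define G where "G = {z\<in>space (rspace P). \<exists>x\<in>fst z \<inter> W. real n powr (lam * D) < real (card (cluster (rstat \<rho> z) (fst z \<inter> W) x))}"
    have "{z\<in>space (rspace P). bad z} \<in> sets (rspace P)" using badp by (simp add: pred_def)
    moreover have Gs: "space (rspace P) - {z\<in>space (rspace P). bad z} \<subseteq> G"
    proof
      fix z assume z: "z \<in> space (rspace P) - {z\<in>space (rspace P). bad z}"
      have fin: "finite (fst z \<inter> W)" using z config_of by (intro finite_config_Int[of _ \<Lambda>] W) auto
      obtain x where x: "x \<in> fst z \<inter> W" "s powr (D * (1 - \<kappa>)) \<le> real (card (cluster (rstat \<rho> z) (fst z \<inter> W) x \<inter> B))"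
        using z by (auto simp: bad_def big_def)
      have "finite (cluster (rstat \<rho> z) (fst z \<inter> W) x)" using cluster_subset[OF x(1)] fin by (rule finite_subset)
      hence "card (cluster (rstat \<rho> z) (fst z \<inter> W) x \<inter> B) \<le> card (cluster (rstat \<rho> z) (fst z \<inter> W) x)" by (intro card_mono) auto
      hence "real n powr (lam * D) < real (card (cluster (rstat \<rho> z) (fst z \<inter> W) x))" using x(2) ns by linarith
      thus "z \<in> G" using x(1) z by (auto simp: G_def)
    qed
    moreover have "G \<in> sets (rspace P)"
    proof -
      \<comment> \<open>A strict lower bound for an integer is a non-strict one by the integer after
        the floor, which is the form covered by \<open>pred_rbig\<close>.\<close>
      have eq: "real n powr (lam * D) < real c \<longleftrightarrow> real (Suc (nat \<lfloor>real n powr (lam * D)\<rfloor>)) \<le> real c" for c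
        using floor_less_iff[of "real n powr (lam * D)" "int c"] nat_less_iff[of "\<lfloor>real n powr (lam * D)\<rfloor>" c]
        unfolding of_nat_le_iff Suc_le_eq by simp
      have "G = {z\<in>space (rspace P). big (rstat \<rho> z) (fst z \<inter> W) UNIV (real (Suc (nat \<lfloor>real n powr (lam * D)\<rfloor>)))}"
        unfolding G_def big_def eq by simp
      thus ?thesis using pred_rbig[OF W(2,1), of UNIV] by (simp add: pred_def)
    qed
    ultimately have "1 - measure (rspace P) {z\<in>space (rspace P). bad z} \<le> measure (rspace P) G"
      by (subst N.prob_compl[symmetric]) (auto intro!: N.finite_measure_mono)
    thus ?case using m1 unfolding G_def W_def by linarith
  qed
qed

end

section \<open>Borel enclosure of the connection probability\<close>

definition QI :: "real set" where
  "QI = \<rat> \<inter> {0<..<1}"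

lemma countable_QI: "countable (QI \<times> QI)"
  unfolding QI_def by (intro countable_SIGMA countable_Int1 countable_rat)

lemma QI_between: "0 \<le> s \<Longrightarrow> s < t \<Longrightarrow> t \<le> 1 \<Longrightarrow> \<exists>a\<in>QI. s < a \<and> a < t"
  using Rats_dense_in_real[of s t] by (auto simp: QI_def)

lemma QI_nonempty: "QI \<times> QI \<noteq> {}"
  using QI_between[of 0 1] by auto

text \<open>A connection function is only Lebesgue measurable in general. It is enclosed between the Borel functions
  \<open>edge_lo\<close> and \<open>edge_hi\<close>, which agree outside a null set of mark pairs for every distance.\<close>

definition edge_prob :: "(real \<Rightarrow> real \<Rightarrow> real \<Rightarrow> real) \<Rightarrow> real \<Rightarrow> real \<Rightarrow> real \<Rightarrow> real" where
  "edge_prob \<phi> s t r = 1 - exp (- \<phi> s t r)"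

definition edge_lo :: "(real \<Rightarrow> real \<Rightarrow> real \<Rightarrow> real) \<Rightarrow> real \<Rightarrow> real \<Rightarrow> real \<Rightarrow> real" where
  "edge_lo \<phi> s t r = (SUP q\<in>QI \<times> QI. if s < fst q \<and> t < snd q \<and> 0 < r then edge_prob \<phi> (fst q) (snd q) r else 0)"

definition edge_hi :: "(real \<Rightarrow> real \<Rightarrow> real \<Rightarrow> real) \<Rightarrow> real \<Rightarrow> real \<Rightarrow> real \<Rightarrow> real" where
  "edge_hi \<phi> s t r = (INF q\<in>QI \<times> QI. if fst q < s \<and> snd q < t \<and> 0 < r then edge_prob \<phi> (fst q) (snd q) r else 1)"

context
  fixes \<phi> assumes phi: "connection_function \<phi>"
begin

lemma phi_nonneg: "s \<in> {0<..<1} \<Longrightarrow> t \<in> {0<..<1} \<Longrightarrow> 0 < r \<Longrightarrow> 0 \<le> \<phi> s t r"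
  and phi_sym: "s \<in> {0<..<1} \<Longrightarrow> t \<in> {0<..<1} \<Longrightarrow> 0 < r \<Longrightarrow> \<phi> s t r = \<phi> t s r"
  using phi by (auto simp: connection_function_def)

lemma phi_anti:
  assumes "s \<in> {0<..<1}" "s' \<in> {0<..<1}" "t \<in> {0<..<1}" "t' \<in> {0<..<1}" "0 < r" "s \<le> s'" "t \<le> t'" "r \<le> r'"
  shows "\<phi> s' t' r' \<le> \<phi> s t r"
proof -
  have "\<phi> s' t' r' \<le> \<phi> s t' r'"
    using phi assms unfolding connection_function_def monotone_on_def by auto
  also have "\<dots> \<le> \<phi> s t r'"
    using phi assms unfolding connection_function_def monotone_on_def by auto
  also have "\<dots> \<le> \<phi> s t r"
    using phi assms unfolding connection_function_def monotone_on_def by auto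
  finally show ?thesis .
qed

lemma edge_prob_range: "s \<in> {0<..<1} \<Longrightarrow> t \<in> {0<..<1} \<Longrightarrow> 0 < r \<Longrightarrow> 0 \<le> edge_prob \<phi> s t r \<and> edge_prob \<phi> s t r \<le> 1"
  using phi_nonneg by (simp add: edge_prob_def)

lemma edge_prob_anti:
  "s \<in> {0<..<1} \<Longrightarrow> s' \<in> {0<..<1} \<Longrightarrow> t \<in> {0<..<1} \<Longrightarrow> t' \<in> {0<..<1} \<Longrightarrow> 0 < r \<Longrightarrow> s \<le> s' \<Longrightarrow> t \<le> t' \<Longrightarrow> r \<le> r' \<Longrightarrow>
    edge_prob \<phi> s' t' r' \<le> edge_prob \<phi> s t r"
  using phi_anti by (simp add: edge_prob_def)

lemma QI_D: "q \<in> QI \<times> QI \<Longrightarrow> fst q \<in> {0<..<1} \<and> snd q \<in> {0<..<1}"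
  by (auto simp: QI_def)

lemma lo_term_range:
  assumes "q \<in> QI \<times> QI" shows "0 \<le> (if s < fst q \<and> t < snd q \<and> 0 < r then edge_prob \<phi> (fst q) (snd q) r else 0)"
    "(if s < fst q \<and> t < snd q \<and> 0 < r then edge_prob \<phi> (fst q) (snd q) r else 0) \<le> 1"
  using edge_prob_range[of "fst q" "snd q" r] QI_D[OF assms] by auto

lemma hi_term_range:
  assumes "q \<in> QI \<times> QI" shows "0 \<le> (if fst q < s \<and> snd q < t \<and> 0 < r then edge_prob \<phi> (fst q) (snd q) r else 1)"
    "(if fst q < s \<and> snd q < t \<and> 0 < r then edge_prob \<phi> (fst q) (snd q) r else 1) \<le> 1"
  using edge_prob_range[of "fst q" "snd q" r] QI_D[OF assms] by auto

lemma lo_bdd: "bdd_above ((\<lambda>q. if s < fst q \<and> t < snd q \<and> 0 < r then edge_prob \<phi> (fst q) (snd q) r else 0) ` (QI \<times> QI))"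
  by (rule bdd_aboveI2[where M = 1]) (rule lo_term_range)

lemma hi_bdd: "bdd_below ((\<lambda>q. if fst q < s \<and> snd q < t \<and> 0 < r then edge_prob \<phi> (fst q) (snd q) r else 1) ` (QI \<times> QI))"
  by (rule bdd_belowI2[where m = 0]) (rule hi_term_range)

lemma lo_ge:
  assumes "a \<in> QI" "b \<in> QI" "s < a" "t < b" "0 < r" shows "edge_prob \<phi> a b r \<le> edge_lo \<phi> s t r"
  using cSUP_upper[OF _ lo_bdd, of "(a, b)" s t r] assms by (simp add: edge_lo_def)

lemma hi_le:
  assumes "a \<in> QI" "b \<in> QI" "a < s" "b < t" "0 < r" shows "edge_hi \<phi> s t r \<le> edge_prob \<phi> a b r"
  using cINF_lower[OF hi_bdd, of "(a, b)" s t r] assms by (simp add: edge_hi_def)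

lemma edge_lo_le:
  assumes "s \<in> {0<..<1}" "t \<in> {0<..<1}" "0 < r" shows "edge_lo \<phi> s t r \<le> edge_prob \<phi> s t r"
  unfolding edge_lo_def
proof (rule cSUP_least[OF QI_nonempty])
  fix q assume "q \<in> QI \<times> QI"
  thus "(if s < fst q \<and> t < snd q \<and> 0 < r then edge_prob \<phi> (fst q) (snd q) r else 0) \<le> edge_prob \<phi> s t r"
    using edge_prob_anti[of s "fst q" t "snd q" r r] edge_prob_range[of s t r] assms QI_D[of q] by auto
qed

lemma edge_hi_ge:
  assumes "s \<in> {0<..<1}" "t \<in> {0<..<1}" "0 < r" shows "edge_prob \<phi> s t r \<le> edge_hi \<phi> s t r"
  unfolding edge_hi_def
proof (rule cINF_greatest[OF QI_nonempty])
  fix q assume "q \<in> QI \<times> QI"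
  thus "edge_prob \<phi> s t r \<le> (if fst q < s \<and> snd q < t \<and> 0 < r then edge_prob \<phi> (fst q) (snd q) r else 1)"
    using edge_prob_anti[of "fst q" s "snd q" t r r] edge_prob_range[of s t r] assms QI_D[of q] by auto
qed

text \<open>For fixed marks the edge probability is monotone in the distance and hence Borel. The
  default value 1 at non-positive distances, where nothing is assumed about \<open>\<phi>\<close>,
  keeps it monotone.\<close>

lemma measurable_edge_prob_dist:
  assumes "a \<in> {0<..<1}" "b \<in> {0<..<1}"
  shows "(\<lambda>r. if 0 < r then edge_prob \<phi> a b r else 1) \<in> borel_measurable borel"
proof -
  have "mono (\<lambda>r. - (if 0 < r then edge_prob \<phi> a b r else 1))"
    using edge_prob_anti[of a a b b] edge_prob_range[of a b] assms by (auto intro!: monoI)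
  hence "(\<lambda>r. - (if 0 < r then edge_prob \<phi> a b r else 1)) \<in> borel_measurable borel" by (rule borel_measurable_mono)
  thus ?thesis by simp
qed

lemma measurable_edge_term:
  assumes q: "q \<in> QI \<times> QI" and [measurable]: "Measurable.pred (borel \<Otimes>\<^sub>M borel) (\<lambda>x. C (fst x) (snd x))"
  shows "(\<lambda>(s, t, r). if C s t \<and> 0 < r then edge_prob \<phi> (fst q) (snd q) r else c)
    \<in> borel_measurable (borel \<Otimes>\<^sub>M borel \<Otimes>\<^sub>M (borel :: real measure))"
proof -
  note [measurable] = measurable_edge_prob_dist[OF QI_D[OF q, THEN conjunct1] QI_D[OF q, THEN conjunct2]]
  have [measurable]: "Measurable.pred (borel \<Otimes>\<^sub>M borel \<Otimes>\<^sub>M (borel :: real measure)) (\<lambda>x. C (fst x) (fst (snd x)))"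
    by (rule measurable_compose[OF _ assms(2), of "\<lambda>x. (fst x, fst (snd x))", simplified]) measurable
  have "(\<lambda>x. if C (fst x) (fst (snd x)) \<and> 0 < snd (snd x) then if 0 < snd (snd x) then edge_prob \<phi> (fst q) (snd q) (snd (snd x)) else 1 else c)
    \<in> borel_measurable (borel \<Otimes>\<^sub>M borel \<Otimes>\<^sub>M (borel :: real measure))" by measurable
  also have "(\<lambda>x. if C (fst x) (fst (snd x)) \<and> 0 < snd (snd x) then if 0 < snd (snd x) then edge_prob \<phi> (fst q) (snd q) (snd (snd x)) else 1 else c)
    = (\<lambda>(s, t, r). if C s t \<and> 0 < r then edge_prob \<phi> (fst q) (snd q) r else c)"
    by (auto simp: fun_eq_iff)
  finally show ?thesis .
qed

lemma measurable_edge_lo: "(\<lambda>(s, t, r). edge_lo \<phi> s t r) \<in> borel_measurable (borel \<Otimes>\<^sub>M borel \<Otimes>\<^sub>M borel)"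
proof -
  have "(\<lambda>x. SUP q\<in>QI \<times> QI. case x of (s, t, r) \<Rightarrow> if (s < fst q \<and> t < snd q) \<and> 0 < r then edge_prob \<phi> (fst q) (snd q) r else 0)
    \<in> borel_measurable (borel \<Otimes>\<^sub>M borel \<Otimes>\<^sub>M borel)"
  proof (rule borel_measurable_cSUP[OF countable_QI])
    fix q assume "q \<in> QI \<times> QI"
    thus "(\<lambda>x. case x of (s, t, r) \<Rightarrow> if (s < fst q \<and> t < snd q) \<and> 0 < r then edge_prob \<phi> (fst q) (snd q) r else 0)
      \<in> borel_measurable (borel \<Otimes>\<^sub>M borel \<Otimes>\<^sub>M borel)"
      by (rule measurable_edge_term[where C = "\<lambda>s t. s < fst q \<and> t < snd q"]) measurable
  next
    fix x :: "real \<times> real \<times> real"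
    show "bdd_above ((\<lambda>q. case x of (s, t, r) \<Rightarrow> if (s < fst q \<and> t < snd q) \<and> 0 < r then edge_prob \<phi> (fst q) (snd q) r else 0) ` (QI \<times> QI))"
      using lo_bdd[of "fst x" "fst (snd x)" "snd (snd x)"] by (simp add: case_prod_unfold conj_assoc)
  qed
  thus ?thesis by (simp add: edge_lo_def case_prod_unfold conj_assoc)
qed

lemma measurable_edge_hi: "(\<lambda>(s, t, r). edge_hi \<phi> s t r) \<in> borel_measurable (borel \<Otimes>\<^sub>M borel \<Otimes>\<^sub>M borel)"
proof -
  have "(\<lambda>x. INF q\<in>QI \<times> QI. case x of (s, t, r) \<Rightarrow> if (fst q < s \<and> snd q < t) \<and> 0 < r then edge_prob \<phi> (fst q) (snd q) r else 1)
    \<in> borel_measurable (borel \<Otimes>\<^sub>M borel \<Otimes>\<^sub>M borel)"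
  proof (rule borel_measurable_cINF[OF countable_QI])
    fix q assume "q \<in> QI \<times> QI"
    thus "(\<lambda>x. case x of (s, t, r) \<Rightarrow> if (fst q < s \<and> snd q < t) \<and> 0 < r then edge_prob \<phi> (fst q) (snd q) r else 1)
      \<in> borel_measurable (borel \<Otimes>\<^sub>M borel \<Otimes>\<^sub>M borel)"
      by (rule measurable_edge_term[where C = "\<lambda>s t. fst q < s \<and> snd q < t"]) measurable
  next
    fix x :: "real \<times> real \<times> real"
    show "bdd_below ((\<lambda>q. case x of (s, t, r) \<Rightarrow> if (fst q < s \<and> snd q < t) \<and> 0 < r then edge_prob \<phi> (fst q) (snd q) r else 1) ` (QI \<times> QI))"
      using hi_bdd[of "fst x" "fst (snd x)" "snd (snd x)"] by (simp add: case_prod_unfold conj_assoc)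
  qed
  thus ?thesis by (simp add: edge_hi_def case_prod_unfold conj_assoc)
qed

lemma edge_lo_range: "0 \<le> edge_lo \<phi> s t r" "edge_lo \<phi> s t r \<le> 1"
proof -
  obtain q where q: "q \<in> QI \<times> QI" using QI_nonempty by blast
  show "0 \<le> edge_lo \<phi> s t r"
    unfolding edge_lo_def by (rule order_trans[OF lo_term_range(1)[OF q] cSUP_upper[OF q lo_bdd]])
  show "edge_lo \<phi> s t r \<le> 1"
    unfolding edge_lo_def by (rule cSUP_least[OF QI_nonempty lo_term_range(2)])
qed

lemma edge_lo_sym_le: "edge_lo \<phi> s t r \<le> edge_lo \<phi> t s r"
  unfolding edge_lo_def
proof (rule cSUP_mono[OF QI_nonempty lo_bdd])
  fix q assume q: "q \<in> QI \<times> QI"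
  show "\<exists>q'\<in>QI \<times> QI. (if s < fst q \<and> t < snd q \<and> 0 < r then edge_prob \<phi> (fst q) (snd q) r else 0)
     \<le> (if t < fst q' \<and> s < snd q' \<and> 0 < r then edge_prob \<phi> (fst q') (snd q') r else 0)"
    using q QI_D[OF q] phi_sym[of "fst q" "snd q" r]
    by (intro bexI[of _ "(snd q, fst q)"]) (auto simp: edge_prob_def)
qed

text \<open>The default value 0 in \<open>edge_lo\<close> makes range and monotonicity hold for all
  real marks: for a mark of 1 or more there is no rational mark above it, and the supremum is
  0.\<close>

lemma conn_prob_edge_lo: "conn_prob (edge_lo \<phi>)"
proof
  fix s s' t r r' :: real
  show "0 \<le> edge_lo \<phi> s t r" "edge_lo \<phi> s t r \<le> 1" by (rule edge_lo_range)+
  show "edge_lo \<phi> s t r = edge_lo \<phi> t s r" by (intro antisym edge_lo_sym_le)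
  show "edge_lo \<phi> s' t r \<le> edge_lo \<phi> s t r" if "s \<le> s'"
    unfolding edge_lo_def
  proof (rule cSUP_mono[OF QI_nonempty lo_bdd])
    fix q assume "q \<in> QI \<times> QI"
    thus "\<exists>q'\<in>QI \<times> QI. (if s' < fst q \<and> t < snd q \<and> 0 < r then edge_prob \<phi> (fst q) (snd q) r else 0)
     \<le> (if s < fst q' \<and> t < snd q' \<and> 0 < r then edge_prob \<phi> (fst q') (snd q') r else 0)"
      using that lo_term_range(1)[of q s t r] by (intro bexI[of _ q]) auto
  qed
  show "edge_lo \<phi> s t r' \<le> edge_lo \<phi> s t r" if "0 < r" "r \<le> r'"
    unfolding edge_lo_def
  proof (rule cSUP_mono[OF QI_nonempty lo_bdd])
    fix q assume "q \<in> QI \<times> QI"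
    thus "\<exists>q'\<in>QI \<times> QI. (if s < fst q \<and> t < snd q \<and> 0 < r' then edge_prob \<phi> (fst q) (snd q) r' else 0)
     \<le> (if s < fst q' \<and> t < snd q' \<and> 0 < r then edge_prob \<phi> (fst q') (snd q') r else 0)"
      using that QI_D[of q] edge_prob_anti[of "fst q" "fst q" "snd q" "snd q" r r'] by (intro bexI[of _ q]) auto
  qed
  show "(\<lambda>(s, t, r). edge_lo \<phi> s t r) \<in> borel_measurable (borel \<Otimes>\<^sub>M borel \<Otimes>\<^sub>M borel)" by (rule measurable_edge_lo)
qed

definition gap :: "real \<Rightarrow> real \<Rightarrow> real \<Rightarrow> bool" where
  "gap s t r \<longleftrightarrow> s \<in> {0<..<1} \<and> t \<in> {0<..<1} \<and> 0 < r \<and> edge_lo \<phi> s t r < edge_hi \<phi> s t r"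

lemma no_gap: "\<not> gap s t r \<Longrightarrow> s \<in> {0<..<1} \<Longrightarrow> t \<in> {0<..<1} \<Longrightarrow> 0 < r \<Longrightarrow> edge_lo \<phi> s t r = edge_prob \<phi> s t r"
  using edge_lo_le[of s t r] edge_hi_ge[of s t r] by (auto simp: gap_def)

text \<open>Along a diagonal the gaps of a monotone function are disjoint intervals.\<close>

lemma countable_gap_diagonal: "countable {h. gap h (h + u) r}"
proof -
  define S where "S = {h. gap h (h + u) r}"
  have "\<forall>h\<in>S. \<exists>q\<in>\<rat>. edge_lo \<phi> h (h + u) r < q \<and> q < edge_hi \<phi> h (h + u) r"
    using Rats_dense_in_real by (auto simp: S_def gap_def)
  then obtain q where q: "\<And>h. h \<in> S \<Longrightarrow> q h \<in> \<rat> \<and> edge_lo \<phi> h (h + u) r < q h \<and> q h < edge_hi \<phi> h (h + u) r"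
    by metis
  have lt: "q h' < q h" if h: "h \<in> S" "h' \<in> S" "h < h'" for h h'
  proof -
    have g: "h \<in> {0<..<1}" "h + u \<in> {0<..<1}" "h' \<in> {0<..<1}" "h' + u \<in> {0<..<1}" "0 < r"
      using h by (auto simp: S_def gap_def)
    obtain a where a: "a \<in> QI" "h < a" "a < h'" using QI_between[of h h'] g h by auto
    obtain b where b: "b \<in> QI" "h + u < b" "b < h' + u" using QI_between[of "h + u" "h' + u"] g h by auto
    \<comment> \<open>Along a diagonal both marks increase together, so a rational pair
      \<open>(a, b)\<close> fits strictly between the two points. The edge probability there is at
      least the upper value at \<open>h'\<close> and at most the lower value at
      \<open>h\<close>.\<close>
    have "edge_hi \<phi> h' (h' + u) r \<le> edge_lo \<phi> h (h + u) r"
      by (rule order_trans[OF hi_le lo_ge]) (use a b g in auto)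
    thus ?thesis using q[OF h(1)] q[OF h(2)] by linarith
  qed
  have "inj_on q S"
    by (rule linorder_inj_onI') (use lt in force)
  moreover have "q ` S \<subseteq> \<rat>" using q by blast
  ultimately show ?thesis using countable_rat unfolding S_def[symmetric]
    by (meson countable_image_inj_on countable_subset)
qed

lemma pred_gap:
  assumes [measurable]: "f \<in> borel_measurable M" "g \<in> borel_measurable M" "h \<in> borel_measurable M"
  shows "Measurable.pred M (\<lambda>x. gap (f x) (g x) (h x))"
proof -
  have "(\<lambda>x. (f x, g x, h x)) \<in> measurable M (borel \<Otimes>\<^sub>M borel \<Otimes>\<^sub>M borel)" by measurable
  from measurable_compose[OF this measurable_edge_lo] measurable_compose[OF this measurable_edge_hi]
  have [measurable]: "(\<lambda>x. edge_lo \<phi> (f x) (g x) (h x)) \<in> borel_measurable M" "(\<lambda>x. edge_hi \<phi> (f x) (g x) (h x)) \<in> borel_measurable M"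
    by simp_all
  show ?thesis unfolding gap_def by measurable
qed

text \<open>Fubini in the coordinates \<open>s\<close> and \<open>t - s\<close>, since each diagonal
  carries only countably many gaps. A line parallel to an axis would not do: it may consist entirely
  of gaps if the function jumps across it.\<close>

lemma gap_null: "(\<integral>\<^sup>+s. \<integral>\<^sup>+t. indicator {x. gap (fst x) (snd x) r} (s, t) \<partial>uniform01 \<partial>uniform01) = 0"
proof -
  define F :: "real \<times> real \<Rightarrow> ennreal" where "F = indicator {x. gap (fst x) (snd x) r}"
  have Fm [measurable]: "F \<in> borel_measurable (borel \<Otimes>\<^sub>M borel)"
  proof -
    have "Measurable.pred (borel \<Otimes>\<^sub>M borel) (\<lambda>x :: real \<times> real. gap (fst x) (snd x) r)"
      by (rule pred_gap) measurable
    hence "{x \<in> space (borel \<Otimes>\<^sub>M borel). gap (fst x) (snd x) r} \<in> sets (borel \<Otimes>\<^sub>M borel)" by (simp add: pred_def)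
    thus ?thesis by (simp add: F_def space_pair_measure)
  qed
  have u: "(\<integral>\<^sup>+x. f x \<partial>uniform01) \<le> (\<integral>\<^sup>+x. f x \<partial>lborel)" if [measurable]: "f \<in> borel_measurable borel" for f :: "real \<Rightarrow> ennreal"
  proof -
    have "(\<integral>\<^sup>+x. f x \<partial>uniform01) = (\<integral>\<^sup>+x. f x * indicator {0<..<1} x \<partial>lborel)"
      unfolding uniform01_def by (subst nn_integral_uniform_measure) (auto simp: divide_ennreal_def)
    also have "\<dots> \<le> (\<integral>\<^sup>+x. f x \<partial>lborel)" by (intro nn_integral_mono) (auto simp: indicator_def)
    finally show ?thesis .
  qed
  have [measurable]: "(\<lambda>s. \<integral>\<^sup>+t. F (s, t) \<partial>uniform01) \<in> borel_measurable borel"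
  proof (rule U.borel_measurable_nn_integral)
    have "sets (borel \<Otimes>\<^sub>M uniform01) = sets (borel \<Otimes>\<^sub>M (borel :: real measure))" by (intro sets_pair_measure_cong) simp_all
    thus "(\<lambda>(s, t). F (s, t)) \<in> borel_measurable (borel \<Otimes>\<^sub>M uniform01)"
      using Fm measurable_cong_sets[OF _ refl] by auto
  qed
  have "(\<integral>\<^sup>+s. \<integral>\<^sup>+t. F (s, t) \<partial>uniform01 \<partial>uniform01) \<le> (\<integral>\<^sup>+s. \<integral>\<^sup>+t. F (s, t) \<partial>uniform01 \<partial>lborel)"
    by (rule u) measurable
  also have "\<dots> \<le> (\<integral>\<^sup>+s. \<integral>\<^sup>+t. F (s, t) \<partial>lborel \<partial>lborel)"
    by (intro nn_integral_mono u) measurable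
  also have "\<dots> = (\<integral>\<^sup>+s. \<integral>\<^sup>+h. F (s, s + h) \<partial>lborel \<partial>lborel)"
  proof (rule nn_integral_cong)
    fix s :: real
    show "(\<integral>\<^sup>+t. F (s, t) \<partial>lborel) = (\<integral>\<^sup>+h. F (s, s + h) \<partial>lborel)"
      by (subst nn_integral_real_affine[where c = 1 and t = s]) auto
  qed
  also have "\<dots> = (\<integral>\<^sup>+h. \<integral>\<^sup>+s. F (s, s + h) \<partial>lborel \<partial>lborel)"
  proof (rule lborel_pair.Fubini'[symmetric])
    show "(\<lambda>(s, h). F (s, s + h)) \<in> borel_measurable (lborel \<Otimes>\<^sub>M lborel)" unfolding case_prod_unfold by measurable
  qed
  also have "\<dots> = (\<integral>\<^sup>+(h::real). 0 \<partial>lborel)"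
  proof (rule nn_integral_cong)
    fix h :: real
    have "(\<integral>\<^sup>+s. F (s, s + h) \<partial>lborel) = (\<integral>\<^sup>+s. indicator {s. gap s (s + h) r} s \<partial>lborel)"
      by (simp add: F_def indicator_def)
    also have "\<dots> = emeasure lborel {s. gap s (s + h) r}"
      using countable_gap_diagonal[of h r] by (intro nn_integral_indicator) (simp add: sets.countable)
    also have "\<dots> = 0" by (rule emeasure_lborel_countable[OF countable_gap_diagonal])
    finally show "(\<integral>\<^sup>+s. F (s, s + h) \<partial>lborel) = 0" .
  qed
  finally show ?thesis by (simp add: F_def)
qed

end

section \<open>The decay exponent\<close>

lemma one_minus_exp_ge: "0 \<le> x \<Longrightarrow> min x 1 / 2 \<le> 1 - exp (- x)" for x :: real
proof -
  assume x: "0 \<le> x"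
  have "exp (- x) \<le> 1 / (1 + x)"
    using exp_ge_add_one_self[of x] x by (simp add: exp_minus field_simps)
  moreover have "min x 1 / 2 \<le> 1 - 1 / (1 + x)"
  proof (cases "x \<le> 1")
    case True
    hence "x * x \<le> x * 1" using x by (intro mult_left_mono) auto
    thus ?thesis using True x by (simp add: field_simps)
  qed (simp add: field_simps)
  ultimately show ?thesis by linarith
qed

text \<open>A monotone function on an interval is Borel there and bounded by its end values.
  Integrability has to be secured because the integral of a non-integrable function is 0 by
  convention and would spoil comparisons.\<close>

lemma set_integrable_antimono:
  fixes f :: "real \<Rightarrow> real"
  assumes "antimono_on {a..b} f"
  shows "set_integrable lborel {a..b} f"
proof (cases "a \<le> b")
  case True
  have m: "set_borel_measurable borel {a..b} (\<lambda>x. - f x)"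
  proof -
    have "mono_on {a..b} (\<lambda>x. - f x)" using assms by (auto simp: monotone_on_def)
    hence "(\<lambda>x. - f x) \<in> borel_measurable (restrict_space borel {a..b})" by (rule borel_measurable_mono_on_fnc)
    thus ?thesis unfolding set_borel_measurable_def by (subst (asm) borel_measurable_restrict_space_iff) auto
  qed
  have m': "(\<lambda>x. indicator {a..b} x *\<^sub>R f x) \<in> borel_measurable lborel"
    using borel_measurable_uminus[OF m[unfolded set_borel_measurable_def]] by simp
  have "\<bar>indicator {a..b} x *\<^sub>R f x\<bar> \<le> (\<bar>f a\<bar> + \<bar>f b\<bar>) * indicator {a..b} x" for x
  proof (cases "x \<in> {a..b}")
    case x: True
    hence "f b \<le> f x" "f x \<le> f a" using assms True by (auto simp: monotone_on_def)
    thus ?thesis using x by simp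
  qed simp
  moreover have "integrable lborel (\<lambda>x. (\<bar>f a\<bar> + \<bar>f b\<bar>) * indicator {a..b} x)"
    by (intro integrable_mult_right integrable_real_indicator) (auto simp: emeasure_lborel_Icc_eq)
  ultimately show ?thesis unfolding set_integrable_def
    by (intro Bochner_Integration.integrable_bound[OF _ m', of "\<lambda>x. (\<bar>f a\<bar> + \<bar>f b\<bar>) * indicator {a..b} x"]) (auto simp del: integrable_mult_right_iff)
qed (simp add: set_integrable_def)

section \<open>The mass of the connection function on truncated squares\<close>

context
  fixes \<phi> assumes phi: "connection_function \<phi>"
begin

lemma phi_integrable:
  assumes "0 < a" "s \<in> {0<..<1}" "0 < r"
  shows "set_integrable lborel {a..1 - a} (\<lambda>t. \<phi> s t r)"
  by (rule set_integrable_antimono) (use assms phi_anti[OF phi, of s s _ _ r r] in \<open>auto intro!: monotone_onI\<close>)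

lemma phi_inner_anti:
  assumes a: "0 < a" and s: "s \<in> {0<..<1}" "s' \<in> {0<..<1}" "s \<le> s'" and r: "0 < r"
  shows "(LINT t:{a..1 - a}|lborel. \<phi> s' t r) \<le> (LINT t:{a..1 - a}|lborel. \<phi> s t r)"
  by (rule set_integral_mono) (use assms phi_integrable phi_anti[OF phi, of s s' _ _ r r] in auto)

lemma phi_inner_nonneg:
  assumes a: "0 < a" and s: "s \<in> {0<..<1}" and r: "0 < r"
  shows "0 \<le> (LINT t:{a..1 - a}|lborel. \<phi> s t r)"
  unfolding set_lebesgue_integral_def
  by (rule integral_nonneg_AE) (use assms phi_nonneg[OF phi] in \<open>auto simp: indicator_def\<close>)

lemma phi_outer_integrable:
  assumes a: "0 < a" and r: "0 < r"
  shows "set_integrable lborel {a..1 - a} (\<lambda>s. LINT t:{a..1 - a}|lborel. \<phi> s t r)"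
  by (rule set_integrable_antimono) (use assms in \<open>auto intro!: monotone_onI phi_inner_anti\<close>)

definition mass :: "real \<Rightarrow> real \<Rightarrow> real" where
  "mass a r = (LINT s:{a..1 - a}|lborel. (LINT t:{a..1 - a}|lborel. \<phi> s t r))"

lemma mass_mono:
  assumes a: "0 < a'" "a' \<le> a" and r: "0 < r" shows "mass a r \<le> mass a' r"
proof -
  have sub: "{a..1 - a} \<subseteq> {a'..1 - a'}" using a by auto
  have mono: "(LINT x:{a..1 - a}|lborel. f x) \<le> (LINT x:{a'..1 - a'}|lborel. f x)"
    if "set_integrable lborel {a'..1 - a'} f" "\<And>x. x \<in> {a'..1 - a'} \<Longrightarrow> 0 \<le> f x" for f :: "real \<Rightarrow> real"
  proof -
    have "set_integrable lborel {a..1 - a} f" by (rule set_integrable_subset[OF that(1) _ sub]) simp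
    thus ?thesis unfolding set_lebesgue_integral_def
      by (intro integral_mono) (use that sub in \<open>auto simp: set_integrable_def indicator_def\<close>)
  qed
  have a0: "0 < a" using a by simp
  have "mass a r \<le> (LINT s:{a..1 - a}|lborel. (LINT t:{a'..1 - a'}|lborel. \<phi> s t r))"
    unfolding mass_def
  proof (rule set_integral_mono[OF phi_outer_integrable[OF a0 r]])
    show "set_integrable lborel {a..1 - a} (\<lambda>s. LINT t:{a'..1 - a'}|lborel. \<phi> s t r)"
      by (rule set_integrable_subset[OF phi_outer_integrable[OF a(1) r] _ sub]) simp
    fix s assume s: "s \<in> {a..1 - a}"
    show "(LINT t:{a..1 - a}|lborel. \<phi> s t r) \<le> (LINT t:{a'..1 - a'}|lborel. \<phi> s t r)"
      by (rule mono[OF phi_integrable]) (use s a r phi_nonneg[OF phi] in auto)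
  qed
  also have "\<dots> \<le> mass a' r"
    unfolding mass_def
    by (rule mono[OF phi_outer_integrable[OF a(1) r]]) (use a r phi_inner_nonneg in auto)
  finally show ?thesis .
qed

lemma delta_eff_mono:
  assumes "0 < \<mu>" "\<mu> \<le> \<mu>'"
  shows "delta_eff d \<phi> \<mu> \<le> delta_eff d \<phi> \<mu>'"
proof -
  have "eventually (\<lambda>r. eln (mass (r powr (real d * (\<mu>' - 1))) r) / ereal (real d * ln r)
     \<le> eln (mass (r powr (real d * (\<mu> - 1))) r) / ereal (real d * ln r)) at_top"
    using eventually_gt_at_top[of 1]
  proof eventually_elim
    case (elim r)
    have "real d * (\<mu> - 1) \<le> real d * (\<mu>' - 1)" using assms by (intro mult_left_mono) auto
    hence "r powr (real d * (\<mu> - 1)) \<le> r powr (real d * (\<mu>' - 1))" using elim by (intro powr_mono) auto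
    hence m: "mass (r powr (real d * (\<mu>' - 1))) r \<le> mass (r powr (real d * (\<mu> - 1))) r"
      using elim by (intro mass_mono) auto
    have eln: "eln x \<le> eln y" if "x \<le> y" for x y using that by (auto simp: eln_def)
    show ?case
    proof (cases "d = 0")
      case True
      thus ?thesis by (simp add: ereal_divide_eq zero_ereal_def[symmetric])
    next
      case False
      hence "0 < real d * ln r" using elim by simp
      thus ?thesis by (intro ereal_divide_right_mono eln[OF m]) simp
    qed
  qed
  hence "Liminf at_top (\<lambda>r. eln (mass (r powr (real d * (\<mu>' - 1))) r) / ereal (real d * ln r))
     \<le> Liminf at_top (\<lambda>r. eln (mass (r powr (real d * (\<mu> - 1))) r) / ereal (real d * ln r))"
    by (rule Liminf_mono)
  thus ?thesis unfolding delta_eff_def Let_def mass_def by (simp only: ereal_minus_le_minus)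
qed

text \<open>Monotonicity in \<open>\<mu>\<close> identifies the limit as the infimum over positive
  \<open>\<mu>\<close>, so a strict upper bound on the limit is one at some \<open>\<mu>\<close>
  close to 0.\<close>

lemma delta_eff_0plus_lessD:
  assumes "delta_eff_0plus d \<phi> < x"
  shows "\<exists>\<mu>. 0 < \<mu> \<and> \<mu> < 1 \<and> delta_eff d \<phi> \<mu> < x"
proof -
  let ?f = "delta_eff d \<phi>"
  define l where "l = (INF \<mu>\<in>{0<..}. ?f \<mu>)"
  have "(?f \<longlongrightarrow> l) (at_right 0)"
  proof (rule order_tendstoI)
    fix y assume y: "y < l"
    have "l \<le> ?f \<mu>" if "0 < \<mu>" for \<mu> unfolding l_def using that by (intro INF_lower) auto
    hence "\<forall>\<mu>>0. y < ?f \<mu>" using y by (auto intro: less_le_trans)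
    thus "eventually (\<lambda>\<mu>. y < ?f \<mu>) (at_right 0)" by (auto simp: eventually_at_right_field intro: exI[of _ 1])
  next
    fix y assume "l < y"
    then obtain \<mu>0 where \<mu>0: "0 < \<mu>0" "?f \<mu>0 < y" unfolding l_def by (auto simp: INF_less_iff)
    have "?f \<mu> < y" if "0 < \<mu>" "\<mu> < \<mu>0" for \<mu> using delta_eff_mono[of \<mu> \<mu>0 d] that \<mu>0(2) by (simp add: le_less_trans)
    thus "eventually (\<lambda>\<mu>. ?f \<mu> < y) (at_right 0)" using \<mu>0(1) by (auto simp: eventually_at_right_field)
  qed
  moreover from this have "delta_eff_0plus d \<phi> = l" unfolding delta_eff_0plus_def by (intro tendsto_Lim) auto
  ultimately have "eventually (\<lambda>\<mu>. ?f \<mu> < x) (at_right 0)" using assms by (intro order_tendstoD(2)[of ?f l]) auto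
  moreover have "eventually (\<lambda>\<mu>::real. 0 < \<mu> \<and> \<mu> < 1) (at_right 0)" by (auto simp: eventually_at_right_field intro: exI[of _ 1])
  ultimately have "eventually (\<lambda>\<mu>. 0 < \<mu> \<and> \<mu> < 1 \<and> ?f \<mu> < x) (at_right 0)" by eventually_elim simp
  from eventually_happens[OF this] show ?thesis by auto
qed

text \<open>An exponent below 2 means that the mass is eventually above a power of the volume with
  exponent \<open>c > -2\<close>. A vanishing mass is excluded because \<open>eln\<close> is
  \<open>- \<infinity>\<close> there.\<close>

lemma mass_lower_bound:
  assumes "delta_eff d \<phi> \<mu> < 2" "0 < d"
  shows "\<exists>c>-2. eventually (\<lambda>r. r powr (c * real d) < mass (r powr (real d * (\<mu> - 1))) r) at_top"
proof -
  let ?g = "\<lambda>r. eln (mass (r powr (real d * (\<mu> - 1))) r) / ereal (real d * ln r)"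
  have "- Liminf at_top ?g < 2" using assms unfolding delta_eff_def Let_def mass_def by simp
  hence "- 2 < Liminf at_top ?g" using ereal_minus_less_minus by (metis ereal_uminus_uminus)
  hence "ereal (- 2) < Liminf at_top ?g" by simp
  then obtain c where c: "ereal (- 2) < ereal c" "ereal c < Liminf at_top ?g" using ereal_dense2 by blast
  have "eventually (\<lambda>r. ereal c < ?g r) at_top" by (rule less_LiminfD[OF c(2)])
  moreover have "eventually (\<lambda>r::real. 1 < r) at_top" by (rule eventually_gt_at_top)
  ultimately have "eventually (\<lambda>r. r powr (c * real d) < mass (r powr (real d * (\<mu> - 1))) r) at_top"
  proof eventually_elim
    case (elim r)
    define I where "I = mass (r powr (real d * (\<mu> - 1))) r"
    have dl: "0 < real d * ln r" using elim(2) assms(2) by simp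
    have I0: "0 < I"
    proof (rule ccontr)
      assume "\<not> 0 < I"
      hence "?g r = - \<infinity>" using dl by (simp add: eln_def I_def[symmetric])
      thus False using elim(1) by simp
    qed
    hence "ereal c < ereal (ln I) / ereal (real d * ln r)" using elim(1) by (simp add: eln_def I_def[symmetric])
    moreover have "ereal x / ereal K = ereal (x / K)" if "0 < K" for x K using that by simp
    ultimately have "c < ln I / (real d * ln r)" using dl by (simp only: less_ereal.simps(1))
    hence "c * real d * ln r < ln I" using dl by (simp only: pos_less_divide_eq mult.assoc)
    hence "exp (c * real d * ln r) < I" using I0 by (metis exp_less_cancel_iff exp_ln)
    thus ?case using elim(2) by (simp add: powr_def I_def)
  qed
  thus ?thesis using c(1) by auto
qed

text \<open>If \<open>\<phi> s t r * (s * t)\<close> stayed below \<open>\<eta>\<close> on the whole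
  square, the mass would be at most \<open>\<eta>\<close> times the square of the integral of
  \<open>1 / s\<close>, which is at most \<open>ln (1 / a)\<close>. So a single pair of marks
  accounts for the mass up to a squared logarithm; its halves become the levels
  \<open>\<sigma>\<close> and \<open>\<tau>\<close>.\<close>

lemma mass_pigeonhole:
  assumes a: "0 < a" "a \<le> 1 / 2" and r: "0 < r" and m: "m < mass a r" "0 < m"
  shows "\<exists>s\<in>{a..1 - a}. \<exists>t\<in>{a..1 - a}. m / (ln (1 / a))\<^sup>2 \<le> \<phi> s t r * (s * t)"
proof (rule ccontr)
  define L where "L = ln (1 / a)"
  have L: "0 < L" using a by (simp add: L_def ln_div)
  define \<eta> where "\<eta> = m / L^2"
  have \<eta>: "0 < \<eta>" using m(2) L by (simp add: \<eta>_def)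
  assume neg: "\<not> ?thesis"
  have lt: "\<phi> s t r \<le> \<eta> / s * (1 / t)" if "s \<in> {a..1 - a}" "t \<in> {a..1 - a}" for s t
  proof -
    have "\<phi> s t r * (s * t) < \<eta>" using neg that by (force simp: \<eta>_def L_def)
    thus ?thesis using that a by (auto simp: field_simps less_imp_le)
  qed
  have d: "DERIV (\<lambda>x. k * ln x) x :> k / x" if "a \<le> x" for k x
    using that a by (auto intro!: derivative_eq_intros)
  have ab: "a \<le> 1 - a" using a by simp
  have fi: "has_bochner_integral lborel (\<lambda>x. k / x * indicator {a..1 - a} x) (k * ln (1 - a) - k * ln a)" for k
    by (rule has_bochner_integral_FTC_Icc_real[OF ab]) (use d a in \<open>auto intro!: continuous_intros\<close>)
  have si: "set_integrable lborel {a..1 - a} (\<lambda>x. k / x)" for k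
    using fi[of k] unfolding set_integrable_def by (auto simp: has_bochner_integral_iff mult.commute)
  have sv: "(LINT x:{a..1 - a}|lborel. k / x) = k * (ln (1 - a) - ln a)" for k
    using fi[of k] unfolding set_lebesgue_integral_def by (auto simp: has_bochner_integral_iff mult.commute right_diff_distrib)
  have up: "(LINT x:{a..1 - a}|lborel. k / x) \<le> k * L" if "0 \<le> k" for k
  proof -
    have "ln (1 - a) \<le> 0" using a by simp
    hence "ln (1 - a) - ln a \<le> L" using a by (simp add: L_def ln_div)
    thus ?thesis unfolding sv using that by (intro mult_left_mono)
  qed
  have inner: "(LINT t:{a..1 - a}|lborel. \<phi> s t r) \<le> \<eta> * L / s" if s: "s \<in> {a..1 - a}" for s
  proof -
    have "(LINT t:{a..1 - a}|lborel. \<phi> s t r) \<le> (LINT t:{a..1 - a}|lborel. (\<eta> / s) / t)"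
    proof (rule set_integral_mono[OF phi_integrable si])
      show "\<phi> s t r \<le> \<eta> / s / t" if "t \<in> {a..1 - a}" for t using lt[OF s that] by simp
    qed (use s a r in auto)
    also have "\<dots> \<le> \<eta> / s * L" by (rule up) (use \<eta> s a in auto)
    finally show ?thesis by simp
  qed
  have "mass a r \<le> (LINT s:{a..1 - a}|lborel. \<eta> * L / s)"
    unfolding mass_def by (rule set_integral_mono[OF phi_outer_integrable[OF a(1) r] si inner])
  also have "\<dots> \<le> \<eta> * L * L" by (rule up) (use \<eta> L in auto)
  also have "\<dots> = m" using L by (simp add: \<eta>_def power2_eq_square)
  finally show False using m(1) by simp
qed

end

text \<open>Half of the smaller of the two slacks \<open>\<mu>\<close> and \<open>2 + c\<close> is
  given away to absorb the constants, the squared logarithm and the factor \<open>D\<close> in the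
  distance.\<close>

lemma decay_asymp:
  fixes D \<mu> c :: real
  assumes "1 \<le> D" "0 < \<mu>" "\<mu> < 1" "- 2 < c"
  defines "\<epsilon> \<equiv> min \<mu> (2 + c) / 2"
  shows "eventually (\<lambda>S. S powr (- (D * (1 - \<epsilon>))) \<le> (D * S) powr (D * (\<mu> - 1)) / 2 \<and>
    S powr (- (D * (2 - \<epsilon>))) \<le> ((D * S) powr (D * (\<mu> - 1)))^2 / 8 \<and>
    S powr (- (D * (2 - \<epsilon>))) \<le> (D * S) powr (c * D) / (ln (1 / (D * S) powr (D * (\<mu> - 1))))\<^sup>2 / 8 \<and>
    (D * S) powr (D * (\<mu> - 1)) \<le> 1 / 2) at_top"
proof -
  have D: "0 < D" using assms by simp
  have \<epsilon>: "\<epsilon> < \<mu>" "\<epsilon> < 2 + c" using assms by (auto simp: \<epsilon>_def)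
  define b where "b = D * (1 - \<mu>)"
  define e1 where "e1 = D * (1 - \<epsilon>)"
  define e2 where "e2 = D * (2 - \<epsilon>)"
  define cc where "cc = - (c * D)"
  have b: "0 < b" using D assms by (simp add: b_def)
  have "D * \<epsilon> < D * \<mu>" "D * \<epsilon> < D * (2 + c)" "0 < D * \<mu>" using D \<epsilon> assms by auto
  hence o: "b < e1" "2 * b < e2" "cc < e2" by (auto simp: b_def e1_def e2_def cc_def algebra_simps)
  have r: "D * (\<mu> - 1) = - b" "c * D = - cc" by (simp_all add: b_def cc_def algebra_simps)
  have 1: "eventually (\<lambda>S. S powr (- e1) \<le> (D * S) powr (- b) / 2) at_top" using D o(1) by real_asymp
  have 2: "eventually (\<lambda>S. S powr (- e2) \<le> ((D * S) powr (- b))^2 / 8) at_top" using D o(2) by real_asymp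
  have 3: "eventually (\<lambda>S. S powr (- e2) \<le> (D * S) powr (- cc) / (ln (1 / (D * S) powr (- b)))\<^sup>2 / 8) at_top"
    using D o(3) b by real_asymp
  have 4: "eventually (\<lambda>S. (D * S) powr (- b) \<le> 1 / 2) at_top" using D b by real_asymp
  show ?thesis unfolding r e1_def[symmetric] e2_def[symmetric] using 1 2 3 4 by eventually_elim simp
qed

text \<open>Truncating the integral at \<open>a\<close> keeps the marks found by
  \<open>mass_pigeonhole\<close> above \<open>S powr (- (D * (1 - \<epsilon>)))\<close>. This is
  what \<open>\<mu> > 0\<close> is for: at such levels a large cluster still contains many low
  marks.\<close>

lemma edge_lo_decay:
  fixes D :: real
  assumes phi: "connection_function \<phi>" and d: "0 < d" and \<delta>: "delta_eff_0plus d \<phi> < 2" and D_def: "D = real d"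
  shows "\<exists>\<epsilon> S0. 0 < \<epsilon> \<and> \<epsilon> < 1 \<and> (\<forall>S\<ge>S0. \<exists>\<sigma> \<tau>. 0 < \<sigma> \<and> \<sigma> \<le> 1 \<and> 0 < \<tau> \<and> \<tau> \<le> 1 \<and> S powr (- (D * (1 - \<epsilon>))) \<le> \<sigma> \<and>
       S powr (- (D * (1 - \<epsilon>))) \<le> \<tau> \<and> S powr (- (D * (2 - \<epsilon>))) \<le> edge_lo \<phi> \<sigma> \<tau> (D * S) * (\<sigma> * \<tau>))"
proof -
  have D1: "1 \<le> D" using d by (simp add: D_def)
  obtain \<mu> where \<mu>: "0 < \<mu>" "\<mu> < 1" "delta_eff d \<phi> \<mu> < 2" using delta_eff_0plus_lessD[OF phi \<delta>] by blast
  obtain c where c: "- 2 < c" "eventually (\<lambda>r. r powr (c * real d) < mass \<phi> (r powr (real d * (\<mu> - 1))) r) at_top"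
    using mass_lower_bound[OF phi \<mu>(3) d] by blast
  define \<epsilon> where "\<epsilon> = min \<mu> (2 + c) / 2"
  have \<epsilon>: "0 < \<epsilon>" "\<epsilon> < 1" using \<mu> c by (auto simp: \<epsilon>_def)
  have l: "filterlim (\<lambda>S. D * S) at_top at_top" using D1 by real_asymp
  have "eventually (\<lambda>S. \<exists>\<sigma> \<tau>. 0 < \<sigma> \<and> \<sigma> \<le> 1 \<and> 0 < \<tau> \<and> \<tau> \<le> 1 \<and> S powr (- (D * (1 - \<epsilon>))) \<le> \<sigma> \<and>
       S powr (- (D * (1 - \<epsilon>))) \<le> \<tau> \<and> S powr (- (D * (2 - \<epsilon>))) \<le> edge_lo \<phi> \<sigma> \<tau> (D * S) * (\<sigma> * \<tau>)) at_top"
    using eventually_compose_filterlim[OF c(2)[folded D_def] l] decay_asymp[OF D1 \<mu>(1,2) c(1), folded \<epsilon>_def] eventually_gt_at_top[of 0]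
  proof eventually_elim
    case (elim S)
    define r where "r = D * S"
    define a where "a = r powr (D * (\<mu> - 1))"
    have r: "0 < r" using elim(3) D1 by (simp add: r_def)
    have "0 < a" using r by (simp add: a_def)
    moreover have "a \<le> 1 / 2" using elim(2) unfolding a_def r_def by blast
    ultimately have a: "0 < a" "a \<le> 1 / 2" .
    define \<eta> where "\<eta> = r powr (c * D) / (ln (1 / a))\<^sup>2"
    obtain s t where st: "s \<in> {a..1 - a}" "t \<in> {a..1 - a}" "\<eta> \<le> \<phi> s t r * (s * t)"
      using mass_pigeonhole[OF phi a r, of "r powr (c * D)"] elim(1) r unfolding r_def[symmetric] a_def[symmetric] \<eta>_def by auto
    have s: "0 < s" "s < 1" "0 < t" "t < 1" "a \<le> s" "a \<le> t" using st a by auto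
    have aa: "a^2 \<le> s * t" unfolding power2_eq_square using s a by (intro mult_mono) auto
    have f0: "0 \<le> \<phi> s t r" using phi_nonneg[OF phi] s r by simp
    \<comment> \<open>\<open>edge_lo\<close> looks at rational marks strictly above its arguments,
      so the marks are halved and a rational is put between the half and the mark. The price is a
      factor 4 in \<open>\<sigma> * \<tau>\<close>.\<close>
    obtain q1 where q1: "q1 \<in> QI" "s / 2 < q1" "q1 < s" using QI_between[of "s / 2" s] s by auto
    obtain q2 where q2: "q2 \<in> QI" "t / 2 < q2" "q2 < t" using QI_between[of "t / 2" t] s by auto
    have "edge_prob \<phi> s t r \<le> edge_prob \<phi> q1 q2 r"
      by (rule edge_prob_anti[OF phi]) (use q1 q2 s r in \<open>auto simp: QI_def\<close>)
    also have "\<dots> \<le> edge_lo \<phi> (s / 2) (t / 2) r" by (rule lo_ge[OF phi q1(1) q2(1) q1(2) q2(2) r])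
    finally have lo: "min (\<phi> s t r) 1 / 2 \<le> edge_lo \<phi> (s / 2) (t / 2) r"
      using one_minus_exp_ge[OF f0] by (simp add: edge_prob_def)
    \<comment> \<open>\<open>1 - exp (- x)\<close> is comparable to \<open>x\<close> only up to
      \<open>x = 1\<close>. Beyond that the edge probability is at least a constant, and
      \<open>a^2 \<le> s * t\<close> takes over.\<close>
    have "min \<eta> (a^2) \<le> min (\<phi> s t r) 1 * (s * t)"
      using st(3) aa by (auto simp: min_def)
    hence "min \<eta> (a^2) / 8 \<le> min (\<phi> s t r) 1 / 2 * (s / 2 * (t / 2))" by simp
    also have "\<dots> \<le> edge_lo \<phi> (s / 2) (t / 2) r * (s / 2 * (t / 2))" using lo s by (intro mult_right_mono) auto
    finally have "min \<eta> (a^2) / 8 \<le> edge_lo \<phi> (s / 2) (t / 2) r * (s / 2 * (t / 2))" .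
    moreover have "S powr (- (D * (2 - \<epsilon>))) \<le> min \<eta> (a^2) / 8"
      using elim(2) unfolding r_def[symmetric] a_def[symmetric] \<eta>_def by (auto simp: min_def)
    moreover have "S powr (- (D * (1 - \<epsilon>))) \<le> a / 2"
      using elim(2) unfolding r_def[symmetric] a_def[symmetric] by blast
    ultimately show ?case using s unfolding r_def[symmetric]
      by (intro exI[of _ "s / 2"] exI[of _ "t / 2"]) auto
  qed
  then obtain S0 where "\<forall>S\<ge>S0. \<exists>\<sigma> \<tau>. 0 < \<sigma> \<and> \<sigma> \<le> 1 \<and> 0 < \<tau> \<and> \<tau> \<le> 1 \<and> S powr (- (D * (1 - \<epsilon>))) \<le> \<sigma> \<and>
       S powr (- (D * (1 - \<epsilon>))) \<le> \<tau> \<and> S powr (- (D * (2 - \<epsilon>))) \<le> edge_lo \<phi> \<sigma> \<tau> (D * S) * (\<sigma> * \<tau>)"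
    unfolding eventually_at_top_linorder by blast
  thus ?thesis using \<epsilon> by blast
qed

section \<open>The percolation graph\<close>

lemma reachable_image:
  assumes f: "inj f"
  shows "{w. (f x, w) \<in> ((\<lambda>(x, y). (f x, f y)) ` r)\<^sup>*} = f ` {y. (x, y) \<in> r\<^sup>*}"
proof (intro set_eqI iffI)
  fix w assume "w \<in> {w. (f x, w) \<in> ((\<lambda>(x, y). (f x, f y)) ` r)\<^sup>*}"
  hence "(f x, w) \<in> ((\<lambda>(x, y). (f x, f y)) ` r)\<^sup>*" by simp
  thus "w \<in> f ` {y. (x, y) \<in> r\<^sup>*}"
  proof (induction rule: rtrancl_induct)
    case (step w w')
    thus ?case using f by (auto dest!: injD intro: rtrancl_into_rtrancl)
  qed auto
next
  fix w assume "w \<in> f ` {y. (x, y) \<in> r\<^sup>*}"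
  then obtain y where y: "w = f y" "(x, y) \<in> r\<^sup>*" by auto
  have "(f x, f y) \<in> ((\<lambda>(x, y). (f x, f y)) ` r)\<^sup>*"
    using y(2)
  proof (induction rule: rtrancl_induct)
    case (step y y')
    hence "(f y, f y') \<in> (\<lambda>(x, y). (f x, f y)) ` r" by force
    thus ?case using step by (auto intro: rtrancl_into_rtrancl)
  qed simp
  thus "w \<in> {w. (f x, w) \<in> ((\<lambda>(x, y). (f x, f y)) ` r)\<^sup>*}" by (simp add: y)
qed

text \<open>On tight realisations the minorant and the connection function itself produce the same
  graph, edge by edge.\<close>

definition tight :: "(real \<Rightarrow> real \<Rightarrow> real \<Rightarrow> real) \<Rightarrow> 'd::finite realisation \<Rightarrow> bool" where
  "tight \<phi> z \<longleftrightarrow> (\<forall>x\<in>fst z. \<forall>y\<in>fst z. x \<noteq> y \<longrightarrow>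
     edge_lo \<phi> (umark z x) (umark z y) (dist x y) = edge_prob \<phi> (umark z x) (umark z y) (dist x y))"

lemma vertex_eq: "vertex z x = (x, umark z x)"
  by (cases z) (simp add: vertex_def umark_def)

lemma inj_vertex: "inj (vertex z)"
  by (simp add: vertex_eq inj_def)

lemma vertices_induced: "fst (induced (percolation_graph \<phi> z) (W \<times> UNIV)) = vertex z ` (fst z \<inter> W)"
  by (cases z) (auto simp: induced_def percolation_graph_def Let_def vertex_def)

lemma edges_induced:
  assumes phi: "connection_function \<phi>" and t: "tight \<phi> z"
  shows "snd (induced (percolation_graph \<phi> z) (W \<times> UNIV)) = (\<lambda>(x, y). (vertex z x, vertex z y)) ` linked (rstat (edge_lo \<phi>) z) (fst z \<inter> W)"
proof -
  interpret conn_prob "edge_lo \<phi>" by (rule conn_prob_edge_lo[OF phi])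
  obtain \<omega> u v where z: "z = (\<omega>, u, v)" by (cases z)
  have m: "umark z x = u (point_rank \<omega> x)" for x by (simp add: z umark_def)
  have e: "rstat (edge_lo \<phi>) z {x, y} \<longleftrightarrow> v {point_rank \<omega> x, point_rank \<omega> y} \<le> 1 - exp (- \<phi> (umark z x) (umark z y) (dist x y))"
    if "x \<in> \<omega>" "y \<in> \<omega>" "x \<noteq> y" for x y
    using t that unfolding rstat_def stat_pair[OF that(3)]
    by (simp add: tight_def z edge_prob_def emark_def)
  have "snd (induced (percolation_graph \<phi> z) (W \<times> UNIV)) = {(vertex z x, vertex z y) | x y. x \<in> \<omega> \<inter> W \<and> y \<in> \<omega> \<inter> W \<and> x \<noteq> y \<and>
     v {point_rank \<omega> x, point_rank \<omega> y} \<le> 1 - exp (- \<phi> (umark z x) (umark z y) (dist x y))}"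
    unfolding vertex_eq m by (auto simp: z induced_def percolation_graph_def Let_def vertex_def)
  also have "\<dots> = (\<lambda>(x, y). (vertex z x, vertex z y)) ` linked (rstat (edge_lo \<phi>) z) (\<omega> \<inter> W)"
  proof -
    have l: "linked (rstat (edge_lo \<phi>) z) (\<omega> \<inter> W) = {(x, y). x \<in> \<omega> \<inter> W \<and> y \<in> \<omega> \<inter> W \<and> x \<noteq> y \<and>
        v {point_rank \<omega> x, point_rank \<omega> y} \<le> 1 - exp (- \<phi> (umark z x) (umark z y) (dist x y))}"
      unfolding linked_def using e by blast
    have "{(f x, f y) | x y. R x y} = (\<lambda>(x, y). (f x, f y)) ` {(x, y). R x y}" for f :: "real^'a \<Rightarrow> (real^'a) \<times> real" and R
      by (auto simp del: split_paired_Ex)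
    thus ?thesis unfolding l .
  qed
  finally show ?thesis by (simp add: z)
qed

lemma component_induced:
  assumes "connection_function \<phi>" "tight \<phi> z"
  shows "component (induced (percolation_graph \<phi> z) (W \<times> UNIV)) (vertex z x) = vertex z ` cluster (rstat (edge_lo \<phi>) z) (fst z \<inter> W) x"
  unfolding component_def edges_induced[OF assms] reachable_image[OF inj_vertex] cluster_def by auto

lemma induced_all: "induced (percolation_graph \<phi> z) (UNIV \<times> UNIV) = percolation_graph \<phi> z"
  by (simp add: induced_def)

lemma component_percolation:
  assumes "connection_function \<phi>" "tight \<phi> z"
  shows "component (percolation_graph \<phi> z) (vertex z x) = vertex z ` cluster (rstat (edge_lo \<phi>) z) (fst z) x"
  using component_induced[OF assms, of UNIV x] unfolding induced_all by simp

lemma infinite_vertex_image: "infinite (vertex z ` A) = infinite A"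
  by (simp add: finite_image_iff inj_on_subset[OF inj_vertex])

lemma max_component_card_iff:
  assumes "connection_function \<phi>" "tight \<phi> z" "finite (fst z \<inter> W)" "0 \<le> N"
  shows "N < real (max_component_card (induced (percolation_graph \<phi> z) (W \<times> UNIV)))
    \<longleftrightarrow> (\<exists>x\<in>fst z \<inter> W. N < real (card (cluster (rstat (edge_lo \<phi>) z) (fst z \<inter> W) x)))"
proof -
  define C where "C = (\<lambda>x. card (cluster (rstat (edge_lo \<phi>) z) (fst z \<inter> W) x)) ` (fst z \<inter> W)"
  have "card (vertex z ` A) = card A" for A by (rule card_image) (rule inj_on_subset[OF inj_vertex], simp)
  hence m: "max_component_card (induced (percolation_graph \<phi> z) (W \<times> UNIV)) = Sup C"
    unfolding max_component_card_def components_def vertices_induced image_image component_induced[OF assms(1,2)] C_def by simp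
  have fC: "finite C" using assms(3) by (simp add: C_def)
  have "N < real (Sup C) \<longleftrightarrow> (\<exists>c\<in>C. N < real c)"
  \<comment> \<open>Without vertices the supremum is 0 by convention, and \<open>0 \<le> N\<close>
    makes both sides false.\<close>
  proof (cases "C = {}")
    case True
    thus ?thesis using assms(4) by (simp add: Sup_nat_def)
  next
    case False
    hence S: "Sup C = Max C" using fC by (simp add: cSup_eq_Max)
    show ?thesis
    proof
      assume "N < real (Sup C)"
      thus "\<exists>c\<in>C. N < real c" using Max_in[OF fC False] S by auto
    next
      assume "\<exists>c\<in>C. N < real c"
      then obtain c where c: "c \<in> C" "N < real c" by auto
      hence "c \<le> Sup C" using fC S by simp
      thus "N < real (Sup C)" using c(2) by linarith
    qed
  qed
  thus ?thesis unfolding m C_def by auto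
qed

section \<open>Almost surely the enclosure is tight on all pairs of points\<close>

lemma AE_mark: "AE \<xi> in mk. fst \<xi> i \<in> {0<..<1}"
proof (rule mk.AE_pair_measure)
  have "(\<lambda>\<xi>. fst \<xi> i) \<in> borel_measurable mk" by measurable
  thus "{\<xi> \<in> space mk. fst \<xi> i \<in> {0<..<1}} \<in> sets mk" by measurable
  have "AE x in uniform01. x \<in> {0<..<1}" unfolding uniform01_def by (rule AE_uniform_measureI) auto
  hence "AE u in vmarks. u i \<in> {0<..<1}" by (rule AE_PiM_component[OF U.prob_space_axioms UNIV_I])
  thus "AE u in vmarks. AE v in emarks. fst (u, v) i \<in> {0<..<1}" by eventually_elim simp
qed

text \<open>Projecting the infinite product to two coordinates gives a pair of independent uniform
  marks, for which the gaps at a fixed distance are null. The distance is not random because the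
  configuration is fixed.\<close>

lemma AE_no_gap:
  assumes phi: "connection_function \<phi>" and ij: "i \<noteq> j"
  shows "AE \<xi> in mk. \<not> gap \<phi> (fst \<xi> i) (fst \<xi> j) r"
proof (rule mk.AE_pair_measure)
  have [measurable]: "Measurable.pred (borel \<Otimes>\<^sub>M borel) (\<lambda>x :: real \<times> real. gap \<phi> (fst x) (snd x) r)"
    by (rule pred_gap[OF phi]) measurable
  define F :: "real \<times> real \<Rightarrow> ennreal" where "F = indicator {x. gap \<phi> (fst x) (snd x) r}"
  have Fm: "F \<in> borel_measurable (borel \<Otimes>\<^sub>M borel)"
  proof -
    have "{x \<in> space (borel \<Otimes>\<^sub>M borel). gap \<phi> (fst x) (snd x) r} \<in> sets (borel \<Otimes>\<^sub>M borel)" by measurable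
    thus ?thesis by (simp add: F_def space_pair_measure)
  qed
  have "Measurable.pred mk (\<lambda>\<xi>. \<not> gap \<phi> (fst \<xi> i) (fst \<xi> j) r)"
    by (intro pred_intros_logic pred_gap[OF phi]) measurable
  thus "{\<xi> \<in> space mk. \<not> gap \<phi> (fst \<xi> i) (fst \<xi> j) r} \<in> sets mk" by (simp add: pred_def)
  let ?P = "Pi\<^sub>M {i, j} (\<lambda>_. uniform01)"
  let ?T = "\<lambda>u. \<lambda>n\<in>{i, j}. u n :: real"
  have T: "?T \<in> measurable vmarks ?P" by (intro measurable_restrict measurable_component_singleton) auto
  have d: "distr vmarks ?P ?T = ?P"
    using distr_PiM_reindex[of UNIV "\<lambda>_. uniform01" "\<lambda>n. n" "{i, j}"] U.prob_space_axioms by simp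
  have FP: "(\<lambda>u. F (u i, u j)) \<in> borel_measurable ?P"
  proof -
    have "(\<lambda>u. (u i, u j)) \<in> measurable ?P (borel \<Otimes>\<^sub>M borel)"
      by (intro measurable_Pair measurable_compose[OF measurable_component_singleton]) auto
    thus ?thesis by (rule measurable_compose[OF _ Fm])
  qed
  have "(\<integral>\<^sup>+u. F (u i, u j) \<partial>vmarks) = (\<integral>\<^sup>+u. F (?T u i, ?T u j) \<partial>vmarks)" by simp
  also have "\<dots> = (\<integral>\<^sup>+u. F (u i, u j) \<partial>distr vmarks ?P ?T)" by (rule nn_integral_distr[OF T, symmetric]) (use FP in simp)
  also have "\<dots> = (\<integral>\<^sup>+u. F (u i, u j) \<partial>?P)" unfolding d ..
  also have "\<dots> = (\<integral>\<^sup>+s. \<integral>\<^sup>+u. F ((u(i := s)) i, (u(i := s)) j) \<partial>Pi\<^sub>M {j} (\<lambda>_. uniform01) \<partial>uniform01)"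
    by (rule UP.product_nn_integral_insert_rev) (use ij FP in auto)
  also have "\<dots> = (\<integral>\<^sup>+s. \<integral>\<^sup>+t. F (s, t) \<partial>uniform01 \<partial>uniform01)"
  proof (rule nn_integral_cong)
    fix s :: real
    have "(\<lambda>t. F (s, t)) \<in> borel_measurable uniform01"
      using measurable_compose[OF measurable_Pair1'[of s borel borel] Fm] by simp
    from UP.product_nn_integral_singleton[OF this, of j]
    show "(\<integral>\<^sup>+u. F ((u(i := s)) i, (u(i := s)) j) \<partial>Pi\<^sub>M {j} (\<lambda>_. uniform01)) = (\<integral>\<^sup>+t. F (s, t) \<partial>uniform01)"
      using ij by simp
  qed
  also have "\<dots> = 0" unfolding F_def by (rule gap_null[OF phi])
  finally have 0: "(\<integral>\<^sup>+u. F (u i, u j) \<partial>vmarks) = 0" .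
  have "(\<lambda>u. F (u i, u j)) \<in> borel_measurable vmarks"
  proof -
    have "(\<lambda>u. (u i, u j)) \<in> measurable vmarks (borel \<Otimes>\<^sub>M borel)"
      by (intro measurable_Pair measurable_compose[OF measurable_component_singleton]) auto
    thus ?thesis by (rule measurable_compose[OF _ Fm])
  qed
  from nn_integral_0_iff_AE[OF this] 0 have "AE u in vmarks. F (u i, u j) = 0" by simp
  thus "AE u in vmarks. AE v in emarks. \<not> gap \<phi> (fst (u, v) i) (fst (u, v) j) r"
    by eventually_elim (simp add: F_def indicator_def split: if_splits)
qed

text \<open>A locally finite configuration is countable, so the null sets belonging to its pairs of
  points can be united.\<close>

lemma AE_tight:
  fixes \<omega> :: "(real^'d) set"
  assumes phi: "connection_function \<phi>" and \<omega>: "\<omega> \<in> configurations \<Lambda>"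
  shows "AE \<xi> in mk. (\<forall>i. fst \<xi> i \<in> {0<..<1}) \<and>
    (\<forall>x\<in>\<omega>. \<forall>y\<in>\<omega>. x \<noteq> y \<longrightarrow> \<not> gap \<phi> (umark (\<omega>, \<xi>) x) (umark (\<omega>, \<xi>) y) (dist x y))"
proof -
  have "\<omega> = (\<Union>k::nat. \<omega> \<inter> cball 0 (real k))" using real_arch_simple[of "norm x" for x] by (force simp: mem_cball_0)
  moreover have "countable (\<Union>k::nat. \<omega> \<inter> cball 0 (real k))"
    using \<omega> by (intro countable_UN) (auto simp: configurations_def intro: countable_finite)
  ultimately have c: "countable \<omega>" by simp
  have p: "AE \<xi> in mk. x \<noteq> y \<longrightarrow> \<not> gap \<phi> (umark (\<omega>, \<xi>) x) (umark (\<omega>, \<xi>) y) (dist x y)" if "x \<in> \<omega>" "y \<in> \<omega>" for x y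
  proof (cases "x = y")
    case False
    hence "point_rank \<omega> x \<noteq> point_rank \<omega> y" using inj_on_point_rank[OF \<omega>] that by (auto dest: inj_onD)
    from AE_no_gap[OF phi this, of "dist x y"] show ?thesis by eventually_elim (simp add: umark_def)
  qed simp
  have "AE \<xi> in mk. \<forall>i. fst \<xi> i \<in> {0<..<1}" using AE_mark by (simp add: AE_all_countable)
  moreover have "AE \<xi> in mk. \<forall>x\<in>\<omega>. \<forall>y\<in>\<omega>. x \<noteq> y \<longrightarrow> \<not> gap \<phi> (umark (\<omega>, \<xi>) x) (umark (\<omega>, \<xi>) y) (dist x y)"
    using p by (simp add: AE_ball_countable[OF c])
  ultimately show ?thesis by eventually_elim simp
qed

text \<open>Stated for any measure \<open>Q\<close> on the same \<sigma>-algebra, as it serves both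
  \<open>P\<close> and the Palm law. Every configuration has almost surely good marks, so the law of
  the configuration is irrelevant.\<close>

lemma (in conn_process) loose_null_set:
  assumes phi: "connection_function \<phi>" and Q: "sets Q = sets (configs \<Lambda>)"
  shows "\<exists>N0\<in>null_sets (rspace Q). \<forall>z\<in>space (rspace Q) - N0. tight \<phi> z"
proof -
  define good where "good = (\<lambda>z :: 'd realisation. (\<forall>i. fst (snd z) i \<in> {0<..<1}) \<and>
    \<not> (\<exists>x\<in>fst z. \<exists>y\<in>fst z. x \<noteq> y \<and> gap \<phi> (umark z x) (umark z y) (dist x y)))"
  have gp: "Measurable.pred (rspace P) good"
  proof -
    have "Measurable.pred (borel \<Otimes>\<^sub>M borel \<Otimes>\<^sub>M rspace P) (\<lambda>w. fst (snd w) \<noteq> (fst w :: real^'d) \<and>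
       gap \<phi> (umark (snd (snd w)) (fst (snd w))) (umark (snd (snd w)) (fst w)) (dist (fst (snd w)) (fst w)))"
    proof (intro pred_intros_logic pred_gap[OF phi] pred_eq_borel)
      show "(\<lambda>w. umark (snd (snd w)) (fst (snd w))) \<in> borel_measurable (borel \<Otimes>\<^sub>M borel \<Otimes>\<^sub>M rspace P)"
        by (rule measurable_compose[OF _ measurable_umark, of snd, simplified]) measurable
      show "(\<lambda>w. umark (snd (snd w)) (fst w)) \<in> borel_measurable (borel \<Otimes>\<^sub>M borel \<Otimes>\<^sub>M rspace P)"
        by (rule measurable_compose[OF _ measurable_umark, of "\<lambda>w. (fst w, snd (snd w))", simplified]) measurable
    qed measurable
    hence p1: "Measurable.pred (borel \<Otimes>\<^sub>M (borel \<Otimes>\<^sub>M rspace P)) (\<lambda>(y :: real^'d, w). fst w \<noteq> y \<and>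
       gap \<phi> (umark (snd w) (fst w)) (umark (snd w) y) (dist (fst w) y))" by (simp only: case_prod_unfold)
    have "(\<lambda>w :: (real^'d) \<times> 'd realisation. fst (snd w)) \<in> measurable (borel \<Otimes>\<^sub>M rspace P) (configs \<Lambda>)" by measurable
    from pred_bex_points[OF this p1]
    have p2: "Measurable.pred (borel \<Otimes>\<^sub>M rspace P) (\<lambda>(x :: real^'d, z). \<exists>y\<in>fst z. x \<noteq> y \<and>
       gap \<phi> (umark z x) (umark z y) (dist x y))" by (simp only: case_prod_unfold)
    from pred_bex_points[OF fst_measurable p2]
    have "Measurable.pred (rspace P) (\<lambda>z. \<exists>x\<in>fst z. \<exists>y\<in>fst z. x \<noteq> y \<and> gap \<phi> (umark z x) (umark z y) (dist x y))" .
    moreover have "Measurable.pred (rspace P) (\<lambda>z. \<forall>i. fst (snd z) i \<in> {0<..<1})"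
      unfolding rspace_def by measurable
    ultimately show ?thesis unfolding good_def by (intro pred_intros_logic)
  qed
  have sQ: "sets (rspace Q) = sets (rspace P)"
    using Q sets_P unfolding rspace_def by (intro sets_pair_measure_cong) simp_all
  have spQ: "space (rspace Q) = space (rspace P)" by (rule sets_eq_imp_space_eq[OF sQ])
  define N0 where "N0 = {z\<in>space (rspace P). \<not> good z}"
  have N0s: "N0 \<in> sets (rspace Q)"
  proof -
    have "Measurable.pred (rspace P) (\<lambda>z. \<not> good z)" using gp by (rule pred_intros_logic)
    thus ?thesis by (simp add: N0_def sQ pred_def)
  qed
  have "emeasure (rspace Q) N0 = (\<integral>\<^sup>+\<omega>. emeasure mk (Pair \<omega> -` N0) \<partial>Q)"
    using N0s unfolding rspace_def by (rule mk.emeasure_pair_measure_alt)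
  also have "\<dots> = (\<integral>\<^sup>+\<omega>. 0 \<partial>Q)"
  proof (rule nn_integral_cong)
    fix \<omega> assume "\<omega> \<in> space Q"
    hence \<omega>: "\<omega> \<in> configurations \<Lambda>" using sets_eq_imp_space_eq[OF Q] by simp
    have s: "Pair \<omega> -` N0 \<in> sets mk" using N0s unfolding rspace_def by (rule sets_Pair1)
    have eq: "{\<xi>\<in>space mk. \<not> good (\<omega>, \<xi>)} = Pair \<omega> -` N0"
      using \<omega> by (auto simp: N0_def rspace_def space_pair_measure space_P)
    have "AE \<xi> in mk. good (\<omega>, \<xi>)" using AE_tight[OF phi \<omega>] by eventually_elim (auto simp: good_def)
    thus "emeasure mk (Pair \<omega> -` N0) = 0" using AE_iff_measurable[OF s eq] by simp
  qed
  finally have "N0 \<in> null_sets (rspace Q)" using N0s by auto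
  moreover have "tight \<phi> z" if "z \<in> space (rspace Q) - N0" for z
  proof -
    have g: "good z" using that by (simp add: N0_def spQ)
    show ?thesis unfolding tight_def
    proof (intro ballI impI)
      fix x y assume xy: "x \<in> fst z" "y \<in> fst z" "x \<noteq> y"
      have "umark z w \<in> {0<..<1}" for w using g by (simp add: good_def umark_def)
      moreover have "\<not> gap \<phi> (umark z x) (umark z y) (dist x y)" using g xy by (auto simp: good_def)
      ultimately show "edge_lo \<phi> (umark z x) (umark z y) (dist x y) = edge_prob \<phi> (umark z x) (umark z y) (dist x y)"
        using xy by (intro no_gap[OF phi]) auto
    qed
  qed
  ultimately show ?thesis by blast
qed

section \<open>Passage between the Palm law and the stationary law\<close>

lemma sets_palm: "sets (palm \<Lambda> P) = sets (configs \<Lambda>)"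
  unfolding palm_def by (rule sets.sets_measure_of_eq)

lemma graph_space_eq: "graph_space P = completion (rspace P)"
  by (simp add: graph_space_def rspace_def)

text \<open>The Palm law is built from configurations shifted by their own points. As
  \<open>perc\<close> is shift-invariant, its vanishing almost surely under \<open>P\<close> passes
  to the Palm law.\<close>

lemma not_percolating_theta:
  assumes "stat_process (edge_lo \<phi>) \<Lambda> P" and phi: "connection_function \<phi>"
    and perc: "AE \<omega> in P. stat_process.perc (edge_lo \<phi>) \<omega> = 0"
  shows "theta \<Lambda> P \<phi> = 0"
proof -
  interpret stat_process "edge_lo \<phi>" \<Lambda> P by (rule assms(1))
  let ?Q = "palm \<Lambda> P"
  have sQ: "sets (rspace ?Q) = sets (rspace P)"
    using sets_P sets_palm unfolding rspace_def by (intro sets_pair_measure_cong) simp_all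
  have spQ: "space (rspace ?Q) = space (rspace P)" by (rule sets_eq_imp_space_eq[OF sQ])
  have hp: "Measurable.pred (rspace P) (\<lambda>z. hits z UNIV)" by (rule pred_hits) simp
  define H where "H = {z\<in>space (rspace P). hits z UNIV}"
  have Hs: "H \<in> sets (rspace ?Q)" using hp by (simp add: H_def sQ pred_def)
  define A where "A = {\<omega>\<in>space P. perc \<omega> \<noteq> 0}"
  have As: "A \<in> sets (configs \<Lambda>)" unfolding A_def sets_P[symmetric] using perc_measurable by measurable
  have A0: "emeasure ?Q A = 0"
  proof -
    have "AE \<omega> in P. (\<Sum>x\<in>\<omega> \<inter> cube 1. indicator A (shift (- x) \<omega>)) = (0 :: ennreal)"
      using perc AE_space
    proof eventually_elim
      case (elim \<omega>)
      have \<omega>: "\<omega> \<in> configurations \<Lambda>" using elim(2) by (simp add: space_P)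
      have "shift (- x) \<omega> \<notin> A" if "x \<in> \<omega>" for x
      proof -
        have "- x \<in> \<Lambda>" using \<omega> that by (intro Lam_uminus) (auto simp: configurations_def)
        thus ?thesis using perc_shift[OF \<omega>] elim(1) by (simp add: A_def)
      qed
      thus ?case by (auto intro!: sum.neutral)
    qed
    hence "(\<integral>\<^sup>+ \<omega>. (\<Sum>x\<in>\<omega> \<inter> cube 1. indicator A (shift (- x) \<omega>)) \<partial>P) = (\<integral>\<^sup>+ \<omega>. 0 \<partial>P)"
      by (rule nn_integral_cong_AE)
    \<comment> \<open>The value of a \<open>measure_of\<close> at a set is either the given set
      function or the default 0; here both are 0.\<close>
    thus ?thesis unfolding palm_def emeasure_measure_of_conv by simp
  qed
  have "emeasure (rspace ?Q) H = (\<integral>\<^sup>+\<omega>. emeasure mk (Pair \<omega> -` H) \<partial>?Q)"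
    using Hs unfolding rspace_def by (rule mk.emeasure_pair_measure_alt)
  also have "\<dots> = (\<integral>\<^sup>+\<omega>. ennreal (perc \<omega>) \<partial>?Q)"
  proof (rule nn_integral_cong)
    fix \<omega> assume "\<omega> \<in> space ?Q"
    hence \<omega>: "\<omega> \<in> configurations \<Lambda>" using sets_eq_imp_space_eq[OF sets_palm] by auto
    have "Pair \<omega> -` H = {\<xi>\<in>space mk. hits (\<omega>, \<xi>) UNIV}"
      using \<omega> by (auto simp: H_def rspace_def space_pair_measure space_P)
    thus "emeasure mk (Pair \<omega> -` H) = ennreal (perc \<omega>)"
      by (simp add: perc_def quenched_def mk.emeasure_eq_measure)
  qed
  also have "\<dots> = (\<integral>\<^sup>+\<omega>. 0 \<partial>?Q)"
  proof (rule nn_integral_cong_AE)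
    have "A \<in> null_sets ?Q" using As A0 by (auto simp: sets_palm null_sets_def)
    hence nA: "AE \<omega> in ?Q. \<omega> \<notin> A" by (rule AE_not_in)
    have "space ?Q = space P" using sets_eq_imp_space_eq[OF sets_palm] by (simp add: space_P)
    hence "AE \<omega> in ?Q. \<omega> \<in> space P" using AE_space[of ?Q] by simp
    with nA show "AE \<omega> in ?Q. ennreal (perc \<omega>) = 0" by eventually_elim (auto simp: A_def)
  qed
  finally have Hn: "H \<in> null_sets (rspace ?Q)" using Hs by auto
  obtain N0 where N0: "N0 \<in> null_sets (rspace ?Q)" "\<forall>z\<in>space (rspace ?Q) - N0. tight \<phi> z"
    using loose_null_set[OF phi sets_palm] by blast
  let ?E = "{z\<in>space (graph_space ?Q). infinite (component (percolation_graph \<phi> z) (vertex z 0))}"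
  have "?E \<subseteq> H \<union> N0"
  proof
    fix z assume z: "z \<in> ?E"
    have sp: "z \<in> space (rspace ?Q)" using z by (simp add: graph_space_eq)
    show "z \<in> H \<union> N0"
    proof (cases "z \<in> N0")
      case False
      hence t: "tight \<phi> z" using N0(2) sp by simp
      have i: "infinite (cluster (rstat (edge_lo \<phi>) z) (fst z) 0)"
        using z by (simp add: component_percolation[OF phi t] infinite_vertex_image)
      \<comment> \<open>A cluster started off the configuration is a single point, so an infinite
        one shows that the origin is occupied, without recourse to the Palm formula.\<close>
      have "0 \<in> fst z"
      proof (rule ccontr)
        assume "0 \<notin> fst z"
        hence "cluster (rstat (edge_lo \<phi>) z) (fst z) 0 \<subseteq> {0}"
          unfolding cluster_def by (auto simp: linked_def elim: converse_rtranclE)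
        thus False using i finite_subset by blast
      qed
      hence "hits z UNIV" using i by (auto simp: hits_def)
      thus ?thesis using sp by (simp add: H_def spQ)
    qed simp
  qed
  moreover have "H \<union> N0 \<in> null_sets (completion (rspace ?Q))" using Hn N0(1) by (intro null_sets_completionI null_sets.Un)
  ultimately have "?E \<in> null_sets (graph_space ?Q)" unfolding graph_space_eq by (rule null_sets_completion_subset)
  hence "measure (graph_space ?Q) ?E = 0" by (simp add: null_sets_def measure_def)
  thus ?thesis by (simp add: theta_def Let_def)
qed

theorem theorem2p3:
  fixes \<Lambda> :: "(real^'d) set" and P :: "(real^'d) set measure"
    and \<phi> :: "real \<Rightarrow> real \<Rightarrow> real \<Rightarrow> real" and lam :: real
  assumes "\<Lambda> = UNIV \<or> \<Lambda> = integer_lattice"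
    and "point_process \<Lambda> P"
    and "0 < intensity P" and "intensity P < \<infinity>"
    and "stationary \<Lambda> P" and "ergodic \<Lambda> P" and "positively_correlated P"
    and "connection_function \<phi>"
    and "AE z in graph_space P. at_most_one_infinite_component (percolation_graph \<phi> z)"
    and "delta_eff_0plus CARD('d) \<phi> < 2"
    and "theta \<Lambda> P \<phi> > 0"
    and "0 < lam" and "lam < 1"
  shows "(\<lambda>n :: nat. measure (graph_space P)
            {z \<in> space (graph_space P).
               real (max_component_card (induced (percolation_graph \<phi> z) (cube (real n) \<times> UNIV)))
                 > real n powr (lam * real CARD('d))})
         \<longlonglongrightarrow> 1"
proof -
  note phi = assms(8)
  have sets_P: "sets P = sets (configs \<Lambda>)" and prob_P: "prob_space P" using assms(2) by (auto simp: point_process_def)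
  have sp: "stat_process (edge_lo \<phi>) \<Lambda> P"
    by (rule stat_process.intro[OF conn_process.intro[OF conn_prob_edge_lo[OF phi] conn_process_axioms.intro[OF sets_P prob_P]]
      stat_process_axioms.intro[OF assms(1,5)]])
  interpret stat_process "edge_lo \<phi>" \<Lambda> P by (rule sp)
  have "\<not> (AE \<omega> in P. perc \<omega> = 0)"
  proof
    assume "AE \<omega> in P. perc \<omega> = 0"
    from not_percolating_theta[OF sp phi this] show False using assms(11) by simp
  qed
  hence perc: "AE \<omega> in P. perc \<omega> = 1" using perc_ergodic[OF assms(6)] by blast
  obtain N0 where N0: "N0 \<in> null_sets (rspace P)" "\<forall>z\<in>space (rspace P) - N0. tight \<phi> z"
    using loose_null_set[OF phi sets_P] by blast
  have tight: "AE z in rspace P. tight \<phi> z"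
    using AE_not_in[OF N0(1)] AE_space by eventually_elim (use N0(2) in auto)
  have "AE z in rspace P. at_most_one_infinite_component (percolation_graph \<phi> z)"
    using assms(9) unfolding graph_space_eq AE_completion_iff .
  hence uniq: "AE z in rspace P. \<forall>x\<in>fst z. \<forall>y\<in>fst z. infinite (cluster (rstat (edge_lo \<phi>) z) (fst z) x) \<and>
       infinite (cluster (rstat (edge_lo \<phi>) z) (fst z) y) \<longrightarrow> cluster (rstat (edge_lo \<phi>) z) (fst z) x = cluster (rstat (edge_lo \<phi>) z) (fst z) y"
    using tight
  proof eventually_elim
    case (elim z)
    have v: "fst (percolation_graph \<phi> z) = vertex z ` fst z" using vertices_induced[of \<phi> z UNIV] unfolding induced_all by simp
    show ?case
    proof (intro ballI impI, elim conjE)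
      fix x y assume xy: "x \<in> fst z" "y \<in> fst z"
        "infinite (cluster (rstat (edge_lo \<phi>) z) (fst z) x)" "infinite (cluster (rstat (edge_lo \<phi>) z) (fst z) y)"
      have "component (percolation_graph \<phi> z) (vertex z x) \<in> components (percolation_graph \<phi> z)"
        "component (percolation_graph \<phi> z) (vertex z y) \<in> components (percolation_graph \<phi> z)"
        unfolding components_def v using xy by auto
      moreover have "infinite (component (percolation_graph \<phi> z) (vertex z x))" "infinite (component (percolation_graph \<phi> z) (vertex z y))"
        using xy by (simp_all add: component_percolation[OF phi elim(2)] infinite_vertex_image)
      ultimately have "component (percolation_graph \<phi> z) (vertex z x) = component (percolation_graph \<phi> z) (vertex z y)"
        using elim(1) unfolding at_most_one_infinite_component_def by blast
      thus "cluster (rstat (edge_lo \<phi>) z) (fst z) x = cluster (rstat (edge_lo \<phi>) z) (fst z) y"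
        unfolding component_percolation[OF phi elim(2)] by (simp add: inj_image_eq_iff[OF inj_vertex])
    qed
  qed
  obtain \<epsilon> S0 where \<epsilon>: "0 < \<epsilon>" "\<epsilon> < 1" and decay: "\<forall>S\<ge>S0. \<exists>\<sigma> \<tau>. 0 < \<sigma> \<and> \<sigma> \<le> 1 \<and> 0 < \<tau> \<and> \<tau> \<le> 1 \<and>
     S powr (- (real CARD('d) * (1 - \<epsilon>))) \<le> \<sigma> \<and> S powr (- (real CARD('d) * (1 - \<epsilon>))) \<le> \<tau> \<and>
     S powr (- (real CARD('d) * (2 - \<epsilon>))) \<le> edge_lo \<phi> \<sigma> \<tau> (real CARD('d) * S) * (\<sigma> * \<tau>)"
    using edge_lo_decay[OF phi _ assms(10) refl] by auto
  let ?E = "\<lambda>n::nat. {z \<in> space (graph_space P).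
      real (max_component_card (induced (percolation_graph \<phi> z) (cube (real n) \<times> UNIV))) > real n powr (lam * real CARD('d))}"
  interpret C: prob_space "graph_space P"
  proof
    show "emeasure (graph_space P) (space (graph_space P)) = 1"
      unfolding graph_space_eq space_completion by (simp add: N.emeasure_space_1)
  qed
  have ev: "eventually (\<lambda>n. 1 - \<delta> \<le> measure (graph_space P) (?E n)) sequentially" if \<delta>: "0 < \<delta>" "\<delta> < 1" for \<delta> :: real
  proof -
    let ?G = "\<lambda>n::nat. {z\<in>space (rspace P).
     \<exists>x\<in>fst z \<inter> cube (real n). real n powr (lam * real CARD('d)) < real (card (cluster (rstat (edge_lo \<phi>) z) (fst z \<inter> cube (real n)) x))}"
    have "eventually (\<lambda>n. 1 - \<delta> \<le> measure (rspace P) (?G n)) sequentially"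
      using decay by (intro large_clusters[OF perc uniq assms(4) \<epsilon> _ assms(12,13) \<delta>(1)]) blast
    thus ?thesis
    proof eventually_elim
      case (elim n)
      \<comment> \<open>The measure is bounded below by a positive number, while sets outside the
        \<sigma>-algebra have measure 0 by convention; hence the set is measurable.\<close>
      have Gs: "?G n \<in> sets (rspace P)" using elim \<delta> measure_notin_sets[of "?G n" "rspace P"] by fastforce
      have eq: "z \<in> ?E n \<longleftrightarrow> z \<in> ?G n" if "z \<in> space (rspace P) - N0" for z
      proof -
        have c: "cube (real n) = box_at (0 :: real^'d) (real n)" by (simp add: box_at_def)
        have fin: "finite (fst z \<inter> cube (real n))" unfolding c by (rule finite_config_Int[OF config_of bounded_box_at]) (use that in blast)
        show ?thesis using that max_component_card_iff[OF phi _ fin, of "real n powr (lam * real CARD('d))"] N0(2)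
          by (simp add: graph_space_eq)
      qed
      have sp: "?E n \<subseteq> space (rspace P)" "?G n \<subseteq> space (rspace P)" by (auto simp: graph_space_eq)
      \<comment> \<open>The two events agree off the null set \<open>N0\<close>. The part of the
        graph event inside \<open>N0\<close> is known to be measurable only in the
        completion.\<close>
      have E: "?E n = (?G n - N0) \<union> (?E n \<inter> N0)" using eq sp by blast
      have GN: "?G n - N0 \<in> sets (rspace P)" using Gs N0(1) by auto
      have "?E n \<inter> N0 \<in> null_sets (graph_space P)"
        unfolding graph_space_eq by (rule null_sets_completion_subset[OF _ null_sets_completionI[OF N0(1)]]) auto
      hence "?E n \<inter> N0 \<in> sets (graph_space P)" by (rule null_setsD2)
      moreover have "?G n - N0 \<in> sets (graph_space P)" unfolding graph_space_eq by (rule sets_completionI_sets[OF GN])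
      ultimately have "(?G n - N0) \<union> (?E n \<inter> N0) \<in> sets (graph_space P)" by (intro sets.Un)
      hence Es: "?E n \<in> sets (graph_space P)" by (rule ssubst[OF E, where P = "\<lambda>A. A \<in> sets (graph_space P)"])
      have "1 - \<delta> \<le> measure (rspace P) (?G n - N0)"
        using elim unfolding measure_Diff_null_set[OF Gs N0(1)] .
      also have "\<dots> = measure (graph_space P) (?G n - N0)" unfolding graph_space_eq by (rule measure_completion[OF GN, symmetric])
      also have "\<dots> \<le> measure (graph_space P) (?E n)" by (rule C.finite_measure_mono[OF _ Es]) (use eq sp in blast)
      finally show ?case .
    qed
  qed
  have low: "eventually (\<lambda>n. a < measure (graph_space P) (?E n)) sequentially" if "a < 1" for a
  proof -
    have "0 < min 1 (1 - a)" using that by simp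
    then obtain \<delta> where "0 < \<delta>" "\<delta> < min 1 (1 - a)" using dense by blast
    hence \<delta>: "0 < \<delta>" "\<delta> < 1" "a < 1 - \<delta>" by auto
    have "eventually (\<lambda>n. 1 - \<delta> \<le> measure (graph_space P) (?E n)) sequentially" by (rule ev[OF \<delta>(1,2)])
    thus ?thesis by eventually_elim (use \<delta>(3) in linarith)
  qed
  show ?thesis
  proof (rule order_tendstoI)
    fix a :: real assume "a < 1"
    thus "eventually (\<lambda>n. a < measure (graph_space P) (?E n)) sequentially" by (rule low)
  next
    fix a :: real assume "1 < a"
    thus "eventually (\<lambda>n. measure (graph_space P) (?E n) < a) sequentially"
      by (intro always_eventually allI le_less_trans[OF C.prob_le_1])
  qed
qed

end
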